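(* Let $n\ge2$, $m\ge1$, $\check u_0,\dots,\check u_{m-1}\in\mathbb C^\times$. The following formulas give a level $m$ action of the quantum toroidal algebra $\check{\mathcal E}_n=\mathcal E_n(\check q_1,q_2,\check q_3)$ (generators written with checks) on the total Fock space $\mathbb F_{m,n}$ (level $m$ means that the central element $\check C$ acts as $q^m$): for $0\le j\le n-1$ and $r>0$, $$q^{\check\varepsilon_j}=q^{\check{\mathsf e}_j},\quad\check C=q^m,\quad\check D=q^{\deg},$$ $$\check H_{j,r}=\sum_{i=0}^{m-1}q_1^{\,ir}\check b^{i,j}_r,\qquad\check H_{j,-r}=\sum_{i=0}^{m-1}q^{(m-1)r}q_3^{\,ir}\check b^{i,j}_{-r},$$ $$\check E_j(z)=\sum_{i=0}^{m-1}\check u_i^{-\delta_{j,0}}:e^{\check A^{i,j}(z)}:\check U^{i,j}(z),\qquad\check F_j(z)=\sum_{i=0}^{m-1}\check u_i^{\delta_{j,0}}:e^{\check B^{i,j}(z)}:\check V^{i,j}(z),$$ where for $0\le i\le m-1$ and $1\le j\le n-1$ $$\check U^{i,j}(z)=e^{\epsilon_{i,j}}e^{-\epsilon_{i,j-1}}(q^{m-1-i}z)^{-\partial_{i,j-1}+\partial_{i,j}+1}\,\check d^{(1/2-j)\check{\mathsf e}_{j-1}+(1/2+j)\check{\mathsf e}_j-j(\partial_{i,j-1}-\partial_{i,j})}\,q^{\sum_{s=i+1}^{m-1}(\partial_{s,j-1}-\partial_{s,j})},$$ $$\check V^{i,j}(z)=e^{\epsilon_{i,j-1}}e^{-\epsilon_{i,j}}(q^{i}z)^{\partial_{i,j-1}-\partial_{i,j}+1}\,\check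 d^{-(1/2-j)\check{\mathsf e}_{j-1}-(1/2+j)\check{\mathsf e}_j+j(\partial_{i,j-1}-\partial_{i,j})}\,q^{-\sum_{s=0}^{i-1}(\partial_{s,j-1}-\partial_{s,j})},$$ and for $j=0$ $$\check U^{i,0}(z)=e^{\epsilon_{i,0}}e^{-\epsilon_{i,n-1}}(q^{m-1-i}z)^{-\partial_{i,n-1}+\partial_{i,0}+1}\,\check d^{(1/2-n)\check{\mathsf e}_{n-1}+(1/2)\check{\mathsf e}_0-n\partial_{i,n-1}}\,q^{\sum_{s=i+1}^{m-1}(\partial_{s,n-1}-\partial_{s,0})},$$ $$\check V^{i,0}(z)=e^{\epsilon_{i,n-1}}e^{-\epsilon_{i,0}}(q^{i}z)^{\partial_{i,n-1}-\partial_{i,0}+1}\,\check d^{-(1/2-n)\check{\mathsf e}_{n-1}-(1/2)\check{\mathsf e}_0+n\partial_{i,n-1}}\,q^{-\sum_{s=0}^{i-1}(\partial_{s,n-1}-\partial_{s,0})}.$$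
   Context: **Parameters.** $q,d,\check d\in\mathbb C^\times$ (a square root of $\check d$ fixed); $q_1=q^{-1}d$, $q_2=q^2$, $q_3=q^{-1}d^{-1}$; $\check q_1=q^{-1}\check d$, $\check q_2=q_2=q^2$, $\check q_3=q^{-1}\check d^{-1}$. Assume $(q_1,q_2,q_3)$ generic ($q_1^iq_2^jq_3^k=1$ with $i,j,k\in\mathbb Z$ only if $i=j=k$), and the same for $(\check q_1,\check q_2,\check q_3)$. $[x]=(q^x-q^{-x})/(q-q^{-1})$; $\delta^{(n)}_{i,k}=1$ if $i\equiv k$ mod $n$ and $0$ otherwise. **Fock space.** Bosons $a^{i,j}_r$ ($r\in\mathbb Z\setminus\{0\}$, $0\le i\le m-1$, $0\le j\le n-1$) satisfy $[a^{i,j}_r,a^{k,l}_s]=\delta_{i,k}\delta_{j,l}\delta_{r+s,0}[r]^2/r$. On the space with basis $|\mathfrak m\rangle$, $\mathfrak m=(\mathfrak m_{s,t})\in\mathbb Z^{mn}$, put $e^{\pm\epsilon_{i,j}}|\mathfrak m\rangle=(-1)^{\sum_{s=0}^{i-1}\sum_{t=0}^{n-1}\mathfrak m_{s,t}+\sum_{t=0}^{j-1}\mathfrak m_{i,t}}|\mathfrak m\pm\mathbf 1_{i,j}\rangle$, $\partial_{i,j}|\mathfrak m\rangle=\mathfrak m_{i,j}|\mathfrak m\rangle$, with $\mathbf 1_{i,j}$ the $(i,j)$ unit vector. $\mathbb F_{m,n}=\mathbb C[\{a^{i,j}_{-r}\}_{r>0}]\otimes\bigoplus_{\mathfrak m}\mathbb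 C|\mathfrak m\rangle$ (with $a^{i,j}_r$, $r>0$, annihilating $1\otimes|\mathfrak m\rangle$), graded by $\deg(a^{i_1,j_1}_{-r_1}\cdots a^{i_k,j_k}_{-r_k}|\mathfrak m\rangle)=\sum_l r_l+\frac12\sum_{s,t}\mathfrak m_{s,t}^2$. Operators are extended periodically in $i$ (period $m$) and $j$ (period $n$). $\check{\mathsf e}_j=-\sum_{s=0}^{m-1}\partial_{s,j}$. For $r>0$: $\check b^{i,j}_r=-q^r(\check q_3^ra^{i,j-1}_r-a^{i,j}_r)$, $\check b^{i,j}_{-r}=-(\check q_1^ra^{i,j-1}_{-r}-a^{i,j}_{-r})$, and $\check A^{i,j}_r=-\frac1{[r]}q^{-(m-1)r}q_3^{-ir}\check b^{i,j}_r$, $\ \check A^{i,j}_{-r}=\frac1{[r]}q^{(m-2)r}\bigl(q_3^{ir}\check b^{i,j}_{-r}+(1-q_2^r)\sum_{s=i+1}^{m-1}q_3^{sr}\check b^{s,j}_{-r}\bigr)$, $\check B^{i,j}_r=\frac1{[r]}q^r\bigl(q_1^{ir}\check b^{i,j}_r+(1-q_2^{-r})\sum_{s=0}^{i-1}q_1^{sr}\check b^{s,j}_r\bigr)$, $\ \check B^{i,j}_{-r}=-\frac1{[r]}q_1^{-ir}\check b^{i,j}_{-r}$. $:e^{X(z)}:=\exp(\sum_{r>0}X_{-r}z^r)\exp(\sum_{r>0}X_rz^{-r})$ for $X=\check A^{i,j},\check B^{i,j}$. **Quantum toroidal algebra $\mathcal E_n(\check q_1,\check q_2,\check q_3)$,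 $n\ge2$** (generators written with checks). Let $P=\bigoplus_{i\in\mathbb Z/n\mathbb Z}\mathbb Z\check\varepsilon_i$ with $\check\varepsilon_i$ orthonormal, $\bar\alpha_i=\check\varepsilon_{i-1}-\check\varepsilon_i$. For $n\ge3$: $g_{i,j}(z,w)=z-\check q_1w$ ($i\equiv j-1$), $z-\check q_2w$ ($i\equiv j$), $z-\check q_3w$ ($i\equiv j+1$), $z-w$ otherwise; for $n=2$: $g_{i,j}=z-\check q_2w$ ($i\equiv j$), $(z-\check q_1w)(z-\check q_3w)$ ($i\not\equiv j$). $d_{i,j}=\check d^{\mp1}$ for $i\equiv j\mp1$, $n\ge3$; $d_{i,j}=-1$ for $i\not\equiv j$, $n=2$; $d_{i,j}=1$ otherwise. The algebra is unital associative, generated by $\check E_{i,k},\check F_{i,k},\check H_{i,r}$ ($i\in\mathbb Z/n\mathbb Z$, $k\in\mathbb Z$, $r\in\mathbb Z\setminus\{0\}$) and invertible $q^h$ ($h\in P$), $\check C$, $\check D$. With $\check K_i=q^{\bar\alpha_i}$, $\check E_i(z)=\sum_k\check E_{i,k}z^{-k}$, $\check F_i(z)=\sum_k\check F_{i,k}z^{-k}$, $\check K_i^\pm(z)=\check K_i^{\pm1}\exp(\pm(q-q^{-1})\sum_{r>0}\check H_{i,\pm r}z^{\mp r})$, $\delta(z)=\sum_{k\in\mathbb Z}z^k$, the relations are: - $\check C$ central, $q^hq^{h'}=q^{h+h'}$, $q^0=1$, $\check Dq^h=q^h\check D$; $q^h\check E_i(z)q^{-h}=q^{(h,\bar\alpha_i)}\check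 E_i(z)$, $q^h\check F_i(z)q^{-h}=q^{-(h,\bar\alpha_i)}\check F_i(z)$; $\check DX(z)\check D^{-1}=X(qz)$ for $X=\check E_i,\check F_i,\check K_i^\pm$. - $[\check H_{i,r},\check E_j(z)]=a_{i,j}(r)\check C^{-(r+|r|)/2}z^r\check E_j(z)$, $[\check H_{i,r},\check F_j(z)]=-a_{i,j}(r)\check C^{-(r-|r|)/2}z^r\check F_j(z)$, $[\check H_{i,r},\check H_{j,s}]=\delta_{r+s,0}\,a_{i,j}(r)\frac{\check C^r-\check C^{-r}}{q-q^{-1}}$, where $a_{i,j}(r)=\frac{[r]}r\bigl((q^r+q^{-r})\delta^{(n)}_{i,j}-\check d^r\delta^{(n)}_{i,j-1}-\check d^{-r}\delta^{(n)}_{i,j+1}\bigr)$. - $[\check E_i(z),\check F_j(w)]=\frac{\delta_{i,j}}{q-q^{-1}}\bigl(\delta(\check Cw/z)\check K_i^+(w)-\delta(\check Cz/w)\check K_i^-(z)\bigr)$. - $[\check E_i(z),\check E_j(w)]=[\check F_i(z),\check F_j(w)]=0$ for $i\not\equiv j,j\pm1$; $d_{i,j}g_{i,j}(z,w)\check E_i(z)\check E_j(w)+g_{j,i}(w,z)\check E_j(w)\check E_i(z)=0$; $d_{j,i}g_{j,i}(w,z)\check F_i(z)\check F_j(w)+g_{i,j}(z,w)\check F_j(w)\check F_i(z)=0$. - Serre relations, with $[X,Y]_c=XY-cYX$: for $n\ge3$, $\mathrm{Sym}_{z_1,z_2}[\check E_i(z_1),[\check E_i(z_2),\check E_{i\pm1}(w)]_q]_{q^{-1}}=0$;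 for $n=2$ and $j\not\equiv i$, $\mathrm{Sym}_{z_1,z_2,z_3}[\check E_i(z_1),[\check E_i(z_2),[\check E_i(z_3),\check E_j(w)]_{q^2}]]_{q^{-2}}=0$; and the same with $\check F$ in place of $\check E$. *)

theory Defs
  imports
    Complex_Main
    "HOL-Library.Poly_Mapping"
    "HOL-Library.Product_Plus"
    "HOL-Computational_Algebra.Formal_Power_Series"
    "HOL-Algebra.QuotRing"
begin

section \<open>Scalars\<close>

definition generic :: "complex \<Rightarrow> complex \<Rightarrow> complex \<Rightarrow> bool" where
  "generic q1 q2 q3 \<longleftrightarrow>
     (\<forall>i j k :: int. q1 powi i * q2 powi j * q3 powi k = 1 \<longrightarrow> i = j \<and> j = k)"

definition qnum :: "complex \<Rightarrow> int \<Rightarrow> complex" where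
  "qnum q r = (q powi r - q powi (- r)) / (q - inverse q)"

definition kdelta :: "nat \<Rightarrow> int \<Rightarrow> int \<Rightarrow> complex" where
  "kdelta n i j = (if i mod int n = j mod int n then 1 else 0)"

text \<open>Complex vector spaces with a basis \<open>'b\<close> are realised as \<open>'b \<Rightarrow>\<^sub>0 complex\<close>.\<close>

definition scale :: "complex \<Rightarrow> ('b \<Rightarrow>\<^sub>0 complex) \<Rightarrow> ('b \<Rightarrow>\<^sub>0 complex)"  (infixr \<open>\<cdot>\<close> 75) where
  "c \<cdot> x = Poly_Mapping.map ((*) c) x"


section \<open>Algebras given by generators and actions\<close>

text \<open>Words form a monoid under concatenation, so that the convolution product of
  \<^typ>\<open>'g list \<Rightarrow>\<^sub>0 complex\<close> is the product of the free unital associative algebra on \<open>'g\<close>.\<close>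

instantiation list :: (type) monoid_add
begin
definition zero_list_def: "(0 :: 'a list) = []"
definition plus_list_def: "(xs :: 'a list) + ys = xs @ ys"
instance by standard (auto simp: zero_list_def plus_list_def)
end

abbreviation var :: "'g \<Rightarrow> ('g list \<Rightarrow>\<^sub>0 complex)" where
  "var x \<equiv> Poly_Mapping.single [x] 1"

definition free_algebra :: "'g set \<Rightarrow> ('g list \<Rightarrow>\<^sub>0 complex) ring" where
  "free_algebra X =
     \<lparr>carrier = {x. \<forall>w \<in> Poly_Mapping.keys x. set w \<subseteq> X},
      mult = (*), one = 1, zero = 0, add = (+)\<rparr>"

text \<open>A complex algebra is a ring \<open>A\<close> together with its structure map \<open>\<iota>\<close> from the
  scalars; an action on the subspace \<open>V\<close> is a unital homomorphism of algebras from \<open>A\<close> to the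
  linear endomorphisms of \<open>V\<close> (unitality is the case \<open>c = 1\<close> of the condition on \<open>\<iota>\<close>).\<close>

definition algebra_action ::
    "('a, 'r) ring_scheme \<Rightarrow> (complex \<Rightarrow> 'a) \<Rightarrow> ('b \<Rightarrow>\<^sub>0 complex) set
      \<Rightarrow> ('a \<Rightarrow> ('b \<Rightarrow>\<^sub>0 complex) \<Rightarrow> ('b \<Rightarrow>\<^sub>0 complex)) \<Rightarrow> bool" where
  "algebra_action A \<iota> V act \<longleftrightarrow>
     (\<forall>x \<in> carrier A. \<forall>v \<in> V. act x v \<in> V) \<and>
     (\<forall>x \<in> carrier A. \<forall>v \<in> V. \<forall>w \<in> V. act x (v + w) = act x v + act x w) \<and>
     (\<forall>x \<in> carrier A. \<forall>c. \<forall>v \<in> V. act x (c \<cdot> v) = c \<cdot> act x v) \<and>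
     (\<forall>x \<in> carrier A. \<forall>y \<in> carrier A. \<forall>v \<in> V. act (x \<oplus>\<^bsub>A\<^esub> y) v = act x v + act y v) \<and>
     (\<forall>x \<in> carrier A. \<forall>y \<in> carrier A. \<forall>v \<in> V. act (x \<otimes>\<^bsub>A\<^esub> y) v = act x (act y v)) \<and>
     (\<forall>c. \<forall>v \<in> V. act (\<iota> c) v = c \<cdot> v)"


section \<open>The quantum toroidal algebra\<close>

text \<open>Indices in \<open>\<int>/n\<int>\<close> are represented by the integers \<open>0, \<dots>, n - 1\<close>, and the lattice
  \<open>P\<close> by the finitely supported functions on them.\<close>

datatype gen =
    Egen int int | Fgen int int | Hgen int int
  | Qgen "int \<Rightarrow>\<^sub>0 int"  \<comment> \<open>\<open>q\<^sup>h\<close>\<close>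
  | Cgen | Cinv | Dgen | Dinv

type_synonym gen_alg = "gen list \<Rightarrow>\<^sub>0 complex"

definition lattice_P :: "nat \<Rightarrow> (int \<Rightarrow>\<^sub>0 int) set" where
  "lattice_P n = {h. Poly_Mapping.keys h \<subseteq> {0..<int n}}"

definition eps :: "nat \<Rightarrow> int \<Rightarrow> (int \<Rightarrow>\<^sub>0 int)" where
  "eps n i = Poly_Mapping.single (i mod int n) 1"

definition alpha :: "nat \<Rightarrow> int \<Rightarrow> (int \<Rightarrow>\<^sub>0 int)" where
  "alpha n i = eps n (i - 1) - eps n i"

definition pairing :: "(int \<Rightarrow>\<^sub>0 int) \<Rightarrow> (int \<Rightarrow>\<^sub>0 int) \<Rightarrow> int" where
  "pairing h h' = (\<Sum>k \<in> Poly_Mapping.keys h. Poly_Mapping.lookup h k * Poly_Mapping.lookup h' k)"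

definition gens :: "nat \<Rightarrow> gen set" where
  "gens n =
     {Egen i k | i k. i \<in> {0..<int n}} \<union> {Fgen i k | i k. i \<in> {0..<int n}} \<union>
     {Hgen i r | i r. i \<in> {0..<int n} \<and> r \<noteq> 0} \<union> Qgen ` lattice_P n \<union>
     {Cgen, Cinv, Dgen, Dinv}"

definition Cpow :: "int \<Rightarrow> gen_alg" where
  "Cpow k = (if k \<ge> 0 then var Cgen ^ nat k else var Cinv ^ nat (- k))"

definition qcomm :: "complex \<Rightarrow> gen_alg \<Rightarrow> gen_alg \<Rightarrow> gen_alg" where
  "qcomm c X Y = X * Y - c \<cdot> (Y * X)"

text \<open>The exponential of a formal power series without constant term; in the coefficient of
  degree \<open>N\<close> only the powers up to \<open>N\<close> contribute.\<close>

definition series_exp :: "gen_alg fps \<Rightarrow> gen_alg fps" where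
  "series_exp X = Abs_fps (\<lambda>N. \<Sum>k\<le>N. (1 / fact k) \<cdot> fps_nth (X ^ k) N)"

text \<open>\<open>K\<^sub>i\<^sup>+(z)\<close> as a power series in \<open>z\<^sup>-\<^sup>1\<close>, and \<open>K\<^sub>i\<^sup>-(z)\<close> as a power series in \<open>z\<close>.\<close>

definition Kplus :: "complex \<Rightarrow> nat \<Rightarrow> int \<Rightarrow> gen_alg fps" where
  "Kplus q n i = fps_const (var (Qgen (alpha n i))) *
     series_exp (Abs_fps (\<lambda>r. if r = 0 then 0 else (q - inverse q) \<cdot> var (Hgen i (int r))))"

definition Kminus :: "complex \<Rightarrow> nat \<Rightarrow> int \<Rightarrow> gen_alg fps" where
  "Kminus q n i = fps_const (var (Qgen (- alpha n i))) *
     series_exp (Abs_fps (\<lambda>r. if r = 0 then 0 else (- (q - inverse q)) \<cdot> var (Hgen i (- int r))))"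

definition int_nth :: "'a::zero fps \<Rightarrow> int \<Rightarrow> 'a" where
  "int_nth f k = (if k < 0 then 0 else fps_nth f (nat k))"

definition a_coeff :: "complex \<Rightarrow> complex \<Rightarrow> nat \<Rightarrow> int \<Rightarrow> int \<Rightarrow> int \<Rightarrow> complex" where
  "a_coeff q dc n i j r = qnum q r / of_int r *
     ((q powi r + q powi (- r)) * kdelta n i j
       - dc powi r * kdelta n i (j - 1) - dc powi (- r) * kdelta n i (j + 1))"

text \<open>Laurent polynomials in \<open>z\<close>, \<open>w\<close> are \<^typ>\<open>(int \<times> int) \<Rightarrow>\<^sub>0 complex\<close>; formal
  distributions in \<open>z\<close>, \<open>w\<close> are families \<open>f\<close>, where \<open>f (a, b)\<close> is the coefficient of
  \<open>z\<^sup>a w\<^sup>b\<close>, and form a module over them.\<close>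

type_synonym laurent2 = "(int \<times> int) \<Rightarrow>\<^sub>0 complex"

definition zvar :: laurent2 where "zvar = Poly_Mapping.single (1, 0) 1"
definition wvar :: laurent2 where "wvar = Poly_Mapping.single (0, 1) 1"

definition laurent_mult :: "laurent2 \<Rightarrow> (int \<times> int \<Rightarrow> gen_alg) \<Rightarrow> (int \<times> int \<Rightarrow> gen_alg)" where
  "laurent_mult p f = (\<lambda>e. \<Sum>e' \<in> Poly_Mapping.keys p. Poly_Mapping.lookup p e' \<cdot> f (e - e'))"

definition g_poly ::
    "complex \<Rightarrow> complex \<Rightarrow> nat \<Rightarrow> int \<Rightarrow> int \<Rightarrow> laurent2 \<Rightarrow> laurent2 \<Rightarrow> laurent2" where
  "g_poly q dc n i j z w =
     (let q1 = inverse q * dc; q2 = q ^ 2; q3 = inverse q * inverse dc in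
      if n = 2 then
        (if i mod int n = j mod int n then z - q2 \<cdot> w else (z - q1 \<cdot> w) * (z - q3 \<cdot> w))
      else
        (if i mod int n = (j - 1) mod int n then z - q1 \<cdot> w
         else if i mod int n = j mod int n then z - q2 \<cdot> w
         else if i mod int n = (j + 1) mod int n then z - q3 \<cdot> w
         else z - w))"

definition d_coeff :: "complex \<Rightarrow> nat \<Rightarrow> int \<Rightarrow> int \<Rightarrow> complex" where
  "d_coeff dc n i j =
     (if n = 2 then (if i mod int n = j mod int n then 1 else - 1)
      else if i mod int n = (j - 1) mod int n then inverse dc
      else if i mod int n = (j + 1) mod int n then dc
      else 1)"

text \<open>Coefficients of the products \<open>X\<^sub>i(z) X\<^sub>j(w)\<close> and \<open>X\<^sub>j(w) X\<^sub>i(z)\<close> of currents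
  \<open>X\<^sub>i(z) = \<Sum>\<^sub>k X\<^sub>i\<^sub>,\<^sub>k z\<^sup>-\<^sup>k\<close>.\<close>

definition prod_zw :: "(int \<Rightarrow> int \<Rightarrow> gen) \<Rightarrow> int \<Rightarrow> int \<Rightarrow> int \<times> int \<Rightarrow> gen_alg" where
  "prod_zw X i j = (\<lambda>(a, b). var (X i (- a)) * var (X j (- b)))"

definition prod_wz :: "(int \<Rightarrow> int \<Rightarrow> gen) \<Rightarrow> int \<Rightarrow> int \<Rightarrow> int \<times> int \<Rightarrow> gen_alg" where
  "prod_wz X j i = (\<lambda>(a, b). var (X j (- b)) * var (X i (- a)))"

definition sym2 :: "(int \<Rightarrow> int \<Rightarrow> gen_alg) \<Rightarrow> int \<Rightarrow> int \<Rightarrow> gen_alg" where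
  "sym2 f k1 k2 = f k1 k2 + f k2 k1"

definition sym3 :: "(int \<Rightarrow> int \<Rightarrow> int \<Rightarrow> gen_alg) \<Rightarrow> int \<Rightarrow> int \<Rightarrow> int \<Rightarrow> gen_alg" where
  "sym3 f k1 k2 k3 =
     f k1 k2 k3 + f k1 k3 k2 + f k2 k1 k3 + f k2 k3 k1 + f k3 k1 k2 + f k3 k2 k1"

text \<open>The defining relations, coefficient by coefficient: \<open>k, k1, k2, k3\<close> and \<open>l\<close> stand for the
  coefficients of \<open>z\<^sup>-\<^sup>k\<close> (or of the powers of \<open>z\<^sub>1, z\<^sub>2, z\<^sub>3\<close>) and of \<open>w\<^sup>-\<^sup>l\<close>. In \<open>EF\<close>,
  \<open>\<delta>(C w / z) K\<^sup>+(w)\<close> has the coefficient \<open>C\<^sup>k\<close> times that of \<open>w\<^sup>-\<^sup>(\<^sup>k\<^sup>+\<^sup>l\<^sup>)\<close> in \<open>K\<^sup>+(w)\<close>, and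
  \<open>\<delta>(C z / w) K\<^sup>-(z)\<close> has the coefficient \<open>C\<^sup>l\<close> times that of \<open>z\<^sup>-\<^sup>(\<^sup>k\<^sup>+\<^sup>l\<^sup>)\<close> in \<open>K\<^sup>-(z)\<close>.\<close>

inductive toroidal_rel :: "complex \<Rightarrow> complex \<Rightarrow> nat \<Rightarrow> gen_alg \<Rightarrow> gen_alg \<Rightarrow> bool"
  for q dc :: complex and n :: nat where
  C_central: "x \<in> gens n \<Longrightarrow> toroidal_rel q dc n (var Cgen * var x) (var x * var Cgen)"
| C_inv: "toroidal_rel q dc n (var Cgen * var Cinv) 1"
| C_inv': "toroidal_rel q dc n (var Cinv * var Cgen) 1"
| D_inv: "toroidal_rel q dc n (var Dgen * var Dinv) 1"
| D_inv': "toroidal_rel q dc n (var Dinv * var Dgen) 1"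
| Q_add: "\<lbrakk>h \<in> lattice_P n; h' \<in> lattice_P n\<rbrakk> \<Longrightarrow>
    toroidal_rel q dc n (var (Qgen h) * var (Qgen h')) (var (Qgen (h + h')))"
| Q_0: "toroidal_rel q dc n (var (Qgen 0)) 1"
| DQ: "h \<in> lattice_P n \<Longrightarrow>
    toroidal_rel q dc n (var Dgen * var (Qgen h)) (var (Qgen h) * var Dgen)"
| QE: "\<lbrakk>h \<in> lattice_P n; i \<in> {0..<int n}\<rbrakk> \<Longrightarrow>
    toroidal_rel q dc n (var (Qgen h) * var (Egen i k) * var (Qgen (- h)))
      (q powi pairing h (alpha n i) \<cdot> var (Egen i k))"
| QF: "\<lbrakk>h \<in> lattice_P n; i \<in> {0..<int n}\<rbrakk> \<Longrightarrow>
    toroidal_rel q dc n (var (Qgen h) * var (Fgen i k) * var (Qgen (- h)))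
      (q powi (- pairing h (alpha n i)) \<cdot> var (Fgen i k))"
| DE: "i \<in> {0..<int n} \<Longrightarrow>
    toroidal_rel q dc n (var Dgen * var (Egen i k) * var Dinv) (q powi (- k) \<cdot> var (Egen i k))"
| DF: "i \<in> {0..<int n} \<Longrightarrow>
    toroidal_rel q dc n (var Dgen * var (Fgen i k) * var Dinv) (q powi (- k) \<cdot> var (Fgen i k))"
| DKplus: "i \<in> {0..<int n} \<Longrightarrow>
    toroidal_rel q dc n (var Dgen * fps_nth (Kplus q n i) N * var Dinv)
      (q powi (- int N) \<cdot> fps_nth (Kplus q n i) N)"
| DKminus: "i \<in> {0..<int n} \<Longrightarrow>
    toroidal_rel q dc n (var Dgen * fps_nth (Kminus q n i) N * var Dinv)
      (q powi int N \<cdot> fps_nth (Kminus q n i) N)"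
| HE: "\<lbrakk>i \<in> {0..<int n}; j \<in> {0..<int n}; r \<noteq> 0\<rbrakk> \<Longrightarrow>
    toroidal_rel q dc n (qcomm 1 (var (Hgen i r)) (var (Egen j k)))
      (a_coeff q dc n i j r \<cdot> (Cpow (- ((r + \<bar>r\<bar>) div 2)) * var (Egen j (k + r))))"
| HF: "\<lbrakk>i \<in> {0..<int n}; j \<in> {0..<int n}; r \<noteq> 0\<rbrakk> \<Longrightarrow>
    toroidal_rel q dc n (qcomm 1 (var (Hgen i r)) (var (Fgen j k)))
      ((- a_coeff q dc n i j r) \<cdot> (Cpow (- ((r - \<bar>r\<bar>) div 2)) * var (Fgen j (k + r))))"
| HH: "\<lbrakk>i \<in> {0..<int n}; j \<in> {0..<int n}; r \<noteq> 0; s \<noteq> 0\<rbrakk> \<Longrightarrow>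
    toroidal_rel q dc n (qcomm 1 (var (Hgen i r)) (var (Hgen j s)))
      (if r + s = 0
       then (a_coeff q dc n i j r / (q - inverse q)) \<cdot> (Cpow r - Cpow (- r)) else 0)"
| EF: "\<lbrakk>i \<in> {0..<int n}; j \<in> {0..<int n}\<rbrakk> \<Longrightarrow>
    toroidal_rel q dc n (qcomm 1 (var (Egen i k)) (var (Fgen j l)))
      (if i = j
       then (1 / (q - inverse q)) \<cdot>
         (Cpow k * int_nth (Kplus q n i) (k + l) - Cpow l * int_nth (Kminus q n i) (- (k + l)))
       else 0)"
| comm: "\<lbrakk>X = Egen \<or> X = Fgen; i \<in> {0..<int n}; j \<in> {0..<int n};
     i mod int n \<noteq> j mod int n; i mod int n \<noteq> (j + 1) mod int n;
     i mod int n \<noteq> (j - 1) mod int n\<rbrakk> \<Longrightarrow>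
    toroidal_rel q dc n (qcomm 1 (var (X i k)) (var (X j l))) 0"
| EE: "\<lbrakk>i \<in> {0..<int n}; j \<in> {0..<int n}\<rbrakk> \<Longrightarrow>
    toroidal_rel q dc n
      (d_coeff dc n i j \<cdot>
         laurent_mult (g_poly q dc n i j zvar wvar) (prod_zw Egen i j) (- k, - l)
       + laurent_mult (g_poly q dc n j i wvar zvar) (prod_wz Egen j i) (- k, - l)) 0"
| FF: "\<lbrakk>i \<in> {0..<int n}; j \<in> {0..<int n}\<rbrakk> \<Longrightarrow>
    toroidal_rel q dc n
      (d_coeff dc n j i \<cdot>
         laurent_mult (g_poly q dc n j i wvar zvar) (prod_zw Fgen i j) (- k, - l)
       + laurent_mult (g_poly q dc n i j zvar wvar) (prod_wz Fgen j i) (- k, - l)) 0"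
| Serre: "\<lbrakk>n \<ge> 3; X = Egen \<or> X = Fgen; i \<in> {0..<int n}; j \<in> {0..<int n};
     j mod int n = (i + 1) mod int n \<or> j mod int n = (i - 1) mod int n\<rbrakk> \<Longrightarrow>
    toroidal_rel q dc n
      (sym2 (\<lambda>k1 k2. qcomm (inverse q) (var (X i k1)) (qcomm q (var (X i k2)) (var (X j l)))) k1 k2)
      0"
| Serre2: "\<lbrakk>n = 2; X = Egen \<or> X = Fgen; i \<in> {0..<int n}; j \<in> {0..<int n};
     j mod int n \<noteq> i mod int n\<rbrakk> \<Longrightarrow>
    toroidal_rel q dc n
      (sym3 (\<lambda>k1 k2 k3. qcomm (q powi (- 2)) (var (X i k1))
         (qcomm 1 (var (X i k2)) (qcomm (q ^ 2) (var (X i k3)) (var (X j l))))) k1 k2 k3)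
      0"

definition toroidal_ideal :: "complex \<Rightarrow> complex \<Rightarrow> nat \<Rightarrow> gen_alg set" where
  "toroidal_ideal q dc n = Idl\<^bsub>free_algebra (gens n)\<^esub> {x - y | x y. toroidal_rel q dc n x y}"

text \<open>\<open>\<E>\<^sub>n(q\<^sub>1, q\<^sub>2, q\<^sub>3)\<close> with \<open>q\<^sub>1 = q\<^sup>-\<^sup>1 dc\<close>, \<open>q\<^sub>2 = q\<^sup>2\<close>, \<open>q\<^sub>3 = q\<^sup>-\<^sup>1 dc\<^sup>-\<^sup>1\<close>.\<close>

definition toroidal_algebra :: "complex \<Rightarrow> complex \<Rightarrow> nat \<Rightarrow> gen_alg set ring" where
  "toroidal_algebra q dc n = free_algebra (gens n) Quot toroidal_ideal q dc n"

definition toroidal_class :: "complex \<Rightarrow> complex \<Rightarrow> nat \<Rightarrow> gen_alg \<Rightarrow> gen_alg set" where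
  "toroidal_class q dc n x = toroidal_ideal q dc n +>\<^bsub>free_algebra (gens n)\<^esub> x"


section \<open>The Fock space\<close>

text \<open>The basis vector \<open>(\<mu>, \<nu>)\<close> is \<open>(\<Prod> (a\<^bsup>i,j\<^esup>\<^bsub>-r\<^esub>)\<^bsup>\<mu>(i,j,r)\<^esup>) \<otimes> |\<nu>\<rangle>\<close>.\<close>

type_synonym fock_index = "((int \<times> int \<times> nat) \<Rightarrow>\<^sub>0 nat) \<times> ((int \<times> int) \<Rightarrow>\<^sub>0 int)"
type_synonym fock = "fock_index \<Rightarrow>\<^sub>0 complex"

definition fock_basis :: "nat \<Rightarrow> nat \<Rightarrow> fock_index set" where
  "fock_basis m n =
     {(\<mu>, \<nu>). Poly_Mapping.keys \<mu> \<subseteq> {0..<int m} \<times> {0..<int n} \<times> {1..} \<and>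
              Poly_Mapping.keys \<nu> \<subseteq> {0..<int m} \<times> {0..<int n}}"

definition fock_space :: "nat \<Rightarrow> nat \<Rightarrow> fock set" where
  "fock_space m n = {v. Poly_Mapping.keys v \<subseteq> fock_basis m n}"

abbreviation ket :: "fock_index \<Rightarrow> fock" where
  "ket b \<equiv> Poly_Mapping.single b 1"

definition linear_ext :: "(fock_index \<Rightarrow> fock) \<Rightarrow> fock \<Rightarrow> fock" where
  "linear_ext f v = (\<Sum>b \<in> Poly_Mapping.keys v. Poly_Mapping.lookup v b \<cdot> f b)"

definition diagonal :: "(fock_index \<Rightarrow> complex) \<Rightarrow> fock \<Rightarrow> fock" where
  "diagonal f = linear_ext (\<lambda>b. f b \<cdot> ket b)"

text \<open>For a sequence of operators, \<open>op_power X k N\<close> and \<open>op_exp X N\<close> are the coefficients of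
  \<open>y\<^sup>N\<close> in \<open>(\<Sum>\<^sub>r\<^sub>>\<^sub>0 X\<^sub>r y\<^sup>r)\<^sup>k\<close> and in \<open>exp(\<Sum>\<^sub>r\<^sub>>\<^sub>0 X\<^sub>r y\<^sup>r)\<close>.\<close>

fun op_power :: "(nat \<Rightarrow> fock \<Rightarrow> fock) \<Rightarrow> nat \<Rightarrow> nat \<Rightarrow> fock \<Rightarrow> fock" where
  "op_power X 0 N v = (if N = 0 then v else 0)"
| "op_power X (Suc k) N v = (\<Sum>r = 1..N. X r (op_power X k (N - r) v))"

definition op_exp :: "(nat \<Rightarrow> fock \<Rightarrow> fock) \<Rightarrow> nat \<Rightarrow> fock \<Rightarrow> fock" where
  "op_exp X N v = (\<Sum>k\<le>N. (1 / fact k) \<cdot> op_power X k N v)"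

text \<open>The coefficient of \<open>z\<^sup>p\<close> in \<open>exp(\<Sum>\<^sub>r\<^sub>>\<^sub>0 X\<^sub>-\<^sub>r z\<^sup>r) exp(\<Sum>\<^sub>r\<^sub>>\<^sub>0 X\<^sub>r z\<^sup>-\<^sup>r) v\<close>, with \<open>Xp r = X\<^sub>r\<close> and
  \<open>Xm r = X\<^sub>-\<^sub>r\<close>. Only finitely many \<open>s\<close> contribute when the \<open>X\<^sub>r\<close> are annihilation operators.\<close>

definition normal_exp ::
    "(nat \<Rightarrow> fock \<Rightarrow> fock) \<Rightarrow> (nat \<Rightarrow> fock \<Rightarrow> fock) \<Rightarrow> int \<Rightarrow> fock \<Rightarrow> fock" where
  "normal_exp Xp Xm p v =
     Sum_any (\<lambda>s :: nat. if p + int s < 0 then 0 else op_exp Xm (nat (p + int s)) (op_exp Xp s v))"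

text \<open>In what follows \<open>sq\<close> and \<open>sd\<close> are square roots of \<open>q\<close> and \<open>dc\<close>, used for the half-integral
  powers \<open>q\<^sup>d\<^sup>e\<^sup>g\<close> and \<open>dc\<^sup>x\<close>.\<close>

context
  fixes q d dc sq sd :: complex and m n :: nat and u :: "int \<Rightarrow> complex"
begin

definition boson :: "int \<Rightarrow> int \<Rightarrow> int \<Rightarrow> fock \<Rightarrow> fock" where
  "boson i j r = linear_ext (\<lambda>(\<mu>, \<nu>).
     let x = (i mod int m, j mod int n, nat \<bar>r\<bar>) in
     if r < 0 then ket (\<mu> + Poly_Mapping.single x 1, \<nu>)
     else ((qnum q r)\<^sup>2 / of_int r * of_nat (Poly_Mapping.lookup \<mu> x)) \<cdot>
            ket (\<mu> - Poly_Mapping.single x 1, \<nu>))"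

definition partial :: "fock_index \<Rightarrow> int \<Rightarrow> int \<Rightarrow> int" where
  \<comment> \<open>the eigenvalue of \<open>\<partial>\<^bsub>i,j\<^esub>\<close>\<close>
  "partial b i j = Poly_Mapping.lookup (snd b) (i mod int m, j mod int n)"

definition e_check :: "fock_index \<Rightarrow> int \<Rightarrow> int" where
  \<comment> \<open>the eigenvalue of the zero mode \<open>e\<^sub>j\<close>\<close>
  "e_check b j = - (\<Sum>s = 0..int m - 1. partial b s j)"

definition twice_deg :: "fock_index \<Rightarrow> int" where
  "twice_deg b =
     2 * (\<Sum>(i, j, r) \<in> Poly_Mapping.keys (fst b). int (Poly_Mapping.lookup (fst b) (i, j, r)) * int r)
     + (\<Sum>x \<in> Poly_Mapping.keys (snd b). (Poly_Mapping.lookup (snd b) x)\<^sup>2)"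

text \<open>\<open>e\<^bsup>\<plusminus>\<epsilon>\<^esup>\<close> for \<open>c = \<plusminus>1\<close>.\<close>

definition exp_eps :: "int \<Rightarrow> int \<Rightarrow> int \<Rightarrow> fock \<Rightarrow> fock" where
  "exp_eps c i j = linear_ext (\<lambda>(\<mu>, \<nu>).
     let i' = i mod int m; j' = j mod int n in
     (- 1) powi ((\<Sum>s = 0..i' - 1. \<Sum>t = 0..int n - 1. partial (\<mu>, \<nu>) s t)
                 + (\<Sum>t = 0..j' - 1. partial (\<mu>, \<nu>) i' t))
       \<cdot> ket (\<mu>, \<nu> + Poly_Mapping.single (i', j') c))"

text \<open>The suffixes \<open>_p\<close> and \<open>_m\<close> mark the modes of index \<open>r > 0\<close> and \<open>- r < 0\<close>.\<close>

definition b_p :: "int \<Rightarrow> int \<Rightarrow> nat \<Rightarrow> fock \<Rightarrow> fock" where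
  "b_p i j r v =
     (- (q ^ r)) \<cdot> ((inverse q * inverse dc) ^ r \<cdot> boson i (j - 1) (int r) v - boson i j (int r) v)"

definition b_m :: "int \<Rightarrow> int \<Rightarrow> nat \<Rightarrow> fock \<Rightarrow> fock" where
  "b_m i j r v =
     - ((inverse q * dc) ^ r \<cdot> boson i (j - 1) (- int r) v - boson i j (- int r) v)"

definition q1 :: complex where "q1 = inverse q * d"
definition q2 :: complex where "q2 = q ^ 2"
definition q3 :: complex where "q3 = inverse q * inverse d"

definition A_p :: "int \<Rightarrow> int \<Rightarrow> nat \<Rightarrow> fock \<Rightarrow> fock" where
  "A_p i j r v =
     (- (1 / qnum q (int r)) * q powi (- (int m - 1) * int r) * q3 powi (- i * int r)) \<cdot> b_p i j r v"

definition A_m :: "int \<Rightarrow> int \<Rightarrow> nat \<Rightarrow> fock \<Rightarrow> fock" where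
  "A_m i j r v =
     (1 / qnum q (int r) * q powi ((int m - 2) * int r)) \<cdot>
       (q3 powi (i * int r) \<cdot> b_m i j r v
        + (1 - q2 ^ r) \<cdot> (\<Sum>s = i + 1..int m - 1. q3 powi (s * int r) \<cdot> b_m s j r v))"

definition B_p :: "int \<Rightarrow> int \<Rightarrow> nat \<Rightarrow> fock \<Rightarrow> fock" where
  "B_p i j r v =
     (1 / qnum q (int r) * q ^ r) \<cdot>
       (q1 powi (i * int r) \<cdot> b_p i j r v
        + (1 - q2 powi (- int r)) \<cdot> (\<Sum>s = 0..i - 1. q1 powi (s * int r) \<cdot> b_p s j r v))"

definition B_m :: "int \<Rightarrow> int \<Rightarrow> nat \<Rightarrow> fock \<Rightarrow> fock" where
  "B_m i j r v = (- (1 / qnum q (int r)) * q1 powi (- i * int r)) \<cdot> b_m i j r v"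

text \<open>\<open>U\<^bsup>i,j\<^esup>(z)\<close> sends a basis vector \<open>b\<close> to a multiple of \<open>z\<^bsup>U_exponent i j b\<^esup>\<close>; the power of
  \<open>dc\<close> is written as a power of \<open>sd\<close> with the exponent doubled. \<open>U_op i j p\<close> is the coefficient
  of \<open>z\<^sup>p\<close>; likewise for \<open>V\<close>.\<close>

definition U_exponent :: "int \<Rightarrow> int \<Rightarrow> fock_index \<Rightarrow> int" where
  "U_exponent i j b = - partial b i (j - 1) + partial b i j + 1"

definition U_factor :: "int \<Rightarrow> int \<Rightarrow> fock_index \<Rightarrow> complex" where
  "U_factor i j b =
     (q powi (int m - 1 - i)) powi U_exponent i j b *
     (if j = 0
      then sd powi ((1 - 2 * int n) * e_check b (int n - 1) + e_check b 0
                    - 2 * int n * partial b i (int n - 1))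
      else sd powi ((1 - 2 * j) * e_check b (j - 1) + (1 + 2 * j) * e_check b j
                    - 2 * j * (partial b i (j - 1) - partial b i j))) *
     q powi (\<Sum>s = i + 1..int m - 1. partial b s (j - 1) - partial b s j)"

definition U_op :: "int \<Rightarrow> int \<Rightarrow> int \<Rightarrow> fock \<Rightarrow> fock" where
  "U_op i j p = exp_eps 1 i j \<circ> exp_eps (- 1) i (j - 1) \<circ>
     diagonal (\<lambda>b. if U_exponent i j b = p then U_factor i j b else 0)"

definition V_exponent :: "int \<Rightarrow> int \<Rightarrow> fock_index \<Rightarrow> int" where
  "V_exponent i j b = partial b i (j - 1) - partial b i j + 1"

definition V_factor :: "int \<Rightarrow> int \<Rightarrow> fock_index \<Rightarrow> complex" where
  "V_factor i j b =
     (q powi i) powi V_exponent i j b *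
     (if j = 0
      then sd powi (- (1 - 2 * int n) * e_check b (int n - 1) - e_check b 0
                    + 2 * int n * partial b i (int n - 1))
      else sd powi (- (1 - 2 * j) * e_check b (j - 1) - (1 + 2 * j) * e_check b j
                    + 2 * j * (partial b i (j - 1) - partial b i j))) *
     q powi (- (\<Sum>s = 0..i - 1. partial b s (j - 1) - partial b s j))"

definition V_op :: "int \<Rightarrow> int \<Rightarrow> int \<Rightarrow> fock \<Rightarrow> fock" where
  "V_op i j p = exp_eps 1 i (j - 1) \<circ> exp_eps (- 1) i j \<circ>
     diagonal (\<lambda>b. if V_exponent i j b = p then V_factor i j b else 0)"

definition fock_q_eps :: "int \<Rightarrow> fock \<Rightarrow> fock" where
  "fock_q_eps j = diagonal (\<lambda>b. q powi e_check b j)"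

definition fock_D :: "fock \<Rightarrow> fock" where
  "fock_D = diagonal (\<lambda>b. sq powi twice_deg b)"

definition fock_H_p :: "int \<Rightarrow> nat \<Rightarrow> fock \<Rightarrow> fock" where
  "fock_H_p j r v = (\<Sum>i = 0..int m - 1. q1 powi (i * int r) \<cdot> b_p i j r v)"

definition fock_H_m :: "int \<Rightarrow> nat \<Rightarrow> fock \<Rightarrow> fock" where
  "fock_H_m j r v =
     (\<Sum>i = 0..int m - 1. (q powi ((int m - 1) * int r) * q3 powi (i * int r)) \<cdot> b_m i j r v)"

text \<open>\<open>E\<^sub>j\<^sub>,\<^sub>k\<close> and \<open>F\<^sub>j\<^sub>,\<^sub>k\<close> are the coefficients of \<open>z\<^sup>-\<^sup>k\<close>; the power \<open>a\<close> is contributed by the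
  normally ordered exponential.\<close>

definition fock_E :: "int \<Rightarrow> int \<Rightarrow> fock \<Rightarrow> fock" where
  "fock_E j k v =
     (\<Sum>i = 0..int m - 1. (if j = 0 then inverse (u i) else 1) \<cdot>
        Sum_any (\<lambda>a :: int. normal_exp (A_p i j) (A_m i j) a (U_op i j (- k - a) v)))"

definition fock_F :: "int \<Rightarrow> int \<Rightarrow> fock \<Rightarrow> fock" where
  "fock_F j k v =
     (\<Sum>i = 0..int m - 1. (if j = 0 then u i else 1) \<cdot>
        Sum_any (\<lambda>a :: int. normal_exp (B_p i j) (B_m i j) a (V_op i j (- k - a) v)))"

end

end

theory Submission
  imports Defs "HOL-Computational_Algebra.Polynomial_FPS"
begin

text \<open>
  The proof rests on the observation that only a small part of the relations has to be computed
  with vertex operators; everything else is forced by integrability.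

  The computed part consists of the relations of \<open>K\<close> and \<open>H\<close> among themselves and with \<open>E\<close>, \<open>F\<close>,
  which express the commutators of the bosons, and of the relation between \<open>E\<close> and \<open>F\<close>. For the
  latter write \<open>E\<^sub>i(z)\<close> and \<open>F\<^sub>j(w)\<close> as sums over the rows \<open>a\<close> and \<open>b\<close> of single vertex operators. A family
  of operators whose commutators with all bosons shift its indices is determined by its
  matrix elements between vacuum vectors (lemma \<open>vacuum_uniqueness\<close>), so that identities between
  products of vertex operators become identities between formal power series in one variable.
  For different rows or different nodes the contraction of the two operators is a polynomial in
  \<open>w/z\<close> and both orders of the product expand the same Laurent polynomial: the operators commute
  (\<open>EF_vanish\<close>). For equal row and node the contraction is
  \<open>1 / ((1 - \<gamma> q w/z) (1 - \<gamma> q\<^sup>-\<^sup>1 w/z))\<close> with \<open>\<gamma> = q\<^bsup>2a-m+1\<^esup>\<close>, and the commutator is supported at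
  the two poles \<open>z = q\<^bsup>2a+2-m\<^esup> w\<close> and \<open>z = q\<^bsup>2a-m\<^esup> w\<close> (\<open>EF_diag\<close>). The residues are Cartan
  currents \<open>T\<^sub>a\<^sub>+\<^sub>1\<close> and \<open>T\<^sub>a\<close>, so the sum over the rows telescopes to \<open>T\<^sub>m - T\<^sub>0\<close>, and these
  two currents are \<open>K\<^sup>+\<close> and \<open>K\<^sup>-\<close>; the arguments \<open>q\<^bsup>m\<^esup> w\<close> and \<open>q\<^bsup>-m\<^esup> w\<close> show that the level
  is \<open>m\<close> (\<open>EF_commutator\<close>).

  The quadratic and the Serre relations follow without further computation. The zero modes of
  \<open>E\<^sub>i\<close> and \<open>F\<^sub>i\<close> generate a quantum \<open>sl\<^sub>2\<close> acting locally nilpotently, because they preserve the degree, which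
  bounds the momentum. In such a situation an operator that commutes with \<open>f\<close> and has weight \<open>p\<close>
  is annihilated by the \<open>N\<close>-th power of the \<open>q\<close>-adjoint action of \<open>e\<close> for \<open>N > - p\<close>
  (\<open>qad_vanishes\<close>). The quadratic expression in \<open>E\<^sub>i(z)\<close> and \<open>E\<^sub>j(w)\<close> commutes with the zero mode of
  \<open>F\<^sub>i\<close> and has weight \<open>2 + a\<^sub>i\<^sub>j\<close>. If this is positive, \<open>N = 0\<close> is admissible and the expression
  vanishes; the exceptional case \<open>a\<^sub>i\<^sub>j = -2\<close>, which occurs for \<open>n = 2\<close>, is
  treated with \<open>N = 1\<close> (theorem \<open>EE\<close>). Applied to \<open>E\<^sub>j\<^sub>,\<^sub>0\<close> itself, the same principle gives the Serre
  relation of the zero modes, and the Heisenberg generators spread it to all modes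
  (\<open>serre\<close>, \<open>serre2\<close>). The relations for \<open>F\<close> follow by the symmetry \<open>dual\<close>.

  Finally an assignment of operators to the generators that satisfies the relations is the same as an
  action of the algebra defined by them (\<open>action_of_quotient\<close>).
\<close>

section \<open>Linear algebra over a basis\<close>

lemma lookup_scale [simp]: "Poly_Mapping.lookup (c \<cdot> x) b = c * Poly_Mapping.lookup x b"
  by (auto simp: scale_def Poly_Mapping.map.rep_eq when_def)

lemma scale_simps [simp]:
  "c \<cdot> (x + y) = c \<cdot> x + c \<cdot> y" "c \<cdot> (x - y) = c \<cdot> x - c \<cdot> y"
  "c \<cdot> (- x) = - (c \<cdot> x)" "c \<cdot> 0 = 0" "0 \<cdot> x = 0" "1 \<cdot> x = x"
  "a \<cdot> b \<cdot> x = (a * b) \<cdot> x"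
  by (auto intro!: poly_mapping_eqI simp: lookup_add lookup_minus algebra_simps)

lemma scale_add_left: "(a + b) \<cdot> x = a \<cdot> x + b \<cdot> x"
  and scale_uminus_left: "(- a) \<cdot> x = - (a \<cdot> x)"
  by (auto intro!: poly_mapping_eqI simp: lookup_add algebra_simps)

lemma scale_sum: "c \<cdot> (\<Sum>i\<in>A. f i) = (\<Sum>i\<in>A. c \<cdot> f i)"
  by (induction A rule: infinite_finite_induct) auto


lemma scale_conv_mult: "c \<cdot> (x :: 'b::monoid_add \<Rightarrow>\<^sub>0 complex) = Poly_Mapping.single 0 c * x"
  by (simp add: scale_def mult_map_scale_conv_mult)

lemma keys_scale: "Poly_Mapping.keys (c \<cdot> x) \<subseteq> Poly_Mapping.keys x"
  by (auto simp: in_keys_iff)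

lemma linear_ext_superset:
  assumes "finite A" "Poly_Mapping.keys v \<subseteq> A"
  shows "linear_ext f v = (\<Sum>b\<in>A. Poly_Mapping.lookup v b \<cdot> f b)"
  unfolding linear_ext_def using assms
  by (intro sum.mono_neutral_left) (auto simp: in_keys_iff)

lemma linear_ext_ket [simp]: "linear_ext f (ket b) = f b"
  by (simp add: linear_ext_def)

lemma linear_ext_add: "linear_ext f (v + w) = linear_ext f v + linear_ext f w"
proof -
  let ?A = "Poly_Mapping.keys v \<union> Poly_Mapping.keys w"
  have "linear_ext f (v + w) = (\<Sum>b\<in>?A. Poly_Mapping.lookup (v + w) b \<cdot> f b)"
    by (rule linear_ext_superset) (auto simp: keys_add)
  also have "\<dots> = linear_ext f v + linear_ext f w"
    by (simp add: linear_ext_superset[of ?A] lookup_add scale_add_left sum.distrib)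
  finally show ?thesis .
qed

lemma linear_ext_scale: "linear_ext f (c \<cdot> v) = c \<cdot> linear_ext f v"
proof -
  have "linear_ext f (c \<cdot> v) = (\<Sum>b\<in>Poly_Mapping.keys v. Poly_Mapping.lookup (c \<cdot> v) b \<cdot> f b)"
    by (rule linear_ext_superset) (auto simp: keys_scale)
  then show ?thesis by (simp add: linear_ext_def scale_sum)
qed

definition lin :: "(fock \<Rightarrow> fock) \<Rightarrow> bool" where
  "lin f \<longleftrightarrow> (\<forall>v w. f (v + w) = f v + f w) \<and> (\<forall>c v. f (c \<cdot> v) = c \<cdot> f v)"

lemma lin_linear_ext [simp]: "lin (linear_ext f)"
  by (simp add: lin_def linear_ext_add linear_ext_scale)

lemma lin_0: "lin f \<Longrightarrow> f 0 = 0"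
  by (metis lin_def scale_simps(5))

lemma lin_sum_apply: "lin f \<Longrightarrow> f (\<Sum>i\<in>A. g i) = (\<Sum>i\<in>A. f (g i))"
  by (induction A rule: infinite_finite_induct) (auto simp: lin_0, auto simp: lin_def)

lemma fock_expand: "v = (\<Sum>b\<in>Poly_Mapping.keys v. Poly_Mapping.lookup v b \<cdot> ket b)" for v :: fock
proof (rule poly_mapping_eqI)
  fix k
  have "Poly_Mapping.lookup (\<Sum>b\<in>Poly_Mapping.keys v. Poly_Mapping.lookup v b \<cdot> ket b) k =
      (\<Sum>b\<in>Poly_Mapping.keys v. if b = k then Poly_Mapping.lookup v b else 0)"
    unfolding lookup_sum by (rule sum.cong) (auto simp: lookup_single when_def)
  also have "\<dots> = Poly_Mapping.lookup v k"
    by (simp add: in_keys_iff)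
  finally show "Poly_Mapping.lookup v k =
      Poly_Mapping.lookup (\<Sum>b\<in>Poly_Mapping.keys v. Poly_Mapping.lookup v b \<cdot> ket b) k" ..
qed

lemma lin_ext: "lin f \<Longrightarrow> f v = linear_ext (\<lambda>b. f (ket b)) v"
  by (subst fock_expand) (simp add: lin_sum_apply lin_def linear_ext_def)

lemma lin_eqI:
  assumes "lin f" "lin g" "\<And>b. f (ket b) = g (ket b)"
  shows "f v = g v"
proof -
  have "f v = linear_ext (\<lambda>b. f (ket b)) v" by (rule lin_ext[OF assms(1)])
  also have "\<dots> = linear_ext (\<lambda>b. g (ket b)) v" by (simp only: assms(3))
  also have "\<dots> = g v" by (rule lin_ext[OF assms(2), symmetric])
  finally show ?thesis .
qed

lemma lin_compose: "lin f \<Longrightarrow> lin g \<Longrightarrow> lin (\<lambda>v. f (g v))"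
  and lin_scale: "lin f \<Longrightarrow> lin (\<lambda>v. c \<cdot> f v)"
  and lin_add: "lin f \<Longrightarrow> lin g \<Longrightarrow> lin (\<lambda>v. f v + g v)"
  and lin_diff: "lin f \<Longrightarrow> lin g \<Longrightarrow> lin (\<lambda>v. f v - g v)"
  and lin_uminus: "lin f \<Longrightarrow> lin (\<lambda>v. - f v)"
  and lin_zero: "lin (\<lambda>v. 0)"
  and lin_ident: "lin (\<lambda>v. v)"
  by (auto simp: lin_def mult.commute algebra_simps)

lemma lin_sum: "(\<And>i. i \<in> A \<Longrightarrow> lin (f i)) \<Longrightarrow> lin (\<lambda>v. \<Sum>i\<in>A. f i v)"
  by (induction A rule: infinite_finite_induct) (auto simp: lin_zero intro!: lin_add)


section \<open>The ring of endomorphisms of the Fock space\<close>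

text \<open>Linear endomorphisms as a type of their own: they form a ring in the sense of the type
  classes, so that the relations can be treated as identities of noncommutative algebra, and
  formal power series with such coefficients are available.\<close>

typedef endo = "{f :: fock \<Rightarrow> fock. lin f}" morphisms app Endo
  by (rule exI[of _ "\<lambda>v. v"]) (simp add: lin_ident)

setup_lifting type_definition_endo

lemma lin_app [simp]: "lin (app X)"
  using app[of X] by simp

lemma app_Endo [simp]: "lin f \<Longrightarrow> app (Endo f) = f"
  by (simp add: Endo_inverse)

instantiation endo :: ring_1
begin
lift_definition zero_endo :: endo is "\<lambda>v. 0" by (rule lin_zero)
lift_definition one_endo :: endo is "\<lambda>v. v" by (rule lin_ident)
lift_definition plus_endo :: "endo \<Rightarrow> endo \<Rightarrow> endo" is "\<lambda>f g v. f v + g v" by (rule lin_add)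
lift_definition minus_endo :: "endo \<Rightarrow> endo \<Rightarrow> endo" is "\<lambda>f g v. f v - g v" by (rule lin_diff)
lift_definition uminus_endo :: "endo \<Rightarrow> endo" is "\<lambda>f v. - f v" by (rule lin_uminus)
lift_definition times_endo :: "endo \<Rightarrow> endo \<Rightarrow> endo" is "\<lambda>f g v. f (g v)" by (rule lin_compose)
instance
proof
  show "(0 :: endo) \<noteq> 1"
  proof
    assume "(0 :: endo) = 1"
    then have "app 0 (ket undefined) = app 1 (ket undefined)" by simp
    then have "(0 :: fock) = ket undefined" by (simp add: zero_endo.rep_eq one_endo.rep_eq)
    then show False by (metis lookup_single_eq lookup_zero zero_neq_one)
  qed
qed (transfer; auto simp: fun_eq_iff lin_def)+
end

lift_definition smul :: "complex \<Rightarrow> endo \<Rightarrow> endo"  (infixr \<open>\<bullet>\<close> 74) is "\<lambda>c f v. c \<cdot> f v"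
  by (rule lin_scale)

lemma app_simps [simp]:
  "app 0 v = 0" "app 1 v = v" "app (X + Y) v = app X v + app Y v" "app (X - Y) v = app X v - app Y v"
  "app (- X) v = - app X v" "app (X * Y) v = app X (app Y v)" "app (c \<bullet> X) v = c \<cdot> app X v"
  by (simp_all add: zero_endo.rep_eq one_endo.rep_eq plus_endo.rep_eq minus_endo.rep_eq
      uminus_endo.rep_eq times_endo.rep_eq smul.rep_eq)

lemma app_lin [simp]: "app X (v + w) = app X v + app X w" "app X (c \<cdot> v) = c \<cdot> app X v" "app X 0 = 0"
  using lin_app[of X] by (auto simp: lin_def lin_0)

lemma app_lin_minus [simp]: "app X (- v) = - app X v" "app X (v - w) = app X v - app X w"
proof -
  show *: "app X (- v) = - app X v" for v
    by (metis app_lin(2) scale_simps(6) scale_uminus_left)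
  show "app X (v - w) = app X v - app X w"
    by (metis "*" app_lin(1) uminus_add_conv_diff add.commute)
qed

lemma app_sum_right: "app X (\<Sum>i\<in>A. f i) = (\<Sum>i\<in>A. app X (f i))"
  by (simp add: lin_sum_apply)

lemma app_sum: "app (\<Sum>i\<in>A. f i) v = (\<Sum>i\<in>A. app (f i) v)"
  by (induction A rule: infinite_finite_induct) auto

lemma endo_eqI: "(\<And>v. app X v = app Y v) \<Longrightarrow> X = Y"
  by (simp add: app_inject[symmetric] fun_eq_iff)

lemma endo_ket_eqI: "(\<And>b. app X (ket b) = app Y (ket b)) \<Longrightarrow> X = Y"
  by (rule endo_eqI, rule lin_eqI) auto

lemma smul_simps [simp]:
  "c \<bullet> (X + Y) = c \<bullet> X + c \<bullet> Y" "c \<bullet> (X - Y) = c \<bullet> X - c \<bullet> Y"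
  "c \<bullet> (- X) = - (c \<bullet> X)" "c \<bullet> 0 = 0" "0 \<bullet> X = 0" "1 \<bullet> X = X"
  "a \<bullet> b \<bullet> X = (a * b) \<bullet> X" "(c \<bullet> X) * Y = c \<bullet> (X * Y)" "X * (c \<bullet> Y) = c \<bullet> (X * Y)"
  by (auto intro!: endo_eqI)

lemma smul_left_distrib: "(a + b) \<bullet> X = a \<bullet> X + b \<bullet> X" "(a - b) \<bullet> X = a \<bullet> X - b \<bullet> X"
  "(- a) \<bullet> X = - (a \<bullet> X)"
proof -
  show *: "(a + b) \<bullet> X = a \<bullet> X + b \<bullet> X" for a b by (auto intro!: endo_eqI simp: scale_add_left)
  show **: "(- a) \<bullet> X = - (a \<bullet> X)" for a by (auto intro!: endo_eqI simp: scale_uminus_left)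
  show "(a - b) \<bullet> X = a \<bullet> X - b \<bullet> X" using *[of a "- b"] by (simp add: **)
qed

lemma smul_sum: "c \<bullet> (\<Sum>i\<in>A. f i) = (\<Sum>i\<in>A. c \<bullet> f i)"
  by (induction A rule: infinite_finite_induct) auto

lemma sum_smul: "(\<Sum>i\<in>A. f i) \<bullet> X = (\<Sum>i\<in>A. f i \<bullet> X)"
  by (induction A rule: infinite_finite_induct) (auto simp: smul_left_distrib)

lemma smul_cancel: "c \<noteq> 0 \<Longrightarrow> c \<bullet> X = c \<bullet> Y \<longleftrightarrow> X = Y"
  by (metis (no_types) left_inverse smul_simps(6) smul_simps(7))

lemma smul_eq_0_iff: "c \<bullet> X = 0 \<longleftrightarrow> c = 0 \<or> X = 0"
  by (metis smul_cancel smul_simps(4) smul_simps(5))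

lemma of_nat_endo: "of_nat k = of_nat k \<bullet> (1 :: endo)"
  by (induction k) (auto simp: smul_left_distrib)


section \<open>Quantum sl2 acting locally nilpotently\<close>

lemma conj_inverse:
  fixes K Ki X :: endo
  assumes "K * Ki = 1" "Ki * K = 1" "K * X = c \<bullet> (X * K)" "c \<noteq> 0"
  shows "Ki * X = inverse c \<bullet> (X * Ki)"
proof -
  have "c \<bullet> (Ki * X) = Ki * (c \<bullet> (X * K)) * Ki"
    using assms(1) by (simp add: mult.assoc)
  also have "\<dots> = X * Ki"
    by (simp add: assms(3)[symmetric] assms(2) mult.assoc[symmetric])
  finally have "inverse c \<bullet> (c \<bullet> (Ki * X)) = inverse c \<bullet> (X * Ki)" by simp
  then show ?thesis using assms(4) by simp
qed

lemma qnum_0 [simp]: "qnum q 0 = 0"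
  by (simp add: qnum_def)

lemma qnum_minus: "qnum q (- r) = - qnum q r"
  by (simp add: qnum_def minus_divide_left)

lemma qnum_nonzero:
  assumes "q \<noteq> 0" "\<And>k :: int. k \<noteq> 0 \<Longrightarrow> q powi k \<noteq> 1" "r \<noteq> 0"
  shows "qnum q r \<noteq> 0" "q - inverse q \<noteq> 0"
proof -
  have *: "q powi r - q powi (- r) \<noteq> 0" if "r \<noteq> 0" for r
  proof
    assume "q powi r - q powi (- r) = 0"
    then have "q powi r * q powi r = q powi r * q powi (- r)" by simp
    also have "\<dots> = 1" using assms(1) by (simp add: power_int_minus)
    finally have "q powi r * q powi r = 1" .
    moreover have "q powi (r + r) = q powi r * q powi r"
      by (rule power_int_add) (simp add: assms(1))
    ultimately have "q powi (r + r) = 1" by simp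
    with assms(2)[of "r + r"] that show False by simp
  qed
  show "q - inverse q \<noteq> 0" using *[of 1] by (simp add: power_int_minus)
  then show "qnum q r \<noteq> 0" using *[of r] assms(3) by (simp add: qnum_def)
qed

text \<open>The iterated \<open>q\<close>-adjoint action of \<open>e\<close> on an element
  \<open>y\<close> of weight \<open>p\<close>. For \<open>N = 1 - p\<close> it is the
  \<open>q\<close>-Serre expression.\<close>

primrec qad :: "complex \<Rightarrow> int \<Rightarrow> endo \<Rightarrow> endo \<Rightarrow> nat \<Rightarrow> endo" where
  "qad q p e y 0 = y"
| "qad q p e y (Suc N) = e * qad q p e y N - q powi (p + 2 * int N) \<bullet> (qad q p e y N * e)"

lemma qnum_sum:
  assumes "q \<noteq> 0" "q - inverse q \<noteq> 0"
  shows "(\<Sum>k<N. qnum q (p + 2 * int k)) = qnum q (int N) * qnum q (p + int N - 1)"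
proof (induction N)
  case (Suc N)
  let ?a = "q powi int N" and ?b = "q powi p"
  have d: "q powi (2 * int N) = ?a * ?a"
    unfolding mult_2 by (rule power_int_add) (simp add: assms(1))
  let ?g = "q - inverse q"
  have e: "q powi (p + 2 * int N) = ?b * ?a * ?a" "q powi - (p + 2 * int N) = inverse ?b * inverse ?a * inverse ?a"
    "q powi - int N = inverse ?a" "q powi (p + int N - 1) = ?b * ?a * inverse q"
    "q powi - (p + int N - 1) = inverse ?b * inverse ?a * q"
    "q powi int (Suc N) = ?a * q" "q powi - int (Suc N) = inverse ?a * inverse q"
    "q powi (p + int (Suc N) - 1) = ?b * ?a" "q powi - (p + int (Suc N) - 1) = inverse ?b * inverse ?a"
    using assms(1) d
    by (simp_all add: power_int_add power_int_diff power_int_minus divide_inverse algebra_simps)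
  have key: "(a - ia) * (b * a * iq - ib * ia * q) + (b * a * a - ib * ia * ia) * (q - iq)
      = (a * q - ia * iq) * (b * a - ib * ia)" for a ia b ib iq :: complex
    by (simp add: algebra_simps)
  have "x / G * (y / G) + z / G = (x * y + z * G) / (G * G)" if "G \<noteq> 0" for x y z G :: complex
    using that by (simp add: field_simps)
  then have *: "x / ?g * (y / ?g) + z / ?g = w / ?g * (v / ?g)" if "x * y + z * ?g = w * v" for x y z w v
    using that assms(2) by simp
  show ?case
    unfolding sum.lessThan_Suc Suc unfolding qnum_def e
    by (rule *, rule key)
qed simp

locale sl2_triple =
  fixes q :: complex and e f K Ki :: endo
  assumes q0: "q \<noteq> 0" and not_root: "\<And>k :: int. k \<noteq> 0 \<Longrightarrow> q powi k \<noteq> 1"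
    and K_inv: "K * Ki = 1" "Ki * K = 1"
    and Ke: "K * e = q powi 2 \<bullet> (e * K)"
    and ef: "e * f - f * e = (1 / (q - inverse q)) \<bullet> (K - Ki)"
    and nilp_e: "\<And>v. \<exists>A. app (e ^ A) v = 0"
    and nilp_f: "\<And>v. \<exists>A. app (f ^ A) v = 0"
begin

lemma qad_weight:
  assumes "K * y = q powi p \<bullet> (y * K)"
  shows "K * qad q p e y N = q powi (p + 2 * int N) \<bullet> (qad q p e y N * K)"
proof (induction N)
  case (Suc N)
  let ?S = "qad q p e y N"
  have 1: "K * (e * ?S) = q powi (p + 2 * int (Suc N)) \<bullet> (e * ?S * K)"
  proof -
    have "K * (e * ?S) = q powi 2 \<bullet> (e * (K * ?S))"
      by (simp add: Ke mult.assoc[symmetric])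
    also have "\<dots> = (q powi 2 * q powi (p + 2 * int N)) \<bullet> (e * ?S * K)"
      by (simp add: Suc mult.assoc)
    also have "q powi 2 * q powi (p + 2 * int N) = q powi (p + 2 * int (Suc N))"
      using q0 by (simp add: power_int_add)
    finally show ?thesis .
  qed
  have 2: "K * (?S * e) = q powi (p + 2 * int (Suc N)) \<bullet> (?S * e * K)"
  proof -
    have "K * (?S * e) = q powi (p + 2 * int N) \<bullet> (?S * (K * e))"
      by (simp add: Suc mult.assoc[symmetric])
    also have "\<dots> = (q powi (p + 2 * int N) * q powi 2) \<bullet> (?S * e * K)"
      by (simp add: Ke mult.assoc)
    also have "q powi (p + 2 * int N) * q powi 2 = q powi (p + 2 * int (Suc N))"
      using q0 by (simp add: power_int_add)
    finally show ?thesis .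
  qed
  show ?case
    by (simp only: qad.simps right_diff_distrib left_diff_distrib smul_simps 1 2 mult.commute)
qed (simp add: assms)

text \<open>The \<open>q\<close>-analogue of the formula for \<open>f\<close> acting on
  \<open>e\<^sup>N v\<close> in a module with lowest weight vector \<open>v\<close>; here
  \<open>y\<close> takes the place of \<open>v\<close>, since it commutes with \<open>f\<close>.\<close>

lemma qad_commutator:
  assumes "K * y = q powi p \<bullet> (y * K)" and yf: "y * f = f * y"
  shows "qad q p e y (Suc N) * f - f * qad q p e y (Suc N) =
           (\<Sum>k<Suc N. qnum q (p + 2 * int k)) \<bullet> (qad q p e y N * Ki)"
proof -
  let ?S = "qad q p e y"
  define c where "c N = (\<Sum>k<N. qnum q (p + 2 * int k))" for N
  define g where "g = q - inverse q"
  have g0: "g \<noteq> 0" unfolding g_def by (rule qnum_nonzero(2)[of q 1]) (auto simp: q0 not_root)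
  have step: "?S (Suc N) * f - f * ?S (Suc N) = qnum q (p + 2 * int N) \<bullet> (?S N * Ki)
      + e * (?S N * f - f * ?S N) - q powi (p + 2 * int N) \<bullet> ((?S N * f - f * ?S N) * e)" for N
  proof -
    let ?a = "q powi (p + 2 * int N)"
    have a0: "?a \<noteq> 0" using q0 by simp
    have KS: "K * ?S N = ?a \<bullet> (?S N * K)" by (rule qad_weight[OF assms(1)])
    have KiS: "Ki * ?S N = inverse ?a \<bullet> (?S N * Ki)" by (rule conj_inverse[OF K_inv KS a0])
    have ef': "e * f = f * e + (1 / g) \<bullet> (K - Ki)" using ef by (simp add: g_def algebra_simps)
    have "?S (Suc N) * f - f * ?S (Suc N)
       = e * (?S N * f) - ?a \<bullet> (?S N * (e * f)) - (f * e) * ?S N + ?a \<bullet> (f * ?S N * e)"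
      by (simp add: algebra_simps mult.assoc)
    also have "\<dots> = e * (?S N * f - f * ?S N) - ?a \<bullet> ((?S N * f - f * ?S N) * e)
        + ((1 / g) \<bullet> ((K - Ki) * ?S N) - (?a / g) \<bullet> (?S N * (K - Ki)))"
    proof -
      have "e * (f * ?S N) = f * e * ?S N + (1 / g) \<bullet> ((K - Ki) * ?S N)"
        by (subst mult.assoc[symmetric], subst ef') (simp add: algebra_simps)
      then show ?thesis by (simp add: ef' algebra_simps mult.assoc)
    qed
    also have "(1 / g) \<bullet> ((K - Ki) * ?S N) - (?a / g) \<bullet> (?S N * (K - Ki))
        = (?a / g - inverse ?a / g) \<bullet> (?S N * Ki)"
      by (simp add: algebra_simps KS KiS smul_left_distrib divide_inverse)
    also have "?a / g - inverse ?a / g = qnum q (p + 2 * int N)"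
      unfolding qnum_def g_def power_int_minus by (simp add: diff_divide_distrib)
    finally show ?thesis by (simp add: algebra_simps)
  qed
  have "?S (Suc N) * f - f * ?S (Suc N) = c (Suc N) \<bullet> (?S N * Ki)"
  proof (induction N)
    case 0
    then show ?case using step[of 0] yf by (simp add: c_def)
  next
    case (Suc N)
    let ?a = "q powi (p + 2 * int N)"
    have "Ki * e = inverse (q powi 2) \<bullet> (e * Ki)"
      by (rule conj_inverse[OF K_inv Ke]) (simp add: q0)
    then have *: "?S N * Ki * e = inverse (q powi 2) \<bullet> (?S N * e * Ki)" by (simp add: mult.assoc)
    have **: "q powi (p + 2 * int (Suc N)) * inverse (q powi 2) = ?a"
      using q0 by (simp add: power_int_add power_int_diff field_simps)
    have "?S (Suc (Suc N)) * f - f * ?S (Suc (Suc N)) =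
       qnum q (p + 2 * int (Suc N)) \<bullet> (?S (Suc N) * Ki)
       + c (Suc N) \<bullet> (e * ?S N * Ki) - (q powi (p + 2 * int (Suc N)) * c (Suc N)) \<bullet> (?S N * Ki * e)"
      unfolding step[of "Suc N"] Suc.IH by (simp add: mult.assoc del: qad.simps)
    also have "(q powi (p + 2 * int (Suc N)) * c (Suc N)) \<bullet> (?S N * Ki * e)
        = c (Suc N) \<bullet> (?a \<bullet> (?S N * e * Ki))"
      unfolding * using ** by (simp only: smul_simps) (simp add: mult_ac)
    finally have "?S (Suc (Suc N)) * f - f * ?S (Suc (Suc N)) =
        qnum q (p + 2 * int (Suc N)) \<bullet> (?S (Suc N) * Ki) + c (Suc N) \<bullet> (?S (Suc N) * Ki)"
      by (simp add: algebra_simps)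
    also have "\<dots> = c (Suc (Suc N)) \<bullet> (?S (Suc N) * Ki)"
      by (simp only: c_def sum.lessThan_Suc[of _ "Suc N"] smul_left_distrib add.commute)
    finally show ?case .
  qed
  then show ?thesis by (simp add: c_def)
qed

text \<open>On a vector killed by \<open>e\<close> every step of the adjoint action is left
  multiplication by \<open>e\<close>, which is locally nilpotent; vectors killed by higher powers
  of \<open>e\<close> are reached by induction.\<close>

lemma qad_locally_zero: "\<exists>N0. \<forall>N\<ge>N0. app (qad q p e y N) v = 0"
proof -
  obtain B where "app (e ^ B) v = 0" using nilp_e by blast
  then show ?thesis
  proof (induction B arbitrary: v)
    case 0
    then show ?case by simp
  next
    case (Suc B)
    from Suc.prems have "app (e ^ B) (app e v) = 0" by (simp add: power_Suc2 del: power_Suc)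
    from Suc.IH[OF this] obtain N0 where N0: "\<forall>N\<ge>N0. app (qad q p e y N) (app e v) = 0" by blast
    have *: "app (qad q p e y (N0 + k)) v = app (e ^ k) (app (qad q p e y N0) v)" for k
      by (induction k) (auto simp: N0)
    obtain A where A: "app (e ^ A) (app (qad q p e y N0) v) = 0" using nilp_e by blast
    have "app (qad q p e y N) v = 0" if N: "N \<ge> N0 + A" for N
    proof -
      obtain k where "N = N0 + (k + A)" by (metis N add.assoc add.commute le_Suc_ex)
      then show ?thesis using A by (simp add: * power_add)
    qed
    then show ?case by blast
  qed
qed

text \<open>By local nilpotency all sufficiently high powers of the adjoint action vanish on a given
  vector and on its images under powers of \<open>f\<close>. The commutator with \<open>f\<close>
  then carries the vanishing down as long as its coefficient \<open>[L + 1] [p + L]\<close> is not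
  zero, which stops only at \<open>L = - p\<close>.\<close>

lemma qad_vanishes:
  assumes wt: "K * y = q powi p \<bullet> (y * K)" and yf: "y * f = f * y" and N: "int N \<ge> 1 - p"
  shows "qad q p e y N = 0"
proof (rule endo_eqI)
  fix v
  let ?S = "qad q p e y"
  obtain M where M: "app (f ^ M) v = 0" using nilp_f by blast
  have fz: "app (f ^ k) v = 0" if "k \<ge> M" for k
  proof -
    obtain d where "k = d + M" using \<open>k \<ge> M\<close> by (metis add.commute le_Suc_ex)
    then show ?thesis by (simp add: power_add M)
  qed
  have "\<forall>k. \<exists>N0. \<forall>N\<ge>N0. app (?S N) (app (f ^ k) v) = 0"
    using qad_locally_zero by blast
  from choice[OF this] obtain b where b: "\<And>k N. N \<ge> b k \<Longrightarrow> app (?S N) (app (f ^ k) v) = 0"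
    by blast
  \<comment> \<open>One bound for all powers of \<open>f\<close>, of which only those below \<open>M\<close> matter.\<close>
  define N0 where "N0 = N + (\<Sum>k<M. b k)"
  have big: "app (?S N0) (app (f ^ k) v) = 0" for k
  proof (cases "k < M")
    case True
    then have "b k \<le> (\<Sum>k<M. b k)" by (intro member_le_sum) auto
    then show ?thesis by (intro b) (simp add: N0_def)
  qed (simp add: fz)
  have desc: "app (?S L) (app (f ^ k) v) = 0"
    if "\<And>k. app (?S (Suc L)) (app (f ^ k) v) = 0" "L \<ge> N" for L k
  proof -
    have g0: "q - inverse q \<noteq> 0" by (rule qnum_nonzero(2)[of q 1]) (auto simp: q0 not_root)
    define c where "c = qnum q (int (Suc L)) * qnum q (p + int (Suc L) - 1)"
    have c0: "c \<noteq> 0"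
      using qnum_nonzero(1)[OF q0 not_root, of "int (Suc L)"]
        qnum_nonzero(1)[OF q0 not_root, of "p + int (Suc L) - 1"] that(2) N
      by (auto simp: c_def)
    have "?S (Suc L) * f - f * ?S (Suc L) = c \<bullet> (?S L * Ki)"
      unfolding qad_commutator[OF wt yf] qnum_sum[OF q0 g0] c_def ..
    then have "app (?S (Suc L) * f - f * ?S (Suc L)) (app (f ^ k) v) = app (c \<bullet> (?S L * Ki)) (app (f ^ k) v)"
      by (simp only:)
    moreover have "app (?S (Suc L) * f - f * ?S (Suc L)) (app (f ^ k) v) = 0"
      using that(1)[of "Suc k"] that(1)[of k] by (simp del: qad.simps)
    ultimately have "c \<cdot> app (?S L * Ki) (app (f ^ k) v) = 0"
      by (simp only: app_simps(7))
    then have "inverse c \<cdot> c \<cdot> app (?S L * Ki) (app (f ^ k) v) = 0" by simp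
    then have "app (?S L * Ki) (app (f ^ k) v) = 0"
      using c0 by simp
    moreover have "Ki * ?S L = inverse (q powi (p + 2 * int L)) \<bullet> (?S L * Ki)"
      by (rule conj_inverse[OF K_inv qad_weight[OF wt]]) (simp add: q0)
    ultimately have "app (Ki * ?S L) (app (f ^ k) v) = 0" by simp
    then have "app (K * (Ki * ?S L)) (app (f ^ k) v) = 0" by simp
    then show ?thesis by (simp only: mult.assoc[symmetric] K_inv mult_1_left)
  qed
  have "app (?S (N0 - d)) (app (f ^ k) v) = 0" if "d \<le> N0 - N" for d k
    using that
  proof (induction d arbitrary: k)
    case (Suc d)
    then have "N0 - d = Suc (N0 - Suc d)" "N0 - Suc d \<ge> N" by (auto simp: N0_def)
    moreover have "app (?S (N0 - d)) (app (f ^ k') v) = 0" for k'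
      using Suc by (simp del: qad.simps)
    ultimately show ?case by (metis desc)
  qed (simp add: big)
  from this[of "N0 - N" 0] show "app (?S N) v = app 0 v" by (simp add: N0_def)
qed

end


unbundle fps_syntax

section \<open>Exponential series and exchange relations\<close>

lemma of_nat_mult_endo: "of_nat k * (X :: endo) = of_nat k \<bullet> X"
  by (simp add: of_nat_endo[of k])

lemma fps_deriv_nth_endo: "fps_deriv (f :: endo fps) $ n = of_nat (Suc n) \<bullet> f $ Suc n"
  by (simp add: of_nat_mult_endo del: of_nat_Suc)

lemma fps_linear_ode_zero:
  fixes Z G :: "endo fps"
  assumes "fps_deriv Z = G * Z" "Z $ 0 = 0"
  shows "Z = 0"
proof (rule fps_ext)
  fix n
  have "Z $ n = 0"
  proof (induction n rule: less_induct)
    case (less n)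
    show ?case
    proof (cases n)
      case (Suc k)
      have "of_nat (Suc k) * Z $ Suc k = fps_deriv Z $ k" by simp
      also have "\<dots> = (\<Sum>i=0..k. G $ i * Z $ (k - i))" by (simp add: assms fps_mult_nth)
      also have "\<dots> = 0" using less Suc by (intro sum.neutral) auto
      finally have "of_nat (Suc k) \<bullet> Z $ Suc k = 0" by (simp only: of_nat_mult_endo)
      then show ?thesis by (metis Suc of_nat_eq_0_iff nat.distinct(1) smul_eq_0_iff)
    qed (simp add: assms)
  qed
  then show "Z $ n = 0 $ n" by simp
qed

text \<open>Powers beyond \<open>N\<close> do not contribute to the coefficient of index
  \<open>N\<close>, since the series of interest have no constant term.\<close>

definition exp_fps :: "endo fps \<Rightarrow> endo fps" where
  "exp_fps X = Abs_fps (\<lambda>N. \<Sum>k\<le>N. (1 / fact k) \<bullet> (X ^ k) $ N)"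

lemma fps_power_nth_eq_0:
  fixes X :: "'a :: ring_1 fps"
  assumes "X $ 0 = 0" "N < k"
  shows "(X ^ k) $ N = 0"
  using assms(2)
proof (induction k arbitrary: N)
  case (Suc k)
  have "X $ i * (X ^ k) $ (N - i) = 0" if "i \<le> N" for i
    using Suc assms(1) that by (cases i) auto
  then show ?case by (auto simp: fps_mult_nth intro!: sum.neutral)
qed simp

lemma fps_deriv_power_commuting:
  fixes X :: "'a :: ring_1 fps"
  assumes "X * fps_deriv X = fps_deriv X * X"
  shows "fps_deriv (X ^ Suc k) = of_nat (Suc k) * (fps_deriv X * X ^ k)"
proof (induction k)
  case (Suc k)
  have "fps_deriv (X ^ Suc (Suc k)) = X * (of_nat (Suc k) * (fps_deriv X * X ^ k)) + fps_deriv X * X ^ Suc k"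
    by (subst power_Suc, subst fps_deriv_mult, subst Suc) (rule refl)
  also have "X * (of_nat (Suc k) * (fps_deriv X * X ^ k)) = of_nat (Suc k) * ((X * fps_deriv X) * X ^ k)"
    by (metis mult.assoc mult_of_nat_commute)
  also have "(X * fps_deriv X) * X ^ k = fps_deriv X * X ^ Suc k"
    by (simp add: assms mult.assoc)
  finally show ?case by (simp add: algebra_simps)
qed simp

lemma exp_fps_0 [simp]: "exp_fps X $ 0 = 1"
  by (simp add: exp_fps_def)

lemma exp_fps_deriv:
  assumes "X $ 0 = 0" "\<And>r s. X $ r * X $ s = X $ s * X $ r"
  shows "fps_deriv (exp_fps X) = fps_deriv X * exp_fps X"
proof (rule fps_ext)
  fix N
  have comm: "X * fps_deriv X = fps_deriv X * X"
  proof (rule fps_ext)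
    fix n
    have "(X * fps_deriv X) $ n = (\<Sum>i=0..n. X $ i * fps_deriv X $ (n - i))" by (simp add: fps_mult_nth)
    also have "\<dots> = (\<Sum>i=0..n. fps_deriv X $ (n - i) * X $ i)"
      by (intro sum.cong) (simp_all add: fps_deriv_nth_endo assms(2) del: fps_deriv_nth)
    also have "\<dots> = (fps_deriv X * X) $ n"
      by (subst sum.atLeastAtMost_rev) (simp add: fps_mult_nth)
    finally show "(X * fps_deriv X) $ n = (fps_deriv X * X) $ n" .
  qed
  have der: "of_nat (Suc N) \<bullet> (X ^ Suc k) $ Suc N = of_nat (Suc k) \<bullet> (fps_deriv X * X ^ k) $ N" for k
  proof -
    have "of_nat (Suc N) * (X ^ Suc k) $ Suc N = fps_deriv (X ^ Suc k) $ N"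
      by (simp del: power_Suc of_nat_Suc fps_deriv_mult)
    also have "\<dots> = of_nat (Suc k) * (fps_deriv X * X ^ k) $ N"
      unfolding fps_deriv_power_commuting[OF comm]
      by (simp only: fps_of_nat[symmetric] fps_mult_left_const_nth)
    finally show ?thesis by (simp only: of_nat_mult_endo)
  qed
  have "fps_deriv (exp_fps X) $ N = of_nat (Suc N) \<bullet> (\<Sum>k\<le>Suc N. (1 / fact k) \<bullet> (X ^ k) $ Suc N)"
    by (simp add: exp_fps_def of_nat_mult_endo del: sum.atMost_Suc of_nat_Suc)
  also have "\<dots> = (\<Sum>k\<le>N. (1 / fact (Suc k)) \<bullet> (of_nat (Suc N) \<bullet> (X ^ Suc k) $ Suc N))"
    by (subst sum.atMost_Suc_shift) (simp add: smul_sum mult.commute del: power_Suc)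
  also have "\<dots> = (\<Sum>k\<le>N. (1 / fact k) \<bullet> (fps_deriv X * X ^ k) $ N)"
    unfolding der by (simp add: field_simps del: of_nat_Suc)
  also have "\<dots> = (\<Sum>k\<le>N. \<Sum>i=0..N. fps_deriv X $ i * ((1 / fact k) \<bullet> (X ^ k) $ (N - i)))"
    by (simp add: fps_mult_nth smul_sum)
  also have "\<dots> = (\<Sum>i=0..N. fps_deriv X $ i * (\<Sum>k\<le>N. (1 / fact k) \<bullet> (X ^ k) $ (N - i)))"
    by (subst sum.swap) (simp add: sum_distrib_left)
  also have "\<dots> = (\<Sum>i=0..N. fps_deriv X $ i * (\<Sum>k\<le>N - i. (1 / fact k) \<bullet> (X ^ k) $ (N - i)))"
    by (intro sum.cong refl arg_cong2[where f = "(*)"] sum.mono_neutral_right)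
       (auto simp: fps_power_nth_eq_0[OF assms(1)])
  also have "\<dots> = (fps_deriv X * exp_fps X) $ N"
    by (simp add: fps_mult_nth exp_fps_def)
  finally show "fps_deriv (exp_fps X) $ N = (fps_deriv X * exp_fps X) $ N" .
qed

text \<open>With \<open>X(y) = \<Sum> X\<^sub>r y\<^sup>r\<close> and commuting coefficients,
  \<open>e\<^bsup>X(y)\<^esup> E(w) = h(yw) E(w) e\<^bsup>X(y)\<^esup>\<close>, where
  \<open>h\<close> is the exponential of the series of the scalars \<open>\<kappa>\<close>. Both
  sides satisfy the same first order linear differential equation in \<open>y\<close>; the scalar
  exponential enters only through its logarithmic derivative.\<close>

lemma exp_fps_exchange:
  fixes E :: "int \<Rightarrow> endo" and h :: "complex fps"
  assumes X0: "X $ 0 = 0" and comm: "\<And>r s. X $ r * X $ s = X $ s * X $ r"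
    and XE: "\<And>r l. r > 0 \<Longrightarrow> X $ r * E l - E l * X $ r = \<kappa> r \<bullet> E (l + int r)"
    and h0: "h $ 0 = 1" and h': "fps_deriv h = h * Abs_fps (\<lambda>r. of_nat (Suc r) * \<kappa> (Suc r))"
  shows "exp_fps X $ N * E l = (\<Sum>s\<le>N. h $ s \<bullet> (E (l + int s) * exp_fps X $ (N - s)))"
proof -
  define Y where "Y = exp_fps X"
  define A where "A = Abs_fps (\<lambda>s. h $ s \<bullet> E (l + int s))"
  define Z where "Z = Y * fps_const (E l) - A * Y"
  have Y': "fps_deriv Y = fps_deriv X * Y" unfolding Y_def by (rule exp_fps_deriv[OF X0 comm])
  have A': "fps_deriv X * A = A * fps_deriv X + fps_deriv A"
  proof (rule fps_ext)
    fix N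
    have "(fps_deriv X * A) $ N - (A * fps_deriv X) $ N
        = (\<Sum>i=0..N. fps_deriv X $ (N - i) * A $ i) - (\<Sum>i=0..N. A $ i * fps_deriv X $ (N - i))"
      unfolding fps_mult_nth by (subst sum.atLeastAtMost_rev) simp
    also have "\<dots> = (\<Sum>i=0..N. (h $ i * (of_nat (Suc (N - i)) * \<kappa> (Suc (N - i)))) \<bullet> E (l + int (Suc N)))"
      unfolding sum_subtractf[symmetric]
    proof (intro sum.cong refl)
      fix i assume "i \<in> {0..N}"
      then have i: "l + int i + int (Suc (N - i)) = l + int (Suc N)" by auto
      have "fps_deriv X $ (N - i) * A $ i - A $ i * fps_deriv X $ (N - i) =
         (of_nat (Suc (N - i)) * h $ i) \<bullet> (X $ Suc (N - i) * E (l + int i) - E (l + int i) * X $ Suc (N - i))"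
        by (simp add: A_def fps_deriv_nth_endo mult.commute del: fps_deriv_nth of_nat_Suc)
      also have "\<dots> = (of_nat (Suc (N - i)) * h $ i * \<kappa> (Suc (N - i))) \<bullet> E (l + int (Suc N))"
        by (subst XE) (simp_all only: i zero_less_Suc smul_simps)
      finally show "fps_deriv X $ (N - i) * A $ i - A $ i * fps_deriv X $ (N - i) =
         (h $ i * (of_nat (Suc (N - i)) * \<kappa> (Suc (N - i)))) \<bullet> E (l + int (Suc N))" by (simp only: mult_ac)
    qed
    also have "\<dots> = (fps_deriv h $ N) \<bullet> E (l + int (Suc N))"
      by (simp add: h' fps_mult_nth sum_smul)
    also have "\<dots> = fps_deriv A $ N"
      by (simp add: A_def of_nat_mult_endo mult.commute del: of_nat_Suc)
    finally show "(fps_deriv X * A) $ N = (A * fps_deriv X + fps_deriv A) $ N"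
      by (simp add: algebra_simps)
  qed
  have "fps_deriv Z = fps_deriv X * Y * fps_const (E l) - (A * fps_deriv X + fps_deriv A) * Y"
    by (simp add: Z_def Y' algebra_simps)
  also have "\<dots> = fps_deriv X * Z"
    unfolding A'[symmetric] by (simp add: Z_def algebra_simps)
  finally have "fps_deriv Z = fps_deriv X * Z" .
  moreover have "Z $ 0 = 0"
    by (simp add: Z_def A_def h0 Y_def)
  ultimately have "Z = 0" by (rule fps_linear_ode_zero)
  then have "(Y * fps_const (E l)) $ N = (A * Y) $ N" by (simp add: Z_def)
  then have "Y $ N * E l = (A * Y) $ N" by simp
  then show ?thesis
    unfolding fps_mult_nth[of A Y] by (simp add: A_def Y_def atMost_atLeast0)
qed

text \<open>Factor lists: each pair \<open>(\<beta>, t)\<close> stands for the exchange factor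
  \<open>(q\<^sup>t - \<beta> x) / (1 - \<beta> q\<^sup>t x)\<close> with \<open>x = w / z\<close>.\<close>

definition den_poly :: "complex \<Rightarrow> (complex \<times> int) list \<Rightarrow> complex poly" where
  "den_poly q xs = (\<Prod>(\<beta>, t)\<leftarrow>xs. [:1, - (\<beta> * q powi t):])"

definition num_poly :: "complex \<Rightarrow> (complex \<times> int) list \<Rightarrow> complex poly" where
  "num_poly q xs = (\<Prod>(\<beta>, t)\<leftarrow>xs. [:q powi t, - \<beta>:])"

definition log_coeff :: "complex \<Rightarrow> (complex \<times> int) list \<Rightarrow> nat \<Rightarrow> complex" where
  "log_coeff q xs r = (\<Sum>(\<beta>, t)\<leftarrow>xs. \<beta> ^ r * ((q powi t) ^ r - (inverse (q powi t)) ^ r) / of_nat r)"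

text \<open>Inverting the parameters corresponds to exchanging the roles of \<open>z\<close> and
  \<open>w\<close>.\<close>

definition fac_inv :: "(complex \<times> int) list \<Rightarrow> (complex \<times> int) list" where
  "fac_inv xs = map (\<lambda>(\<beta>, t). (inverse \<beta>, t)) xs"

text \<open>The expansion of the exchange factors in \<open>x\<close>, normalised to have constant term
  \<open>1\<close>.\<close>

definition fac_ratio :: "complex \<Rightarrow> (complex \<times> int) list \<Rightarrow> complex fps" where
  "fac_ratio q xs =
     (\<Prod>(\<beta>, t)\<leftarrow>xs. fps_of_poly [:1, - (\<beta> * inverse (q powi t)):] * inverse (fps_of_poly [:1, - (\<beta> * q powi t):]))"

lemma fac_simps [simp]:
  "den_poly q [] = 1" "den_poly q ((\<beta>, t) # xs) = [:1, - (\<beta> * q powi t):] * den_poly q xs"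
  "num_poly q [] = 1" "num_poly q ((\<beta>, t) # xs) = [:q powi t, - \<beta>:] * num_poly q xs"
  "fac_inv [] = []" "fac_inv ((\<beta>, t) # xs) = (inverse \<beta>, t) # fac_inv xs"
  by (simp_all add: den_poly_def num_poly_def fac_inv_def)

text \<open>The logarithm of a product of factors is the sum of their logarithms, whose coefficients
  are differences of geometric terms.\<close>

lemma fac_ratio_deriv:
  "fac_ratio q xs $ 0 = 1 \<and>
   fps_deriv (fac_ratio q xs) = fac_ratio q xs * Abs_fps (\<lambda>r. of_nat (Suc r) * log_coeff q xs (Suc r))"
proof (induction xs)
  case Nil
  have "Abs_fps (\<lambda>r. of_nat (Suc r) * log_coeff q [] (Suc r)) = 0"
    by (rule fps_ext) (simp add: log_coeff_def)
  then show ?case by (simp add: fac_ratio_def)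
next
  case (Cons x xs)
  obtain \<beta> t where x: "x = (\<beta>, t)" by (cases x)
  define a where "a = \<beta> * q powi t"
  define b where "b = \<beta> * inverse (q powi t)"
  define geo where "geo c = Abs_fps (\<lambda>r. c ^ Suc r)" for c :: complex
  have lin: "fps_of_poly [:1, - c:] = 1 - fps_const c * fps_X" for c :: complex
    by (simp add: fps_of_poly_pCons mult.commute)
  have lin0: "(1 - fps_const c * fps_X) $ 0 \<noteq> 0" for c :: complex by simp
  have geo: "(1 - fps_const c * fps_X) * geo c = fps_const c" for c :: complex
  proof (rule fps_ext)
    fix n show "((1 - fps_const c * fps_X) * geo c) $ n = fps_const c $ n"
      by (cases n) (simp_all add: geo_def algebra_simps)
  qed
  define A where "A = 1 - fps_const a * fps_X"
  define B where "B = 1 - fps_const b * fps_X"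
  have A0: "A \<noteq> 0" "A * inverse A = 1" "inverse A * A = 1"
    using lin0[of a] by (auto simp: A_def inverse_mult_eq_1 inverse_mult_eq_1')
  have gA: "A * geo a = fps_const a" and gB: "B * geo b = fps_const b"
    using geo by (auto simp: A_def B_def)
  have d1: "fps_deriv (B * inverse A) = (B * inverse A) * (geo a - geo b)"
  proof -
    have dA: "fps_deriv A = - fps_const a" and dB: "fps_deriv B = - fps_const b" by (simp_all add: A_def B_def)
    have "fps_deriv (inverse A) = - fps_deriv A * (inverse A)\<^sup>2"
      by (rule fps_inverse_deriv) (use lin0[of a] in \<open>simp add: A_def\<close>)
    then have "fps_deriv (B * inverse A) = B * (fps_const a * (inverse A)\<^sup>2) - fps_const b * inverse A"
      by (simp add: dA dB algebra_simps flip: fps_const_neg)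
    also have "\<dots> = B * (A * geo a * (inverse A)\<^sup>2) - B * geo b * inverse A" by (simp add: gA gB)
    also have "A * geo a * (inverse A)\<^sup>2 = (A * inverse A) * (geo a * inverse A)"
      by (simp only: power2_eq_square mult_ac)
    finally show ?thesis by (simp add: A0 algebra_simps)
  qed
  have ratio: "fac_ratio q (x # xs) = (B * inverse A) * fac_ratio q xs"
    by (simp add: fac_ratio_def x lin A_def B_def a_def b_def)
  have "fps_deriv (fac_ratio q (x # xs)) = fac_ratio q (x # xs) *
      ((geo a - geo b) + Abs_fps (\<lambda>r. of_nat (Suc r) * log_coeff q xs (Suc r)))"
    unfolding ratio fps_deriv_mult[of "B * inverse A" "fac_ratio q xs"] d1
    using Cons.IH by (simp add: algebra_simps del: fps_deriv_mult)
  also have "(geo a - geo b) + Abs_fps (\<lambda>r. of_nat (Suc r) * log_coeff q xs (Suc r))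
      = Abs_fps (\<lambda>r. of_nat (Suc r) * log_coeff q (x # xs) (Suc r))"
    by (rule fps_ext)
       (simp add: log_coeff_def x geo_def a_def b_def power_mult_distrib distrib_left right_diff_distrib
          diff_divide_distrib del: of_nat_Suc power_Suc)
  finally have "fps_deriv (fac_ratio q (x # xs)) = fac_ratio q (x # xs) *
     Abs_fps (\<lambda>r. of_nat (Suc r) * log_coeff q (x # xs) (Suc r))" .
  moreover have "fac_ratio q (x # xs) $ 0 = 1" using Cons.IH by (simp add: ratio A_def B_def)
  ultimately show ?case by blast
qed

lemma fac_ratio_mult:
  assumes "q \<noteq> 0"
  shows "fps_of_poly (den_poly q xs) * fac_ratio q xs =
    fps_const (inverse (q powi (\<Sum>(\<beta>, t)\<leftarrow>xs. t))) * fps_of_poly (num_poly q xs)"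
proof (induction xs)
  case (Cons x xs)
  obtain \<beta> t where x: "x = (\<beta>, t)" by (cases x)
  define A where "A = fps_of_poly [:1, - (\<beta> * q powi t):]"
  have "A $ 0 \<noteq> 0" by (simp add: A_def)
  then have A: "A * inverse A = 1" by (rule inverse_mult_eq_1')
  have "fps_of_poly (den_poly q (x # xs)) * fac_ratio q (x # xs) =
     (A * inverse A) * fps_of_poly [:1, - (\<beta> * inverse (q powi t)):] *
       (fps_of_poly (den_poly q xs) * fac_ratio q xs)"
    by (simp add: x fac_ratio_def A_def fps_of_poly_mult mult_ac)
  also have "\<dots> = fps_of_poly [:1, - (\<beta> * inverse (q powi t)):] *
      (fps_const (inverse (q powi (\<Sum>(\<beta>, t)\<leftarrow>xs. t))) * fps_of_poly (num_poly q xs))"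
    by (simp only: A Cons.IH mult_1_left)
  also have "fps_of_poly [:1, - (\<beta> * inverse (q powi t)):] =
      fps_const (inverse (q powi t)) * fps_of_poly [:q powi t, - \<beta>:]"
    using assms by (simp add: fps_of_poly_pCons algebra_simps)
  finally show ?case
    using assms by (simp add: x fps_of_poly_mult power_int_add mult_ac flip: fps_const_mult)
qed (simp add: fac_ratio_def)

lemma poly_degree:
  assumes "q \<noteq> 0" "\<forall>(\<beta>, t) \<in> set xs. \<beta> \<noteq> 0"
  shows "degree (den_poly q xs) = length xs" "degree (num_poly q xs) = length xs"
    "den_poly q xs \<noteq> 0" "num_poly q xs \<noteq> 0"
proof -
  have "degree (den_poly q xs) = length xs \<and> degree (num_poly q xs) = length xs \<and>
    den_poly q xs \<noteq> 0 \<and> num_poly q xs \<noteq> 0" using assms(2)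
  proof (induction xs)
    case (Cons x xs)
    obtain \<beta> t where x: "x = (\<beta>, t)" by (cases x)
    with Cons assms(1) show ?case by (simp add: degree_mult_eq del: mult_pCons_left)
  qed simp
  then show "degree (den_poly q xs) = length xs" "degree (num_poly q xs) = length xs"
    "den_poly q xs \<noteq> 0" "num_poly q xs \<noteq> 0" by auto
qed

text \<open>Inverting \<open>x\<close> exchanges numerator and denominator up to a scalar, one linear
  factor at a time.\<close>

lemma poly_reflect:
  assumes "q \<noteq> 0" "\<forall>(\<beta>, t) \<in> set xs. \<beta> \<noteq> 0"
  shows "num_poly q xs = smult (\<Prod>(\<beta>, t)\<leftarrow>xs. - \<beta>) (reflect_poly (den_poly q (fac_inv xs)))"
    and "den_poly q xs = smult (\<Prod>(\<beta>, t)\<leftarrow>xs. - \<beta>) (reflect_poly (num_poly q (fac_inv xs)))"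
proof -
  have "num_poly q xs = smult (\<Prod>(\<beta>, t)\<leftarrow>xs. - \<beta>) (reflect_poly (den_poly q (fac_inv xs))) \<and>
    den_poly q xs = smult (\<Prod>(\<beta>, t)\<leftarrow>xs. - \<beta>) (reflect_poly (num_poly q (fac_inv xs)))"
    using assms(2)
  proof (induction xs)
    case (Cons x xs)
    obtain \<beta> t where x: "x = (\<beta>, t)" by (cases x)
    with Cons.prems have b: "\<beta> \<noteq> 0" by simp
    have r: "reflect_poly [:u, v:] = [:v, u:]" if "u \<noteq> 0" "v \<noteq> 0" for u v :: complex
      using that by (simp add: reflect_poly_def)
    have 1: "[:q powi t, - \<beta>:] = smult (- \<beta>) (reflect_poly [:1, - (inverse \<beta> * q powi t):])"
      and 2: "[:1, - (\<beta> * q powi t):] = smult (- \<beta>) (reflect_poly [:q powi t, - inverse \<beta>:])"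
      using b assms(1) by (simp_all add: r)
    from Cons x have IH: "num_poly q xs = smult (\<Prod>(\<beta>, t)\<leftarrow>xs. - \<beta>) (reflect_poly (den_poly q (fac_inv xs)))"
      "den_poly q xs = smult (\<Prod>(\<beta>, t)\<leftarrow>xs. - \<beta>) (reflect_poly (num_poly q (fac_inv xs)))" by auto
    show ?case
      by (simp only: IH x fac_simps reflect_poly_mult 1 2 mult_smult_left mult_smult_right smult_smult
          list.map prod_list.Cons case_prod_conv) (simp only: mult.commute simp_thms)
  qed simp
  then show "num_poly q xs = smult (\<Prod>(\<beta>, t)\<leftarrow>xs. - \<beta>) (reflect_poly (den_poly q (fac_inv xs)))"
    "den_poly q xs = smult (\<Prod>(\<beta>, t)\<leftarrow>xs. - \<beta>) (reflect_poly (num_poly q (fac_inv xs)))" by auto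
qed

lemma coeff_reflect:
  assumes "q \<noteq> 0" "\<forall>(\<beta>, t) \<in> set xs. \<beta> \<noteq> 0" "s \<le> length xs"
  shows "coeff (num_poly q xs) s = (\<Prod>(\<beta>, t)\<leftarrow>xs. - \<beta>) * coeff (den_poly q (fac_inv xs)) (length xs - s)"
    and "coeff (den_poly q xs) s = (\<Prod>(\<beta>, t)\<leftarrow>xs. - \<beta>) * coeff (num_poly q (fac_inv xs)) (length xs - s)"
proof -
  have i: "\<forall>(\<beta>, t) \<in> set (fac_inv xs). \<beta> \<noteq> 0" "length (fac_inv xs) = length xs"
    using assms(2) by (auto simp: fac_inv_def)
  show "coeff (num_poly q xs) s = (\<Prod>(\<beta>, t)\<leftarrow>xs. - \<beta>) * coeff (den_poly q (fac_inv xs)) (length xs - s)"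
    by (subst poly_reflect(1)[OF assms(1,2)]) (use assms(3) i in \<open>simp add: coeff_reflect_poly poly_degree assms(1)\<close>)
  show "coeff (den_poly q xs) s = (\<Prod>(\<beta>, t)\<leftarrow>xs. - \<beta>) * coeff (num_poly q (fac_inv xs)) (length xs - s)"
    by (subst poly_reflect(2)[OF assms(1,2)]) (use assms(3) i in \<open>simp add: coeff_reflect_poly poly_degree assms(1)\<close>)
qed

text \<open>The coefficient of \<open>z\<^sup>-\<^sup>k w\<^sup>-\<^sup>l\<close> in the relation that
  results from \<open>X(z) Y(w) = (\<Prod> (q\<^sup>t - \<beta> x) / (1 - \<beta> q\<^sup>t x))
  Y(w) X(z)\<close> by clearing denominators.\<close>

definition exch :: "complex \<Rightarrow> (complex \<times> int) list \<Rightarrow> (int \<Rightarrow> endo) \<Rightarrow> (int \<Rightarrow> endo) \<Rightarrow> int \<Rightarrow> int \<Rightarrow> endo" where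
  "exch q xs X Y k l = (\<Sum>s\<le>length xs. coeff (den_poly q xs) s \<bullet> (X (k - int s) * Y (l + int s))
     - coeff (num_poly q xs) s \<bullet> (Y (l + int s) * X (k - int s)))"

lemma exch_swap:
  assumes "q \<noteq> 0" "\<forall>(\<beta>, t) \<in> set xs. \<beta> \<noteq> 0"
  shows "exch q xs X Y k l = - ((\<Prod>(\<beta>, t)\<leftarrow>xs. - \<beta>) \<bullet>
     exch q (fac_inv xs) Y X (l + int (length xs)) (k - int (length xs)))"
proof -
  let ?D = "length xs" and ?\<sigma> = "\<Prod>(\<beta>, t)\<leftarrow>xs. - \<beta>"
  have len: "length (fac_inv xs) = ?D" by (simp add: fac_inv_def)
  have "exch q xs X Y k l = (\<Sum>s=0..?D. - (?\<sigma> \<bullet>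
      (coeff (den_poly q (fac_inv xs)) (?D - s) \<bullet> (Y (l + int s) * X (k - int s))
       - coeff (num_poly q (fac_inv xs)) (?D - s) \<bullet> (X (k - int s) * Y (l + int s)))))"
    unfolding exch_def atMost_atLeast0
    by (intro sum.cong refl) (simp add: coeff_reflect[OF assms])
  also have "\<dots> = (\<Sum>s=0..?D. - (?\<sigma> \<bullet>
      (coeff (den_poly q (fac_inv xs)) s \<bullet> (Y (l + int ?D - int s) * X (k - int ?D + int s))
       - coeff (num_poly q (fac_inv xs)) s \<bullet> (X (k - int ?D + int s) * Y (l + int ?D - int s)))))"
    by (subst sum.atLeastAtMost_rev, intro sum.cong refl) (simp add: algebra_simps of_nat_diff)
  finally show ?thesis
    unfolding exch_def len by (simp add: sum_negf sum_subtractf smul_sum atMost_atLeast0)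
qed

definition half_series :: "endo \<Rightarrow> endo fps \<Rightarrow> int \<Rightarrow> endo" where
  "half_series K X k = (if k < 0 then 0 else K * exp_fps X $ nat k)"

text \<open>A Cartan current satisfies the exchange relation whose factors have the prescribed
  logarithm: this is the exchange of exponentials with the denominators cleared. The eigenvalue of
  \<open>K\<close> supplies the constant term of the exchange factor.\<close>

lemma half_series_exchange:
  fixes E :: "int \<Rightarrow> endo"
  assumes q: "q \<noteq> 0" and X0: "X $ 0 = 0" and comm: "\<And>r s. X $ r * X $ s = X $ s * X $ r"
    and XE: "\<And>r l. r > 0 \<Longrightarrow> X $ r * E l - E l * X $ r = log_coeff q xs r \<bullet> E (l + int r)"
    and KE: "\<And>l. K * E l = q powi (\<Sum>(\<beta>, t)\<leftarrow>xs. t) \<bullet> (E l * K)"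
    and nz: "\<forall>(\<beta>, t) \<in> set xs. \<beta> \<noteq> 0"
  shows "exch q xs (half_series K X) E k l = 0"
proof (cases "k < 0")
  case True
  then show ?thesis by (simp add: exch_def half_series_def)
next
  case False
  define N where "N = nat k"
  have k: "k = int N" using False by (simp add: N_def)
  define p where "p = coeff (den_poly q xs)"
  define p' where "p' = coeff (num_poly q xs)"
  define h where "h = fac_ratio q xs"
  define c where "c = q powi (\<Sum>(\<beta>, t)\<leftarrow>xs. t)"
  have c0: "c \<noteq> 0" by (simp add: c_def q)
  let ?Y = "exp_fps X"
  let ?D = "length xs"
  have p0: "p s = 0" "p' s = 0" if "s > ?D" for s
    using that poly_degree[OF q nz] by (auto simp: p_def p'_def coeff_eq_0)
  have hp: "p' u = c * (\<Sum>s\<le>u. p s * h $ (u - s))" for u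
  proof -
    have "(fps_of_poly (den_poly q xs) * h) $ u = inverse c * p' u"
      unfolding h_def fac_ratio_mult[OF q] by (simp add: c_def p'_def)
    moreover have "(fps_of_poly (den_poly q xs) * h) $ u = (\<Sum>s\<le>u. p s * h $ (u - s))"
      by (simp add: fps_mult_nth p_def atMost_atLeast0)
    ultimately show ?thesis using c0 by simp
  qed
  have YE: "?Y $ M * E j = (\<Sum>s\<le>M. h $ s \<bullet> (E (j + int s) * ?Y $ (M - s)))" for M j
    unfolding h_def by (rule exp_fps_exchange[OF X0 comm XE]) (use fac_ratio_deriv[of q xs] in auto)
  have range: "(\<Sum>s\<le>?D. f s) = (\<Sum>s\<le>N. f s)" if "\<And>s. s > N \<Longrightarrow> f s = 0" "\<And>s. s > ?D \<Longrightarrow> f s = 0"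
    for f :: "nat \<Rightarrow> endo"
  proof -
    have "(\<Sum>s\<le>?D. f s) = (\<Sum>s\<le>?D + N. f s)" by (rule sum.mono_neutral_left) (use that in auto)
    also have "\<dots> = (\<Sum>s\<le>N. f s)" by (rule sum.mono_neutral_right) (use that in auto)
    finally show ?thesis .
  qed
  have hs: "half_series K X (int N - int s) = (if s > N then 0 else K * ?Y $ (N - s))" for s
    by (auto simp: half_series_def nat_diff_distrib of_nat_diff)
  have "(\<Sum>s\<le>?D. p s \<bullet> (half_series K X (int N - int s) * E (l + int s)))
      = (\<Sum>s\<le>N. p s \<bullet> (half_series K X (int N - int s) * E (l + int s)))"
    by (rule range) (simp_all add: hs p0)
  also have "\<dots> = (\<Sum>s\<le>N. \<Sum>t\<le>N - s. (p s * h $ t) \<bullet> (K * (E (l + int (s + t)) * ?Y $ (N - (s + t)))))"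
    by (intro sum.cong refl) (simp add: hs mult.assoc YE sum_distrib_left smul_sum add.assoc)
  also have "\<dots> = (\<Sum>u\<le>N. \<Sum>s\<le>u. (p s * h $ (u - s)) \<bullet> (K * (E (l + int u) * ?Y $ (N - u))))"
  proof -
    have "(\<Sum>s\<le>N. \<Sum>t\<le>N - s. g s t) = (\<Sum>u\<le>N. \<Sum>s\<le>u. g s (u - s))" for g :: "nat \<Rightarrow> nat \<Rightarrow> endo"
    proof -
      have "(\<Sum>s\<le>N. \<Sum>t\<le>N - s. g s t) = (\<Sum>(s, t)\<in>{(i, j). i + j \<le> N}. g s t)"
        by (subst sum.Sigma) (auto intro!: sum.cong)
      then show ?thesis by (simp add: sum.triangle_reindex_eq)
    qed
    then show ?thesis by simp
  qed
  also have "\<dots> = (\<Sum>u\<le>N. p' u \<bullet> (E (l + int u) * half_series K X (int N - int u)))"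
  proof (intro sum.cong refl)
    fix u assume "u \<in> {..N}"
    then show "(\<Sum>s\<le>u. (p s * h $ (u - s)) \<bullet> (K * (E (l + int u) * ?Y $ (N - u))))
        = p' u \<bullet> (E (l + int u) * half_series K X (int N - int u))"
      by (simp add: hs hp sum_smul[symmetric] mult.assoc[symmetric] KE c_def[symmetric] mult.commute
          sum_distrib_left mult.left_commute)
  qed
  also have "\<dots> = (\<Sum>s\<le>?D. p' s \<bullet> (E (l + int s) * half_series K X (int N - int s)))"
    by (rule range[symmetric]) (simp_all add: hs p0)
  finally show ?thesis
    by (simp add: exch_def k p_def p'_def sum_subtractf)
qed


section \<open>Toroidal relations that follow from the Heisenberg and sl2 relations\<close>

text \<open>The substitution \<open>(\<beta>, t) \<mapsto> (\<beta>\<^sup>-\<^sup>1, - t)\<close>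
  describes the same exchange factor as a function of \<open>1/x\<close>; it is used to pass from
  series in \<open>z\<^sup>-\<^sup>1\<close> to series in \<open>z\<close>.\<close>

lemma coeff_fac_neg:
  fixes xs :: "(complex \<times> int) list"
  assumes "q \<noteq> 0" "\<forall>(\<beta>, t) \<in> set xs. \<beta> \<noteq> 0"
  defines "ys \<equiv> map (\<lambda>(\<beta>, t). (inverse \<beta>, - t)) xs"
  obtains \<tau> where "\<tau> \<noteq> 0"
    "\<And>s. s \<le> length xs \<Longrightarrow> coeff (den_poly q ys) s = \<tau> * coeff (den_poly q xs) (length xs - s)"
    "\<And>s. s \<le> length xs \<Longrightarrow> coeff (num_poly q ys) s = \<tau> * coeff (num_poly q xs) (length xs - s)"
proof -
  define \<tau> where "\<tau> = (\<Prod>(\<beta>, t)\<leftarrow>xs. - (inverse \<beta> * inverse (q powi t)))"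
  have "\<tau> \<noteq> 0 \<and> den_poly q ys = smult \<tau> (reflect_poly (den_poly q xs)) \<and>
        num_poly q ys = smult \<tau> (reflect_poly (num_poly q xs))"
    using assms(2) unfolding \<tau>_def ys_def
  proof (induction xs)
    case (Cons x xs)
    obtain \<beta> t where x: "x = (\<beta>, t)" by (cases x)
    with Cons.prems have b: "\<beta> \<noteq> 0" by simp
    let ?a = "- (inverse \<beta> * inverse (q powi t))"
    have r: "reflect_poly [:u, v:] = [:v, u:]" if "u \<noteq> 0" "v \<noteq> 0" for u v :: complex
      using that by (simp add: reflect_poly_def)
    have h: "inverse \<beta> * inverse (q powi t) * (\<beta> * q powi t) = 1"
      using b assms(1) by (simp add: field_simps)
    have 1: "[:1, - (inverse \<beta> * q powi - t):] = smult ?a (reflect_poly [:1, - (\<beta> * q powi t):])"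
      and 2: "[:q powi - t, - inverse \<beta>:] = smult ?a (reflect_poly [:q powi t, - \<beta>:])"
      using b assms(1) h by (simp_all add: r power_int_minus)
    from Cons x have IH:
      "den_poly q (map (\<lambda>(\<beta>, t). (inverse \<beta>, - t)) xs) = smult (\<Prod>(\<beta>, t)\<leftarrow>xs. - (inverse \<beta> * inverse (q powi t))) (reflect_poly (den_poly q xs))"
      "num_poly q (map (\<lambda>(\<beta>, t). (inverse \<beta>, - t)) xs) = smult (\<Prod>(\<beta>, t)\<leftarrow>xs. - (inverse \<beta> * inverse (q powi t))) (reflect_poly (num_poly q xs))"
      "(\<Prod>(\<beta>, t)\<leftarrow>xs. - (inverse \<beta> * inverse (q powi t))) \<noteq> 0" by auto
    have "(\<Prod>(\<beta>, t)\<leftarrow>x # xs. - (inverse \<beta> * inverse (q powi t))) \<noteq> 0"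
      using IH(3) b assms(1) by (simp add: x)
    then show ?case
      by (simp only: IH x fac_simps reflect_poly_mult 1 2 mult_smult_left mult_smult_right smult_smult
          list.map prod_list.Cons case_prod_conv) (simp only: mult.commute simp_thms)
  qed simp
  then show ?thesis
    by (intro that[of \<tau>]) (auto simp: coeff_reflect_poly poly_degree[OF assms(1,2)])
qed

lemma exch_cong:
  assumes "den_poly q xs = den_poly q ys" "num_poly q xs = num_poly q ys" "length xs = length ys"
  shows "exch q xs X Y k l = exch q ys X Y k l"
  by (simp add: exch_def assms)

lemma exch_derivation:
  "T * exch q xs X Y k l - exch q xs X Y k l * T =
     exch q xs (\<lambda>k. T * X k - X k * T) Y k l + exch q xs X (\<lambda>l. T * Y l - Y l * T) k l"
  unfolding exch_def sum.distrib[symmetric] sum_distrib_left sum_distrib_right sum_subtractf[symmetric]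
  by (intro sum.cong refl) (simp add: algebra_simps)

lemma exch_smul_left: "exch q xs (\<lambda>k. a \<bullet> X k) Y k l = a \<bullet> exch q xs X Y k l"
  unfolding exch_def smul_sum by (intro sum.cong refl) (simp add: mult.commute)

lemma exch_smul_right: "exch q xs X (\<lambda>k. a \<bullet> Y k) k l = a \<bullet> exch q xs X Y k l"
  unfolding exch_def smul_sum by (intro sum.cong refl) (simp add: mult.commute)

lemma exch_diff_left: "exch q xs (\<lambda>k. X k - X' k) Y k l = exch q xs X Y k l - exch q xs X' Y k l"
  unfolding exch_def sum_subtractf[symmetric] by (intro sum.cong refl) (simp add: algebra_simps)

lemma exch_0: "exch q xs (\<lambda>k. 0) Y k l = 0" "exch q xs X (\<lambda>k. 0) k l = 0"
  by (simp_all add: exch_def)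

lemma exch_shift:
  "exch q xs (\<lambda>k. X (k + r)) Y k l = exch q xs X Y (k + r) l"
  "exch q xs X (\<lambda>k. Y (k + r)) k l = exch q xs X Y k (l + r)"
  by (simp_all add: exch_def algebra_simps)

lemma exch_twist:
  assumes "c \<noteq> 0"
  shows "exch q xs (\<lambda>k. c powi k \<bullet> X k) Y k l =
     c powi (k + l) \<bullet> exch q xs X (\<lambda>l. c powi (- l) \<bullet> Y l) k l"
proof -
  have e: "c powi (k - s) = c powi (k + l) * c powi (- (l + s))" for s
    using assms by (subst power_int_add[symmetric]) auto
  show ?thesis
    unfolding exch_def smul_sum by (intro sum.cong refl) (simp add: e mult_ac del: minus_add_distrib)
qed

lemma exch_weight:
  assumes "\<And>k. K * X k = a \<bullet> (X k * K)" "\<And>k. K * Y k = b \<bullet> (Y k * K)"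
  shows "K * exch q xs X Y k l = (a * b) \<bullet> (exch q xs X Y k l * K)"
proof -
  have 1: "K * (X k * Y l) = (a * b) \<bullet> (X k * Y l * K)" for k l
    by (simp add: mult.assoc[symmetric] assms(1)) (simp add: mult.assoc assms(2))
  have 2: "K * (Y l * X k) = (a * b) \<bullet> (Y l * X k * K)" for k l
    by (simp add: mult.assoc[symmetric] assms(2)) (simp add: mult.assoc assms(1) mult.commute)
  show ?thesis
    unfolding exch_def sum_distrib_left sum_distrib_right smul_sum
    by (intro sum.cong refl) (simp add: right_diff_distrib left_diff_distrib 1 2 mult.commute)
qed

lemma endo_elimination:
  assumes "a \<bullet> A + b \<bullet> B = 0" "a' \<bullet> A + b' \<bullet> B = (0 :: endo)" "a * b' - b * a' \<noteq> 0"
  shows "A = 0" "B = 0"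
proof -
  have "b' \<bullet> (a \<bullet> A + b \<bullet> B) - b \<bullet> (a' \<bullet> A + b' \<bullet> B) = (a * b' - b * a') \<bullet> A"
    by (simp add: smul_left_distrib mult.commute)
  then show "A = 0" using assms by (simp add: smul_eq_0_iff)
  have "a \<bullet> (a' \<bullet> A + b' \<bullet> B) - a' \<bullet> (a \<bullet> A + b \<bullet> B) = (a * b' - b * a') \<bullet> B"
    by (simp add: smul_left_distrib mult.commute)
  then show "B = 0" using assms by (simp add: smul_eq_0_iff)
qed

text \<open>The exchange factors of the nodes \<open>i\<close> and \<open>j\<close> of the cyclic
  quiver. For \<open>n = 2\<close> the two distinct nodes are neighbours in both directions and
  get both factors.\<close>

definition facs :: "complex \<Rightarrow> nat \<Rightarrow> int \<Rightarrow> int \<Rightarrow> (complex \<times> int) list" where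
  "facs dc n i j = (if i = j then [(1, 2)] else []) @
     (if i mod int n = (j - 1) mod int n then [(dc, - 1)] else []) @
     (if i mod int n = (j + 1) mod int n then [(inverse dc, - 1)] else [])"

text \<open>The entries of the Cartan matrix, which do not depend on the parameters
  \<open>\<beta>\<close> of the factors.\<close>

definition wt :: "nat \<Rightarrow> int \<Rightarrow> int \<Rightarrow> int" where
  "wt n i j = (\<Sum>(\<beta>, t)\<leftarrow>facs 1 n i j. t)"

lemma wt_facs: "(\<Sum>(\<beta>, t)\<leftarrow>facs dc n i j. t) = wt n i j"
  by (simp add: wt_def facs_def)

definition h_series :: "complex \<Rightarrow> (int \<Rightarrow> endo) \<Rightarrow> endo fps" where
  "h_series g H = Abs_fps (\<lambda>r. if r = 0 then 0 else g \<bullet> H (int r))"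

definition ecomm :: "complex \<Rightarrow> endo \<Rightarrow> endo \<Rightarrow> endo" where
  "ecomm c X Y = X * Y - c \<bullet> (Y * X)"

lemma ecomm_derivation:
  "T * ecomm c X Y - ecomm c X Y * T = ecomm c (T * X - X * T) Y + ecomm c X (T * Y - Y * T)"
  by (simp add: ecomm_def algebra_simps)

lemma ecomm_smul: "ecomm c (a \<bullet> X) Y = a \<bullet> ecomm c X Y" "ecomm c X (a \<bullet> Y) = a \<bullet> ecomm c X Y"
  by (simp_all add: ecomm_def mult.commute)

lemma ecomm_add: "ecomm c (X + X') Y = ecomm c X Y + ecomm c X' Y"
   "ecomm c X (Y + Y') = ecomm c X Y + ecomm c X Y'"
  by (simp_all add: ecomm_def algebra_simps)

lemma mod_neighbours:
  fixes i j :: int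
  assumes "i \<in> {0..<int n}" "j \<in> {0..<int n}" "n \<ge> 2"
  shows "i mod int n = (j - 1) mod int n \<longleftrightarrow> j = i + 1 \<or> (i = int n - 1 \<and> j = 0)"
    and "i mod int n = (j + 1) mod int n \<longleftrightarrow> i = j + 1 \<or> (j = int n - 1 \<and> i = 0)"
proof -
  have m: "i mod int n = i" using assms by simp
  have "(j - 1) mod int n = (if j = 0 then int n - 1 else j - 1)"
    using assms by (auto simp: zmod_minus1)
  then show "i mod int n = (j - 1) mod int n \<longleftrightarrow> j = i + 1 \<or> (i = int n - 1 \<and> j = 0)"
    unfolding m using assms by auto
  have "(j + 1) mod int n = (if j = int n - 1 then 0 else j + 1)"
    using assms by auto
  then show "i mod int n = (j + 1) mod int n \<longleftrightarrow> i = j + 1 \<or> (j = int n - 1 \<and> i = 0)"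
    unfolding m using assms by auto
qed

text \<open>The relations from which the remaining ones will be deduced. Besides the Heisenberg
  relations and the commutators of \<open>E\<close> with \<open>F\<close> they contain the
  integrability of the zero modes. The parameter \<open>c\<close> is the value of the central
  element, and the nondegeneracy conditions express that the parameters are generic.\<close>

locale toroidal_ops =
  fixes q dc c :: complex and n :: nat and E F H :: "int \<Rightarrow> int \<Rightarrow> endo" and K Ki :: "int \<Rightarrow> endo"
  assumes q0: "q \<noteq> 0" and dc0: "dc \<noteq> 0" and c0: "c \<noteq> 0"
    and not_root: "\<And>k :: int. k \<noteq> 0 \<Longrightarrow> q powi k \<noteq> 1"
    and nondeg: "\<And>k :: int. k \<noteq> 0 \<Longrightarrow> (q * dc) powi k \<noteq> 1 \<and> (q * inverse dc) powi k \<noteq> 1"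
    and n2: "n \<ge> 2"
    and K_inv: "\<And>i. i \<in> {0..<int n} \<Longrightarrow> K i * Ki i = 1 \<and> Ki i * K i = 1"
    and KE: "\<And>i j k. i \<in> {0..<int n} \<Longrightarrow> j \<in> {0..<int n} \<Longrightarrow>
        K i * E j k = q powi wt n i j \<bullet> (E j k * K i)"
    and KF: "\<And>i j k. i \<in> {0..<int n} \<Longrightarrow> j \<in> {0..<int n} \<Longrightarrow>
        K i * F j k = q powi (- wt n i j) \<bullet> (F j k * K i)"
    and HH: "\<And>i r s. i \<in> {0..<int n} \<Longrightarrow> r * s > 0 \<Longrightarrow> H i r * H i s = H i s * H i r"
    and HE: "\<And>i j r k. i \<in> {0..<int n} \<Longrightarrow> j \<in> {0..<int n} \<Longrightarrow> r \<noteq> 0 \<Longrightarrow>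
        H i r * E j k - E j k * H i r =
          (a_coeff q dc n i j r * (if r > 0 then c powi (- r) else 1)) \<bullet> E j (k + r)"
    and HF: "\<And>i j r k. i \<in> {0..<int n} \<Longrightarrow> j \<in> {0..<int n} \<Longrightarrow> r \<noteq> 0 \<Longrightarrow>
        H i r * F j k - F j k * H i r =
          (- a_coeff q dc n i j r * (if r > 0 then 1 else c powi (- r))) \<bullet> F j (k + r)"
    and EF: "\<And>i j k l. i \<in> {0..<int n} \<Longrightarrow> j \<in> {0..<int n} \<Longrightarrow>
        E i k * F j l - F j l * E i k = (if i = j then (1 / (q - inverse q)) \<bullet>
          (c powi k \<bullet> half_series (K i) (h_series (q - inverse q) (H i)) (k + l)
           - c powi l \<bullet> half_series (Ki i) (h_series (- (q - inverse q)) (\<lambda>r. H i (- r))) (- (k + l)))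
         else 0)"
    and nilp_E: "\<And>i v. i \<in> {0..<int n} \<Longrightarrow> \<exists>A. app (E i 0 ^ A) v = 0"
    and nilp_F: "\<And>i v. i \<in> {0..<int n} \<Longrightarrow> \<exists>A. app (F i 0 ^ A) v = 0"
begin

lemma g0: "q - inverse q \<noteq> 0"
  by (rule qnum_nonzero(2)[of q 1]) (auto simp: q0 not_root)

lemma facs_nz: "\<forall>(\<beta>, t) \<in> set (facs dc n i j). \<beta> \<noteq> 0"
  by (auto simp: facs_def dc0)

text \<open>The structure constants of the Heisenberg algebra are the logarithms of the exchange
  factors.\<close>

lemma log_coeff_facs:
  assumes "i \<in> {0..<int n}" "j \<in> {0..<int n}" "r > 0"
  shows "log_coeff q (facs dc n i j) r = (q - inverse q) * a_coeff q dc n i j (int r)"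
    and "log_coeff q (map (\<lambda>(\<beta>, t). (inverse \<beta>, - t)) (facs dc n i j)) r
        = - (q - inverse q) * a_coeff q dc n i j (- int r)"
proof -
  have ij: "i mod int n = j mod int n \<longleftrightarrow> i = j" using assms by simp
  define x where "x = q ^ r"
  define y where "y = dc ^ r"
  have xy: "x \<noteq> 0" "y \<noteq> 0" by (auto simp: x_def y_def q0 dc0)
  have e: "(q\<^sup>2) ^ r = x * x" "(q powi - 1) ^ r = inverse x" "q powi int r = x" "q powi - int r = inverse x"
    "inverse q ^ r = inverse x" "inverse dc ^ r = inverse y" "dc powi int r = y" "dc powi - int r = inverse y"
    "q ^ r = x" "dc ^ r = y"
    by (simp_all add: x_def y_def power_int_minus power_inverse power2_eq_square power_mult_distrib power_int_def)
  have 1: "(q - inverse q) * a_coeff q dc n i j (int r) = (x - inverse x) * inverse (of_nat r) *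
      ((x + inverse x) * kdelta n i j - y * kdelta n i (j - 1) - inverse y * kdelta n i (j + 1))"
    unfolding a_coeff_def qnum_def e using g0 by (simp add: divide_inverse)
  have 2: "- (q - inverse q) * a_coeff q dc n i j (- int r) = - ((x - inverse x) * inverse (of_nat r)) *
      ((x + inverse x) * kdelta n i j - inverse y * kdelta n i (j - 1) - y * kdelta n i (j + 1))"
  proof -
    have "- G * ((b - a) / G / - R * Z) = - ((a - b) * inverse R) * Z"
      if "G \<noteq> 0" "R \<noteq> 0" for G R a b Z :: complex
      using that by (simp add: field_simps)
    from this[OF g0, of "of_nat r"] show ?thesis
      unfolding a_coeff_def qnum_def minus_minus e using assms(3) by simp
  qed
  show "log_coeff q (facs dc n i j) r = (q - inverse q) * a_coeff q dc n i j (int r)"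
    unfolding 1
    by (simp add: log_coeff_def facs_def kdelta_def ij e power_int_minus power_inverse divide_inverse)
      (simp add: algebra_simps)
  show "log_coeff q (map (\<lambda>(\<beta>, t). (inverse \<beta>, - t)) (facs dc n i j)) r
        = - (q - inverse q) * a_coeff q dc n i j (- int r)"
    unfolding 2
    by (simp add: log_coeff_def facs_def kdelta_def ij e power_int_minus power_inverse divide_inverse)
      (simp add: algebra_simps)
qed

abbreviation "Kp i \<equiv> half_series (K i) (h_series (q - inverse q) (H i))"
abbreviation "Km i \<equiv> half_series (Ki i) (h_series (- (q - inverse q)) (\<lambda>r. H i (- r)))"

text \<open>Up to the factor \<open>1 / (q - q\<^sup>-\<^sup>1)\<close> the commutator of
  \<open>E\<^sub>i(z)\<close> with the zero mode of \<open>F\<^sub>i\<close>.\<close>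

definition Psi :: "int \<Rightarrow> int \<Rightarrow> endo" where
  "Psi i k = c powi k \<bullet> Kp i k - Km i (- k)"

lemma EF0:
  assumes "i \<in> {0..<int n}"
  shows "F i 0 * E i k - E i k * F i 0 = - ((1 / (q - inverse q)) \<bullet> Psi i k)"
  using EF[OF assms assms, of k 0] by (simp add: Psi_def algebra_simps)

lemma EF_ne:
  assumes "i \<in> {0..<int n}" "j \<in> {0..<int n}" "i \<noteq> j"
  shows "E i k * F j l = F j l * E i k"
  using EF[OF assms(1,2), of k l] assms(3) by simp

lemma KiE:
  assumes "i \<in> {0..<int n}" "j \<in> {0..<int n}"
  shows "Ki i * E j k = q powi (- wt n i j) \<bullet> (E j k * Ki i)"
  unfolding power_int_minus using conj_inverse[OF _ _ KE[OF assms, of k]] K_inv[OF assms(1)] q0 by simp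

text \<open>Each of the two Cartan currents in \<open>Psi\<close> satisfies the exchange relation with
  \<open>E\<^sub>j\<close>, the second one after the inversion of the argument. The twist by
  powers of \<open>c\<close> is absorbed by a rescaling of the variable.\<close>

lemma Psi_exch:
  assumes i: "i \<in> {0..<int n}" and j: "j \<in> {0..<int n}"
  shows "exch q (facs dc n i j) (Psi i) (E j) k l = 0"
proof -
  let ?xs = "facs dc n i j" and ?D = "length (facs dc n i j)" and ?g = "q - inverse q"
  have plus: "exch q ?xs (\<lambda>k. c powi k \<bullet> Kp i k) (E j) k l = 0"
  proof -
    have "exch q ?xs (Kp i) (\<lambda>l. c powi (- l) \<bullet> E j l) k l = 0"
    proof (rule half_series_exchange[OF q0])
      fix r l assume r: "r > (0::nat)"
      show "h_series ?g (H i) $ r * (c powi - l \<bullet> E j l) - (c powi - l \<bullet> E j l) * h_series ?g (H i) $ r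
          = log_coeff q ?xs r \<bullet> (c powi - (l + int r) \<bullet> E j (l + int r))"
      proof -
        have "h_series ?g (H i) $ r * (c powi - l \<bullet> E j l) - (c powi - l \<bullet> E j l) * h_series ?g (H i) $ r
          = (c powi - l * ?g) \<bullet> (H i (int r) * E j l - E j l * H i (int r))"
          using r by (simp add: h_series_def mult.commute)
        also have "c powi - (l + int r) = c powi (- l) * c powi - int r"
          using c0 by (simp add: power_int_add[symmetric])
        ultimately show ?thesis
          using r by (simp add: HE[OF i j] log_coeff_facs(1)[OF i j r] mult_ac)
      qed
    next
      fix r s show "h_series ?g (H i) $ r * h_series ?g (H i) $ s = h_series ?g (H i) $ s * h_series ?g (H i) $ r"
        using HH[OF i, of "int r" "int s"] by (simp add: h_series_def)
    qed (simp_all add: h_series_def KE[OF i j] wt_facs facs_nz mult.commute)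
    then show ?thesis by (subst exch_twist[OF c0]) simp
  qed
  let ?ys = "map (\<lambda>(\<beta>, t). (inverse \<beta>, - t)) ?xs"
  have minus': "exch q ?ys (Km i) (\<lambda>l. E j (- l)) k l = 0" for k l
  proof (rule half_series_exchange[OF q0])
    fix r l assume r: "r > (0::nat)"
    show "h_series (- ?g) (\<lambda>r. H i (- r)) $ r * E j (- l) - E j (- l) * h_series (- ?g) (\<lambda>r. H i (- r)) $ r
          = log_coeff q ?ys r \<bullet> E j (- (l + int r))"
    proof -
      have "h_series (- ?g) (\<lambda>r. H i (- r)) $ r * E j (- l) - E j (- l) * h_series (- ?g) (\<lambda>r. H i (- r)) $ r
         = (- ?g) \<bullet> (H i (- int r) * E j (- l) - E j (- l) * H i (- int r))"
        using r by (simp add: h_series_def)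
      also have "\<dots> = (- ?g * a_coeff q dc n i j (- int r)) \<bullet> E j (- l - int r)"
        using r by (subst HE[OF i j]) simp_all
      finally show ?thesis by (simp only: log_coeff_facs(2)[OF i j r]) simp
    qed
  next
    fix r s
    show "h_series (- ?g) (\<lambda>r. H i (- r)) $ r * h_series (- ?g) (\<lambda>r. H i (- r)) $ s
       = h_series (- ?g) (\<lambda>r. H i (- r)) $ s * h_series (- ?g) (\<lambda>r. H i (- r)) $ r"
      using HH[OF i, of "- int r" "- int s"] by (simp add: h_series_def)
  next
    have "(\<Sum>(\<beta>, t)\<leftarrow>?ys. t) = - (\<Sum>(\<beta>, t)\<leftarrow>?xs. t)" by (simp add: facs_def)
    then show "Ki i * E j (- l) = q powi (\<Sum>(\<beta>, t)\<leftarrow>?ys. t) \<bullet> (E j (- l) * Ki i)" for l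
      by (simp add: KiE[OF i j] wt_facs)
    show "\<forall>(\<beta>, t)\<in>set ?ys. \<beta> \<noteq> 0" by (auto simp: facs_def dc0)
  qed (simp add: h_series_def)
  obtain \<tau> where \<tau>: "\<tau> \<noteq> 0"
    "\<And>s. s \<le> ?D \<Longrightarrow> coeff (den_poly q ?ys) s = \<tau> * coeff (den_poly q ?xs) (?D - s)"
    "\<And>s. s \<le> ?D \<Longrightarrow> coeff (num_poly q ?ys) s = \<tau> * coeff (num_poly q ?xs) (?D - s)"
    using coeff_fac_neg[OF q0 facs_nz[of i j]] by metis
  have "exch q ?ys (Km i) (\<lambda>l. E j (- l)) (int ?D - k) (- l - int ?D) =
      (\<Sum>s=0..?D. \<tau> \<bullet> (coeff (den_poly q ?xs) (?D - s) \<bullet> (Km i (int ?D - k - int s) * E j (l + int ?D - int s))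
     - coeff (num_poly q ?xs) (?D - s) \<bullet> (E j (l + int ?D - int s) * Km i (int ?D - k - int s))))"
    unfolding exch_def atMost_atLeast0 length_map
    by (intro sum.cong refl) (simp add: \<tau> algebra_simps)
  also have "\<dots> = (\<Sum>s=0..?D. \<tau> \<bullet> (coeff (den_poly q ?xs) s \<bullet> (Km i (- (k - int s)) * E j (l + int s))
     - coeff (num_poly q ?xs) s \<bullet> (E j (l + int s) * Km i (- (k - int s)))))"
    by (subst sum.atLeastAtMost_rev, intro sum.cong refl) (simp add: of_nat_diff algebra_simps)
  also have "\<dots> = \<tau> \<bullet> exch q ?xs (\<lambda>k. Km i (- k)) (E j) k l"
    by (simp only: exch_def smul_sum atMost_atLeast0)
  finally have minus: "exch q ?xs (\<lambda>k. Km i (- k)) (E j) k l = 0"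
    using minus' \<tau>(1) by (simp add: smul_eq_0_iff)
  show ?thesis
    unfolding Psi_def[abs_def] using plus minus by (simp only: exch_diff_left) simp
qed

lemma wt_simps:
  assumes i: "i \<in> {0..<int n}" and j: "j \<in> {0..<int n}"
  shows "i = j \<Longrightarrow> wt n i j = 2" "i = j \<Longrightarrow> facs dc n i j = [(1, 2)]"
    "n \<noteq> 2 \<Longrightarrow> wt n i j \<ge> - 1" "n = 2 \<Longrightarrow> i \<noteq> j \<Longrightarrow> wt n i j = - 2"
    "n = 2 \<Longrightarrow> i \<noteq> j \<Longrightarrow> facs dc n i j = [(dc, - 1), (inverse dc, - 1)]"
proof -
  have f: "facs dc n i j = (if i = j then [(1, 2)] else []) @
     (if j = i + 1 \<or> (i = int n - 1 \<and> j = 0) then [(dc, - 1)] else []) @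
     (if i = j + 1 \<or> (j = int n - 1 \<and> i = 0) then [(inverse dc, - 1)] else [])" for dc
    unfolding facs_def mod_neighbours[OF i j n2] ..
  have b: "0 \<le> i" "i \<le> int n - 1" "0 \<le> j" "j \<le> int n - 1" using i j by auto
  show "i = j \<Longrightarrow> wt n i j = 2" "i = j \<Longrightarrow> facs dc n i j = [(1, 2)]"
    unfolding wt_def f using n2 by auto
  show "n \<noteq> 2 \<Longrightarrow> wt n i j \<ge> - 1"
    unfolding wt_def f using n2 b by (auto split: if_splits)
  show "n = 2 \<Longrightarrow> i \<noteq> j \<Longrightarrow> wt n i j = - 2"
    "n = 2 \<Longrightarrow> i \<noteq> j \<Longrightarrow> facs dc n i j = [(dc, - 1), (inverse dc, - 1)]"
    unfolding wt_def f using b by auto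
qed

lemma triple: "i \<in> {0..<int n} \<Longrightarrow> sl2_triple q (E i 0) (F i 0) (K i) (Ki i)"
proof
  assume i: "i \<in> {0..<int n}"
  show "K i * E i 0 = q powi 2 \<bullet> (E i 0 * K i)" using KE[OF i i] wt_simps(1)[OF i i] by simp
  show "E i 0 * F i 0 - F i 0 * E i 0 = (1 / (q - inverse q)) \<bullet> (K i - Ki i)"
    using EF[OF i i, of 0 0] by (simp add: half_series_def)
qed (use q0 not_root K_inv nilp_E nilp_F in auto)

text \<open>The expression that has to vanish for the quadratic relation.\<close>

abbreviation "Q i j \<equiv> exch q (facs dc n i j) (E i) (E j)"

lemma Q_weight:
  assumes "i \<in> {0..<int n}" "j \<in> {0..<int n}" "i' \<in> {0..<int n}"
  shows "K i' * Q i j k l = q powi (wt n i' i + wt n i' j) \<bullet> (Q i j k l * K i')"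
proof -
  have "K i' * Q i j k l = (q powi wt n i' i * q powi wt n i' j) \<bullet> (Q i j k l * K i')"
    by (rule exch_weight; rule KE; fact)
  then show ?thesis using q0 by (simp add: power_int_add)
qed

text \<open>The commutator with \<open>F\<^sub>i\<^sub>,\<^sub>0\<close> is a derivation that replaces
  \<open>E\<^sub>i\<close> by the Cartan current \<open>Psi\<close>, which satisfies the same
  exchange relation. For \<open>i = j\<close> the replacement of the second argument is reduced to
  that of the first by the symmetry of the exchange relation.\<close>

lemma Q_commutes_F:
  assumes i: "i \<in> {0..<int n}" and j: "j \<in> {0..<int n}"
  shows "Q i j k l * F i 0 = F i 0 * Q i j k l"
proof -
  let ?g = "1 / (q - inverse q)"
  have X: "exch q (facs dc n i j) (\<lambda>k. F i 0 * E i k - E i k * F i 0) (E j) k l = 0"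
    unfolding EF0[OF i] smul_simps(3)[symmetric] smul_left_distrib(3)[symmetric]
    by (simp add: exch_smul_left Psi_exch[OF i j] flip: smul_left_distrib(3))
  have Y: "exch q (facs dc n i j) (E i) (\<lambda>k. F i 0 * E j k - E j k * F i 0) k l = 0"
  proof (cases "i = j")
    case True
    have "exch q [(1, 2)] (E i) (Psi i) k l = 0"
      using exch_swap[OF q0, of "[(1, 2)]" "E i" "Psi i" k l] Psi_exch[OF i i] wt_simps(2)[OF i i] by simp
    then show ?thesis
      unfolding True[symmetric] EF0[OF i] wt_simps(2)[OF i i refl]
      by (simp add: exch_smul_right flip: smul_left_distrib(3))
  next
    case False
    then show ?thesis using EF_ne[OF j i] by (simp add: exch_0)
  qed
  show ?thesis using exch_derivation[of "F i 0" q "facs dc n i j" "E i" "E j" k l] X Y by simp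
qed


lemma a_diag_nz:
  assumes i: "i \<in> {0..<int n}" and r: "r \<noteq> 0"
  shows "a_coeff q dc n i i r \<noteq> 0"
proof -
  have "i mod int n \<noteq> (i - 1) mod int n" "i mod int n \<noteq> (i + 1) mod int n"
    using mod_neighbours[OF i i n2] n2 by auto
  moreover have "qnum q r \<noteq> 0" by (rule qnum_nonzero) (auto simp: q0 not_root r)
  moreover have "q powi r + q powi (- r) \<noteq> 0"
  proof
    assume "q powi r + q powi (- r) = 0"
    then have "q powi r * (q powi r + q powi (- r)) = 0" by simp
    then have "q powi r * q powi r + 1 = 0"
      using q0 by (simp add: power_int_minus distrib_left)
    then have "q powi r * q powi r = - 1" by (simp add: eq_neg_iff_add_eq_0)
    then have "(q powi r * q powi r) * (q powi r * q powi r) = 1" by simp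
    moreover have "(q powi r * q powi r) * (q powi r * q powi r) = q powi (r + r + (r + r))"
      using q0 by (simp only: power_int_add[of q] q0 simp_thms)
    ultimately show False using not_root[of "r + r + (r + r)"] r by simp
  qed
  ultimately show ?thesis using r by (auto simp: a_coeff_def kdelta_def)
qed

text \<open>Two different nodes can be told apart by the Heisenberg generators of index
  \<open>r\<close>. According to the number of edges between the nodes, a vanishing determinant
  would make a power of \<open>q dc\<close> or \<open>q dc\<^sup>-\<^sup>1\<close>, a sixth power,
  or a fourth power of \<open>q\<^sup>r\<close> equal to \<open>1\<close>.\<close>

lemma a_det_nz:
  assumes i: "i \<in> {0..<int n}" and j: "j \<in> {0..<int n}" and ne: "i \<noteq> j" and r: "r \<noteq> 0"
  shows "a_coeff q dc n i i r * a_coeff q dc n j j r - a_coeff q dc n i j r * a_coeff q dc n j i r \<noteq> 0"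
proof
  assume det: "a_coeff q dc n i i r * a_coeff q dc n j j r - a_coeff q dc n i j r * a_coeff q dc n j i r = 0"
  define x where "x = q powi r"
  define y where "y = dc powi r"
  have xy: "x \<noteq> 0" "y \<noteq> 0" by (auto simp: x_def y_def q0 dc0)
  have xm: "q powi (- r) = inverse x" "dc powi (- r) = inverse y" by (simp_all add: x_def y_def power_int_minus)
  define p where "p = qnum q r / of_int r"
  have p: "p \<noteq> 0" using qnum_nonzero(1)[OF q0 not_root r] r by (simp add: p_def)
  have ji: "j mod int n = (i - 1) mod int n \<longleftrightarrow> i mod int n = (j + 1) mod int n"
     "j mod int n = (i + 1) mod int n \<longleftrightarrow> i mod int n = (j - 1) mod int n"
    unfolding mod_neighbours[OF i j n2] mod_neighbours[OF j i n2] by auto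
  have ii: "i mod int n \<noteq> (i - 1) mod int n" "i mod int n \<noteq> (i + 1) mod int n"
     "j mod int n \<noteq> (j - 1) mod int n" "j mod int n \<noteq> (j + 1) mod int n"
    using mod_neighbours[OF i i n2] mod_neighbours[OF j j n2] n2 by auto
  have ij: "i mod int n \<noteq> j mod int n" "j mod int n \<noteq> i mod int n" using i j ne by auto
  define s where "s = (if i mod int n = (j - 1) mod int n then 1 else 0 :: complex)"
  define t where "t = (if i mod int n = (j + 1) mod int n then 1 else 0 :: complex)"
  have "p * p * ((x + inverse x) ^ 2 - (s * y + t * inverse y) * (t * y + s * inverse y)) = 0"
  proof -
    have "a_coeff q dc n i i r = p * (x + inverse x)" "a_coeff q dc n j j r = p * (x + inverse x)"
      "a_coeff q dc n i j r = p * (- (s * y) - t * inverse y)"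
      "a_coeff q dc n j i r = p * (- (t * y) - s * inverse y)"
      unfolding a_coeff_def kdelta_def p_def[symmetric] xm x_def[symmetric] y_def[symmetric]
      by (simp_all add: ii ij ji s_def t_def)
    with det show ?thesis by (simp add: power2_eq_square algebra_simps)
  qed
  with p have d: "(x + inverse x) ^ 2 = (s * y + t * inverse y) * (t * y + s * inverse y)" by simp
  have pw: "x * x = q powi (r + r)" "y * y = dc powi (r + r)"
    unfolding x_def y_def by (subst power_int_add, simp add: q0 dc0, simp)+
  consider "s = 1" "t = 1" | "s * t = 0" "s * s + t * t = 1" | "s = 0" "t = 0"
  proof -
    have "s = 0 \<or> s = 1" "t = 0 \<or> t = 1" by (auto simp: s_def t_def)
    then show ?thesis using that by auto
  qed
  then show False
  proof cases
    case 1
    then have "(x + inverse x) ^ 2 = (y + inverse y) ^ 2" using d by (simp add: power2_eq_square)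
    then have "((x + inverse x) ^ 2 - (y + inverse y) ^ 2) * (x * x * y * y) = 0" by simp
    moreover have "((x + inverse x) ^ 2 - (y + inverse y) ^ 2) * (x * x * y * y) = (x * x - y * y) * (x * x * y * y - 1)"
      using xy by (simp add: field_simps power2_eq_square)
    ultimately have "x * x = y * y \<or> x * x * y * y = 1" by auto
    then consider "x * x * inverse y * inverse y = 1" | "x * x * y * y = 1"
      using xy by (auto simp: field_simps)
    then show False
    proof cases
      case 1
      have "x * x * inverse y * inverse y = (q * inverse dc) powi (r + r)"
        using pw by (simp add: power_int_mult_distrib power_int_inverse mult.assoc flip: inverse_mult_distrib)
      with 1 nondeg[of "r + r"] r show False by simp
    next
      case 2
      have "x * x * y * y = (q * dc) powi (r + r)"
        using pw by (simp add: power_int_mult_distrib mult.assoc)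
      with 2 nondeg[of "r + r"] r show False by simp
    qed
  next
    case 2
    have "(s * y + t * inverse y) * (t * y + s * inverse y) = s * t * (y * y + inverse y * inverse y) + (s * s + t * t) * (y * inverse y)"
      by (simp add: algebra_simps)
    also have "\<dots> = 1" using 2 xy by simp
    finally have "(x + inverse x) ^ 2 * (x * x) = x * x" using d by simp
    moreover have "(x + inverse x) ^ 2 * (x * x) = ((x + inverse x) * x) ^ 2"
      by (simp only: power2_eq_square mult_ac)
    moreover have "(x + inverse x) * x = x * x + 1" using xy by (simp add: distrib_right)
    ultimately have "(x * x + 1) ^ 2 = x * x" by (simp only:)
    then have "x * x * x * x + x * x + 1 = 0" by (simp add: power2_eq_square algebra_simps)
    then have "(x * x - 1) * (x * x * x * x + x * x + 1) = 0" by simp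
    then have "x * x * x * x * x * x = 1" by (simp add: algebra_simps)
    moreover have "x * x * x * x * x * x = q powi (r + r + r + r + r + r)"
      by (simp only: x_def power_int_add[of q] q0 simp_thms)
    ultimately show False using not_root[of "r + r + r + r + r + r"] r by simp
  next
    case 3
    then have "x + inverse x = 0" using d by simp
    then have "x * x = - 1" using xy by (simp add: field_simps add_eq_0_iff)
    then have "x * x * x * x = 1" by simp
    moreover have "x * x * x * x = q powi (r + r + r + r)"
      by (simp only: x_def power_int_add[of q] q0 simp_thms)
    ultimately show False using not_root[of "r + r + r + r"] r by simp
  qed
qed

lemma Q_derivation:
  assumes i: "i \<in> {0..<int n}" and j: "j \<in> {0..<int n}" and i': "i' \<in> {0..<int n}" and r: "r \<noteq> 0"
  shows "H i' r * Q i j k l - Q i j k l * H i' r =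
     (if r > 0 then c powi (- r) else 1) \<bullet>
       (a_coeff q dc n i' i r \<bullet> Q i j (k + r) l + a_coeff q dc n i' j r \<bullet> Q i j k (l + r))"
  unfolding exch_derivation HE[OF i' i r] HE[OF i' j r] exch_smul_left exch_smul_right
    exch_shift(1)[where X = "E i"] exch_shift(2)[where Y = "E j"] by (simp add: mult.commute)

text \<open>The expression commutes with \<open>F\<^sub>i\<^sub>,\<^sub>0\<close> and has weight
  \<open>2 + a\<^sub>i\<^sub>j\<close> for the \<open>sl\<^sub>2\<close> of the node
  \<open>i\<close>. A positive weight forces it to vanish. Weight \<open>0\<close>, which occurs
  when \<open>n = 2\<close> and \<open>i \<noteq> j\<close>, only shows that it commutes with
  \<open>E\<^sub>i\<^sub>,\<^sub>0\<close>; bracketing with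
  \<open>H\<^sub>i\<^sub>,\<^sub>1\<close> and with \<open>F\<^sub>i\<^sub>,\<^sub>0\<close> it is
  found to commute with \<open>E\<^sub>i\<^sub>,\<^sub>1\<close> and
  \<open>H\<^sub>i\<^sub>,\<^sub>1\<close> as well, and likewise for \<open>j\<close>. The action
  of \<open>H\<^sub>i\<^sub>,\<^sub>1\<close> and \<open>H\<^sub>j\<^sub>,\<^sub>1\<close> being
  nondegenerate, the expression is zero.\<close>

theorem EE:
  assumes i: "i \<in> {0..<int n}" and j: "j \<in> {0..<int n}"
  shows "Q i j k l = 0"
proof -
  interpret T: sl2_triple q "E i 0" "F i 0" "K i" "Ki i" by (rule triple[OF i])
  have w: "wt n i i = 2" by (rule wt_simps(1)[OF i i refl])
  show ?thesis
  proof (cases "n = 2 \<and> i \<noteq> j")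
    case False
    then have "wt n i j \<ge> - 1" using wt_simps[OF i j] by auto
    with T.qad_vanishes[OF Q_weight[OF i j i] Q_commutes_F[OF i j], of 0 k l]
    show ?thesis by (simp add: w)
  next
    case True
    then have n: "n = 2" and ne: "i \<noteq> j" by auto
    have w2: "wt n i j = - 2" "wt n j i = - 2" "wt n j j = 2"
      using wt_simps[OF i j] wt_simps[OF j i] wt_simps[OF j j] n ne by auto
    have fs: "facs dc n i j = [(dc, - 1), (inverse dc, - 1)]" "facs dc n j i = [(dc, - 1), (inverse dc, - 1)]"
      using wt_simps[OF i j] wt_simps[OF j i] n ne by auto
    \<comment> \<open>For \<open>n = 2\<close> the list of factors is invariant under inversion, hence the situation is symmetric in
      \<open>i\<close> and \<open>j\<close>.\<close>
    have sw: "Q i j k l = - exch q (facs dc n j i) (E j) (E i) (l + 2) (k - 2)" for k l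
    proof -
      have "exch q (fac_inv (facs dc n i j)) (E j) (E i) k l = exch q (facs dc n j i) (E j) (E i) k l" for k l
        by (rule exch_cong) (simp_all add: fs mult.commute)
      then show ?thesis
        using exch_swap[OF q0 facs_nz, of i j "E i" "E j" k l] dc0 by (simp add: fs)
    qed
    have main: "a_coeff q dc n i' i 1 \<bullet> Q i j (k + 1) l + a_coeff q dc n i' j 1 \<bullet> Q i j k (l + 1) = 0"
      if i': "i' = i \<or> i' = j" for i' k l
    proof -
      have i'n: "i' \<in> {0..<int n}" using i' i j by auto
      interpret T': sl2_triple q "E i' 0" "F i' 0" "K i'" "Ki i'" by (rule triple[OF i'n])
      have w0: "wt n i' i + wt n i' j = 0" using i' w w2 by auto
      have F0: "Q i j k l * F i' 0 = F i' 0 * Q i j k l" for k l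
        using i' Q_commutes_F[OF i j] Q_commutes_F[OF j i] sw by (auto simp: algebra_simps)
      have KQ: "K i' * Q i j k l = q powi 0 \<bullet> (Q i j k l * K i')" for k l
        using Q_weight[OF i j i'n] w0 by simp
      \<comment> \<open>The first step of the adjoint action for weight \<open>0\<close> is the commutator.\<close>
      have E0: "E i' 0 * Q i j k l = Q i j k l * E i' 0" for k l
        using T'.qad_vanishes[OF KQ F0, of 1 k l] by simp
      have H1: "H i' 1 * E i' 0 - E i' 0 * H i' 1 = (a_coeff q dc n i' i' 1 * inverse c) \<bullet> E i' 1"
        using HE[OF i'n i'n, of 1 0] by (simp add: power_int_minus)
      have E1: "E i' 1 * Q i j k l = Q i j k l * E i' 1" for k l
      proof -
        define DQ where "DQ = H i' 1 * Q i j k l - Q i j k l * H i' 1"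
        have "DQ * E i' 0 = E i' 0 * DQ"
          unfolding DQ_def by (subst (1 2) Q_derivation[OF i j i'n]) (simp_all add: algebra_simps E0)
        moreover have "H i' 1 * (E i' 0 * Q i j k l - Q i j k l * E i' 0)
            - (E i' 0 * Q i j k l - Q i j k l * E i' 0) * H i' 1
          = (H i' 1 * E i' 0 - E i' 0 * H i' 1) * Q i j k l - Q i j k l * (H i' 1 * E i' 0 - E i' 0 * H i' 1)
            + (E i' 0 * DQ - DQ * E i' 0)"
          by (simp add: DQ_def algebra_simps)
        ultimately have "(a_coeff q dc n i' i' 1 * inverse c) \<bullet> (E i' 1 * Q i j k l - Q i j k l * E i' 1) = 0"
          by (simp add: E0 H1)
        then show ?thesis using a_diag_nz[OF i'n, of 1] c0 by (auto simp: smul_eq_0_iff simp del: smul_simps)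
      qed
      have "E i' 1 * F i' 0 - F i' 0 * E i' 1 = (1 / (q - inverse q)) \<bullet> Psi i' 1"
        using EF0[OF i'n, of 1] by (simp add: algebra_simps)
      also have "Psi i' 1 = (c * (q - inverse q)) \<bullet> (K i' * H i' 1)"
        by (simp add: Psi_def half_series_def exp_fps_def h_series_def)
      finally have "E i' 1 * F i' 0 - F i' 0 * E i' 1 = c \<bullet> (K i' * H i' 1)"
        using g0 by simp
      moreover have "(E i' 1 * F i' 0 - F i' 0 * E i' 1) * Q i j k l = Q i j k l * (E i' 1 * F i' 0 - F i' 0 * E i' 1)"
      proof -
        have 1: "E i' 1 * (F i' 0 * Q i j k l) = Q i j k l * (E i' 1 * F i' 0)"
          by (simp only: F0[symmetric]) (simp only: mult.assoc[symmetric] E1)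
        have 2: "F i' 0 * (E i' 1 * Q i j k l) = Q i j k l * (F i' 0 * E i' 1)"
          by (simp only: E1) (simp only: mult.assoc[symmetric] F0)
        show ?thesis by (simp only: left_diff_distrib right_diff_distrib mult.assoc 1 2)
      qed
      ultimately have "c \<bullet> (K i' * (H i' 1 * Q i j k l)) = c \<bullet> (Q i j k l * (K i' * H i' 1))"
        by (simp add: mult.assoc)
      then have "K i' * (H i' 1 * Q i j k l) = Q i j k l * (K i' * H i' 1)"
        using smul_cancel[OF c0] by simp
      also have "\<dots> = K i' * (Q i j k l * H i' 1)" using KQ by (simp add: mult.assoc[symmetric])
      finally have "Ki i' * K i' * (H i' 1 * Q i j k l) = Ki i' * K i' * (Q i j k l * H i' 1)"
        by (simp only: mult.assoc)
      then have "H i' 1 * Q i j k l - Q i j k l * H i' 1 = 0" using K_inv[OF i'n] by simp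
      then show ?thesis
        unfolding Q_derivation[OF i j i'n one_neq_zero] using c0 by (simp add: smul_eq_0_iff del: smul_simps)
    qed
    have "Q i j (k - 1 + 1) l = 0"
      by (rule endo_elimination(1)[OF main[of i "k - 1" l] main[of j "k - 1" l]])
         (use a_det_nz[OF i j ne, of 1] in \<open>auto simp: mult.commute\<close>)
    then show ?thesis by simp
  qed
qed

text \<open>If a vanishing expression of degree one in \<open>E\<^sub>j\<close> is bracketed with
  \<open>H\<^sub>i\<^sub>,\<^sub>r\<close> and \<open>H\<^sub>j\<^sub>,\<^sub>r\<close>, the parts
  \<open>A\<close>, in which an index of \<open>E\<^sub>i\<close> is raised, and \<open>B\<close>,
  in which that of \<open>E\<^sub>j\<close> is raised, appear with independent coefficients. The
  premise is phrased for every operator with such commutators because the expression is then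
  differentiated only once.\<close>

lemma H_spread:
  assumes i: "i \<in> {0..<int n}" and j: "j \<in> {0..<int n}" and ne: "i \<noteq> j" and r: "r \<noteq> 0"
    and "\<And>i' \<alpha> \<beta>. i' = i \<or> i' = j \<Longrightarrow>
       (\<And>k. H i' r * E i k - E i k * H i' r = \<alpha> \<bullet> E i (k + r)) \<Longrightarrow>
       (\<And>k. H i' r * E j k - E j k * H i' r = \<beta> \<bullet> E j (k + r)) \<Longrightarrow> \<alpha> \<bullet> A + \<beta> \<bullet> B = 0"
  shows "A = 0" "B = 0"
proof -
  define \<gamma> where "\<gamma> = (if r > 0 then c powi (- r) else 1)"
  have \<gamma>: "\<gamma> \<noteq> 0" using c0 by (simp add: \<gamma>_def)
  have "(a_coeff q dc n i i r * \<gamma>) \<bullet> A + (a_coeff q dc n i j r * \<gamma>) \<bullet> B = 0"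
    "(a_coeff q dc n j i r * \<gamma>) \<bullet> A + (a_coeff q dc n j j r * \<gamma>) \<bullet> B = 0"
    unfolding \<gamma>_def by (rule assms(5); use HE r i j in blast)+
  moreover have "(a_coeff q dc n i i r * \<gamma>) * (a_coeff q dc n j j r * \<gamma>) -
       (a_coeff q dc n i j r * \<gamma>) * (a_coeff q dc n j i r * \<gamma>) =
     (a_coeff q dc n i i r * a_coeff q dc n j j r - a_coeff q dc n i j r * a_coeff q dc n j i r) * \<gamma> ^ 2"
    by (simp add: power2_eq_square algebra_simps)
  ultimately show "A = 0" "B = 0"
    using endo_elimination a_det_nz[OF i j ne r] \<gamma> by (metis mult_eq_0_iff power_not_zero)+
qed

lemma zero_mode_serre:
  assumes i: "i \<in> {0..<int n}" and j: "j \<in> {0..<int n}" and ne: "i \<noteq> j"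
    and N: "int N \<ge> 1 - wt n i j"
  shows "qad q (wt n i j) (E i 0) (E j 0) N = 0"
proof -
  interpret T: sl2_triple q "E i 0" "F i 0" "K i" "Ki i" by (rule triple[OF i])
  show ?thesis
    by (rule T.qad_vanishes[OF KE[OF i j] _ N]) (use EF_ne[OF j i] ne in auto)
qed

text \<open>The symmetrised expression is known to vanish when all modes are zero. Applying
  \<open>H_spread\<close>, first \<open>l\<close>, then the index of one factor
  \<open>E\<^sub>i\<close> and then that of the other become arbitrary; at each step the
  additional terms coincide with the desired one or are already known to vanish.\<close>

theorem serre:
  assumes i: "i \<in> {0..<int n}" and j: "j \<in> {0..<int n}" and w: "wt n i j = - 1"
  shows "ecomm (inverse q) (E i k1) (ecomm q (E i k2) (E j l)) +
         ecomm (inverse q) (E i k2) (ecomm q (E i k1) (E j l)) = 0"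
proof -
  define T where "T k1 k2 l = ecomm (inverse q) (E i k1) (ecomm q (E i k2) (E j l)) +
         ecomm (inverse q) (E i k2) (ecomm q (E i k1) (E j l))" for k1 k2 l
  have sym: "T k1 k2 l = T k2 k1 l" for k1 k2 l by (simp add: T_def add.commute)
  have ne: "i \<noteq> j" using w wt_simps(1)[OF i j] by auto
  have sp: "T (k1 + r) k2 l + T k1 (k2 + r) l = 0 \<and> T k1 k2 (l + r) = 0"
    if "T k1 k2 l = 0" "r \<noteq> 0" for k1 k2 l r
  proof -
    have *: "\<alpha> \<bullet> (T (k1 + r) k2 l + T k1 (k2 + r) l) + \<beta> \<bullet> T k1 k2 (l + r) = 0"
      if h: "\<And>k. H i' r * E i k - E i k * H i' r = \<alpha> \<bullet> E i (k + r)"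
         "\<And>k. H i' r * E j k - E j k * H i' r = \<beta> \<bullet> E j (k + r)" for i' \<alpha> \<beta>
    proof -
      have "0 = H i' r * T k1 k2 l - T k1 k2 l * H i' r" using \<open>T k1 k2 l = 0\<close> by simp
      also have "\<dots> = (H i' r * ecomm (inverse q) (E i k1) (ecomm q (E i k2) (E j l))
            - ecomm (inverse q) (E i k1) (ecomm q (E i k2) (E j l)) * H i' r)
          + (H i' r * ecomm (inverse q) (E i k2) (ecomm q (E i k1) (E j l))
            - ecomm (inverse q) (E i k2) (ecomm q (E i k1) (E j l)) * H i' r)"
        by (simp add: T_def algebra_simps)
      also have "\<dots> = \<alpha> \<bullet> (T (k1 + r) k2 l + T k1 (k2 + r) l) + \<beta> \<bullet> T k1 k2 (l + r)"
        by (simp only: ecomm_derivation h ecomm_smul ecomm_add) (simp add: T_def)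
      finally show ?thesis ..
    qed
    have "T (k1 + r) k2 l + T k1 (k2 + r) l = 0"
      by (rule H_spread(1)[OF i j ne \<open>r \<noteq> 0\<close>, where B = "T k1 k2 (l + r)"])
         (rule *, assumption, assumption)
    moreover have "T k1 k2 (l + r) = 0"
      by (rule H_spread(2)[OF i j ne \<open>r \<noteq> 0\<close>, where A = "T (k1 + r) k2 l + T k1 (k2 + r) l"])
         (rule *, assumption, assumption)
    ultimately show ?thesis ..
  qed
  have "ecomm (inverse q) (E i 0) (ecomm q (E i 0) (E j 0)) = qad q (- 1) (E i 0) (E j 0) 2"
    using q0 by (simp add: ecomm_def numeral_2_eq_2 power_int_minus algebra_simps)
  then have T0: "T 0 0 0 = 0" using zero_mode_serre[OF i j ne, of 2] w by (simp add: T_def)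
  have T1: "T 0 0 l = 0" for l using sp[OF T0, of l] T0 by (cases "l = 0") auto
  have T2: "T r 0 l = 0" for r l
  proof (cases "r = 0")
    case False
    then have "T r 0 l + T r 0 l = 0" using sp[OF T1[of l], of r] sym[of 0 r l] by simp
    then have "2 \<bullet> T r 0 l = 0" using smul_left_distrib(1)[of 1 1 "T r 0 l"] by simp
    then show ?thesis by (simp add: smul_eq_0_iff)
  qed (simp add: T1)
  have "T r s l = 0" for r s l
    using sp[OF T2[of r l], of s] T2[of "r + s" l] T2[of r l] by (cases "s = 0") auto
  then show ?thesis by (simp add: T_def)
qed

text \<open>The same argument with one more factor \<open>E\<^sub>i\<close>.\<close>

theorem serre2:
  assumes i: "i \<in> {0..<int n}" and j: "j \<in> {0..<int n}" and w: "wt n i j = - 2"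
  defines "S k1 k2 k3 l \<equiv> ecomm (q powi (- 2)) (E i k1) (ecomm 1 (E i k2) (ecomm (q ^ 2) (E i k3) (E j l)))"
  shows "S k1 k2 k3 l + S k1 k3 k2 l + S k2 k1 k3 l + S k2 k3 k1 l + S k3 k1 k2 l + S k3 k2 k1 l = 0"
proof -
  define T where "T k1 k2 k3 l = S k1 k2 k3 l + S k1 k3 k2 l + S k2 k1 k3 l + S k2 k3 k1 l + S k3 k1 k2 l + S k3 k2 k1 l" for k1 k2 k3 l
  have sym: "T k1 k2 k3 l = T k2 k1 k3 l" "T k1 k2 k3 l = T k1 k3 k2 l" for k1 k2 k3 l
    by (simp_all add: T_def)
  have ne: "i \<noteq> j" using w wt_simps(1)[OF i j] by auto
  have sp: "T (k1 + r) k2 k3 l + T k1 (k2 + r) k3 l + T k1 k2 (k3 + r) l = 0 \<and> T k1 k2 k3 (l + r) = 0"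
    if "T k1 k2 k3 l = 0" "r \<noteq> 0" for k1 k2 k3 l r
  proof -
    have *: "\<alpha> \<bullet> (T (k1 + r) k2 k3 l + T k1 (k2 + r) k3 l + T k1 k2 (k3 + r) l) + \<beta> \<bullet> T k1 k2 k3 (l + r) = 0"
      if h: "\<And>k. H i' r * E i k - E i k * H i' r = \<alpha> \<bullet> E i (k + r)"
         "\<And>k. H i' r * E j k - E j k * H i' r = \<beta> \<bullet> E j (k + r)" for i' \<alpha> \<beta>
    proof -
      have DS: "H i' r * S a b c' l - S a b c' l * H i' r =
         \<alpha> \<bullet> (S (a + r) b c' l + S a (b + r) c' l + S a b (c' + r) l) + \<beta> \<bullet> S a b c' (l + r)" for a b c'
        unfolding S_def by (simp only: ecomm_derivation h ecomm_smul ecomm_add) simp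
      have "0 = H i' r * T k1 k2 k3 l - T k1 k2 k3 l * H i' r" using \<open>T k1 k2 k3 l = 0\<close> by simp
      also have "\<dots> = (H i' r * S k1 k2 k3 l - S k1 k2 k3 l * H i' r) + (H i' r * S k1 k3 k2 l - S k1 k3 k2 l * H i' r)
          + (H i' r * S k2 k1 k3 l - S k2 k1 k3 l * H i' r) + (H i' r * S k2 k3 k1 l - S k2 k3 k1 l * H i' r)
          + (H i' r * S k3 k1 k2 l - S k3 k1 k2 l * H i' r) + (H i' r * S k3 k2 k1 l - S k3 k2 k1 l * H i' r)"
        by (simp add: T_def algebra_simps)
      also have "\<dots> = \<alpha> \<bullet> (T (k1 + r) k2 k3 l + T k1 (k2 + r) k3 l + T k1 k2 (k3 + r) l) + \<beta> \<bullet> T k1 k2 k3 (l + r)"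
        by (simp only: DS) (simp add: T_def)
      finally show ?thesis ..
    qed
    have "T (k1 + r) k2 k3 l + T k1 (k2 + r) k3 l + T k1 k2 (k3 + r) l = 0"
      by (rule H_spread(1)[OF i j ne \<open>r \<noteq> 0\<close>, where B = "T k1 k2 k3 (l + r)"])
         (rule *, assumption, assumption)
    moreover have "T k1 k2 k3 (l + r) = 0"
      by (rule H_spread(2)[OF i j ne \<open>r \<noteq> 0\<close>, where A = "T (k1 + r) k2 k3 l + T k1 (k2 + r) k3 l + T k1 k2 (k3 + r) l"])
         (rule *, assumption, assumption)
    ultimately show ?thesis ..
  qed
  have "S 0 0 0 0 = qad q (- 2) (E i 0) (E j 0) 3"
    using q0 by (simp add: S_def ecomm_def numeral_3_eq_3 power_int_minus algebra_simps)
  then have "S 0 0 0 0 = 0" using zero_mode_serre[OF i j ne, of 3] w by simp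
  then have T0: "T 0 0 0 0 = 0" by (simp add: T_def)
  have T1: "T 0 0 0 l = 0" for l using sp[OF T0, of l] T0 by (cases "l = 0") auto
  have two: "X = 0" if "X + X = 0" for X :: endo
  proof -
    have "2 \<bullet> X = 0" using that smul_left_distrib(1)[of 1 1 X] by simp
    then show ?thesis by (simp add: smul_eq_0_iff)
  qed
  have three: "X = 0" if "X + X + X = 0" for X :: endo
  proof -
    have "3 \<bullet> X = X + X + X" using smul_left_distrib(1)[of 2 1 X] smul_left_distrib(1)[of 1 1 X] by simp
    then show ?thesis using that by (simp add: smul_eq_0_iff)
  qed
  have T2: "T r 0 0 l = 0" for r l
  proof (cases "r = 0")
    case False
    then have "T r 0 0 l + T r 0 0 l + T r 0 0 l = 0"
      using sp[OF T1[of l], of r] sym(1)[of 0 r 0 l] sym(2)[of 0 0 r l] by simp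
    then show ?thesis by (rule three)
  qed (simp add: T1)
  have T3: "T r s 0 l = 0" for r s l
  proof (cases "s = 0")
    case False
    then have "T r s 0 l + T r s 0 l = 0"
      using sp[OF T2[of r l], of s] T2[of "r + s" l] sym(2)[of r 0 s l] by simp
    then show ?thesis by (rule two)
  qed (simp add: T2)
  have "T r s t l = 0" for r s t l
    using sp[OF T3[of r s l], of t] T3[of "r + t" s l] T3[of r "s + t" l] T3[of r s l] by (cases "t = 0") auto
  then show ?thesis by (simp add: T_def)
qed

text \<open>Exchanging \<open>E\<close> and \<open>F\<close> and reversing all mode indices inverts
  \<open>dc\<close> and the level and exchanges \<open>K\<close> with its inverse. Every relation
  derived for \<open>E\<close> thereby has a counterpart for \<open>F\<close>.\<close>

theorem dual: "toroidal_ops q (inverse dc) (inverse c) n (\<lambda>i k. F i (- k)) (\<lambda>i k. E i (- k))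
    (\<lambda>i r. - H i (- r)) Ki K"
proof
  have a: "a_coeff q (inverse dc) n i j r = a_coeff q dc n i j (- r)" for i j r
    by (simp add: a_coeff_def qnum_minus power_int_inverse power_int_minus add.commute)
  have hs: "h_series g (\<lambda>r. - H i (- r)) = h_series (- g) (\<lambda>r. H i (- r))" for g i
    by (rule fps_ext) (simp add: h_series_def smul_left_distrib)
  have hs': "h_series (- g) (\<lambda>r. - H i (- (- r))) = h_series g (H i)" for g i
    by (rule fps_ext) (simp add: h_series_def smul_left_distrib)
  fix i j :: int
  assume i: "i \<in> {0..<int n}"
  show "Ki i * K i = 1 \<and> K i * Ki i = 1" using K_inv[OF i] by simp
  show "- H i (- r) * - H i (- s) = - H i (- s) * - H i (- r)" if "r * s > 0" for r s
    using HH[OF i, of "- r" "- s"] that by simp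
  show "\<exists>A. app (F i (- 0) ^ A) v = 0" "\<exists>A. app (E i (- 0) ^ A) v = 0" for v
    using nilp_F[OF i] nilp_E[OF i] by simp_all
  assume j: "j \<in> {0..<int n}"
  show "Ki i * F j (- k) = q powi wt n i j \<bullet> (F j (- k) * Ki i)" for k
    using conj_inverse[OF _ _ KF[OF i j, of "- k"]] K_inv[OF i] q0 by (simp add: power_int_minus)
  show "Ki i * E j (- k) = q powi (- wt n i j) \<bullet> (E j (- k) * Ki i)" for k
    by (rule KiE[OF i j])
  show "- H i (- r) * F j (- k) - F j (- k) * - H i (- r) =
       (a_coeff q (inverse dc) n i j r * (if 0 < r then inverse c powi - r else 1)) \<bullet> F j (- (k + r))"
    if "r \<noteq> 0" for r k
    using HF[OF i j, of "- r" "- k"] that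
    by (auto simp: a power_int_inverse power_int_minus smul_left_distrib algebra_simps)
  show "- H i (- r) * E j (- k) - E j (- k) * - H i (- r) =
       (- a_coeff q (inverse dc) n i j r * (if 0 < r then 1 else inverse c powi - r)) \<bullet> E j (- (k + r))"
    if "r \<noteq> 0" for r k
    using HE[OF i j, of "- r" "- k"] that
    by (auto simp: a power_int_inverse power_int_minus smul_left_distrib algebra_simps)
  show "F i (- k) * E j (- l) - E j (- l) * F i (- k) =
       (if i = j then (1 / (q - inverse q)) \<bullet>
         (inverse c powi k \<bullet> half_series (Ki i) (h_series (q - inverse q) (\<lambda>r. - H i (- r))) (k + l)
          - inverse c powi l \<bullet> half_series (K i) (h_series (- (q - inverse q)) (\<lambda>r. - H i (- (- r)))) (- (k + l)))
        else 0)" for k l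
  proof -
    have "- k - l = - l - k" by simp
    then show ?thesis
      using EF[OF j i, of "- l" "- k"] unfolding hs hs'
      by (auto simp: power_int_inverse power_int_minus algebra_simps simp del: uminus_add_conv_diff)
  qed
qed (use q0 dc0 c0 not_root nondeg n2 in \<open>auto simp: mult.commute\<close>)

end


section \<open>Bosons\<close>

definition graded :: "(fock_index \<Rightarrow> 'a :: ab_group_add) \<Rightarrow> 'a \<Rightarrow> endo \<Rightarrow> bool" where
  "graded g D X \<longleftrightarrow> (\<forall>b. \<forall>b' \<in> Poly_Mapping.keys (app X (ket b)). g b' = g b + D)"

lemma lookup_app:
  "Poly_Mapping.lookup (app X w) b' =
     (\<Sum>b\<in>Poly_Mapping.keys w. Poly_Mapping.lookup w b * Poly_Mapping.lookup (app X (ket b)) b')"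
proof -
  have "app X w = (\<Sum>b\<in>Poly_Mapping.keys w. Poly_Mapping.lookup w b \<cdot> app X (ket b))"
    using lin_ext[of "app X" w] by (simp add: linear_ext_def)
  then show ?thesis by (simp add: lookup_sum)
qed

lemma keys_app:
  assumes "b' \<in> Poly_Mapping.keys (app X w)"
  shows "\<exists>b \<in> Poly_Mapping.keys w. b' \<in> Poly_Mapping.keys (app X (ket b))"
proof (rule ccontr)
  assume "\<not> ?thesis"
  then have "Poly_Mapping.lookup (app X w) b' = 0"
    unfolding lookup_app[of X w] by (intro sum.neutral) (auto simp: in_keys_iff)
  with assms show False by (simp add: in_keys_iff)
qed

lemma gradedD: "graded g D X \<Longrightarrow> b' \<in> Poly_Mapping.keys (app X (ket b)) \<Longrightarrow> g b' = g b + D"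
  unfolding graded_def by blast

lemma graded_mult: "graded g D X \<Longrightarrow> graded g D' Y \<Longrightarrow> graded g (D + D') (X * Y)"
  unfolding graded_def
proof (intro allI ballI)
  fix b b'
  assume X: "\<forall>b. \<forall>b'\<in>Poly_Mapping.keys (app X (ket b)). g b' = g b + D"
    and Y: "\<forall>b. \<forall>b'\<in>Poly_Mapping.keys (app Y (ket b)). g b' = g b + D'"
    and b': "b' \<in> Poly_Mapping.keys (app (X * Y) (ket b))"
  from b' have "b' \<in> Poly_Mapping.keys (app X (app Y (ket b)))" by simp
  from keys_app[OF this] obtain b1 where "b1 \<in> Poly_Mapping.keys (app Y (ket b))"
    "b' \<in> Poly_Mapping.keys (app X (ket b1))" by blast
  then show "g b' = g b + (D + D')" using X Y by (metis add.assoc add.commute)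
qed

lemma graded_1: "graded g 0 1" and graded_0: "graded g D 0"
  by (auto simp: graded_def)

lemma graded_add: "graded g D X \<Longrightarrow> graded g D Y \<Longrightarrow> graded g D (X + Y)"
  unfolding graded_def using keys_add by fastforce

lemma graded_smul: "graded g D X \<Longrightarrow> graded g D (c \<bullet> X)"
  unfolding graded_def using keys_scale by fastforce

lemma graded_uminus: "graded g D X \<Longrightarrow> graded g D (- X)"
  using graded_smul[of g D X "- 1"] by (simp add: smul_left_distrib)


lemma graded_sum: "(\<And>i. i \<in> A \<Longrightarrow> graded g D (X i)) \<Longrightarrow> graded g D (\<Sum>i\<in>A. X i)"
  by (induction A rule: infinite_finite_induct) (auto intro: graded_0 graded_add)

lemma graded_exp_fps:
  fixes g :: "fock_index \<Rightarrow> 'a :: ab_group_add"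
  assumes X: "\<And>r. r > 0 \<Longrightarrow> graded g (D r) (X $ r)" and "X $ 0 = 0"
    and D: "D 0 = 0" "\<And>r s. D (r + s) = D r + D s"
  shows "graded g (D N) (exp_fps X $ N)"
proof -
  have X': "graded g (D r) (X $ r)" for r
    using X[of r] assms(2) by (cases "r = 0") (auto simp: graded_0)
  have "graded g (D N) ((X ^ k) $ N)" for k N
  proof (induction k arbitrary: N)
    case 0
    then show ?case by (auto simp: D graded_1 graded_0)
  next
    case (Suc k)
    have "graded g (D N) (X $ i * (X ^ k) $ (N - i))" if "i \<le> N" for i
      using graded_mult[OF X'[of i] Suc[of "N - i"]] that by (simp add: D(2)[symmetric])
    then show ?case by (auto simp: fps_mult_nth intro!: graded_sum)
  qed
  then show ?thesis by (auto simp: exp_fps_def intro!: graded_sum graded_smul)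
qed

text \<open>An element whose commutator with the exponent is a scalar in a single degree
  \<open>r0\<close> differentiates the exponential.\<close>

lemma exp_fps_commutator:
  assumes comm: "\<And>r. T * X $ r - X $ r * T = (if r = r0 then c \<bullet> 1 else 0)"
    and X0: "X $ 0 = 0" and r0: "r0 > 0"
  shows "T * exp_fps X $ N - exp_fps X $ N * T = (if r0 \<le> N then c \<bullet> exp_fps X $ (N - r0) else 0)"
proof -
  have pw: "T * (X ^ k) $ N - (X ^ k) $ N * T
      = (if r0 \<le> N \<and> k > 0 then (of_nat k * c) \<bullet> (X ^ (k - 1)) $ (N - r0) else 0)" for k N
  proof (induction k arbitrary: N)
    case (Suc k)
    let ?Y = "X ^ k"
    have split: "T * (a * b) - (a * b) * T = (T * a - a * T) * b + a * (T * b - b * T)" for a b :: endo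
      by (simp add: algebra_simps)
    have 1: "(\<Sum>i=0..N. (T * X $ i - X $ i * T) * ?Y $ (N - i)) = (if r0 \<le> N then c \<bullet> ?Y $ (N - r0) else 0)"
    proof -
      have "(\<Sum>i=0..N. (T * X $ i - X $ i * T) * ?Y $ (N - i)) = (\<Sum>i=0..N. if i = r0 then c \<bullet> ?Y $ (N - r0) else 0)"
        by (intro sum.cong refl) (auto simp: comm)
      then show ?thesis by simp
    qed
    have 2: "(\<Sum>i=0..N. X $ i * (T * ?Y $ (N - i) - ?Y $ (N - i) * T))
        = (if r0 \<le> N \<and> k > 0 then (of_nat k * c) \<bullet> ?Y $ (N - r0) else 0)"
    proof (cases "r0 \<le> N \<and> k > 0")
      case True
      then have Yk: "?Y = X * X ^ (k - 1)" by (metis Suc_pred' power_Suc)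
      have "(\<Sum>i=0..N. X $ i * (T * ?Y $ (N - i) - ?Y $ (N - i) * T))
        = (\<Sum>i=0..N. if i \<le> N - r0 then (of_nat k * c) \<bullet> (X $ i * (X ^ (k - 1)) $ (N - r0 - i)) else 0)"
      proof (intro sum.cong refl)
        fix i assume "i \<in> {0..N}"
        then have "r0 \<le> N - i \<longleftrightarrow> i \<le> N - r0" "N - i - r0 = N - r0 - i" using True by auto
        then show "X $ i * (T * ?Y $ (N - i) - ?Y $ (N - i) * T)
          = (if i \<le> N - r0 then (of_nat k * c) \<bullet> (X $ i * (X ^ (k - 1)) $ (N - r0 - i)) else 0)"
          using True by (simp add: Suc)
      qed
      also have "\<dots> = (\<Sum>i\<in>{0..N} \<inter> {i. i \<le> N - r0}. (of_nat k * c) \<bullet> (X $ i * (X ^ (k - 1)) $ (N - r0 - i)))"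
        by (subst sum.inter_restrict) auto
      also have "{0..N} \<inter> {i. i \<le> N - r0} = {0..N - r0}" by auto
      also have "(\<Sum>i=0..N - r0. (of_nat k * c) \<bullet> (X $ i * (X ^ (k - 1)) $ (N - r0 - i))) = (of_nat k * c) \<bullet> ?Y $ (N - r0)"
        unfolding Yk fps_mult_nth smul_sum ..
      finally show ?thesis using True by simp
    next
      case False
      then have "X $ i * (T * ?Y $ (N - i) - ?Y $ (N - i) * T) = 0" if "i \<le> N" for i
        using that by (auto simp: Suc)
      then show ?thesis using False by (auto intro: sum.neutral)
    qed
    have "T * (X ^ Suc k) $ N - (X ^ Suc k) $ N * T
        = (\<Sum>i=0..N. (T * X $ i - X $ i * T) * ?Y $ (N - i)) + (\<Sum>i=0..N. X $ i * (T * ?Y $ (N - i) - ?Y $ (N - i) * T))"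
      unfolding power_Suc fps_mult_nth sum_distrib_left sum_distrib_right sum_subtractf[symmetric] sum.distrib[symmetric]
      by (intro sum.cong refl split)
    then show ?case unfolding 1 2 by (auto simp: smul_left_distrib algebra_simps)
  qed auto
  have "T * exp_fps X $ N - exp_fps X $ N * T = (\<Sum>k\<le>N. (1 / fact k) \<bullet> (T * (X ^ k) $ N - (X ^ k) $ N * T))"
    by (simp add: exp_fps_def sum_distrib_left sum_distrib_right sum_subtractf)
  also have "\<dots> = (if r0 \<le> N then c \<bullet> exp_fps X $ (N - r0) else 0)"
  proof (cases "r0 \<le> N")
    case True
    then have N: "N = Suc (N - 1)" using r0 by simp
    have "(\<Sum>k\<le>N. (1 / fact k) \<bullet> (T * (X ^ k) $ N - (X ^ k) $ N * T))
        = (\<Sum>k\<le>N - 1. (1 / fact (Suc k)) \<bullet> ((of_nat (Suc k) * c) \<bullet> (X ^ k) $ (N - r0)))"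
      unfolding pw by (subst N, subst sum.atMost_Suc_shift) (use True N in simp)
    also have "\<dots> = (\<Sum>k\<le>N - 1. c \<bullet> (1 / fact k) \<bullet> (X ^ k) $ (N - r0))"
      by (intro sum.cong refl) (simp add: field_simps del: of_nat_Suc)
    also have "\<dots> = (\<Sum>k\<le>N - r0. c \<bullet> (1 / fact k) \<bullet> (X ^ k) $ (N - r0))"
      by (intro sum.mono_neutral_right) (use r0 in \<open>auto simp: fps_power_nth_eq_0[OF X0]\<close>)
    finally show ?thesis using True by (simp add: exp_fps_def smul_sum)
  qed (simp add: pw)
  finally show ?thesis .
qed

lemma exp_fps_commute:
  assumes "\<And>r. T * X $ r = X $ r * T" "X $ 0 = 0"
  shows "T * exp_fps X $ N = exp_fps X $ N * T"
  using exp_fps_commutator[of T X "Suc N" 0 N] assms by simp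

text \<open>Negative indices occur when degrees are shifted; the corresponding coefficients are zero.\<close>

definition cre_series :: "endo fps \<Rightarrow> int \<Rightarrow> endo" where
  "cre_series M k = (if k < 0 then 0 else exp_fps M $ nat k)"

text \<open>The condition under which the infinite sum in the normally ordered exponential is finite on
  every vector.\<close>

definition locfin :: "endo fps \<Rightarrow> bool" where
  "locfin P \<longleftrightarrow> (\<forall>v. \<exists>S. \<forall>s>S. app (exp_fps P $ s) v = 0)"

definition nexp_fun :: "endo fps \<Rightarrow> endo fps \<Rightarrow> int \<Rightarrow> fock \<Rightarrow> fock" where
  "nexp_fun P M p v = Sum_any (\<lambda>s :: nat. app (cre_series M (p + int s)) (app (exp_fps P $ s) v))"

definition nexp :: "endo fps \<Rightarrow> endo fps \<Rightarrow> int \<Rightarrow> endo" where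
  "nexp P M p = Endo (nexp_fun P M p)"

lemma nexp_fun_eq:
  assumes "\<And>s. s > S \<Longrightarrow> app (exp_fps P $ s) v = 0"
  shows "nexp_fun P M p v = (\<Sum>s\<le>S. app (cre_series M (p + int s)) (app (exp_fps P $ s) v))"
  unfolding nexp_fun_def
proof (rule Sum_any.expand_superset)
  have "s \<le> S" if "app (cre_series M (p + int s)) (app (exp_fps P $ s) v) \<noteq> 0" for s
    using assms[of s] that by (cases "s > S") auto
  then show "{a. app (cre_series M (p + int a)) (app (exp_fps P $ a) v) \<noteq> 0} \<subseteq> {..S}" by auto
qed simp

lemma locfin_bound2:
  assumes "locfin P"
  obtains S where "\<And>s. s > S \<Longrightarrow> app (exp_fps P $ s) v = 0" "\<And>s. s > S \<Longrightarrow> app (exp_fps P $ s) w = 0"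
proof -
  obtain S1 S2 where "\<forall>s>S1. app (exp_fps P $ s) v = 0" "\<forall>s>S2. app (exp_fps P $ s) w = 0"
    using assms unfolding locfin_def by metis
  then show thesis by (intro that[of "max S1 S2"]) auto
qed

lemma lin_nexp_fun: "locfin P \<Longrightarrow> lin (nexp_fun P M p)"
  unfolding lin_def
proof (intro conjI allI)
  fix v w c
  assume P: "locfin P"
  obtain S where S: "\<And>s. s > S \<Longrightarrow> app (exp_fps P $ s) v = 0" "\<And>s. s > S \<Longrightarrow> app (exp_fps P $ s) w = 0"
    using locfin_bound2[OF P, of v w] by blast
  have "nexp_fun P M p (v + w) = (\<Sum>s\<le>S. app (cre_series M (p + int s)) (app (exp_fps P $ s) (v + w)))"
    by (rule nexp_fun_eq) (simp add: S)
  then show "nexp_fun P M p (v + w) = nexp_fun P M p v + nexp_fun P M p w"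
    by (simp add: nexp_fun_eq[OF S(1)] nexp_fun_eq[OF S(2)] sum.distrib)
  have "nexp_fun P M p (c \<cdot> v) = (\<Sum>s\<le>S. app (cre_series M (p + int s)) (app (exp_fps P $ s) (c \<cdot> v)))"
    by (rule nexp_fun_eq) (simp add: S)
  then show "nexp_fun P M p (c \<cdot> v) = c \<cdot> nexp_fun P M p v"
    by (simp add: nexp_fun_eq[OF S(1)] scale_sum)
qed

lemma app_nexp:
  assumes "locfin P" "\<And>s. s > S \<Longrightarrow> app (exp_fps P $ s) v = 0"
  shows "app (nexp P M p) v = (\<Sum>s\<le>S. app (cre_series M (p + int s)) (app (exp_fps P $ s) v))"
  by (simp add: nexp_def lin_nexp_fun[OF assms(1)] nexp_fun_eq[OF assms(2)])

lemma cre_series_commutator: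
  assumes "\<And>r. T * M $ r - M $ r * T = (if r = r0 then c \<bullet> 1 else 0)" "M $ 0 = 0" "r0 > 0"
  shows "T * cre_series M k - cre_series M k * T = c \<bullet> cre_series M (k - int r0)"
  using exp_fps_commutator[OF assms, of "nat k"]
  by (auto simp: cre_series_def nat_diff_distrib)

text \<open>An element that commutes with one half of the normally ordered exponential only sees the
  other half. The index \<open>p\<close> is lowered when that half consists of creation operators
  and raised when it consists of annihilation operators.\<close>

lemma nexp_commutator_cre:
  assumes P: "locfin P" and TP: "\<And>r. T * P $ r = P $ r * T" and P0: "P $ 0 = 0"
    and TM: "\<And>r. T * M $ r - M $ r * T = (if r = r0 then c \<bullet> 1 else 0)" "M $ 0 = 0" "r0 > 0"
  shows "T * nexp P M p - nexp P M p * T = c \<bullet> nexp P M (p - int r0)"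
proof (rule endo_eqI)
  fix v
  obtain S where S: "\<And>s. s > S \<Longrightarrow> app (exp_fps P $ s) v = 0" "\<And>s. s > S \<Longrightarrow> app (exp_fps P $ s) (app T v) = 0"
    using locfin_bound2[OF P, of v "app T v"] by blast
  have T: "app T (app (exp_fps P $ s) v) = app (exp_fps P $ s) (app T v)" for s
    using arg_cong[OF exp_fps_commute[OF TP P0, of s], of "\<lambda>X. app X v"] by simp
  have M: "app T (app (cre_series M k) w) - app (cre_series M k) (app T w) = c \<cdot> app (cre_series M (k - int r0)) w" for k w
    using arg_cong[OF cre_series_commutator[OF TM, of k], of "\<lambda>X. app X w"] by simp
  have "app (T * nexp P M p - nexp P M p * T) v = (\<Sum>s\<le>S. app T (app (cre_series M (p + int s)) (app (exp_fps P $ s) v))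
      - app (cre_series M (p + int s)) (app T (app (exp_fps P $ s) v)))"
    by (simp add: app_nexp[OF P S(1)] app_nexp[OF P S(2)] app_sum_right sum_subtractf T)
  also have "\<dots> = app (c \<bullet> nexp P M (p - int r0)) v"
    by (simp add: M app_nexp[OF P S(1)] scale_sum algebra_simps)
  finally show "app (T * nexp P M p - nexp P M p * T) v = app (c \<bullet> nexp P M (p - int r0)) v" .
qed

lemma nexp_commutator_ann:
  assumes P: "locfin P" and TM: "\<And>r. T * M $ r = M $ r * T" and M0: "M $ 0 = 0"
    and TP: "\<And>r. T * P $ r - P $ r * T = (if r = r0 then c \<bullet> 1 else 0)" "P $ 0 = 0" "r0 > 0"
  shows "T * nexp P M p - nexp P M p * T = c \<bullet> nexp P M (p + int r0)"
proof (rule endo_eqI)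
  fix v
  obtain S where S: "\<And>s. s > S \<Longrightarrow> app (exp_fps P $ s) v = 0" "\<And>s. s > S \<Longrightarrow> app (exp_fps P $ s) (app T v) = 0"
    using locfin_bound2[OF P, of v "app T v"] by blast
  have S': "s > S + r0 \<Longrightarrow> app (exp_fps P $ s) v = 0" "s > S + r0 \<Longrightarrow> app (exp_fps P $ s) (app T v) = 0" for s
    using S by auto
  have T: "app T (app (cre_series M k) w) = app (cre_series M k) (app T w)" for k w
  proof -
    have "T * cre_series M k = cre_series M k * T"
      using exp_fps_commute[OF TM M0, of "nat k"] by (simp add: cre_series_def)
    then have "app (T * cre_series M k) w = app (cre_series M k * T) w" by (rule arg_cong)
    then show ?thesis by simp
  qed
  have Pc: "app T (app (exp_fps P $ s) v) - app (exp_fps P $ s) (app T v)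
     = (if r0 \<le> s then c \<cdot> app (exp_fps P $ (s - r0)) v else 0)" for s
    using arg_cong[OF exp_fps_commutator[OF TP, of s], of "\<lambda>X. app X v"] by (auto split: if_splits)
  have "app (T * nexp P M p - nexp P M p * T) v = (\<Sum>s\<le>S + r0. app (cre_series M (p + int s))
      (app T (app (exp_fps P $ s) v) - app (exp_fps P $ s) (app T v)))"
    by (simp add: app_nexp[OF P S'(1)] app_nexp[OF P S'(2)] app_sum_right sum_subtractf T)
  also have "\<dots> = (\<Sum>s\<in>{..S + r0} \<inter> {s. r0 \<le> s}. c \<cdot> app (cre_series M (p + int s)) (app (exp_fps P $ (s - r0)) v))"
    unfolding Pc by (subst sum.inter_restrict) (auto intro!: sum.cong)
  also have "\<dots> = (\<Sum>s\<le>S. c \<cdot> app (cre_series M (p + int r0 + int s)) (app (exp_fps P $ s) v))"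
    by (rule sum.reindex_bij_witness[of _ "\<lambda>s. s + r0" "\<lambda>s. s - r0"]) (auto simp: algebra_simps)
  also have "\<dots> = app (c \<bullet> nexp P M (p + int r0)) v"
    by (simp add: app_nexp[OF P S(1)] scale_sum)
  finally show "app (T * nexp P M p - nexp P M p * T) v = app (c \<bullet> nexp P M (p + int r0)) v" .
qed

definition shift :: "((int \<times> int) \<Rightarrow>\<^sub>0 int) \<Rightarrow> endo" where
  "shift \<beta> = Endo (linear_ext (\<lambda>(\<mu>, \<nu>). ket (\<mu>, \<nu> + \<beta>)))"

lemma app_shift [simp]: "app (shift \<beta>) (ket (\<mu>, \<nu>)) = ket (\<mu>, \<nu> + \<beta>)"
  by (simp add: shift_def)

text \<open>Vertex operators: on the sector of momentum \<open>\<nu>\<close>, the coefficient of \<open>z\<^sup>-\<^sup>k\<close> of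
  \<open>f(\<nu>) z\<^bsup>ex(\<nu>)\<^esup>\<close> times a normally ordered exponential times the momentum shift by \<open>\<beta>\<close>.\<close>

definition vertex ::
  "endo fps \<Rightarrow> endo fps \<Rightarrow> (((int \<times> int) \<Rightarrow>\<^sub>0 int) \<Rightarrow> complex) \<Rightarrow> ((int \<times> int) \<Rightarrow>\<^sub>0 int)
     \<Rightarrow> (((int \<times> int) \<Rightarrow>\<^sub>0 int) \<Rightarrow> int) \<Rightarrow> int \<Rightarrow> endo" where
  "vertex P M f \<beta> ex k = Endo (linear_ext (\<lambda>(\<mu>, \<nu>).
     f \<nu> \<cdot> app (nexp P M (- k - ex \<nu>)) (ket (\<mu>, \<nu> + \<beta>))))"

lemma vertex_ket: "app (vertex P M f \<beta> ex k) (ket (\<mu>, \<nu>)) = f \<nu> \<cdot> app (nexp P M (- k - ex \<nu>)) (ket (\<mu>, \<nu> + \<beta>))"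
  by (simp add: vertex_def)

text \<open>All vectors of one momentum sector are treated alike, so that vertex operators can be
  composed without expanding in basis vectors.\<close>

lemma vertex_sector:
  assumes "\<And>b. b \<in> Poly_Mapping.keys w \<Longrightarrow> snd b = \<nu>"
  shows "app (vertex P M f \<beta> ex k) w = f \<nu> \<cdot> app (nexp P M (- k - ex \<nu>)) (app (shift \<beta>) w)"
proof -
  have "app (vertex P M f \<beta> ex k) w = (\<Sum>b\<in>Poly_Mapping.keys w. Poly_Mapping.lookup w b \<cdot> app (vertex P M f \<beta> ex k) (ket b))"
    using lin_ext[of "app (vertex P M f \<beta> ex k)" w] by (simp add: linear_ext_def)
  also have "\<dots> = (\<Sum>b\<in>Poly_Mapping.keys w. f \<nu> \<cdot> app (nexp P M (- k - ex \<nu>)) (app (shift \<beta>) (Poly_Mapping.lookup w b \<cdot> ket b)))"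
  proof (intro sum.cong refl)
    fix b assume "b \<in> Poly_Mapping.keys w"
    from assms[OF this] obtain \<mu> where "b = (\<mu>, \<nu>)" by (cases b) auto
    then show "Poly_Mapping.lookup w b \<cdot> app (vertex P M f \<beta> ex k) (ket b)
       = f \<nu> \<cdot> app (nexp P M (- k - ex \<nu>)) (app (shift \<beta>) (Poly_Mapping.lookup w b \<cdot> ket b))"
      by (simp add: vertex_ket mult.commute)
  qed
  also have "\<dots> = f \<nu> \<cdot> app (nexp P M (- k - ex \<nu>)) (app (shift \<beta>) (\<Sum>b\<in>Poly_Mapping.keys w. Poly_Mapping.lookup w b \<cdot> ket b))"
    by (simp add: scale_sum app_sum_right)
  also have "(\<Sum>b\<in>Poly_Mapping.keys w. Poly_Mapping.lookup w b \<cdot> ket b) = w" by (rule fock_expand[symmetric])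
  finally show ?thesis .
qed

lemma vertex_commutator:
  assumes nx: "\<And>p. T * nexp P M p - nexp P M p * T = c \<bullet> nexp P M (p - r)"
    and gr: "graded snd 0 T" and sh: "T * shift \<beta> = shift \<beta> * T"
  shows "T * vertex P M f \<beta> ex k - vertex P M f \<beta> ex k * T = c \<bullet> vertex P M f \<beta> ex (k + r)"
proof (rule endo_ket_eqI)
  fix b :: fock_index
  obtain \<mu> \<nu> where b: "b = (\<mu>, \<nu>)" by (cases b)
  have w: "app (vertex P M f \<beta> ex k) (app T (ket b)) = f \<nu> \<cdot> app (nexp P M (- k - ex \<nu>)) (app (shift \<beta>) (app T (ket b)))"
    using gr by (intro vertex_sector) (auto simp: graded_def b)
  have "app (shift \<beta>) (app T (ket b)) = app T (ket (\<mu>, \<nu> + \<beta>))"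
    using arg_cong[OF sh, of "\<lambda>X. app X (ket b)"] by (simp add: b)
  moreover have "app T (app (nexp P M p) v) - app (nexp P M p) (app T v) = c \<cdot> app (nexp P M (p - r)) v" for p v
    using arg_cong[OF nx[of p], of "\<lambda>X. app X v"] by simp
  ultimately show "app (T * vertex P M f \<beta> ex k - vertex P M f \<beta> ex k * T) (ket b)
      = app (c \<bullet> vertex P M f \<beta> ex (k + r)) (ket b)"
    by (simp add: w) (simp add: b vertex_ket algebra_simps)
qed

locale bosons =
  fixes q :: complex and m n :: nat
  assumes q0: "q \<noteq> 0" and not_root: "\<And>k :: int. k \<noteq> 0 \<Longrightarrow> q powi k \<noteq> 1"
    and m1: "m \<ge> 1" and n2: "n \<ge> 2"
begin

definition al :: "int \<Rightarrow> int \<Rightarrow> int \<Rightarrow> endo" where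
  "al s t r = Endo (boson q m n s t r)"

definition mode :: "int \<Rightarrow> int \<Rightarrow> int \<Rightarrow> int \<times> int \<times> nat" where
  "mode s t r = (s mod int m, t mod int n, nat \<bar>r\<bar>)"

definition cr :: "int \<Rightarrow> complex" where
  "cr r = (qnum q r)\<^sup>2 / of_int r"

lemma lin_boson: "lin (boson q m n s t r)"
  unfolding boson_def by (rule lin_linear_ext)

lemma app_al: "app (al s t r) = boson q m n s t r"
  by (simp add: al_def lin_boson)

lemma al_cre: "r < 0 \<Longrightarrow> app (al s t r) (ket (\<mu>, \<nu>)) = ket (\<mu> + Poly_Mapping.single (mode s t r) 1, \<nu>)"
  by (simp add: app_al boson_def mode_def)

lemma al_ann: "r > 0 \<Longrightarrow> app (al s t r) (ket (\<mu>, \<nu>)) =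
    (cr r * of_nat (Poly_Mapping.lookup \<mu> (mode s t r))) \<cdot> ket (\<mu> - Poly_Mapping.single (mode s t r) 1, \<nu>)"
  by (simp add: app_al boson_def mode_def cr_def Let_def)

lemma cr_minus: "cr (- r) = - cr r"
  by (simp add: cr_def qnum_minus)

lemma cr_nz: "r \<noteq> 0 \<Longrightarrow> cr r \<noteq> 0"
  using qnum_nonzero(1)[OF q0 not_root] by (simp add: cr_def)

lemma al_mod: "al (s mod int m) (t mod int n) r = al s t r"
  by (simp add: al_def boson_def)

lemma al_commutator:
  assumes "r \<noteq> 0" "r' \<noteq> 0"
  shows "al s t r * al s' t' r' - al s' t' r' * al s t r =
    (if s mod int m = s' mod int m \<and> t mod int n = t' mod int n \<and> r + r' = 0 then cr r \<bullet> 1 else 0)"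
proof -
  have pos_neg: "al s t r * al s' t' r' - al s' t' r' * al s t r =
    (if s mod int m = s' mod int m \<and> t mod int n = t' mod int n \<and> r + r' = 0 then cr r \<bullet> 1 else 0)"
    if r: "r > 0" "r' < 0" for s t r s' t' r'
  proof (rule endo_ket_eqI)
    fix b :: fock_index
    obtain \<mu> \<nu> where b: "b = (\<mu>, \<nu>)" by (cases b)
    define x where "x = mode s t r"
    define y where "y = mode s' t' r'"
    have xy: "(s mod int m = s' mod int m \<and> t mod int n = t' mod int n \<and> r + r' = 0) \<longleftrightarrow> x = y"
      using r by (auto simp: x_def y_def mode_def)
    have "app (al s t r * al s' t' r' - al s' t' r' * al s t r) (ket b) =
        (cr r * of_nat (Poly_Mapping.lookup (\<mu> + Poly_Mapping.single y 1) x)) \<cdot> ket (\<mu> + Poly_Mapping.single y 1 - Poly_Mapping.single x 1, \<nu>)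
       - (cr r * of_nat (Poly_Mapping.lookup \<mu> x)) \<cdot> ket (\<mu> - Poly_Mapping.single x 1 + Poly_Mapping.single y 1, \<nu>)"
      using r by (simp add: b al_cre al_ann flip: x_def y_def)
    also have "\<dots> = (if x = y then cr r \<cdot> ket b else 0)"
    proof (cases "Poly_Mapping.lookup \<mu> x = 0")
      case True
      then show ?thesis by (auto simp: lookup_add lookup_single b)
    next
      case False
      have "\<mu> + Poly_Mapping.single y 1 - Poly_Mapping.single x 1 = \<mu> - Poly_Mapping.single x 1 + Poly_Mapping.single y 1"
        using False by (intro poly_mapping_eqI) (auto simp: lookup_add lookup_minus lookup_single when_def)
      moreover have "\<mu> + Poly_Mapping.single x 1 - Poly_Mapping.single x 1 = \<mu>" by simp
      ultimately show ?thesis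
        by (auto simp: lookup_add lookup_single b distrib_left scale_add_left)
    qed
    finally show "app (al s t r * al s' t' r' - al s' t' r' * al s t r) (ket b) =
      app (if s mod int m = s' mod int m \<and> t mod int n = t' mod int n \<and> r + r' = 0 then cr r \<bullet> 1 else 0) (ket b)"
      unfolding xy by simp
  qed
  consider "r > 0" "r' < 0" | "r < 0" "r' > 0" | "r > 0" "r' > 0" | "r < 0" "r' < 0" using assms by linarith
  then show ?thesis
  proof cases
    case 1
    then show ?thesis by (rule pos_neg)
  next
    case 2
    have "al s t r * al s' t' r' - al s' t' r' * al s t r = - (al s' t' r' * al s t r - al s t r * al s' t' r')"
      by simp
    also have "\<dots> = (if s mod int m = s' mod int m \<and> t mod int n = t' mod int n \<and> r + r' = 0 then cr r \<bullet> 1 else 0)"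
    proof (cases "r + r' = 0")
      case True
      then have "r' = - r" by simp
      then show ?thesis using pos_neg[OF 2(2,1), of s' t' s t] by (auto simp: cr_minus smul_left_distrib)
    next
      case False
      then show ?thesis using pos_neg[OF 2(2,1), of s' t' s t] by (auto simp: add.commute)
    qed
    finally show ?thesis .
  next
    case 3
    have "al s t r * al s' t' r' = al s' t' r' * al s t r"
    proof (rule endo_ket_eqI)
      fix b :: fock_index
      obtain \<mu> \<nu> where b: "b = (\<mu>, \<nu>)" by (cases b)
      define x where "x = mode s t r"
      define y where "y = mode s' t' r'"
      have "\<mu> - Poly_Mapping.single x 1 - Poly_Mapping.single y 1 = \<mu> - Poly_Mapping.single y 1 - Poly_Mapping.single x 1"
        by (intro poly_mapping_eqI) (auto simp: lookup_minus)
      moreover have "x = y \<Longrightarrow> cr r = cr r'" using 3 by (auto simp: x_def y_def mode_def eq_nat_nat_iff)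
      ultimately show "app (al s t r * al s' t' r') (ket b) = app (al s' t' r' * al s t r) (ket b)"
        using 3 by (cases "x = y") (simp_all add: b al_ann lookup_minus lookup_single mult_ac flip: x_def y_def)
    qed
    then show ?thesis using 3 by auto
  next
    case 4
    have "al s t r * al s' t' r' = al s' t' r' * al s t r"
      using 4 by (intro endo_ket_eqI) (auto simp: al_cre add_ac split: prod.splits)
    then show ?thesis using 4 by auto
  qed
qed

lemma lookup_al_cre:
  assumes "r < 0"
  shows "Poly_Mapping.lookup (app (al s t r) w) (\<mu>', \<nu>') =
    (if Poly_Mapping.lookup \<mu>' (mode s t r) = 0 then 0
     else Poly_Mapping.lookup w (\<mu>' - Poly_Mapping.single (mode s t r) 1, \<nu>'))"
proof -
  let ?x = "mode s t r"
  have "\<mu> + Poly_Mapping.single ?x 1 = \<mu>' \<longleftrightarrow> Poly_Mapping.lookup \<mu>' ?x \<noteq> 0 \<and> \<mu> = \<mu>' - Poly_Mapping.single ?x 1"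
    for \<mu> :: "(int \<times> int \<times> nat) \<Rightarrow>\<^sub>0 nat"
  proof
    assume "Poly_Mapping.lookup \<mu>' ?x \<noteq> 0 \<and> \<mu> = \<mu>' - Poly_Mapping.single ?x 1"
    then show "\<mu> + Poly_Mapping.single ?x 1 = \<mu>'"
      by (intro poly_mapping_eqI) (auto simp: lookup_add lookup_minus lookup_single when_def)
  qed (auto simp: lookup_add)
  then have *: "Poly_Mapping.lookup (app (al s t r) (ket b)) (\<mu>', \<nu>') =
      (if b = (\<mu>' - Poly_Mapping.single ?x 1, \<nu>') then (if Poly_Mapping.lookup \<mu>' ?x = 0 then 0 else 1) else 0)" for b
    using assms by (cases b) (auto simp: al_cre lookup_single when_def)
  show ?thesis
    unfolding lookup_app[of _ w] * by (auto simp: if_distrib in_keys_iff cong: if_cong)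
qed

lemma lookup_al_ann:
  assumes "r > 0"
  shows "Poly_Mapping.lookup (app (al s t r) w) (\<mu>', \<nu>') =
    cr r * of_nat (Suc (Poly_Mapping.lookup \<mu>' (mode s t r))) *
      Poly_Mapping.lookup w (\<mu>' + Poly_Mapping.single (mode s t r) 1, \<nu>')"
proof -
  let ?x = "mode s t r"
  have "Poly_Mapping.lookup \<mu> ?x \<noteq> 0 \<Longrightarrow> \<mu> - Poly_Mapping.single ?x 1 = \<mu>' \<longleftrightarrow> \<mu> = \<mu>' + Poly_Mapping.single ?x 1"
    for \<mu> :: "(int \<times> int \<times> nat) \<Rightarrow>\<^sub>0 nat"
  proof
    assume "Poly_Mapping.lookup \<mu> ?x \<noteq> 0" "\<mu> - Poly_Mapping.single ?x 1 = \<mu>'"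
    then show "\<mu> = \<mu>' + Poly_Mapping.single ?x 1"
      by (intro poly_mapping_eqI) (auto simp: lookup_add lookup_minus lookup_single when_def)
  qed auto
  then have *: "Poly_Mapping.lookup (app (al s t r) (ket b)) (\<mu>', \<nu>') =
      (if b = (\<mu>' + Poly_Mapping.single ?x 1, \<nu>') then cr r * of_nat (Suc (Poly_Mapping.lookup \<mu>' ?x)) else 0)" for b
    using assms by (cases b; cases "Poly_Mapping.lookup (fst b) ?x = 0")
      (auto simp: al_ann lookup_single when_def lookup_add)
  show ?thesis
    unfolding lookup_app[of _ w] * by (auto simp: if_distrib in_keys_iff mult.commute cong: if_cong)
qed

text \<open>All modes of the currents \<open>b\<close>, \<open>A\<close>, \<open>B\<close> and
  \<open>H\<close> of index \<open>k\<close> lie in this space.\<close>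

definition bspan :: "int \<Rightarrow> endo set" where
  "bspan k = {X. \<exists>\<phi>. X = (\<Sum>s\<in>{0..<int m}. \<Sum>t\<in>{0..<int n}. \<phi> s t \<bullet> al s t k)}"

lemma bspan_add: "X \<in> bspan k \<Longrightarrow> Y \<in> bspan k \<Longrightarrow> X + Y \<in> bspan k"
  unfolding bspan_def mem_Collect_eq
proof (elim exE)
  fix \<phi> \<psi>
  assume "X = (\<Sum>s\<in>{0..<int m}. \<Sum>t\<in>{0..<int n}. \<phi> s t \<bullet> al s t k)" "Y = (\<Sum>s\<in>{0..<int m}. \<Sum>t\<in>{0..<int n}. \<psi> s t \<bullet> al s t k)"
  then show "\<exists>\<phi>. X + Y = (\<Sum>s\<in>{0..<int m}. \<Sum>t\<in>{0..<int n}. \<phi> s t \<bullet> al s t k)"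
    by (intro exI[of _ "\<lambda>s t. \<phi> s t + \<psi> s t"]) (simp add: smul_left_distrib sum.distrib)
qed

lemma bspan_smul: "X \<in> bspan k \<Longrightarrow> c \<bullet> X \<in> bspan k"
  unfolding bspan_def mem_Collect_eq
proof (elim exE)
  fix \<phi> assume "X = (\<Sum>s\<in>{0..<int m}. \<Sum>t\<in>{0..<int n}. \<phi> s t \<bullet> al s t k)"
  then show "\<exists>\<phi>. c \<bullet> X = (\<Sum>s\<in>{0..<int m}. \<Sum>t\<in>{0..<int n}. \<phi> s t \<bullet> al s t k)"
    by (intro exI[of _ "\<lambda>s t. c * \<phi> s t"]) (simp add: smul_sum)
qed

lemma bspan_uminus: "X \<in> bspan k \<Longrightarrow> - X \<in> bspan k"
  using bspan_smul[of X k "- 1"] by (simp add: smul_left_distrib)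

lemma bspan_diff: "X \<in> bspan k \<Longrightarrow> Y \<in> bspan k \<Longrightarrow> X - Y \<in> bspan k"
  using bspan_add[OF _ bspan_uminus] by fastforce

lemma bspan_0: "0 \<in> bspan k"
  unfolding bspan_def by (intro CollectI exI[of _ "\<lambda>s t. 0"]) simp

lemma bspan_sum: "(\<And>i. i \<in> A \<Longrightarrow> X i \<in> bspan k) \<Longrightarrow> (\<Sum>i\<in>A. X i) \<in> bspan k"
  by (induction A rule: infinite_finite_induct) (auto intro: bspan_0 bspan_add)

lemma smul_indicator: "(if c then 1 else 0) \<bullet> X = (if c then X else 0)"
  by simp

lemma bspan_al: "al s t k \<in> bspan k"
proof -
  have "(\<Sum>s'\<in>{0..<int m}. \<Sum>t'\<in>{0..<int n}. (if s' = s mod int m \<and> t' = t mod int n then 1 else 0) \<bullet> al s' t' k)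
     = (\<Sum>s'\<in>{0..<int m}. if s' = s mod int m then \<Sum>t'\<in>{0..<int n}. if t' = t mod int n then al s' t' k else 0 else 0)"
    by (intro sum.cong refl) (auto simp: smul_indicator)
  also have "\<dots> = al s t k" using m1 n2 by (simp add: al_mod)
  finally show ?thesis unfolding bspan_def by (intro CollectI exI) (rule sym)
qed

lemma bspan_induct [consumes 1, case_names al add smul zero]:
  assumes "X \<in> bspan k" "\<And>s t. s \<in> {0..<int m} \<Longrightarrow> t \<in> {0..<int n} \<Longrightarrow> Q (al s t k)"
    "\<And>X Y. Q X \<Longrightarrow> Q Y \<Longrightarrow> Q (X + Y)" "\<And>c X. Q X \<Longrightarrow> Q (c \<bullet> X)" "Q 0"
  shows "Q X"
proof -
  have S: "Q (\<Sum>i\<in>A. f i)" if "\<And>i. i \<in> A \<Longrightarrow> Q (f i)" for A :: "int set" and f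
    using that by (induction A rule: infinite_finite_induct) (auto intro: assms)
  from assms(1) obtain \<phi> where "X = (\<Sum>s\<in>{0..<int m}. \<Sum>t\<in>{0..<int n}. \<phi> s t \<bullet> al s t k)"
    unfolding bspan_def by blast
  then show ?thesis by (auto intro!: S assms(2,4))
qed

lemma bspan_scalar:
  assumes "X \<in> bspan k" "Y \<in> bspan l" "k \<noteq> 0" "l \<noteq> 0"
  shows "\<exists>c. X * Y - Y * X = c \<bullet> 1 \<and> (k + l \<noteq> 0 \<longrightarrow> c = 0)"
  using assms(1)
proof (induction X rule: bspan_induct)
  case (al s t)
  show ?case using assms(2)
  proof (induction Y rule: bspan_induct)
    case (al s' t')
    show ?case using al_commutator[OF assms(3,4), of s t s' t']
      by (intro exI[of _ "if s mod int m = s' mod int m \<and> t mod int n = t' mod int n \<and> k + l = 0 then cr k else 0"]) auto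
  next
    case (add X Y)
    then obtain c c' where "al s t k * X - X * al s t k = c \<bullet> 1 \<and> (k + l \<noteq> 0 \<longrightarrow> c = 0)"
      "al s t k * Y - Y * al s t k = c' \<bullet> 1 \<and> (k + l \<noteq> 0 \<longrightarrow> c' = 0)" by blast
    then show ?case by (intro exI[of _ "c + c'"]) (auto simp: algebra_simps smul_left_distrib)
  next
    case (smul a X)
    then obtain c where "al s t k * X - X * al s t k = c \<bullet> 1 \<and> (k + l \<noteq> 0 \<longrightarrow> c = 0)" by blast
    then show ?case by (intro exI[of _ "a * c"]) (simp flip: smul_simps(2,7))
  qed (auto intro: exI[of _ 0])
next
  case (add X X')
  then obtain c c' where "X * Y - Y * X = c \<bullet> 1 \<and> (k + l \<noteq> 0 \<longrightarrow> c = 0)"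
      "X' * Y - Y * X' = c' \<bullet> 1 \<and> (k + l \<noteq> 0 \<longrightarrow> c' = 0)" by blast
  then show ?case by (intro exI[of _ "c + c'"]) (auto simp: algebra_simps smul_left_distrib)
next
  case (smul a X)
  then obtain c where "X * Y - Y * X = c \<bullet> 1 \<and> (k + l \<noteq> 0 \<longrightarrow> c = 0)" by blast
  then show ?case by (intro exI[of _ "a * c"]) (simp flip: smul_simps(2,7))
qed (auto intro: exI[of _ 0])

lemma bspan_commute:
  assumes "X \<in> bspan k" "Y \<in> bspan l" "k \<noteq> 0" "l \<noteq> 0" "k + l \<noteq> 0"
  shows "X * Y = Y * X"
proof -
  obtain c where "X * Y - Y * X = c \<bullet> 1" "c = 0"
    using bspan_scalar[OF assms(1-4)] assms(5) by blast
  then show ?thesis by simp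
qed

lemma al_shift: "al s t r * shift \<beta> = shift \<beta> * al s t r" if "r \<noteq> 0"
proof (rule endo_ket_eqI)
  fix b show "app (al s t r * shift \<beta>) (ket b) = app (shift \<beta> * al s t r) (ket b)"
    using that by (cases b; cases "r < 0") (simp_all add: al_cre al_ann)
qed

lemma bspan_shift:
  assumes "X \<in> bspan k" "k \<noteq> 0"
  shows "X * shift \<beta> = shift \<beta> * X"
  using assms(1) by (induction X rule: bspan_induct) (simp_all add: al_shift[OF assms(2)] distrib_left distrib_right)

definition bdeg :: "fock_index \<Rightarrow> int" where
  "bdeg b = (\<Sum>(i, j, r) \<in> Poly_Mapping.keys (fst b). int (Poly_Mapping.lookup (fst b) (i, j, r)) * int r)"

lemma bdeg_superset:
  assumes "finite A" "Poly_Mapping.keys \<mu> \<subseteq> A"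
  shows "bdeg (\<mu>, \<nu>) = (\<Sum>x\<in>A. int (Poly_Mapping.lookup \<mu> x) * int (snd (snd x)))"
proof -
  have "bdeg (\<mu>, \<nu>) = (\<Sum>x\<in>Poly_Mapping.keys \<mu>. int (Poly_Mapping.lookup \<mu> x) * int (snd (snd x)))"
    by (simp add: bdeg_def case_prod_beta)
  also have "\<dots> = (\<Sum>x\<in>A. int (Poly_Mapping.lookup \<mu> x) * int (snd (snd x)))"
    by (rule sum.mono_neutral_left[OF assms]) (auto simp: in_keys_iff)
  finally show ?thesis .
qed

lemma bdeg_nonneg: "bdeg b \<ge> 0"
  by (auto simp: bdeg_def intro!: sum_nonneg)

lemma bdeg_add: "bdeg (\<mu> + Poly_Mapping.single x 1, \<nu>) = bdeg (\<mu>, \<nu>) + int (snd (snd x))"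
proof -
  let ?A = "insert x (Poly_Mapping.keys \<mu>)"
  have "Poly_Mapping.keys (\<mu> + Poly_Mapping.single x 1) \<subseteq> ?A"
    using keys_add[of \<mu> "Poly_Mapping.single x 1"] by (auto split: if_splits)
  then have "bdeg (\<mu> + Poly_Mapping.single x 1, \<nu>) = (\<Sum>y\<in>?A. int (Poly_Mapping.lookup (\<mu> + Poly_Mapping.single x 1) y) * int (snd (snd y)))"
    by (intro bdeg_superset) auto
  also have "\<dots> = (\<Sum>y\<in>?A. int (Poly_Mapping.lookup \<mu> y) * int (snd (snd y)) + (if y = x then int (snd (snd x)) else 0))"
    by (intro sum.cong refl) (auto simp: lookup_add lookup_single algebra_simps)
  also have "\<dots> = bdeg (\<mu>, \<nu>) + int (snd (snd x))"
    by (subst bdeg_superset[of ?A]) (auto simp: sum.distrib)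
  finally show ?thesis .
qed

lemma bspan_graded:
  assumes "X \<in> bspan k" "k \<noteq> 0"
  shows "graded snd 0 X" "graded bdeg (- k) X"
proof -
  have "graded snd 0 (al s t k) \<and> graded bdeg (- k) (al s t k)" for s t
  proof (cases "k < 0")
    case True
    have "snd (snd (mode s t k)) = nat (- k)" using True by (simp add: mode_def)
    then show ?thesis using True by (auto simp: graded_def al_cre bdeg_add simp del: One_nat_def)
  next
    case False
    have m: "snd (snd (mode s t k)) = nat k" using False by (simp add: mode_def)
    have "snd b' = snd b \<and> bdeg b' = bdeg b - k" if "b' \<in> Poly_Mapping.keys (app (al s t k) (ket b))" for b b'
    proof -
      obtain \<mu> \<nu> where b: "b = (\<mu>, \<nu>)" by (cases b)
      let ?x = "mode s t k"
      have nz: "Poly_Mapping.lookup \<mu> ?x \<noteq> 0" and b': "b' = (\<mu> - Poly_Mapping.single ?x 1, \<nu>)"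
        using that False assms(2) keys_scale
        by (auto simp: b al_ann in_keys_iff lookup_single when_def split: if_splits)
      have "\<mu> - Poly_Mapping.single ?x 1 + Poly_Mapping.single ?x 1 = \<mu>"
        using nz by (intro poly_mapping_eqI) (auto simp: lookup_add lookup_minus lookup_single when_def)
      then show ?thesis using bdeg_add[of "\<mu> - Poly_Mapping.single ?x 1" ?x \<nu>] m False by (simp add: b b')
    qed
    then show ?thesis by (auto simp: graded_def)
  qed
  with assms(1) have "graded snd 0 X \<and> graded bdeg (- k) X"
    by (induction X rule: bspan_induct) (auto intro: graded_add graded_smul graded_0)
  then show "graded snd 0 X" "graded bdeg (- k) X" by auto
qed

definition annih :: "endo fps \<Rightarrow> bool" where
  "annih P \<longleftrightarrow> P $ 0 = 0 \<and> (\<forall>r>0. P $ r \<in> bspan (int r))"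

definition creat :: "endo fps \<Rightarrow> bool" where
  "creat M \<longleftrightarrow> M $ 0 = 0 \<and> (\<forall>r>0. M $ r \<in> bspan (- int r))"

lemma annih_graded:
  assumes "annih P"
  shows "graded snd 0 (exp_fps P $ N)" "graded bdeg (- int N) (exp_fps P $ N)"
proof -
  have "graded snd 0 (P $ r)" "graded bdeg (- int r) (P $ r)" if "r > 0" for r
    using bspan_graded[of "P $ r" "int r"] assms that by (auto simp: annih_def)
  then show "graded snd 0 (exp_fps P $ N)" "graded bdeg (- int N) (exp_fps P $ N)"
    using graded_exp_fps[where D = "\<lambda>_. 0" and X = P and g = snd]
      graded_exp_fps[where D = "\<lambda>r. - int r" and X = P and g = bdeg] assms by (auto simp: annih_def)
qed

lemma creat_graded:
  assumes "creat M"
  shows "graded snd 0 (cre_series M k)" "graded bdeg k (cre_series M k)"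
proof -
  have "graded snd 0 (M $ r)" "graded bdeg (int r) (M $ r)" if "r > 0" for r
    using bspan_graded[of "M $ r" "- int r"] assms that by (auto simp: creat_def)
  then have "graded snd 0 (exp_fps M $ N)" "graded bdeg (int N) (exp_fps M $ N)" for N
    using graded_exp_fps[where D = "\<lambda>_. 0" and X = M and g = snd]
      graded_exp_fps[where D = "\<lambda>r. int r" and X = M and g = bdeg] assms by (auto simp: creat_def)
  from this[of "nat k"] show "graded snd 0 (cre_series M k)" "graded bdeg k (cre_series M k)"
    by (auto simp: cre_series_def graded_0)
qed

lemma annih_ket:
  assumes "annih P" "int s > bdeg b"
  shows "app (exp_fps P $ s) (ket b) = 0"
proof -
  have "b' \<notin> Poly_Mapping.keys (app (exp_fps P $ s) (ket b))" for b'
    using gradedD[OF annih_graded(2)[OF assms(1), of s], of b' b] bdeg_nonneg[of b'] assms(2) by auto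
  then show ?thesis by (metis keys_eq_empty equals0I)
qed

lemma annih_locfin:
  assumes "annih P"
  shows "locfin P"
  unfolding locfin_def
proof (intro allI)
  fix v :: fock
  let ?S = "nat (\<Sum>b\<in>Poly_Mapping.keys v. bdeg b)"
  have "app (exp_fps P $ s) v = 0" if "s > ?S" for s
  proof -
    have "app (exp_fps P $ s) v = (\<Sum>b\<in>Poly_Mapping.keys v. Poly_Mapping.lookup v b \<cdot> app (exp_fps P $ s) (ket b))"
      using lin_ext[of "app (exp_fps P $ s)" v] by (simp add: linear_ext_def)
    also have "\<dots> = 0"
    proof (intro sum.neutral ballI)
      fix b assume "b \<in> Poly_Mapping.keys v"
      then have "bdeg b \<le> (\<Sum>b\<in>Poly_Mapping.keys v. bdeg b)"
        by (intro member_le_sum) (auto simp: bdeg_nonneg)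
      then have "int s > bdeg b" using that by linarith
      then show "Poly_Mapping.lookup v b \<cdot> app (exp_fps P $ s) (ket b) = 0" by (simp add: annih_ket[OF assms])
    qed
    finally show ?thesis .
  qed
  then show "\<exists>S. \<forall>s>S. app (exp_fps P $ s) v = 0" by blast
qed

text \<open>A boson commutes with the momentum shift and with one of the two exponentials, and
  differentiates the other one.\<close>

lemma vertex_bspan:
  assumes P: "annih P" and M: "creat M" and T: "T \<in> bspan r" and r: "r \<noteq> 0"
    and c: "r > 0 \<Longrightarrow> T * M $ nat r - M $ nat r * T = c \<bullet> 1"
           "r < 0 \<Longrightarrow> T * P $ nat (- r) - P $ nat (- r) * T = c \<bullet> 1"
  shows "T * vertex P M f \<beta> ex k - vertex P M f \<beta> ex k * T = c \<bullet> vertex P M f \<beta> ex (k + r)"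
proof (rule vertex_commutator)
  show "graded snd 0 T" by (rule bspan_graded[OF T r])
  show "T * shift \<beta> = shift \<beta> * T" by (rule bspan_shift[OF T r])
  fix p
  show "T * nexp P M p - nexp P M p * T = c \<bullet> nexp P M (p - r)"
  proof (cases "r > 0")
    case True
    have "T * nexp P M p - nexp P M p * T = c \<bullet> nexp P M (p - int (nat r))"
    proof (rule nexp_commutator_cre[OF annih_locfin[OF P]])
      show "T * P $ s = P $ s * T" for s
        using P bspan_commute[OF T _ r, of "P $ s" "int s"] True by (cases "s = 0") (auto simp: annih_def)
      show "T * M $ s - M $ s * T = (if s = nat r then c \<bullet> 1 else 0)" for s
        using M bspan_commute[OF T _ r, of "M $ s" "- int s"] c(1) True by (cases "s = 0") (auto simp: creat_def)
    qed (use P M True in \<open>auto simp: annih_def creat_def\<close>)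
    then show ?thesis using True by simp
  next
    case False
    with r have neg: "r < 0" by simp
    have "T * nexp P M p - nexp P M p * T = c \<bullet> nexp P M (p + int (nat (- r)))"
    proof (rule nexp_commutator_ann[OF annih_locfin[OF P]])
      show "T * M $ s = M $ s * T" for s
        using M bspan_commute[OF T _ r, of "M $ s" "- int s"] neg by (cases "s = 0") (auto simp: creat_def)
      show "T * P $ s - P $ s * T = (if s = nat (- r) then c \<bullet> 1 else 0)" for s
        using P bspan_commute[OF T _ r, of "P $ s" "int s"] c(2) neg by (cases "s = 0") (auto simp: annih_def)
    qed (use P M neg in \<open>auto simp: annih_def creat_def\<close>)
    then show ?thesis using neg by simp
  qed
qed

section \<open>Vacuum matrix elements\<close>

text \<open>Only the bosons of the \<open>m \<times> n\<close> array have to be absent: the other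
  labels of basis vectors, which lie outside the Fock space, are left untouched by all operators.\<close>

definition vac :: "fock_index \<Rightarrow> bool" where
  "vac b \<longleftrightarrow> (\<forall>s\<in>{0..<int m}. \<forall>t\<in>{0..<int n}. \<forall>r>0. Poly_Mapping.lookup (fst b) (s, t, r) = 0)"

lemma vac_annih:
  assumes "annih P" "vac b" "s > 0"
  shows "app (exp_fps P $ s) (ket b) = 0"
proof -
  have P1: "app (P $ r) (ket b) = 0" for r
  proof (cases "r = 0")
    case False
    have "app X (ket b) = 0" if "X \<in> bspan (int r)" for X
      using that
    proof (induction X rule: bspan_induct)
      case (al s t)
      then show ?case using assms(2) False by (cases b) (auto simp: al_ann mode_def vac_def)
    qed auto
    then show ?thesis using assms(1) False by (simp add: annih_def)
  qed (use assms in \<open>auto simp: annih_def\<close>)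
  have "app ((P ^ k) $ N) (ket b) = 0" if "N > 0" for k N
    using that
  proof (induction k arbitrary: N)
    case (Suc k)
    have "app (P $ i) (app ((P ^ k) $ (N - i)) (ket b)) = 0" if "i \<le> N" for i
    proof (cases "N - i = 0")
      case True
      then show ?thesis using P1 that by (cases k) (auto simp: fps_power_zeroth assms(1)[unfolded annih_def])
    next
      case False
      then show ?thesis using Suc by simp
    qed
    then show ?case by (auto simp: fps_mult_nth app_sum intro!: sum.neutral)
  qed simp
  then show ?thesis using assms(3) by (auto simp: exp_fps_def app_sum intro!: sum.neutral)
qed

lemma vac_creat:
  assumes "creat M" "vac b" "k \<noteq> 0"
  shows "Poly_Mapping.lookup (app (cre_series M k) w) b = 0"
proof -
  have M1: "Poly_Mapping.lookup (app (M $ r) w) b = 0" for r w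
  proof (cases "r = 0")
    case False
    have "Poly_Mapping.lookup (app X w) b = 0" if "X \<in> bspan (- int r)" for X
      using that
    proof (induction X rule: bspan_induct)
      case (al s t)
      then show ?case using assms(2) False by (cases b) (auto simp: lookup_al_cre mode_def vac_def)
    qed (auto simp: lookup_add)
    then show ?thesis using assms(1) False by (simp add: creat_def)
  qed (use assms in \<open>auto simp: creat_def\<close>)
  have "Poly_Mapping.lookup (app ((M ^ k) $ N) w) b = 0" if "N > 0" for k N
    using that by (cases k) (auto simp: fps_mult_nth app_sum lookup_sum M1 intro!: sum.neutral)
  then have "Poly_Mapping.lookup (app (exp_fps M $ N) w) b = 0" if "N > 0" for N
    using that by (auto simp: exp_fps_def app_sum lookup_sum intro!: sum.neutral)
  then show ?thesis using assms(3) by (auto simp: cre_series_def)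
qed

lemma nexp_vac:
  assumes "annih P" "vac b"
  shows "app (nexp P M p) (ket b) = app (cre_series M p) (ket b)"
  using app_nexp[OF annih_locfin[OF assms(1)], of 0 "ket b" M p] vac_annih[OF assms] by simp

lemma vac_vertex:
  assumes P: "annih P" and M: "creat M" and b: "vac (\<mu>, \<nu>)" and b': "vac b'"
  shows "Poly_Mapping.lookup (app (vertex P M f \<beta> ex k) (ket (\<mu>, \<nu>))) b' =
     (if - k - ex \<nu> = 0 \<and> b' = (\<mu>, \<nu> + \<beta>) then f \<nu> else 0)"
proof -
  have v: "vac (\<mu>, \<nu> + \<beta>)" using b by (simp add: vac_def)
  show ?thesis
  proof (cases "- k - ex \<nu> = 0")
    case True
    then show ?thesis by (auto simp: vertex_ket nexp_vac[OF P v] cre_series_def lookup_single when_def)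
  next
    case False
    then show ?thesis by (simp add: vertex_ket nexp_vac[OF P v] vac_creat[OF M b' False])
  qed
qed

text \<open>The annihilation part of the left operator has to be moved past the creation part of the
  right one, at the price of the contraction \<open>h\<close>, the exponential of the commutators;
  the remaining exponentials act trivially on vacuum vectors.\<close>

lemma vac_product:
  assumes P: "annih P" and M: "creat M" and P': "annih P'" and M': "creat M'"
    and b: "vac (\<mu>, \<nu>)" and b': "vac b'"
    and PM: "\<And>r. r > 0 \<Longrightarrow> P $ r * M' $ r - M' $ r * P $ r = \<kappa> r \<bullet> 1"
    and h0: "h $ 0 = 1" and h': "fps_deriv h = h * Abs_fps (\<lambda>r. of_nat (Suc r) * \<kappa> (Suc r))"
  shows "Poly_Mapping.lookup (app (vertex P M f \<beta> ex k * vertex P' M' f' \<beta>' ex' l) (ket (\<mu>, \<nu>))) b' =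
     (if b' = (\<mu>, \<nu> + \<beta>' + \<beta>) \<and> - l - ex' \<nu> \<ge> 0 \<and> - k - ex (\<nu> + \<beta>') = l + ex' \<nu>
      then f' \<nu> * f (\<nu> + \<beta>') * h $ nat (- l - ex' \<nu>) else 0)"
proof -
  let ?p = "- l - ex' \<nu>" and ?p' = "- k - ex (\<nu> + \<beta>')" and ?b2 = "(\<mu>, \<nu> + \<beta>' + \<beta>)"
  have v: "vac (\<mu>, \<nu> + \<beta>')" "vac ?b2" using b by (simp_all add: vac_def)
  have comm_r: "P $ r * P $ s = P $ s * P $ r" for r s
    using P bspan_commute[of "P $ r" "int r" "P $ s" "int s"] by (cases "r = 0"; cases "s = 0") (auto simp: annih_def)
  have ex: "exp_fps P $ N * cre_series M' p = (\<Sum>s\<le>N. h $ s \<bullet> (cre_series M' (p - int s) * exp_fps P $ (N - s)))" for N p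
  proof -
    have "exp_fps P $ N * cre_series M' (- (- p)) = (\<Sum>s\<le>N. h $ s \<bullet> (cre_series M' (- (- p + int s)) * exp_fps P $ (N - s)))"
    proof (rule exp_fps_exchange[where E = "\<lambda>l. cre_series M' (- l)", OF _ comm_r _ h0 h'])
      fix r l assume r: "r > (0::nat)"
      have "P $ r * cre_series M' (- l) - cre_series M' (- l) * P $ r = \<kappa> r \<bullet> cre_series M' (- l - int r)"
      proof (rule cre_series_commutator)
        fix s show "P $ r * M' $ s - M' $ s * P $ r = (if s = r then \<kappa> r \<bullet> 1 else 0)"
          using P M' bspan_commute[of "P $ r" "int r" "M' $ s" "- int s"] PM[OF r] r
          by (cases "s = 0") (auto simp: annih_def creat_def)
      qed (use M' r in \<open>auto simp: creat_def\<close>)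
      then show "P $ r * cre_series M' (- l) - cre_series M' (- l) * P $ r = \<kappa> r \<bullet> cre_series M' (- (l + int r))"
        by simp
    qed (use P in \<open>simp add: annih_def\<close>)
    then show ?thesis by simp
  qed
  have exv: "app (exp_fps P $ N) (app (cre_series M' p) (ket ?b2)) = (h $ N) \<cdot> app (cre_series M' (p - int N)) (ket ?b2)" for N p
  proof -
    have "app (exp_fps P $ N) (app (cre_series M' p) (ket ?b2))
      = (\<Sum>s\<le>N. (h $ s) \<cdot> app (cre_series M' (p - int s)) (app (exp_fps P $ (N - s)) (ket ?b2)))"
      using arg_cong[OF ex[of N p], of "\<lambda>X. app X (ket ?b2)"] by (simp add: app_sum)
    also have "\<dots> = (\<Sum>s\<le>N. if s = N then (h $ N) \<cdot> app (cre_series M' (p - int N)) (ket ?b2) else 0)"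
      by (intro sum.cong refl) (auto simp: vac_annih[OF P v(2)])
    finally show ?thesis by simp
  qed
  define w where "w = app (cre_series M' ?p) (ket (\<mu>, \<nu> + \<beta>'))"
  have sh: "app (shift \<beta>) w = app (cre_series M' ?p) (ket ?b2)"
  proof -
    have "shift \<beta> * M' $ r = M' $ r * shift \<beta>" for r
      using M' bspan_shift[of "M' $ r" "- int r" \<beta>] by (cases "r = 0") (auto simp: creat_def)
    then have "shift \<beta> * exp_fps M' $ N = exp_fps M' $ N * shift \<beta>" for N
      using M' by (intro exp_fps_commute) (auto simp: creat_def)
    then have "shift \<beta> * cre_series M' ?p = cre_series M' ?p * shift \<beta>" by (simp add: cre_series_def)
    from arg_cong[OF this, of "\<lambda>X. app X (ket (\<mu>, \<nu> + \<beta>'))"] show ?thesis by (simp add: w_def)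
  qed
  have keysw: "snd b = \<nu> + \<beta>'" if "b \<in> Poly_Mapping.keys w" for b
    using gradedD[OF creat_graded(1)[OF M'], of b ?p "(\<mu>, \<nu> + \<beta>')"] that by (simp add: w_def)
  have "app (vertex P M f \<beta> ex k * vertex P' M' f' \<beta>' ex' l) (ket (\<mu>, \<nu>))
      = (f' \<nu> * f (\<nu> + \<beta>')) \<cdot> app (nexp P M ?p') (app (cre_series M' ?p) (ket ?b2))"
    by (simp add: vertex_ket nexp_vac[OF P' v(1)] flip: w_def) (simp add: vertex_sector[OF keysw] sh)
  moreover have "Poly_Mapping.lookup (app (nexp P M ?p') (app (cre_series M' ?p) (ket ?b2))) b'
      = (if b' = ?b2 \<and> ?p \<ge> 0 \<and> ?p' = - ?p then h $ nat ?p else 0)"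
  proof -
    obtain S where S: "\<And>s. s > S \<Longrightarrow> app (exp_fps P $ s) (app (cre_series M' ?p) (ket ?b2)) = 0"
      using annih_locfin[OF P] unfolding locfin_def by metis
    define S' where "S' = S + nat \<bar>?p'\<bar>"
    have S': "\<And>s. s > S' \<Longrightarrow> app (exp_fps P $ s) (app (cre_series M' ?p) (ket ?b2)) = 0"
      using S by (auto simp: S'_def)
    have "Poly_Mapping.lookup (app (nexp P M ?p') (app (cre_series M' ?p) (ket ?b2))) b'
      = (\<Sum>s\<le>S'. h $ s * Poly_Mapping.lookup (app (cre_series M (?p' + int s)) (app (cre_series M' (?p - int s)) (ket ?b2))) b')"
      by (simp add: app_nexp[OF annih_locfin[OF P] S'] exv lookup_sum del: minus_add_distrib)
    also have "\<dots> = (\<Sum>s\<le>S'. if s = nat (- ?p') then (if b' = ?b2 \<and> ?p \<ge> 0 \<and> ?p' = - ?p then h $ nat ?p else 0) else 0)"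
    proof (intro sum.cong refl)
      fix s assume "s \<in> {..S'}"
      show "h $ s * Poly_Mapping.lookup (app (cre_series M (?p' + int s)) (app (cre_series M' (?p - int s)) (ket ?b2))) b'
        = (if s = nat (- ?p') then (if b' = ?b2 \<and> ?p \<ge> 0 \<and> ?p' = - ?p then h $ nat ?p else 0) else 0)"
      proof (cases "?p' + int s = 0")
        case False
        then show ?thesis using vac_creat[OF M b' False] by auto
      next
        case True
        then have s: "s = nat (- ?p')" and "app (cre_series M (?p' + int s)) x = x" for x
          by (auto simp: cre_series_def)
        then have "h $ s * Poly_Mapping.lookup (app (cre_series M (?p' + int s)) (app (cre_series M' (?p - int s)) (ket ?b2))) b'
          = h $ s * Poly_Mapping.lookup (app (cre_series M' (?p - int s)) (ket ?b2)) b'" by simp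
        also have "\<dots> = (if ?p - int s = 0 \<and> b' = ?b2 then h $ s else 0)"
          using vac_creat[OF M' b', of "?p - int s" "ket ?b2"]
          by (cases "?p - int s = 0") (auto simp: cre_series_def lookup_single when_def)
        finally have L: "h $ s * Poly_Mapping.lookup (app (cre_series M (?p' + int s)) (app (cre_series M' (?p - int s)) (ket ?b2))) b'
          = (if ?p - int s = 0 \<and> b' = ?b2 then h $ s else 0)" .
        have e: "?p - int s = 0 \<longleftrightarrow> ?p \<ge> 0 \<and> ?p' = - ?p" "?p - int s = 0 \<Longrightarrow> nat ?p = s"
          using True by linarith+
        show ?thesis
        proof (cases "?p - int s = 0")
          case True
          then show ?thesis unfolding L s[symmetric] using e by simp
        next
          case False
          then show ?thesis unfolding L s[symmetric] using e(1) by auto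
        qed
      qed
    qed
    also have "\<dots> = (if b' = ?b2 \<and> ?p \<ge> 0 \<and> ?p' = - ?p then h $ nat ?p else 0)"
      by (auto simp: S'_def)
    finally show ?thesis .
  qed
  ultimately show ?thesis by (auto simp: algebra_simps)
qed

text \<open>Induction on the sum of the degrees of \<open>b\<close> and \<open>b'\<close>. A boson that
  is present in \<open>b\<close> arises from a creation operator, which can be moved to the left
  of \<open>T\<close>, where it either lowers \<open>b'\<close> or gives zero; a boson present in
  \<open>b'\<close> is detected by an annihilation operator, which can be moved to the right,
  where it kills the vacuum. In both cases the commutators contribute matrix elements of smaller
  degree.\<close>

lemma vacuum_uniqueness:
  fixes T :: "int \<Rightarrow> int \<Rightarrow> endo"
  assumes comm: "\<And>s t r. s \<in> {0..<int m} \<Longrightarrow> t \<in> {0..<int n} \<Longrightarrow> r \<noteq> 0 \<Longrightarrow>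
      \<exists>\<phi> \<psi>. \<forall>k l. al s t r * T k l - T k l * al s t r = \<phi> \<bullet> T (k + r) l + \<psi> \<bullet> T k (l + r)"
    and vac0: "\<And>k l b b'. vac b \<Longrightarrow> vac b' \<Longrightarrow> Poly_Mapping.lookup (app (T k l) (ket b)) b' = 0"
  shows "T k l = 0"
proof -
  have "Poly_Mapping.lookup (app (T k l) (ket b)) b' = 0" for k l b b'
  proof (induction "nat (bdeg b + bdeg b')" arbitrary: b b' k l rule: less_induct)
    case less
    have IH: "Poly_Mapping.lookup (app (T k l) (ket b1)) b1' = 0"
      if "bdeg b1 + bdeg b1' < bdeg b + bdeg b'" for k l b1 b1'
      using less that bdeg_nonneg[of b1] bdeg_nonneg[of b1'] by auto
    obtain \<mu> \<nu> where b: "b = (\<mu>, \<nu>)" by (cases b)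
    obtain \<mu>' \<nu>' where b': "b' = (\<mu>', \<nu>')" by (cases b')
    have remove: "\<exists>\<mu>1. \<mu> = \<mu>1 + Poly_Mapping.single x 1" if "Poly_Mapping.lookup \<mu> x \<noteq> 0"
      for \<mu> :: "(int \<times> int \<times> nat) \<Rightarrow>\<^sub>0 nat" and x
      using that
      by (intro exI[of _ "\<mu> - Poly_Mapping.single x 1"] poly_mapping_eqI)
         (auto simp: lookup_add lookup_minus lookup_single when_def)
    consider s t r where "s \<in> {0..<int m}" "t \<in> {0..<int n}" "r > 0" "Poly_Mapping.lookup \<mu> (s, t, r) \<noteq> 0"
      | s t r where "vac b" "s \<in> {0..<int m}" "t \<in> {0..<int n}" "r > 0" "Poly_Mapping.lookup \<mu>' (s, t, r) \<noteq> 0"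
      | "vac b" "vac b'"
      unfolding vac_def b b' fst_conv by blast
    then show ?case
    proof cases
      case 1
      then have md: "mode s t (- int r) = (s, t, r)" by (simp add: mode_def)
      obtain \<mu>1 where \<mu>1: "\<mu> = \<mu>1 + Poly_Mapping.single (s, t, r) 1" using remove[OF 1(4)] by blast
      let ?b1 = "(\<mu>1, \<nu>)"
      have kb: "ket b = app (al s t (- int r)) (ket ?b1)" using 1 by (simp add: al_cre md b \<mu>1)
      have deg: "bdeg b = bdeg ?b1 + int r" unfolding b \<mu>1 bdeg_add by simp
      obtain \<phi> \<psi> where c: "\<And>k l. al s t (- int r) * T k l - T k l * al s t (- int r)
          = \<phi> \<bullet> T (k + - int r) l + \<psi> \<bullet> T k (l + - int r)"
        using comm[OF 1(1,2), of "- int r"] 1(3) by auto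
      have "app (T k l) (ket b) = app (al s t (- int r)) (app (T k l) (ket ?b1))
          - (\<phi> \<cdot> app (T (k - int r) l) (ket ?b1) + \<psi> \<cdot> app (T k (l - int r)) (ket ?b1))"
        using arg_cong[OF c[of k l], of "\<lambda>X. app X (ket ?b1)"] by (simp add: kb algebra_simps)
      moreover have "Poly_Mapping.lookup (app (T k l) (ket ?b1)) b' = 0" for k l
        by (rule IH) (use deg 1(3) in simp)
      moreover have "Poly_Mapping.lookup (app (al s t (- int r)) (app (T k l) (ket ?b1))) b' = 0"
      proof (cases "Poly_Mapping.lookup \<mu>' (s, t, r) = 0")
        case False
        then obtain \<mu>2 where \<mu>2: "\<mu>' = \<mu>2 + Poly_Mapping.single (s, t, r) 1" using remove by blast
        have "bdeg b' = bdeg (\<mu>2, \<nu>') + int r" unfolding b' \<mu>2 bdeg_add by simp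
        then have "Poly_Mapping.lookup (app (T k l) (ket ?b1)) (\<mu>2, \<nu>') = 0" using deg 1(3) by (intro IH) simp
        then show ?thesis using 1(3) by (simp add: b' lookup_al_cre md \<mu>2)
      qed (use 1(3) in \<open>simp add: b' lookup_al_cre md\<close>)
      ultimately show ?thesis by (simp add: lookup_minus lookup_add)
    next
      case 2
      then have md: "mode s t (int r) = (s, t, r)" by (simp add: mode_def)
      obtain \<mu>1 where \<mu>1: "\<mu>' = \<mu>1 + Poly_Mapping.single (s, t, r) 1" using remove[OF 2(5)] by blast
      let ?b1 = "(\<mu>1, \<nu>')"
      have deg: "bdeg b' = bdeg ?b1 + int r" unfolding b' \<mu>1 bdeg_add by simp
      obtain \<phi> \<psi> where c: "\<And>k l. al s t (int r) * T k l - T k l * al s t (int r)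
          = \<phi> \<bullet> T (k + int r) l + \<psi> \<bullet> T k (l + int r)"
        using comm[OF 2(2,3), of "int r"] 2(4) by auto
      have "Poly_Mapping.lookup \<mu> (s, t, r) = 0" using 2 by (simp add: vac_def b)
      then have kill: "app (al s t (int r)) (ket b) = 0" using 2 by (simp add: b al_ann md)
      have "app (al s t (int r)) (app (T k l) (ket b)) = \<phi> \<cdot> app (T (k + int r) l) (ket b) + \<psi> \<cdot> app (T k (l + int r)) (ket b)"
        using arg_cong[OF c[of k l], of "\<lambda>X. app X (ket b)"] by (simp add: kill)
      moreover have "Poly_Mapping.lookup (app (T k l) (ket b)) ?b1 = 0" for k l
        by (rule IH) (use deg 2(4) in simp)
      ultimately have "Poly_Mapping.lookup (app (al s t (int r)) (app (T k l) (ket b))) ?b1 = 0"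
        by (simp add: lookup_add)
      moreover have "Poly_Mapping.lookup (app (al s t (int r)) (app (T k l) (ket b))) ?b1 =
          cr (int r) * of_nat (Suc (Poly_Mapping.lookup \<mu>1 (s, t, r))) * Poly_Mapping.lookup (app (T k l) (ket b)) b'"
        using 2(4) by (subst lookup_al_ann) (simp_all add: md b' \<mu>1)
      ultimately show ?thesis using cr_nz[of "int r"] 2(4) by (simp del: of_nat_Suc)
    next
      case 3
      then show ?thesis by (rule vac0)
    qed
  qed
  then have "app (T k l) (ket b) = app 0 (ket b)" for b
    by (intro poly_mapping_eqI) simp
  then show ?thesis by (rule endo_ket_eqI)
qed

end


section \<open>The currents of the Fock representation\<close>

lemma powi_mult_nat: "a powi (k * int r) = (a ^ r) powi k" for a :: complex
proof -
  have "a powi (k * int r) = a powi (int r * k)" by (simp only: mult.commute)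
  then show ?thesis by (simp only: power_int_mult power_int_of_nat)
qed

lemma powi_pow: "(a powi k) ^ r = (a ^ r) powi k" for a :: complex
proof -
  have "(a powi k) ^ r = a powi (k * int r)" by (simp only: power_int_mult power_int_of_nat)
  then show ?thesis by (simp only: powi_mult_nat)
qed

lemma inverse_square_powi: "inverse (x * x) powi s = x powi (- 2 * s)" for x :: complex
proof -
  have "inverse (x * x) = x powi (- 2)" by (simp add: power_int_minus power2_eq_square)
  then show ?thesis by (simp only: power_int_mult)
qed

lemma telescope_powi:
  assumes "Z \<noteq> (0 :: complex)" "a \<le> b"
  shows "(1 - Z) * (\<Sum>s\<in>{a..<b}. Z powi s) = Z powi a - Z powi b"
  using assms(2)
proof (induction b rule: int_ge_induct)
  case (step b)
  have "{a..<b + 1} = insert b {a..<b}" using step by auto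
  then show ?case using step assms(1) by (simp add: distrib_left power_int_add left_diff_distrib mult.commute)
qed simp

locale fock_rep = bosons +
  fixes d dc sq sd :: complex and u :: "int \<Rightarrow> complex"
  assumes d0: "d \<noteq> 0" and dc0: "dc \<noteq> 0" and sq: "sq\<^sup>2 = q" and sd: "sd\<^sup>2 = dc"
    and nondeg: "\<And>k :: int. k \<noteq> 0 \<Longrightarrow> (q * dc) powi k \<noteq> 1 \<and> (q * inverse dc) powi k \<noteq> 1"
    and u0: "\<And>i. i \<in> {0..<int m} \<Longrightarrow> u i \<noteq> 0"
begin

lemma g0: "q - inverse q \<noteq> 0"
  by (rule qnum_nonzero(2)[of q 1]) (auto simp: q0 not_root)

lemma qnum_nz: "r \<noteq> 0 \<Longrightarrow> qnum q r \<noteq> 0"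
  by (rule qnum_nonzero(1)[OF q0 not_root])

abbreviation "rows \<equiv> {0..<int m}"
abbreviation "cols \<equiv> {0..<int n}"

definition bp :: "int \<Rightarrow> int \<Rightarrow> nat \<Rightarrow> endo" where
  "bp i j r = - (q ^ r) \<bullet> ((inverse q * inverse dc) ^ r \<bullet> al i (j - 1) (int r) - al i j (int r))"

definition bm :: "int \<Rightarrow> int \<Rightarrow> nat \<Rightarrow> endo" where
  "bm i j r = - ((inverse q * dc) ^ r \<bullet> al i (j - 1) (- int r) - al i j (- int r))"

lemma app_b: "app (bp i j r) v = b_p q dc m n i j r v" "app (bm i j r) v = b_m q dc m n i j r v"
  by (simp_all add: bp_def bm_def b_p_def b_m_def app_al)

lemma bp_span: "bp i j r \<in> bspan (int r)"
  unfolding bp_def by (intro bspan_smul bspan_diff bspan_al)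

lemma bm_span: "bm i j r \<in> bspan (- int r)"
  unfolding bm_def by (intro bspan_smul bspan_diff bspan_uminus bspan_al)

text \<open>The commutators of the \<open>b\<close> reproduce the structure constants of the toroidal
  algebra in each row.\<close>

lemma b_commutator:
  assumes s: "s \<in> rows" "s' \<in> rows" and i: "i \<in> cols" "j \<in> cols" and r: "r > 0"
  shows "bp s i r * bm s' j r - bm s' j r * bp s i r =
    (if s = s' then qnum q (int r) * a_coeff q dc n i j (int r) else 0) \<bullet> 1"
proof -
  define X where "X k l = al s k (int r) * al s' l (- int r) - al s' l (- int r) * al s k (int r)" for k l
  have X: "X k l = (if s = s' then cr (int r) * kdelta n k l else 0) \<bullet> 1" for k l
    using r s by (simp add: X_def al_commutator kdelta_def)
  define a where "a = (inverse q * inverse dc) ^ r"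
  define b where "b = (inverse q * dc) ^ r"
  have "bp s i r * bm s' j r - bm s' j r * bp s i r =
    (q ^ r) \<bullet> ((a * b) \<bullet> X (i - 1) (j - 1) - a \<bullet> X (i - 1) j - b \<bullet> X i (j - 1) + X i j)"
  proof -
    have "(- Q \<bullet> (a \<bullet> A - B)) * - (b \<bullet> C - D) - - (b \<bullet> C - D) * (- Q \<bullet> (a \<bullet> A - B)) =
      Q \<bullet> ((a * b) \<bullet> (A * C - C * A) - a \<bullet> (A * D - D * A) - b \<bullet> (B * C - C * B) + (B * D - D * B))"
      for Q :: complex and A B C D :: endo
      by (simp add: algebra_simps smul_left_distrib)
    then show ?thesis unfolding bp_def bm_def X_def a_def[symmetric] b_def[symmetric] .
  qed
  also have "\<dots> = (if s = s' then cr (int r) * q ^ r * (a * b * kdelta n (i - 1) (j - 1) - a * kdelta n (i - 1) j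
      - b * kdelta n i (j - 1) + kdelta n i j) else 0) \<bullet> 1"
    by (simp add: X algebra_simps smul_left_distrib)
  also have "kdelta n (i - 1) (j - 1) = kdelta n i j"
    by (simp add: kdelta_def mod_eq_dvd_iff)
  also have "kdelta n (i - 1) j = kdelta n i (j + 1)"
  proof -
    have "(i - 1) mod int n = j mod int n \<longleftrightarrow> i mod int n = (j + 1) mod int n"
      by (metis add_diff_cancel diff_add_cancel mod_add_left_eq mod_diff_left_eq)
    then show ?thesis by (simp add: kdelta_def)
  qed
  also have "cr (int r) * q ^ r * (a * b * kdelta n i j - a * kdelta n i (j + 1) - b * kdelta n i (j - 1) + kdelta n i j)
     = qnum q (int r) * a_coeff q dc n i j (int r)"
  proof -
    have e: "q ^ r * (a * b) = q powi - int r" "q ^ r * a = dc powi - int r" "q ^ r * b = dc powi int r" "q ^ r = q powi int r"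
      using q0 dc0 by (simp_all add: a_def b_def power_mult_distrib power_int_minus power_inverse field_simps)
    have "cr (int r) * q ^ r * (a * b * kdelta n i j - a * kdelta n i (j + 1) - b * kdelta n i (j - 1) + kdelta n i j)
      = cr (int r) * (q ^ r * (a * b) * kdelta n i j - q ^ r * a * kdelta n i (j + 1) - q ^ r * b * kdelta n i (j - 1) + q ^ r * kdelta n i j)"
      by (simp add: algebra_simps)
    also have "\<dots> = cr (int r) * (q powi - int r * kdelta n i j - dc powi - int r * kdelta n i (j + 1)
       - dc powi int r * kdelta n i (j - 1) + q powi int r * kdelta n i j)"
      by (simp only: e(1) e(2) e(3)) (simp only: e(4))
    finally show ?thesis by (simp add: cr_def a_coeff_def power2_eq_square algebra_simps)
  qed
  finally show ?thesis .
qed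

text \<open>All currents of the representation have modes of this form. Their commutators thus reduce
  to the pairing \<open>\<Sum>\<^sub>s x\<^sub>s y\<^sub>s\<close> of the coefficient vectors,
  multiplied by a factor that only depends on the columns (lemma \<open>row_commutator\<close>).\<close>

definition rowp :: "(int \<Rightarrow> nat \<Rightarrow> complex) \<Rightarrow> int \<Rightarrow> nat \<Rightarrow> endo" where
  "rowp x j r = (\<Sum>s\<in>rows. x s r \<bullet> bp s j r)"

definition rowm :: "(int \<Rightarrow> nat \<Rightarrow> complex) \<Rightarrow> int \<Rightarrow> nat \<Rightarrow> endo" where
  "rowm y j r = (\<Sum>s\<in>rows. y s r \<bullet> bm s j r)"

lemma row_commutator:
  assumes "i \<in> cols" "j \<in> cols" "r > 0"
  shows "rowp x i r * rowm y j r - rowm y j r * rowp x i r =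
    ((\<Sum>s\<in>rows. x s r * y s r) * (qnum q (int r) * a_coeff q dc n i j (int r))) \<bullet> 1"
proof -
  let ?c = "qnum q (int r) * a_coeff q dc n i j (int r)"
  have "rowp x i r * rowm y j r - rowm y j r * rowp x i r =
     (\<Sum>s\<in>rows. \<Sum>s'\<in>rows. (x s r * y s' r) \<bullet> (bp s i r * bm s' j r))
     - (\<Sum>s'\<in>rows. \<Sum>s\<in>rows. (x s r * y s' r) \<bullet> (bm s' j r * bp s i r))"
    by (simp add: rowp_def rowm_def sum_product mult.commute)
  also have "(\<Sum>s'\<in>rows. \<Sum>s\<in>rows. (x s r * y s' r) \<bullet> (bm s' j r * bp s i r))
     = (\<Sum>s\<in>rows. \<Sum>s'\<in>rows. (x s r * y s' r) \<bullet> (bm s' j r * bp s i r))" by (rule sum.swap)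
  also have "(\<Sum>s\<in>rows. \<Sum>s'\<in>rows. (x s r * y s' r) \<bullet> (bp s i r * bm s' j r)) - \<dots>
     = (\<Sum>s\<in>rows. \<Sum>s'\<in>rows. if s' = s then (x s r * y s r * ?c) \<bullet> 1 else 0)"
    unfolding sum_subtractf[symmetric]
  proof (intro sum.cong refl)
    fix s s' assume "s \<in> rows" "s' \<in> rows"
    from b_commutator[OF this assms]
    show "(x s r * y s' r) \<bullet> (bp s i r * bm s' j r) - (x s r * y s' r) \<bullet> (bm s' j r * bp s i r)
       = (if s' = s then (x s r * y s r * ?c) \<bullet> 1 else 0)"
      by (auto simp flip: smul_simps(2))
  qed
  also have "\<dots> = (\<Sum>s\<in>rows. (x s r * y s r * ?c) \<bullet> 1)" by simp
  finally show ?thesis by (simp only: sum_smul[symmetric] sum_distrib_right)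
qed

definition fpsp :: "(int \<Rightarrow> nat \<Rightarrow> complex) \<Rightarrow> int \<Rightarrow> endo fps" where
  "fpsp x j = Abs_fps (\<lambda>r. if r = 0 then 0 else rowp x j r)"

definition fpsm :: "(int \<Rightarrow> nat \<Rightarrow> complex) \<Rightarrow> int \<Rightarrow> endo fps" where
  "fpsm y j = Abs_fps (\<lambda>r. if r = 0 then 0 else rowm y j r)"

lemma fpsp_nth [simp]: "fpsp x j $ r = (if r = 0 then 0 else rowp x j r)"
  and fpsm_nth [simp]: "fpsm y j $ r = (if r = 0 then 0 else rowm y j r)"
  by (simp_all add: fpsp_def fpsm_def)

lemma rowp_span: "rowp x j r \<in> bspan (int r)"
  unfolding rowp_def by (intro bspan_sum bspan_smul bp_span)

lemma rowm_span: "rowm y j r \<in> bspan (- int r)"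
  unfolding rowm_def by (intro bspan_sum bspan_smul bm_span)

lemma annih_fpsp [simp]: "annih (fpsp x j)" and creat_fpsm [simp]: "creat (fpsm y j)"
  by (simp_all add: annih_def creat_def rowp_span rowm_span)

text \<open>The coefficients of \<open>A\<close>, \<open>B\<close> and \<open>H\<close> in terms of the
  rows; the row \<open>a\<close> is the superscript of \<open>A\<close> and \<open>B\<close>.
  Powers are written in the form \<open>(q\<^sup>r)\<^sup>k\<close>, which makes them rational
  functions of the three quantities \<open>q\<^sup>r\<close>, \<open>q\<^sub>1\<^sup>r\<close>,
  \<open>q\<^sub>3\<^sup>r\<close>.\<close>

definition xA :: "int \<Rightarrow> int \<Rightarrow> nat \<Rightarrow> complex" where
  "xA a s r = (if s = a then - (1 / qnum q (int r) * (q ^ r) powi (- (int m - 1)) * (q3 q d ^ r) powi (- a)) else 0)"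

definition yA :: "int \<Rightarrow> int \<Rightarrow> nat \<Rightarrow> complex" where
  "yA a s r = (if s < a then 0 else 1 / qnum q (int r) * (q ^ r) powi (int m - 2) * (q3 q d ^ r) powi s *
     (if s = a then 1 else 1 - q ^ r * q ^ r))"

definition xB :: "int \<Rightarrow> int \<Rightarrow> nat \<Rightarrow> complex" where
  "xB a s r = (if s > a then 0 else 1 / qnum q (int r) * q ^ r * (q1 q d ^ r) powi s *
     (if s = a then 1 else 1 - inverse (q ^ r * q ^ r)))"

definition yB :: "int \<Rightarrow> int \<Rightarrow> nat \<Rightarrow> complex" where
  "yB a s r = (if s = a then - (1 / qnum q (int r) * (q1 q d ^ r) powi (- a)) else 0)"

definition xH :: "int \<Rightarrow> nat \<Rightarrow> complex" where
  "xH s r = (q1 q d ^ r) powi s"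

definition yH :: "int \<Rightarrow> nat \<Rightarrow> complex" where
  "yH s r = (q ^ r) powi (int m - 1) * (q3 q d ^ r) powi s"

lemma q13: "q1 q d ^ r * q3 q d ^ r = inverse (q ^ r * q ^ r)" "q1 q d ^ r \<noteq> 0" "q3 q d ^ r \<noteq> 0"
  using q0 d0 by (simp_all add: q1_def q3_def power_mult_distrib power_inverse field_simps)

lemma q13_powi: "(q1 q d ^ r) powi s * (q3 q d ^ r) powi s = inverse (q ^ r * q ^ r) powi s"
  unfolding q13(1)[symmetric] by (simp add: power_int_mult_distrib)


lemma app_AB:
  assumes "a \<in> rows" "r > 0"
  shows "app (rowp (xA a) j r) v = A_p q d dc m n a j r v"
    and "app (rowm (yA a) j r) v = A_m q d dc m n a j r v"
    and "app (rowp (xB a) j r) v = B_p q d dc m n a j r v"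
    and "app (rowm (yB a) j r) v = B_m q d dc m n a j r v"
proof -
  have q2: "q2 q ^ r = q ^ r * q ^ r" "q2 q powi - int r = inverse (q ^ r * q ^ r)"
    by (simp_all add: q2_def power_int_minus power_mult_distrib power2_eq_square)
  have pw: "q powi (- (int m - 1) * int r) = (q ^ r) powi (- (int m - 1))"
     "q powi ((int m - 2) * int r) = (q ^ r) powi (int m - 2)"
     "\<And>s. q3 q d powi (s * int r) = (q3 q d ^ r) powi s" "\<And>s. q1 q d powi (s * int r) = (q1 q d ^ r) powi s"
    by (rule powi_mult_nat)+
  have "rowp (xA a) j r = (\<Sum>s\<in>rows. if s = a then xA a a r \<bullet> bp a j r else 0)"
    unfolding rowp_def by (intro sum.cong) (auto simp: xA_def)
  then have "rowp (xA a) j r = xA a a r \<bullet> bp a j r" using assms(1) by simp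
  then show "app (rowp (xA a) j r) v = A_p q d dc m n a j r v"
    unfolding A_p_def pw by (simp add: app_b xA_def)
  have "rowm (yB a) j r = (\<Sum>s\<in>rows. if s = a then yB a a r \<bullet> bm a j r else 0)"
    unfolding rowm_def by (intro sum.cong) (auto simp: yB_def)
  then have "rowm (yB a) j r = yB a a r \<bullet> bm a j r" using assms(1) by simp
  then show "app (rowm (yB a) j r) v = B_m q d dc m n a j r v"
    unfolding B_m_def pw by (simp add: app_b yB_def)
  have "rowm (yA a) j r = (\<Sum>s\<in>insert a {a+1..int m - 1}. yA a s r \<bullet> bm s j r)"
    unfolding rowm_def by (rule sum.mono_neutral_right) (use assms in \<open>auto simp: yA_def\<close>)
  also have "\<dots> = yA a a r \<bullet> bm a j r + (\<Sum>s\<in>{a+1..int m - 1}. yA a s r \<bullet> bm s j r)"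
    by simp
  also have "(\<Sum>s\<in>{a+1..int m - 1}. yA a s r \<bullet> bm s j r) =
     (\<Sum>s\<in>{a+1..int m - 1}. (1 / qnum q (int r) * (q ^ r) powi (int m - 2) * (1 - q ^ r * q ^ r)) \<bullet> ((q3 q d ^ r) powi s \<bullet> bm s j r))"
    by (intro sum.cong refl) (auto simp: yA_def mult_ac)
  finally have eq: "rowm (yA a) j r = yA a a r \<bullet> bm a j r + \<dots>" .
  show "app (rowm (yA a) j r) v = A_m q d dc m n a j r v"
    unfolding eq A_m_def pw q2 by (simp add: app_b yA_def app_sum scale_sum mult.assoc)
  have "rowp (xB a) j r = (\<Sum>s\<in>insert a {0..a - 1}. xB a s r \<bullet> bp s j r)"
    unfolding rowp_def by (rule sum.mono_neutral_right) (use assms in \<open>auto simp: xB_def\<close>)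
  also have "\<dots> = xB a a r \<bullet> bp a j r + (\<Sum>s\<in>{0..a - 1}. xB a s r \<bullet> bp s j r)"
    by simp
  also have "(\<Sum>s\<in>{0..a - 1}. xB a s r \<bullet> bp s j r) =
     (\<Sum>s\<in>{0..a - 1}. (1 / qnum q (int r) * q ^ r * (1 - inverse (q ^ r * q ^ r))) \<bullet> ((q1 q d ^ r) powi s \<bullet> bp s j r))"
    by (intro sum.cong refl) (auto simp: xB_def mult_ac)
  finally have eq: "rowp (xB a) j r = xB a a r \<bullet> bp a j r + \<dots>" .
  show "app (rowp (xB a) j r) v = B_p q d dc m n a j r v"
    unfolding eq B_p_def pw q2 by (simp add: app_b xB_def app_sum scale_sum mult.assoc)
qed

lemma app_H:
  shows "app (rowp xH j r) v = fock_H_p q d dc m n j r v"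
    and "app (rowm yH j r) v = fock_H_m q d dc m n j r v"
proof -
  have pw: "q powi ((int m - 1) * int r) = (q ^ r) powi (int m - 1)"
     "\<And>s. q3 q d powi (s * int r) = (q3 q d ^ r) powi s" "\<And>s. q1 q d powi (s * int r) = (q1 q d ^ r) powi s"
    by (rule powi_mult_nat)+
  have r: "rows = {0..int m - 1}" by auto
  show "app (rowp xH j r) v = fock_H_p q d dc m n j r v"
    by (simp only: fock_H_p_def pw rowp_def xH_def app_sum r app_simps app_b)
  show "app (rowm yH j r) v = fock_H_m q d dc m n j r v"
    by (simp only: fock_H_m_def pw rowm_def yH_def app_sum r app_simps app_b)
qed

text \<open>The following pairings are computed from \<open>q\<^sub>1 q\<^sub>3 =
  q\<^sup>-\<^sup>2\<close>: the tails in the definition of \<open>A\<close> and \<open>B\<close>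
  are arranged such that the geometric sums over the rows telescope and different rows decouple.\<close>

lemma pair_AB:
  assumes "a \<in> rows" "b \<in> rows"
  shows "(\<Sum>s\<in>rows. xA a s r * yB b s r) =
    (if a = b then (q powi (2 * a - int m + 1)) ^ r / (qnum q (int r))\<^sup>2 else 0)"
proof -
  have "(\<Sum>s\<in>rows. xA a s r * yB b s r) = (\<Sum>s\<in>rows. if s = a then xA a a r * yB b a r else 0)"
    by (intro sum.cong) (auto simp: xA_def)
  also have "\<dots> = xA a a r * yB b a r" using assms by simp
  also have "\<dots> = (if a = b then (q powi (2 * a - int m + 1)) ^ r / (qnum q (int r))\<^sup>2 else 0)"
  proof -
    have "(q1 q d ^ r) powi (- a) * (q3 q d ^ r) powi (- a) = (q ^ r) powi (2 * a)"
      unfolding q13_powi inverse_square_powi by simp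
    moreover have "(q ^ r) powi (2 * a) * (q ^ r) powi (- (int m - 1)) = (q ^ r) powi (2 * a - int m + 1)"
      by (subst power_int_add[symmetric]) (simp_all add: q0 algebra_simps)
    ultimately have "(q ^ r) powi (- (int m - 1)) * (q3 q d ^ r) powi (- a) * (q1 q d ^ r) powi (- a) = (q ^ r) powi (2 * a - int m + 1)"
      by (metis mult.assoc mult.commute)
    moreover have "(q powi (2 * a - int m + 1)) ^ r = (q ^ r) powi (2 * a - int m + 1)"
      by (rule powi_pow)
    ultimately show ?thesis by (cases "a = b") (simp_all add: xA_def yB_def power2_eq_square)
  qed
  finally show ?thesis .
qed

lemma geo_rows:
  assumes "a \<le> b" "r > 0"
  defines "Z \<equiv> inverse (q ^ r * q ^ r)"
  shows "(1 - q ^ r * q ^ r) * (\<Sum>s\<in>{a+1..b}. Z powi s) = Z powi b - Z powi a"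
    and "(1 - Z) * (\<Sum>s\<in>{a..<b}. Z powi s) = Z powi a - Z powi b"
proof -
  have Z0: "Z \<noteq> 0" by (simp add: Z_def q0)
  show "(1 - Z) * (\<Sum>s\<in>{a..<b}. Z powi s) = Z powi a - Z powi b" by (rule telescope_powi[OF Z0 assms(1)])
  have "(1 - Z) * (\<Sum>s\<in>{a+1..<b+1}. Z powi s) = Z powi (a + 1) - Z powi (b + 1)"
    by (rule telescope_powi[OF Z0]) (use assms in simp)
  moreover have "{a+1..<b+1} = {a+1..b}" by auto
  moreover have "Z powi (a + 1) - Z powi (b + 1) = Z * (Z powi a - Z powi b)"
    using Z0 by (simp add: power_int_add algebra_simps)
  moreover have "1 - q ^ r * q ^ r = - (1 - Z) * inverse Z" using q0 by (simp add: Z_def field_simps)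
  ultimately have "(1 - q ^ r * q ^ r) * (\<Sum>s\<in>{a+1..b}. Z powi s) = - inverse Z * (Z * (Z powi a - Z powi b))"
    by (metis (no_types, opaque_lifting) mult.assoc mult.commute mult_minus_left)
  then show "(1 - q ^ r * q ^ r) * (\<Sum>s\<in>{a+1..b}. Z powi s) = Z powi b - Z powi a"
    using Z0 by (simp add: mult.assoc[symmetric])
qed

lemma pair_BA:
  assumes "a \<in> rows" "b \<in> rows" "r > 0"
  shows "(\<Sum>s\<in>rows. xB b s r * yA a s r) =
    (if a = b then (q powi (int m - 1 - 2 * a)) ^ r / (qnum q (int r))\<^sup>2 else 0)"
proof -
  define Q where "Q = q ^ r * q ^ r"
  define Z where "Z = inverse (q ^ r * q ^ r)"
  have ZQ: "Z = inverse Q" "Q \<noteq> 0" "Z \<noteq> 0" by (simp_all add: Z_def Q_def q0)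
  have zz: "(q1 q d ^ r) powi s * (q3 q d ^ r) powi s = Z powi s" for s unfolding Z_def by (rule q13_powi)
  define w where "w = q ^ r * (q ^ r) powi (int m - 2) / (qnum q (int r))\<^sup>2"
  define F where "F s = (if s < a \<or> s > b then 0 else (if s = b then 1 else 1 - Z) * (if s = a then 1 else 1 - Q) * Z powi s)" for s
  have "xB b s r * yA a s r = w * F s" for s
    unfolding xB_def yA_def w_def F_def Z_def[symmetric] unfolding Q_def[symmetric]
    by (auto simp: zz[symmetric] power2_eq_square)
  then have S: "(\<Sum>s\<in>rows. xB b s r * yA a s r) = w * (\<Sum>s\<in>rows. F s)" by (simp add: sum_distrib_left)
  consider "a > b" | "a = b" | "a < b" by linarith
  then show ?thesis
  proof cases
    case 1
    then have "(\<Sum>s\<in>rows. F s) = 0" by (intro sum.neutral) (auto simp: F_def)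
    then show ?thesis using S 1 by simp
  next
    case 2
    have "(\<Sum>s\<in>rows. F s) = (\<Sum>s\<in>rows. if s = a then Z powi a else 0)"
      by (intro sum.cong) (auto simp: F_def 2)
    also have "\<dots> = Z powi a" using assms by simp
    finally have "(\<Sum>s\<in>rows. xB b s r * yA a s r) = w * Z powi a" using S by simp
    also have "\<dots> = (q powi (int m - 1 - 2 * a)) ^ r / (qnum q (int r))\<^sup>2"
    proof -
      have "Z powi a = (q ^ r) powi (- 2 * a)"
        unfolding Z_def by (rule inverse_square_powi)
      moreover have "q ^ r * (q ^ r) powi (int m - 2) * (q ^ r) powi (- 2 * a) = (q ^ r) powi (1 + (int m - 2) + - 2 * a)"
        by (simp only: power_int_add[of "q ^ r"] q0 power_not_zero power_int_1_right simp_thms power_eq_0_iff)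
      moreover have "1 + (int m - 2) + - 2 * a = int m - 1 - 2 * a" by simp
      moreover have "(q powi (int m - 1 - 2 * a)) ^ r = (q ^ r) powi (int m - 1 - 2 * a)"
        by (rule powi_pow)
      ultimately show ?thesis by (simp add: w_def)
    qed
    finally show ?thesis using 2 by simp
  next
    case 3
    have "(\<Sum>s\<in>rows. F s) = (\<Sum>s\<in>insert a (insert b {a+1..b-1}). F s)"
      by (rule sum.mono_neutral_right) (use assms 3 in \<open>auto simp: F_def\<close>)
    also have "\<dots> = F a + (F b + (\<Sum>s\<in>{a+1..b-1}. F s))" using 3 by simp
    also have "(\<Sum>s\<in>{a+1..b-1}. F s) = (1 - Z) * ((1 - Q) * (\<Sum>s\<in>{a+1..b-1}. Z powi s))"
      unfolding sum_distrib_left by (intro sum.cong) (auto simp: F_def)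
    also have "(1 - Q) * (\<Sum>s\<in>{a+1..b-1}. Z powi s) = Z powi (b - 1) - Z powi a"
      unfolding Q_def Z_def by (rule geo_rows(1)) (use 3 assms in auto)
    also have "Z powi (b - 1) = Z powi b * Q" using ZQ(3) by (simp add: power_int_diff ZQ(1) divide_inverse)
    also have "F a = (1 - Z) * Z powi a" using 3 by (simp add: F_def)
    also have "F b = (1 - Q) * Z powi b" using 3 by (simp add: F_def)
    finally have "(\<Sum>s\<in>rows. F s) = (1 - Z) * Z powi a + ((1 - Q) * Z powi b + (1 - Z) * (Z powi b * Q - Z powi a))" .
    also have "\<dots> = 0" using ZQ by (simp add: algebra_simps)
    finally show ?thesis using S 3 by simp
  qed
qed

lemma pair_HA:
  assumes "a \<in> rows" "r > 0"
  shows "(\<Sum>s\<in>rows. xH s r * yA a s r) = (q ^ r) powi (- int m) / qnum q (int r)"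
proof -
  define Z where "Z = inverse (q ^ r * q ^ r)"
  have zz: "(q1 q d ^ r) powi s * (q3 q d ^ r) powi s = Z powi s" for s unfolding Z_def by (rule q13_powi)
  define w where "w = (q ^ r) powi (int m - 2) / qnum q (int r)"
  have "(\<Sum>s\<in>rows. xH s r * yA a s r) = (\<Sum>s\<in>insert a {a+1..int m - 1}. xH s r * yA a s r)"
    by (rule sum.mono_neutral_right) (use assms in \<open>auto simp: yA_def\<close>)
  also have "\<dots> = xH a r * yA a a r + (\<Sum>s\<in>{a+1..int m - 1}. xH s r * yA a s r)" by simp
  also have "xH a r * yA a a r = w * Z powi a"
    by (simp add: xH_def yA_def w_def zz[symmetric])
  also have "(\<Sum>s\<in>{a+1..int m - 1}. xH s r * yA a s r) = w * ((1 - q ^ r * q ^ r) * (\<Sum>s\<in>{a+1..int m - 1}. Z powi s))"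
    unfolding sum_distrib_left by (intro sum.cong) (auto simp: xH_def yA_def w_def zz[symmetric])
  also have "(1 - q ^ r * q ^ r) * (\<Sum>s\<in>{a+1..int m - 1}. Z powi s) = Z powi (int m - 1) - Z powi a"
    unfolding Z_def by (rule geo_rows(1)) (use assms in auto)
  also have "w * Z powi a + w * (Z powi (int m - 1) - Z powi a) = w * Z powi (int m - 1)" by (simp add: algebra_simps)
  also have "Z powi (int m - 1) = (q ^ r) powi (- (int m - 1) - (int m - 1))"
    unfolding Z_def inverse_square_powi by (rule arg_cong[where f = "power_int (q ^ r)"]) simp
  also have "w * (q ^ r) powi (- (int m - 1) - (int m - 1)) = (q ^ r) powi ((int m - 2) + (- (int m - 1) - (int m - 1))) / qnum q (int r)"
    by (subst power_int_add) (simp_all add: q0 w_def)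
  also have "(int m - 2) + (- (int m - 1) - (int m - 1)) = - int m" by simp
  finally show ?thesis .
qed

lemma pair_AH:
  assumes "a \<in> rows"
  shows "(\<Sum>s\<in>rows. xA a s r * yH s r) = - (1 / qnum q (int r))"
proof -
  have "(\<Sum>s\<in>rows. xA a s r * yH s r) = (\<Sum>s\<in>rows. if s = a then xA a a r * yH a r else 0)"
    by (intro sum.cong) (auto simp: xA_def)
  also have "\<dots> = xA a a r * yH a r" using assms by simp
  also have "\<dots> = - (1 / qnum q (int r)) * ((q ^ r) powi (- (int m - 1)) * (q ^ r) powi (int m - 1)) * ((q3 q d ^ r) powi (- a) * (q3 q d ^ r) powi a)"
    by (simp add: xA_def yH_def)
  also have "(q ^ r) powi (- (int m - 1)) * (q ^ r) powi (int m - 1) = 1"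
    by (subst power_int_add[symmetric]) (simp_all add: q0)
  also have "(q3 q d ^ r) powi (- a) * (q3 q d ^ r) powi a = 1"
    using q13(3)[of r] by (subst power_int_add[symmetric]) simp_all
  finally show ?thesis by simp
qed

lemma pair_HB:
  assumes "a \<in> rows"
  shows "(\<Sum>s\<in>rows. xH s r * yB a s r) = - (1 / qnum q (int r))"
proof -
  have "(\<Sum>s\<in>rows. xH s r * yB a s r) = (\<Sum>s\<in>rows. if s = a then xH a r * yB a a r else 0)"
    by (intro sum.cong) (auto simp: yB_def)
  also have "\<dots> = xH a r * yB a a r" using assms by simp
  also have "\<dots> = - (1 / qnum q (int r)) * ((q1 q d ^ r) powi (- a) * (q1 q d ^ r) powi a)"
    by (simp add: xH_def yB_def)
  also have "(q1 q d ^ r) powi (- a) * (q1 q d ^ r) powi a = 1"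
    using q13(2)[of r] by (subst power_int_add[symmetric]) simp_all
  finally show ?thesis by simp
qed

lemma pair_BH:
  assumes "a \<in> rows" "r > 0"
  shows "(\<Sum>s\<in>rows. xB a s r * yH s r) = (q ^ r) powi int m / qnum q (int r)"
proof -
  define Z where "Z = inverse (q ^ r * q ^ r)"
  have zz: "(q1 q d ^ r) powi s * (q3 q d ^ r) powi s = Z powi s" for s unfolding Z_def by (rule q13_powi)
  have zi: "inverse (q ^ r) * inverse (q ^ r) = Z" by (simp add: Z_def)
  define w where "w = q ^ r * (q ^ r) powi (int m - 1) / qnum q (int r)"
  have "(\<Sum>s\<in>rows. xB a s r * yH s r) = (\<Sum>s\<in>insert a {0..<a}. xB a s r * yH s r)"
    by (rule sum.mono_neutral_right) (use assms in \<open>auto simp: xB_def\<close>)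
  also have "\<dots> = xB a a r * yH a r + (\<Sum>s\<in>{0..<a}. xB a s r * yH s r)" by simp
  also have "xB a a r * yH a r = w * Z powi a"
    by (simp add: xB_def yH_def w_def zz[symmetric])
  also have "(\<Sum>s\<in>{0..<a}. xB a s r * yH s r) = w * ((1 - Z) * (\<Sum>s\<in>{0..<a}. Z powi s))"
    unfolding sum_distrib_left by (intro sum.cong) (auto simp: xB_def yH_def w_def zz[symmetric] zi)
  also have "(1 - Z) * (\<Sum>s\<in>{0..<a}. Z powi s) = Z powi 0 - Z powi a"
    unfolding Z_def by (rule geo_rows(2)) (use assms in auto)
  also have "w * Z powi a + w * (Z powi 0 - Z powi a) = w" by (simp add: algebra_simps)
  also have "w = (q ^ r) powi int m / qnum q (int r)"
    using q0 by (simp add: w_def power_int_diff)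
  finally show ?thesis .
qed

lemma pair_HH:
  assumes "r > 0"
  shows "(\<Sum>s\<in>rows. xH s r * yH s r) * qnum q (int r) = ((q ^ m) ^ r - inverse ((q ^ m) ^ r)) / (q - inverse q)"
proof -
  define x where "x = q ^ r"
  define Z where "Z = inverse (x * x)"
  have zz: "(q1 q d ^ r) powi s * (q3 q d ^ r) powi s = Z powi s" for s unfolding Z_def x_def by (rule q13_powi)
  have x0: "x \<noteq> 0" by (simp add: x_def q0)
  have "(\<Sum>s\<in>rows. xH s r * yH s r) = x powi (int m - 1) * (\<Sum>s\<in>rows. Z powi s)"
    unfolding sum_distrib_left by (intro sum.cong) (auto simp: xH_def yH_def x_def zz[symmetric])
  moreover have "x powi (int m - 1) * (x * (1 - Z)) * (\<Sum>s\<in>rows. Z powi s) = x powi int m * (Z powi 0 - Z powi int m)"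
  proof -
    have "(1 - Z) * (\<Sum>s\<in>rows. Z powi s) = Z powi 0 - Z powi int m"
      unfolding Z_def x_def by (rule geo_rows(2)) (use assms in auto)
    moreover have "x powi (int m - 1) * x = x powi int m" using x0 by (simp add: power_int_diff)
    ultimately show ?thesis by (metis (no_types, opaque_lifting) mult.assoc mult.commute)
  qed
  moreover have "x * (1 - Z) = x - inverse x" using x0 by (simp add: Z_def algebra_simps)
  moreover have "x powi int m * (Z powi 0 - Z powi int m) = x ^ m - inverse (x ^ m)"
    using x0 by (simp add: Z_def right_diff_distrib power_inverse power_mult_distrib)
  ultimately have "(\<Sum>s\<in>rows. xH s r * yH s r) * (x - inverse x) = x ^ m - inverse (x ^ m)" by (simp add: mult_ac)
  moreover have "qnum q (int r) = (x - inverse x) / (q - inverse q)"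
    by (simp add: qnum_def x_def power_int_minus)
  moreover have "x ^ m = (q ^ m) ^ r" by (simp add: x_def power_mult[symmetric] mult.commute)
  ultimately show ?thesis by simp
qed

end


section \<open>Momentum factors\<close>

lemma neg_one_powi_cong: "even (x - y) \<Longrightarrow> (- 1 :: complex) powi x = (- 1) powi y"
  by (cases "even x") (auto simp: power_int_minus_one_minus power_int_minus_left)

context fock_rep
begin

definition prev_col :: "int \<Rightarrow> int" where "prev_col i = (i - 1) mod int n"

definition pt :: "((int \<times> int) \<Rightarrow>\<^sub>0 int) \<Rightarrow> int \<Rightarrow> int \<Rightarrow> int" where
  "pt \<nu> s t = Poly_Mapping.lookup \<nu> (s mod int m, t mod int n)"

text \<open>The change of the momentum under \<open>E\<close> in row \<open>a\<close> and node
  \<open>i\<close>.\<close>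

definition beta :: "int \<Rightarrow> int \<Rightarrow> ((int \<times> int) \<Rightarrow>\<^sub>0 int)" where
  "beta a i = Poly_Mapping.single (a, i) 1 - Poly_Mapping.single (a, prev_col i) 1"

text \<open>The only nonzero entries of \<open>beta a i\<close>, as a function of the column.\<close>

definition gg :: "int \<Rightarrow> int \<Rightarrow> int" where
  "gg i c = (if c = i then 1 else 0) - (if c = prev_col i then 1 else 0)"

text \<open>The eigenvalue of the zero mode, as a function of the momentum.\<close>

definition ech :: "((int \<times> int) \<Rightarrow>\<^sub>0 int) \<Rightarrow> int \<Rightarrow> int" where
  "ech \<nu> c = - (\<Sum>s\<in>rows. pt \<nu> s c)"

lemma prev_col_cases: "i \<in> cols \<Longrightarrow> prev_col i = (if i = 0 then int n - 1 else i - 1)"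
  using n2 by (auto simp: prev_col_def zmod_minus1)

lemma prev_col_cols: "i \<in> cols \<Longrightarrow> prev_col i \<in> cols"
  using n2 by (simp add: prev_col_def)

lemma pt_simps [simp]: "pt (\<nu> + \<nu>') s t = pt \<nu> s t + pt \<nu>' s t" "pt (- \<nu>) s t = - pt \<nu> s t"
   "pt (\<nu> - \<nu>') s t = pt \<nu> s t - pt \<nu>' s t"
  by (simp_all add: pt_def lookup_add lookup_minus)

lemma pt_pc: "pt \<nu> s (i - 1) = pt \<nu> s (prev_col i)"
  by (simp add: pt_def prev_col_def)

lemma pt_beta:
  assumes "a \<in> rows" "i \<in> cols" "s \<in> rows" "c \<in> cols"
  shows "pt (beta a i) s c = (if s = a then gg i c else 0)"
  using assms by (auto simp: pt_def beta_def gg_def lookup_minus lookup_single when_def)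

lemma ech_beta:
  assumes "a \<in> rows" "i \<in> cols" "c \<in> cols"
  shows "ech (beta a i) c = - gg i c"
  using assms by (simp add: ech_def pt_beta)

lemma ech_add: "ech (\<nu> + \<nu>') c = ech \<nu> c + ech \<nu>' c"
  by (simp add: ech_def sum.distrib)

lemma partial_pt: "partial m n (\<mu>, \<nu>) s t = pt \<nu> s t"
  by (simp add: partial_def pt_def)

lemma e_check_ech: "e_check m n (\<mu>, \<nu>) c = ech \<nu> c"
proof -
  have "{0..int m - 1} = rows" by auto
  then show ?thesis by (simp add: e_check_def ech_def partial_pt)
qed

text \<open>On the sector of momentum \<open>\<nu>\<close> the operators \<open>U\<close> and
  \<open>V\<close> are multiples \<open>fU\<close> and \<open>fV\<close> of a monomial in
  \<open>z\<close> times a shift of the momentum. The exponents of \<open>z\<close>, of the square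
  root of \<open>dc\<close>, of \<open>q\<close> and of \<open>-1\<close> are kept apart, since
  they behave differently under shifts.\<close>

definition exU :: "int \<Rightarrow> int \<Rightarrow> ((int \<times> int) \<Rightarrow>\<^sub>0 int) \<Rightarrow> int" where
  "exU a i \<nu> = - pt \<nu> a (prev_col i) + pt \<nu> a i + 1"

definition exV :: "int \<Rightarrow> int \<Rightarrow> ((int \<times> int) \<Rightarrow>\<^sub>0 int) \<Rightarrow> int" where
  "exV a i \<nu> = pt \<nu> a (prev_col i) - pt \<nu> a i + 1"

definition XU :: "int \<Rightarrow> int \<Rightarrow> ((int \<times> int) \<Rightarrow>\<^sub>0 int) \<Rightarrow> int" where
  "XU a i \<nu> = (if i = 0 then (1 - 2 * int n) * ech \<nu> (int n - 1) + ech \<nu> 0 - 2 * int n * pt \<nu> a (int n - 1)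
     else (1 - 2 * i) * ech \<nu> (i - 1) + (1 + 2 * i) * ech \<nu> i - 2 * i * (pt \<nu> a (i - 1) - pt \<nu> a i))"

definition YU :: "int \<Rightarrow> int \<Rightarrow> ((int \<times> int) \<Rightarrow>\<^sub>0 int) \<Rightarrow> int" where
  "YU a i \<nu> = (int m - 1 - a) * exU a i \<nu> + (\<Sum>s\<in>rows. if s > a then pt \<nu> s (prev_col i) - pt \<nu> s i else 0)"

definition YV :: "int \<Rightarrow> int \<Rightarrow> ((int \<times> int) \<Rightarrow>\<^sub>0 int) \<Rightarrow> int" where
  "YV a i \<nu> = a * exV a i \<nu> - (\<Sum>s\<in>rows. if s < a then pt \<nu> s (prev_col i) - pt \<nu> s i else 0)"

definition SU :: "int \<Rightarrow> int \<Rightarrow> ((int \<times> int) \<Rightarrow>\<^sub>0 int) \<Rightarrow> int" where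
  "SU a i \<nu> = (if i = 0 then (\<Sum>t\<in>{0..<int n - 1}. pt \<nu> a t) else pt \<nu> a (i - 1) + 1)"

definition fU :: "int \<Rightarrow> int \<Rightarrow> ((int \<times> int) \<Rightarrow>\<^sub>0 int) \<Rightarrow> complex" where
  "fU a i \<nu> = (- 1) powi SU a i \<nu> * sd powi XU a i \<nu> * q powi YU a i \<nu>"

definition fV :: "int \<Rightarrow> int \<Rightarrow> ((int \<times> int) \<Rightarrow>\<^sub>0 int) \<Rightarrow> complex" where
  "fV a i \<nu> = (- 1) powi (SU a i \<nu> + 1) * sd powi (- XU a i \<nu>) * q powi YV a i \<nu>"

text \<open>The exponent of the sign in the operator of multiplication by
  \<open>e\<^bsup>\<plusminus>\<epsilon>\<^esup>\<close>.\<close>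

definition esg :: "((int \<times> int) \<Rightarrow>\<^sub>0 int) \<Rightarrow> int \<Rightarrow> int \<Rightarrow> int" where
  "esg \<nu> a c = (\<Sum>s = 0..a - 1. \<Sum>t = 0..int n - 1. pt \<nu> s t) + (\<Sum>t = 0..c - 1. pt \<nu> a t)"

lemma exp_eps_ket:
  assumes "a \<in> rows"
  shows "exp_eps m n c a i (ket (\<mu>, \<nu>)) =
    (- 1) powi esg \<nu> a (i mod int n) \<cdot> ket (\<mu>, \<nu> + Poly_Mapping.single (a, i mod int n) c)"
  using assms by (simp add: exp_eps_def esg_def partial_pt Let_def)

lemma esg_shift:
  assumes "a \<in> rows" "c \<in> cols" "c' \<in> cols"
  shows "esg (\<nu> + Poly_Mapping.single (a, c') z) a c = esg \<nu> a c + (if c' < c then z else 0)"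
proof -
  have 1: "pt (Poly_Mapping.single (a, c') z) s t = (if s = a \<and> t = c' then z else 0)" if "s \<in> rows" "t \<in> cols" for s t
    using that assms by (auto simp: pt_def lookup_single when_def)
  have "(\<Sum>s = 0..a - 1. \<Sum>t = 0..int n - 1. pt (Poly_Mapping.single (a, c') z) s t) = 0"
    by (intro sum.neutral ballI) (use assms in \<open>auto simp: 1\<close>)
  moreover have "(\<Sum>t = 0..c - 1. pt (Poly_Mapping.single (a, c') z) a t) = (\<Sum>t = 0..c - 1. if t = c' then z else 0)"
    by (intro sum.cong) (use assms in \<open>auto simp: 1\<close>)
  ultimately show ?thesis using assms by (simp add: esg_def sum.distrib)
qed

lemma esg_even:
  assumes "a \<in> rows" "i \<in> cols"
  shows "even (esg \<nu> a (prev_col i) + esg \<nu> a i - (if i = 0 then (\<Sum>t\<in>{0..<int n - 1}. pt \<nu> a t) else pt \<nu> a (i - 1)))"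
proof (cases "i = 0")
  case True
  have "{0..int n - 1 - 1} = {0..<int n - 1}" by auto
  then show ?thesis using True assms by (simp add: esg_def prev_col_cases)
next
  case False
  have "{0..i - 1} = insert (i - 1) {0..i - 1 - 1}" using False assms by auto
  then have "(\<Sum>t = 0..i - 1. pt \<nu> a t) = pt \<nu> a (i - 1) + (\<Sum>t = 0..i - 1 - 1. pt \<nu> a t)" by simp
  then show ?thesis using False assms by (simp add: esg_def prev_col_cases)
qed

definition U0 :: "int \<Rightarrow> int \<Rightarrow> fock \<Rightarrow> fock" where
  "U0 a i = exp_eps m n 1 a i \<circ> exp_eps m n (- 1) a (i - 1) \<circ> diagonal (U_factor q sd m n a i)"

definition V0 :: "int \<Rightarrow> int \<Rightarrow> fock \<Rightarrow> fock" where
  "V0 a i = exp_eps m n 1 a (i - 1) \<circ> exp_eps m n (- 1) a i \<circ> diagonal (V_factor q sd m n a i)"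

lemma lin_exp_eps: "lin (exp_eps m n c a i)"
  unfolding exp_eps_def by (rule lin_linear_ext)

lemma exp_eps_scale: "exp_eps m n c a i (x \<cdot> v) = x \<cdot> exp_eps m n c a i v"
  using lin_exp_eps by (simp add: lin_def)

lemma diagonal_ket [simp]: "diagonal f (ket b) = f b \<cdot> ket b"
  by (simp add: diagonal_def)

lemma sum_rows_gt: "a \<in> rows \<Longrightarrow> (\<Sum>s = a + 1..int m - 1. f s) = (\<Sum>s\<in>rows. if s > a then f s else 0)" for f :: "int \<Rightarrow> int"
  by (subst sum.inter_filter[symmetric]) (auto intro!: sum.cong)

lemma sum_rows_lt: "a \<in> rows \<Longrightarrow> (\<Sum>s = 0..a - 1. f s) = (\<Sum>s\<in>rows. if s < a then f s else 0)" for f :: "int \<Rightarrow> int"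
  by (subst sum.inter_filter[symmetric]) (auto intro!: sum.cong)

lemma exponents: "U_exponent m n a i (\<mu>, \<nu>) = exU a i \<nu>" "V_exponent m n a i (\<mu>, \<nu>) = exV a i \<nu>"
  by (simp_all add: U_exponent_def V_exponent_def exU_def exV_def partial_pt pt_pc)

lemma U0_ket:
  assumes a: "a \<in> rows" and i: "i \<in> cols"
  shows "U0 a i (ket (\<mu>, \<nu>)) = fU a i \<nu> \<cdot> ket (\<mu>, \<nu> + beta a i)"
proof -
  let ?\<nu> = "\<nu> + Poly_Mapping.single (a, prev_col i) (- 1)"
  have im: "i mod int n = i" "(i - 1) mod int n = prev_col i" using i by (simp_all add: prev_col_def)
  have "U0 a i (ket (\<mu>, \<nu>)) = (U_factor q sd m n a i (\<mu>, \<nu>) * (- 1) powi esg \<nu> a (prev_col i) * (- 1) powi esg ?\<nu> a i)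
     \<cdot> ket (\<mu>, ?\<nu> + Poly_Mapping.single (a, i) 1)"
    by (simp add: U0_def exp_eps_scale exp_eps_ket[OF a] im)
  also have "?\<nu> + Poly_Mapping.single (a, i) 1 = \<nu> + beta a i"
    by (simp add: beta_def single_uminus algebra_simps)
  also have "(- 1 :: complex) powi esg \<nu> a (prev_col i) * (- 1) powi esg ?\<nu> a i = (- 1) powi (esg \<nu> a (prev_col i) + esg ?\<nu> a i)"
    by (simp add: power_int_add)
  then have "U_factor q sd m n a i (\<mu>, \<nu>) * (- 1) powi esg \<nu> a (prev_col i) * (- 1) powi esg ?\<nu> a i
      = U_factor q sd m n a i (\<mu>, \<nu>) * (- 1) powi (esg \<nu> a (prev_col i) + esg ?\<nu> a i)" by simp
  also have "(- 1 :: complex) powi (esg \<nu> a (prev_col i) + esg ?\<nu> a i) = (- 1) powi SU a i \<nu>"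
    using esg_even[OF a i, of \<nu>] esg_shift[OF a i prev_col_cols[OF i], of \<nu> "- 1"] i
    by (intro neg_one_powi_cong) (auto simp: SU_def prev_col_cases)
  also have "U_factor q sd m n a i (\<mu>, \<nu>) = sd powi XU a i \<nu> * q powi YU a i \<nu>"
  proof -
    have "YU a i \<nu> = (int m - 1 - a) * exU a i \<nu> + (\<Sum>s = a + 1..int m - 1. pt \<nu> s (i - 1) - pt \<nu> s i)"
      by (simp add: YU_def sum_rows_gt[OF a] pt_pc)
    then have "q powi YU a i \<nu> = (q powi (int m - 1 - a)) powi exU a i \<nu> * q powi (\<Sum>s = a + 1..int m - 1. pt \<nu> s (i - 1) - pt \<nu> s i)"
      using q0 by (simp add: power_int_add power_int_mult)
    then show ?thesis
      by (simp add: U_factor_def exponents XU_def partial_pt e_check_ech)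
  qed
  finally show ?thesis by (simp add: fU_def mult_ac)
qed

lemma V0_ket:
  assumes a: "a \<in> rows" and i: "i \<in> cols"
  shows "V0 a i (ket (\<mu>, \<nu>)) = fV a i \<nu> \<cdot> ket (\<mu>, \<nu> + - beta a i)"
proof -
  let ?\<nu> = "\<nu> + Poly_Mapping.single (a, i) (- 1)"
  have im: "i mod int n = i" "(i - 1) mod int n = prev_col i" using i by (simp_all add: prev_col_def)
  have "V0 a i (ket (\<mu>, \<nu>)) = (V_factor q sd m n a i (\<mu>, \<nu>) * (- 1) powi esg \<nu> a i * (- 1) powi esg ?\<nu> a (prev_col i))
     \<cdot> ket (\<mu>, ?\<nu> + Poly_Mapping.single (a, prev_col i) 1)"
    by (simp add: V0_def exp_eps_scale exp_eps_ket[OF a] im)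
  also have "?\<nu> + Poly_Mapping.single (a, prev_col i) 1 = \<nu> + - beta a i"
    by (simp add: beta_def single_uminus algebra_simps)
  also have "(- 1 :: complex) powi esg \<nu> a i * (- 1) powi esg ?\<nu> a (prev_col i) = (- 1) powi (esg \<nu> a i + esg ?\<nu> a (prev_col i))"
    by (simp add: power_int_add)
  then have "V_factor q sd m n a i (\<mu>, \<nu>) * (- 1) powi esg \<nu> a i * (- 1) powi esg ?\<nu> a (prev_col i)
      = V_factor q sd m n a i (\<mu>, \<nu>) * (- 1) powi (esg \<nu> a i + esg ?\<nu> a (prev_col i))" by simp
  also have "(- 1 :: complex) powi (esg \<nu> a i + esg ?\<nu> a (prev_col i)) = (- 1) powi (SU a i \<nu> + 1)"
    using esg_even[OF a i, of \<nu>] esg_shift[OF a prev_col_cols[OF i] i, of \<nu> "- 1"] i n2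
    by (intro neg_one_powi_cong) (auto simp: SU_def prev_col_cases)
  also have "V_factor q sd m n a i (\<mu>, \<nu>) = sd powi (- XU a i \<nu>) * q powi YV a i \<nu>"
  proof -
    have "YV a i \<nu> = a * exV a i \<nu> + - (\<Sum>s = 0..a - 1. pt \<nu> s (i - 1) - pt \<nu> s i)"
      by (simp add: YV_def sum_rows_lt[OF a] pt_pc)
    then have "q powi YV a i \<nu> = (q powi a) powi exV a i \<nu> * q powi (- (\<Sum>s = 0..a - 1. pt \<nu> s (i - 1) - pt \<nu> s i))"
      using q0 by (simp only: power_int_add power_int_mult simp_thms)
    then show ?thesis
      by (simp add: V_factor_def exponents XU_def partial_pt e_check_ech algebra_simps)
  qed
  finally show ?thesis by (simp add: fV_def mult_ac)
qed

text \<open>The exponents are affine functions of the momentum, so that a shift by \<open>beta b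
  j\<close> changes them by a constant.\<close>

lemma XU_add: "XU a i (\<nu> + \<nu>') = XU a i \<nu> + XU a i \<nu>'"
  by (simp add: XU_def ech_add algebra_simps)

lemma XU_uminus: "XU a i (- \<nu>) = - XU a i \<nu>"
  by (simp add: XU_def ech_def sum_negf algebra_simps)

text \<open>Only neighbouring nodes of the same row see each other. The case \<open>i = 0\<close>,
  where the exponents have a different form, restores the cyclic symmetry: the terms proportional
  to \<open>n\<close> compensate the jump of the column index at the end of a row.\<close>

lemma XU_beta:
  assumes "a \<in> rows" "b \<in> rows" "i \<in> cols" "j \<in> cols"
  shows "XU a i (beta b j) - XU b j (beta a i) =
     (if a = b \<and> i \<noteq> j then (if prev_col j = i then 2 else 0) - (if prev_col i = j then 2 else 0) else 0)"
    and "XU a i (beta a i) = 0"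
proof -
  have c: "int n - 1 \<in> cols" "0 \<in> cols" using n2 by auto
  have X: "XU a i (beta b j) = - (gg j (prev_col i) + gg j i) + (if a = b then 0
      else if i = 0 then 2 * int n * gg j (prev_col i) else 2 * i * (gg j (prev_col i) - gg j i))"
    if "a \<in> rows" "b \<in> rows" "i \<in> cols" "j \<in> cols" for a b i j
  proof (cases "i = 0")
    case True
    then show ?thesis using that c by (simp add: XU_def ech_beta pt_beta prev_col_cases algebra_simps)
  next
    case False
    then have "i - 1 \<in> cols" using that by auto
    then show ?thesis using that False by (simp add: XU_def ech_beta pt_beta prev_col_cases algebra_simps)
  qed
  have inj: "prev_col i = prev_col j \<longleftrightarrow> i = j" and pne: "prev_col i \<noteq> i" "prev_col j \<noteq> j"
    using assms n2 by (auto simp: prev_col_cases split: if_splits)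
  show "XU a i (beta a i) = 0"
    unfolding X[OF assms(1,1,3,3)] using pne by (simp add: gg_def)
  show "XU a i (beta b j) - XU b j (beta a i) =
     (if a = b \<and> i \<noteq> j then (if prev_col j = i then 2 else 0) - (if prev_col i = j then 2 else 0) else 0)"
  proof (cases "i = j")
    case True
    then show ?thesis unfolding X[OF assms] X[OF assms(2,1,4,3)] by auto
  next
    case False
    define P where "P = (if prev_col j = i then 1 else 0 :: int)"
    define R where "R = (if prev_col i = j then 1 else 0 :: int)"
    have g: "gg j i = - P" "gg j (prev_col i) = R" "gg i j = - R" "gg i (prev_col j) = P"
      using False inj by (auto simp: gg_def P_def R_def)
    have PR: "P = 1 \<and> prev_col j = i \<or> P = 0 \<and> prev_col j \<noteq> i" "R = 1 \<and> prev_col i = j \<or> R = 0 \<and> prev_col i \<noteq> j"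
      by (auto simp: P_def R_def)
    have r: "(if prev_col j = i then 2 else 0 :: int) = 2 * P" "(if prev_col i = j then 2 else 0 :: int) = 2 * R"
      by (simp_all add: P_def R_def)
    show ?thesis
    proof (cases "a = b")
      case True
      then show ?thesis unfolding X[OF assms] X[OF assms(2,1,4,3)] g r using False by simp
    next
      case ne: False
      have "2 * P - 2 * R + (if i = 0 then 2 * int n * R else 2 * i * (R + P)) - (if j = 0 then 2 * int n * P else 2 * j * (P + R)) = 0"
        using PR
      proof (elim disjE conjE)
        assume "P = 1" "prev_col j = i" "R = 1" "prev_col i = j"
        then show ?thesis using assms n2 False by (auto simp: prev_col_cases split: if_splits)
      next
        assume "P = 1" "prev_col j = i" "R = 0" "prev_col i \<noteq> j"
        then show ?thesis using assms n2 False by (auto simp: prev_col_cases split: if_splits)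
      next
        assume "P = 0" "prev_col j \<noteq> i" "R = 1" "prev_col i = j"
        then show ?thesis using assms n2 False by (auto simp: prev_col_cases split: if_splits)
      qed simp
      then show ?thesis
        unfolding X[OF assms] X[OF assms(2,1,4,3)] g using ne by (auto simp: algebra_simps)
    qed
  qed
qed

lemma SU_beta:
  assumes "a \<in> rows" "b \<in> rows" "i \<in> cols" "j \<in> cols"
  shows "even (SU a i (\<nu> + beta b j) - SU a i \<nu> - (if a = b then gg j (prev_col i) else 0))"
    and "even (SU a i (\<nu> + - beta b j) - SU a i \<nu> - (if a = b then gg j (prev_col i) else 0))"
proof -
  have c: "int n - 1 \<in> cols" "0 \<in> cols" using n2 by auto
  define l where "l = (if i = 0 then (\<Sum>t\<in>{0..<int n - 1}. pt (beta b j) a t) else pt (beta b j) a (i - 1))"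
  have l: "SU a i (\<nu> + beta b j) = SU a i \<nu> + l" "SU a i (\<nu> + - beta b j) = SU a i \<nu> - l"
    by (simp_all add: SU_def l_def sum.distrib sum_subtractf)
  have "even (l - (if a = b then gg j (prev_col i) else 0))"
  proof (cases "i = 0")
    case True
    have cs: "cols = insert (int n - 1) {0..<int n - 1}" using n2 by auto
    have "(\<Sum>t\<in>cols. pt (beta b j) a t) = (\<Sum>t\<in>cols. if a = b then gg j t else 0)"
      using assms by (intro sum.cong) (auto simp: pt_beta)
    also have "\<dots> = 0"
      using assms(4) prev_col_cols[OF assms(4)] by (cases "a = b") (simp_all add: gg_def sum_subtractf)
    finally have "l = - pt (beta b j) a (int n - 1)" using True by (simp add: cs l_def)
    then show ?thesis using assms c True by (simp add: pt_beta prev_col_cases)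
  next
    case False
    then have "i - 1 \<in> cols" using assms by auto
    then show ?thesis using assms False by (simp add: l_def pt_beta prev_col_cases)
  qed
  then show "even (SU a i (\<nu> + beta b j) - SU a i \<nu> - (if a = b then gg j (prev_col i) else 0))"
    "even (SU a i (\<nu> + - beta b j) - SU a i \<nu> - (if a = b then gg j (prev_col i) else 0))"
    unfolding l by presburger+
qed

text \<open>The Cartan matrix, as the change of the exponent of \<open>z\<close> under a shift of the
  momentum.\<close>

definition GG :: "int \<Rightarrow> int \<Rightarrow> int" where "GG i j = gg j i - gg j (prev_col i)"

lemma GG_cases:
  assumes "i \<in> cols" "j \<in> cols"
  shows "GG i j = (if i = j then 2 else 0 - (if prev_col j = i then 1 else 0) - (if prev_col i = j then 1 else 0))"
    and "GG j i = GG i j"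
  using assms n2 by (auto simp: GG_def gg_def prev_col_cases split: if_splits)

lemma ex_beta:
  assumes "a \<in> rows" "b \<in> rows" "i \<in> cols" "j \<in> cols"
  shows "exU a i (\<nu> + - beta b j) = exU a i \<nu> - (if a = b then GG i j else 0)"
    and "exV b j (\<nu> + beta a i) = exV b j \<nu> - (if a = b then GG i j else 0)"
  using assms GG_cases(2)[OF assms(3,4)] prev_col_cols[OF assms(3)] prev_col_cols[OF assms(4)]
  by (simp_all add: exU_def exV_def pt_beta GG_def)

lemma Y_beta:
  assumes "a \<in> rows" "b \<in> rows" "i \<in> cols" "j \<in> cols"
  shows "YU a i (\<nu> + - beta b j) = YU a i \<nu> - (if a = b then (int m - 1 - a) * GG i j else 0) + (if b > a then GG i j else 0)"
    and "YV b j (\<nu> + beta a i) = YV b j \<nu> - (if a = b then b * GG i j else 0) + (if a < b then GG i j else 0)"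
proof -
  have p: "prev_col i \<in> cols" "prev_col j \<in> cols" using prev_col_cols assms by auto
  have 1: "(\<Sum>s\<in>rows. if s > a then pt (\<nu> + - beta b j) s (prev_col i) - pt (\<nu> + - beta b j) s i else 0)
     = (\<Sum>s\<in>rows. if s > a then pt \<nu> s (prev_col i) - pt \<nu> s i else 0) + (\<Sum>s\<in>rows. if s = b then (if b > a then GG i j else 0) else 0)"
    unfolding sum.distrib[symmetric]
    by (intro sum.cong refl) (use assms p in \<open>auto simp: pt_beta GG_def\<close>)
  have 2: "(\<Sum>s\<in>rows. if s < b then pt (\<nu> + beta a i) s (prev_col j) - pt (\<nu> + beta a i) s j else 0)
     = (\<Sum>s\<in>rows. if s < b then pt \<nu> s (prev_col j) - pt \<nu> s j else 0) - (\<Sum>s\<in>rows. if s = a then (if a < b then GG j i else 0) else 0)"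
    unfolding sum_subtractf[symmetric]
    by (intro sum.cong refl) (use assms p in \<open>auto simp: pt_beta GG_def\<close>)
  show "YU a i (\<nu> + - beta b j) = YU a i \<nu> - (if a = b then (int m - 1 - a) * GG i j else 0) + (if b > a then GG i j else 0)"
    unfolding YU_def 1 ex_beta[OF assms] using assms by (simp add: algebra_simps)
  show "YV b j (\<nu> + beta a i) = YV b j \<nu> - (if a = b then b * GG i j else 0) + (if a < b then GG i j else 0)"
    unfolding YV_def 2 ex_beta[OF assms] using assms GG_cases(2)[OF assms(3,4)] by (simp add: algebra_simps)
qed

text \<open>The central position of the contraction in row \<open>a\<close>; the contraction of
  \<open>E\<close> and \<open>F\<close> has its zeros or poles at \<open>z = gam a \<beta>
  w\<close>, where \<open>\<beta>\<close> is \<open>dc\<close> or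
  \<open>dc\<^sup>-\<^sup>1\<close> for neighbouring nodes and \<open>q\<close> or
  \<open>q\<^sup>-\<^sup>1\<close> for equal nodes.\<close>

definition gam :: "int \<Rightarrow> complex" where "gam a = q powi (2 * a - int m + 1)"

definition betas :: "int \<Rightarrow> int \<Rightarrow> complex list" where
  "betas i j = (if prev_col j = i then [dc] else []) @ (if prev_col i = j then [inverse dc] else [])"

lemma sd0: "sd \<noteq> 0" using sd dc0 by auto

text \<open>The factor is the ratio by which the two expansions of the contraction, around \<open>w/z =
  0\<close> and around \<open>z/w = 0\<close>, differ; it is supplied by the powers of
  \<open>q\<close> and \<open>dc\<close> and by the signs in \<open>U\<close> and
  \<open>V\<close>.\<close>

lemma momentum_exchange:
  assumes ab: "a \<in> rows" "b \<in> rows" and ij: "i \<in> cols" "j \<in> cols" and ne: "a \<noteq> b \<or> i \<noteq> j"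
  shows "fU a i \<nu> * fV b j (\<nu> + beta a i) = fV b j \<nu> * fU a i (\<nu> + - beta b j) *
     (if a = b then (\<Prod>\<beta>\<leftarrow>betas i j. - (gam a * \<beta>)) else 1)"
proof -
  define S1 S2 X1 X2 Y1 Y2 where S1: "S1 = (SU b j \<nu> + 1) + SU a i (\<nu> + - beta b j)"
    and S2: "S2 = SU a i \<nu> + (SU b j (\<nu> + beta a i) + 1)"
    and X1: "X1 = - XU b j \<nu> + XU a i (\<nu> + - beta b j)" and X2: "X2 = XU a i \<nu> + - XU b j (\<nu> + beta a i)"
    and Y1: "Y1 = YV b j \<nu> + YU a i (\<nu> + - beta b j)" and Y2: "Y2 = YU a i \<nu> + YV b j (\<nu> + beta a i)"
  have Z1: "fV b j \<nu> * fU a i (\<nu> + - beta b j) = (- 1) powi S1 * sd powi X1 * q powi Y1"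
    unfolding fU_def fV_def S1 X1 Y1 using q0 sd0 by (simp only: power_int_add neg_equal_0_iff_equal one_neq_zero simp_thms mult_ac)
  have Z2: "fU a i \<nu> * fV b j (\<nu> + beta a i) = (- 1) powi S2 * sd powi X2 * q powi Y2"
    unfolding fU_def fV_def S2 X2 Y2 using q0 sd0 by (simp only: power_int_add neg_equal_0_iff_equal one_neq_zero simp_thms mult_ac)
  define D where "D = (if a = b then (if prev_col j = i then 1 else 0) + (if prev_col i = j then 1 else 0) else (0::int))"
  define \<Delta> where "\<Delta> = (if a = b then (if prev_col j = i then 2 else 0) - (if prev_col i = j then 2 else 0) else (0::int))"
  have S: "even (S2 - (S1 + D))"
  proof -
    have "even ((if a = b then gg i (prev_col j) else 0) + (if a = b then gg j (prev_col i) else 0) - D)"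
      using ij ne n2 unfolding D_def gg_def by (auto simp: prev_col_cases)
    then show ?thesis using SU_beta(1)[OF ab(2,1) ij(2,1), of \<nu>] SU_beta(2)[OF ab ij, of \<nu>]
      unfolding S1 S2 by presburger
  qed
  have X: "X2 = X1 + \<Delta>"
    unfolding X1 X2 XU_add XU_uminus \<Delta>_def using XU_beta(1)[OF ab ij] ne by (auto split: if_splits)
  have Y: "Y2 = Y1 + (2 * a - int m + 1) * D"
    unfolding Y1 Y2 Y_beta[OF ab ij] using GG_cases(1)[OF ij] ne by (auto simp: D_def algebra_simps)
  have "(- 1 :: complex) powi S2 = (- 1) powi (S1 + D)" by (rule neg_one_powi_cong[OF S])
  then have "fU a i \<nu> * fV b j (\<nu> + beta a i) = fV b j \<nu> * fU a i (\<nu> + - beta b j) *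
       ((- 1) powi D * sd powi \<Delta> * q powi ((2 * a - int m + 1) * D))"
    unfolding Z1 Z2 X Y using q0 sd0 by (simp add: power_int_add)
  also have "(- 1) powi D * sd powi \<Delta> * q powi ((2 * a - int m + 1) * D)
      = (if a = b then (\<Prod>\<beta>\<leftarrow>betas i j. - (gam a * \<beta>)) else 1)"
  proof -
    have "sd powi 2 = dc" "sd powi (- 2) = inverse dc" using sd by (simp_all add: power_int_minus)
    moreover have "q powi ((2 * a - int m + 1) * 2) = gam a * gam a"
      by (subst mult_2_right, subst power_int_add) (simp_all add: q0 gam_def)
    ultimately show ?thesis
      using dc0 by (cases "a = b"; cases "prev_col j = i"; cases "prev_col i = j")
        (simp_all add: D_def \<Delta>_def betas_def gam_def[symmetric] power_int_minus)
  qed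
  finally show ?thesis .
qed

section \<open>The commutator of the currents\<close>

definition EV :: "int \<Rightarrow> int \<Rightarrow> int \<Rightarrow> endo" where
  "EV a i = vertex (fpsp (xA a) i) (fpsm (yA a) i) (fU a i) (beta a i) (exU a i)"

definition FV :: "int \<Rightarrow> int \<Rightarrow> int \<Rightarrow> endo" where
  "FV a i = vertex (fpsp (xB a) i) (fpsm (yB a) i) (fV a i) (- beta a i) (exV a i)"

lemma product_comm:
  fixes X Y :: "int \<Rightarrow> endo"
  assumes "\<And>k. T * X k - X k * T = \<phi> \<bullet> X (k + r)" "\<And>k. T * Y k - Y k * T = \<psi> \<bullet> Y (k + r)"
  shows "T * (X k * Y l - Y l * X k) - (X k * Y l - Y l * X k) * T =
     \<phi> \<bullet> (X (k + r) * Y l - Y l * X (k + r)) + \<psi> \<bullet> (X k * Y (l + r) - Y (l + r) * X k)"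
proof -
  have "T * (X k * Y l - Y l * X k) - (X k * Y l - Y l * X k) * T =
     ((T * X k - X k * T) * Y l - Y l * (T * X k - X k * T)) + (X k * (T * Y l - Y l * T) - (T * Y l - Y l * T) * X k)"
    by (simp add: algebra_simps)
  then show ?thesis by (simp add: assms)
qed

text \<open>The scalars \<open>\<phi>\<close> and \<open>\<psi>\<close> are also recorded as
  commutators with the exponents, because those of the Cartan currents are combinations of the
  same exponents.\<close>

lemma mode_scalars:
  assumes "r \<noteq> 0"
  obtains \<phi> \<psi> where "\<And>k. al s t r * EV a i k - EV a i k * al s t r = \<phi> \<bullet> EV a i (k + r)"
    "\<And>k. al s t r * FV b j k - FV b j k * al s t r = \<psi> \<bullet> FV b j (k + r)"
    "r > 0 \<Longrightarrow> al s t r * rowm (yA a) i (nat r) - rowm (yA a) i (nat r) * al s t r = \<phi> \<bullet> 1"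
    "r > 0 \<Longrightarrow> al s t r * rowm (yB b) j (nat r) - rowm (yB b) j (nat r) * al s t r = \<psi> \<bullet> 1"
    "r < 0 \<Longrightarrow> al s t r * rowp (xA a) i (nat (- r)) - rowp (xA a) i (nat (- r)) * al s t r = \<phi> \<bullet> 1"
    "r < 0 \<Longrightarrow> al s t r * rowp (xB b) j (nat (- r)) - rowp (xB b) j (nat (- r)) * al s t r = \<psi> \<bullet> 1"
proof -
  have "\<exists>\<phi>. (r > 0 \<longrightarrow> al s t r * rowm y i (nat r) - rowm y i (nat r) * al s t r = \<phi> \<bullet> 1) \<and>
     (r < 0 \<longrightarrow> al s t r * rowp x i (nat (- r)) - rowp x i (nat (- r)) * al s t r = \<phi> \<bullet> 1)" for x y i
    using bspan_scalar[OF bspan_al[of s t r] rowm_span[of y i "nat r"]] bspan_scalar[OF bspan_al[of s t r] rowp_span[of x i "nat (- r)"]] assms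
    by (cases "r > 0") auto
  then obtain \<phi> \<psi> where p: "r > 0 \<longrightarrow> al s t r * rowm (yA a) i (nat r) - rowm (yA a) i (nat r) * al s t r = \<phi> \<bullet> 1"
     "r < 0 \<longrightarrow> al s t r * rowp (xA a) i (nat (- r)) - rowp (xA a) i (nat (- r)) * al s t r = \<phi> \<bullet> 1"
     "r > 0 \<longrightarrow> al s t r * rowm (yB b) j (nat r) - rowm (yB b) j (nat r) * al s t r = \<psi> \<bullet> 1"
     "r < 0 \<longrightarrow> al s t r * rowp (xB b) j (nat (- r)) - rowp (xB b) j (nat (- r)) * al s t r = \<psi> \<bullet> 1"
    by meson
  have "al s t r * EV a i k - EV a i k * al s t r = \<phi> \<bullet> EV a i (k + r)" for k
    unfolding EV_def by (rule vertex_bspan[OF annih_fpsp creat_fpsm bspan_al assms]) (use p in auto)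
  moreover have "al s t r * FV b j k - FV b j k * al s t r = \<psi> \<bullet> FV b j (k + r)" for k
    unfolding FV_def by (rule vertex_bspan[OF annih_fpsp creat_fpsm bspan_al assms]) (use p in auto)
  ultimately show thesis using p by (intro that[of \<phi> \<psi>]) auto
qed

lemma linear_ode:
  "fps_deriv (1 - fps_const c * fps_X) = (1 - fps_const c * fps_X) * Abs_fps (\<lambda>r. - (c ^ Suc r))" for c :: complex
proof (rule fps_ext)
  fix k show "fps_deriv (1 - fps_const c * fps_X) $ k = ((1 - fps_const c * fps_X) * Abs_fps (\<lambda>r. - (c ^ Suc r))) $ k"
    by (cases k) (simp_all add: algebra_simps)
qed

text \<open>With \<open>t = 0\<close> the polynomial is \<open>\<Prod> (1 - x y)\<close>, the
  exponential of minus the power sums.\<close>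

lemma den_poly_ode:
  "fps_of_poly (den_poly q (map (\<lambda>x. (x, 0)) xs)) $ 0 = 1 \<and>
   fps_deriv (fps_of_poly (den_poly q (map (\<lambda>x. (x, 0)) xs))) = fps_of_poly (den_poly q (map (\<lambda>x. (x, 0)) xs)) *
     Abs_fps (\<lambda>r. - (\<Sum>x\<leftarrow>xs. x ^ Suc r))"
proof (induction xs)
  case Nil
  have "Abs_fps (\<lambda>r. - (\<Sum>x\<leftarrow>[]. x ^ Suc r)) = (0 :: complex fps)" by (rule fps_ext) simp
  then show ?case by simp
next
  case (Cons x xs)
  let ?P = "fps_of_poly (den_poly q (map (\<lambda>x. (x, 0)) xs))" and ?L = "1 - fps_const x * fps_X"
  have P: "fps_of_poly (den_poly q (map (\<lambda>x. (x, 0)) (x # xs))) = ?L * ?P"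
    by (simp add: fps_of_poly_mult fps_of_poly_pCons mult.commute del: mult_pCons_left)
  have "fps_deriv (?L * ?P) = ?L * (?P * Abs_fps (\<lambda>r. - (\<Sum>x\<leftarrow>xs. x ^ Suc r))) + (?L * Abs_fps (\<lambda>r. - (x ^ Suc r))) * ?P"
    by (simp only: fps_deriv_mult linear_ode) (simp only: Cons.IH)
  also have "\<dots> = (?L * ?P) * (Abs_fps (\<lambda>r. - (\<Sum>x\<leftarrow>xs. x ^ Suc r)) + Abs_fps (\<lambda>r. - (x ^ Suc r)))"
    by (simp only: distrib_left mult_ac)
  also have "Abs_fps (\<lambda>r. - (\<Sum>x\<leftarrow>xs. x ^ Suc r)) + Abs_fps (\<lambda>r. - (x ^ Suc r)) = Abs_fps (\<lambda>r. - (\<Sum>x\<leftarrow>x # xs. x ^ Suc r))"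
    by (rule fps_ext) simp
  finally show ?case unfolding P using Cons.IH by simp
qed

lemma a_coeff_pc:
  assumes "i \<in> cols" "j \<in> cols" "r > 0"
  shows "a_coeff q dc n i j (int r) = qnum q (int r) / of_nat r *
     ((q ^ r + inverse (q ^ r)) * (if i = j then 1 else 0) - dc ^ r * (if prev_col j = i then 1 else 0) - inverse (dc ^ r) * (if prev_col i = j then 1 else 0))"
proof -
  have "i mod int n = (j + 1) mod int n \<longleftrightarrow> prev_col i = j"
    using mod_neighbours(2)[OF assms(1,2) n2] assms by (auto simp: prev_col_cases)
  moreover have "i mod int n = (j - 1) mod int n \<longleftrightarrow> prev_col j = i" using assms by (auto simp: prev_col_def)
  ultimately show ?thesis using assms by (simp add: a_coeff_def kdelta_def power_int_minus)
qed

lemma gam_inverse: "inverse (gam a) = q powi (int m - 1 - 2 * a)"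
  unfolding gam_def power_int_minus[symmetric] by (rule arg_cong[where f = "power_int q"]) simp

lemma gam0: "gam a \<noteq> 0" by (simp add: gam_def q0)

text \<open>The contractions in the two orders are the polynomials \<open>\<Prod> (1 - x w/z)\<close>
  and \<open>\<Prod> (1 - x\<^sup>-\<^sup>1 z/w)\<close>, which agree up to the monomial factor
  that is compensated by \<open>momentum_exchange\<close>. In particular there are no poles at
  which a delta function could be supported.\<close>

theorem EF_vanish:
  assumes ab: "a \<in> rows" "b \<in> rows" and ij: "i \<in> cols" "j \<in> cols" and ne: "a \<noteq> b \<or> i \<noteq> j"
  shows "EV a i k * FV b j l = FV b j l * EV a i k"
proof -
  define T where "T k l = EV a i k * FV b j l - FV b j l * EV a i k" for k l
  \<comment> \<open>The zeros of the contraction; there are none between different rows.\<close>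
  define xs where "xs = (if a = b then map (\<lambda>\<beta>. gam a * \<beta>) (betas i j) else [])"
  define h1 where "h1 = fps_of_poly (den_poly q (map (\<lambda>x. (x, 0)) xs))"
  define h2 where "h2 = fps_of_poly (den_poly q (map (\<lambda>x. (x, 0)) (map inverse xs)))"
  have len: "int (length xs) = (if a = b then - GG i j else 0)"
    using ne by (auto simp: xs_def betas_def GG_cases[OF ij])
  have nz: "\<forall>(\<beta>, t) \<in> set (map (\<lambda>x. (x, 0)) xs). \<beta> \<noteq> 0"
    by (auto simp: xs_def betas_def gam0 dc0 split: if_splits)
  have rel: "h1 $ p = (\<Prod>x\<leftarrow>xs. - x) * h2 $ (length xs - p)" if "p \<le> length xs" for p
  proof -
    have 1: "num_poly q (map (\<lambda>x. (x, 0)) ys) = den_poly q (map (\<lambda>x. (x, 0)) ys)" for ys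
      by (induction ys) simp_all
    have 2: "fac_inv (map (\<lambda>x. (x, 0)) xs) = map (\<lambda>x. (x, 0)) (map inverse xs)" by (simp add: fac_inv_def)
    have 3: "(\<Prod>(\<beta>, t)\<leftarrow>map (\<lambda>x. (x, 0 :: int)) xs. - \<beta>) = (\<Prod>x\<leftarrow>xs. - x)" by (simp add: comp_def)
    show ?thesis
      using coeff_reflect(1)[OF q0 nz, of p] that unfolding 1 2 3 by (simp add: h1_def h2_def)
  qed
  have deg: "h1 $ p = 0" "h2 $ p = 0" if "p > length xs" for p
  proof -
    have nz': "\<forall>(\<beta>, t) \<in> set (map (\<lambda>x. (x, 0)) (map inverse xs)). \<beta> \<noteq> 0" using nz by auto
    show "h1 $ p = 0" "h2 $ p = 0"
      using that poly_degree(1)[OF q0 nz] poly_degree(1)[OF q0 nz'] by (auto simp: h1_def h2_def coeff_eq_0)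
  qed
  have cancel: "x / (qnum q (int r))\<^sup>2 * (qnum q (int r) * (qnum q (int r) / R * y)) = x * y / R"
    if "r > 0" for x y R :: complex and r
    using qnum_nz[of "int r"] that by (simp add: power2_eq_square)
  have k1: "fpsp (xA a) i $ r * fpsm (yB b) j $ r - fpsm (yB b) j $ r * fpsp (xA a) i $ r
       = (- (\<Sum>x\<leftarrow>xs. x ^ r) / of_nat r) \<bullet> 1" if r: "r > 0" for r
  proof -
    have "(\<Sum>s\<in>rows. xA a s r * yB b s r) * (qnum q (int r) * a_coeff q dc n i j (int r)) = - (\<Sum>x\<leftarrow>xs. x ^ r) / of_nat r"
    proof (cases "a = b")
      case True
      then have "i \<noteq> j" using ne by simp
      then show ?thesis
        unfolding pair_AB[OF ab] a_coeff_pc[OF ij r] if_P[OF True] if_P[OF True[symmetric]] cancel[OF r]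
        by (auto simp: True xs_def betas_def gam_def power_mult_distrib power_inverse divide_inverse algebra_simps)
    qed (use r in \<open>simp add: pair_AB[OF ab] xs_def\<close>)
    with row_commutator[OF ij r, of "xA a" "yB b"] r show ?thesis by simp
  qed
  have k2: "fpsp (xB b) j $ r * fpsm (yA a) i $ r - fpsm (yA a) i $ r * fpsp (xB b) j $ r
       = (- (\<Sum>x\<leftarrow>map inverse xs. x ^ r) / of_nat r) \<bullet> 1" if r: "r > 0" for r
  proof -
    have "(\<Sum>s\<in>rows. xB b s r * yA a s r) * (qnum q (int r) * a_coeff q dc n j i (int r)) = - (\<Sum>x\<leftarrow>map inverse xs. x ^ r) / of_nat r"
    proof (cases "a = b")
      case True
      then have "i \<noteq> j" using ne by simp
      then show ?thesis
        unfolding pair_BA[OF ab r] a_coeff_pc[OF ij(2,1) r] if_P[OF True] if_P[OF True[symmetric]] cancel[OF r]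
        by (auto simp: True xs_def betas_def gam_inverse power_mult_distrib power_inverse divide_inverse algebra_simps)
    qed (use r in \<open>simp add: pair_BA[OF ab r] xs_def\<close>)
    with row_commutator[OF ij(2,1) r, of "xB b" "yA a"] r show ?thesis by simp
  qed
  have abs: "Abs_fps (\<lambda>r. of_nat (Suc r) * (- (\<Sum>x\<leftarrow>ys. x ^ Suc r) / of_nat (Suc r))) = Abs_fps (\<lambda>r. - (\<Sum>x\<leftarrow>ys. x ^ Suc r))"
    for ys :: "complex list" by (rule fps_ext) (simp del: of_nat_Suc power_Suc)
  have "T k l = 0"
  proof (rule vacuum_uniqueness)
    fix s t r :: int assume "r \<noteq> 0"
    then obtain \<phi> \<psi> where "\<And>k. al s t r * EV a i k - EV a i k * al s t r = \<phi> \<bullet> EV a i (k + r)"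
      "\<And>k. al s t r * FV b j k - FV b j k * al s t r = \<psi> \<bullet> FV b j (k + r)"
      by (rule mode_scalars[of r s t a i b j]) blast
    from product_comm[where X = "EV a i" and Y = "FV b j", OF this] show "\<exists>\<phi> \<psi>. \<forall>k l. al s t r * T k l - T k l * al s t r = \<phi> \<bullet> T (k + r) l + \<psi> \<bullet> T k (l + r)"
      unfolding T_def by blast
  next
    fix k l b0 b' assume v: "vac b0" "vac b'"
    obtain \<mu> \<nu> where b0: "b0 = (\<mu>, \<nu>)" by (cases b0)
    let ?p = "- l - exV b j \<nu>" and ?p' = "- k - exU a i \<nu>" and ?D = "int (length xs)"
    let ?Z1 = "fV b j \<nu> * fU a i (\<nu> + - beta b j)" and ?Z2 = "fU a i \<nu> * fV b j (\<nu> + beta a i)"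
    have v0: "vac (\<mu>, \<nu>)" using v b0 by simp
    have e1: "exU a i (\<nu> + - beta b j) = exU a i \<nu> + ?D" and e2: "exV b j (\<nu> + beta a i) = exV b j \<nu> + ?D"
      using ex_beta[OF ab ij, of \<nu>] len by auto
    have 1: "Poly_Mapping.lookup (app (EV a i k * FV b j l) (ket b0)) b' =
      (if b' = (\<mu>, \<nu> + - beta b j + beta a i) \<and> ?p \<ge> 0 \<and> ?p' - ?D = - ?p then ?Z1 * h1 $ nat ?p else 0)"
    proof -
      have "Poly_Mapping.lookup (app (EV a i k * FV b j l) (ket b0)) b' =
        (if b' = (\<mu>, \<nu> + - beta b j + beta a i) \<and> ?p \<ge> 0 \<and> - k - exU a i (\<nu> + - beta b j) = l + exV b j \<nu>
         then ?Z1 * h1 $ nat ?p else 0)"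
        unfolding b0 EV_def FV_def
        by (rule vac_product[OF annih_fpsp creat_fpsm annih_fpsp creat_fpsm v0 v(2) k1])
           (use den_poly_ode[of xs] in \<open>simp_all only: h1_def abs\<close>)
      moreover have "- k - (exU a i \<nu> + ?D) = l + exV b j \<nu> \<longleftrightarrow> ?p' - ?D = - ?p" by linarith
      ultimately show ?thesis unfolding e1 by (simp only:)
    qed
    have 2: "Poly_Mapping.lookup (app (FV b j l * EV a i k) (ket b0)) b' =
      (if b' = (\<mu>, \<nu> + - beta b j + beta a i) \<and> ?p' \<ge> 0 \<and> ?p - ?D = - ?p' then ?Z2 * h2 $ nat ?p' else 0)"
    proof -
      have "Poly_Mapping.lookup (app (FV b j l * EV a i k) (ket b0)) b' =
        (if b' = (\<mu>, \<nu> + beta a i + - beta b j) \<and> ?p' \<ge> 0 \<and> - l - exV b j (\<nu> + beta a i) = k + exU a i \<nu>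
         then ?Z2 * h2 $ nat ?p' else 0)"
        unfolding b0 EV_def FV_def
        by (rule vac_product[OF annih_fpsp creat_fpsm annih_fpsp creat_fpsm v0 v(2) k2])
           (use den_poly_ode[of "map inverse xs"] in \<open>simp_all only: h2_def abs\<close>)
      moreover have "- l - (exV b j \<nu> + ?D) = k + exU a i \<nu> \<longleftrightarrow> ?p - ?D = - ?p'" by linarith
      moreover have "\<nu> + beta a i + - beta b j = \<nu> + - beta b j + beta a i" by (simp add: algebra_simps)
      ultimately show ?thesis unfolding e2 by (simp only:)
    qed
    have Z: "?Z2 = ?Z1 * (\<Prod>x\<leftarrow>xs. - x)"
      using momentum_exchange[OF ab ij ne, of \<nu>] by (simp add: xs_def comp_def)
    have "(if ?p \<ge> 0 \<and> ?p' - ?D = - ?p then ?Z1 * h1 $ nat ?p else 0) = (if ?p' \<ge> 0 \<and> ?p - ?D = - ?p' then ?Z2 * h2 $ nat ?p' else 0)"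
    proof (cases "?p + ?p' = ?D")
      case True
      consider "?p < 0" | "?p > ?D" | "?p \<ge> 0" "?p \<le> ?D" by linarith
      then show ?thesis
      proof cases
        case 1
        then have "nat ?p' > length xs" using True by linarith
        then show ?thesis using 1 by (simp add: deg)
      next
        case 2
        then have "nat ?p > length xs" "?p' < 0" using True by linarith+
        then show ?thesis by (simp add: deg)
      next
        case 3
        then have "nat ?p' = length xs - nat ?p" "nat ?p \<le> length xs" "?p' \<ge> 0" using True by linarith+
        then show ?thesis using 3 True rel[of "nat ?p"] by (simp add: Z)
      qed
    qed auto
    then show "Poly_Mapping.lookup (app (T k l) (ket b0)) b' = 0"
      unfolding T_def app_simps lookup_minus using 1 2 by (auto simp del: minus_add_distrib)
  qed
  then show ?thesis by (simp add: T_def)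
qed

end


context fock_rep
begin

text \<open>The ratio \<open>z / w\<close> at the pole that the contractions of the rows \<open>a -
  1\<close> and \<open>a\<close> have in common.\<close>

definition cc :: "int \<Rightarrow> complex" where "cc a = q powi (2 * a - int m)"

definition xG :: "int \<Rightarrow> int \<Rightarrow> nat \<Rightarrow> complex" where
  "xG a s r = (if s < a then (q - inverse q) * xH s r else 0)"

definition yG :: "int \<Rightarrow> int \<Rightarrow> nat \<Rightarrow> complex" where
  "yG a s r = (if s < a then 0 else - (q - inverse q) * cc a ^ r * yH s r)"

definition fT :: "int \<Rightarrow> int \<Rightarrow> ((int \<times> int) \<Rightarrow>\<^sub>0 int) \<Rightarrow> complex" where
  "fT a i \<nu> = q powi (\<Sum>s\<in>rows. if s < a then pt \<nu> s i - pt \<nu> s (prev_col i) else pt \<nu> s (prev_col i) - pt \<nu> s i)"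

text \<open>The coefficients of \<open>\<delta>(cc a w / z) T\<^sub>a(w)\<close>, where
  \<open>T\<^sub>a\<close> interpolates between \<open>K\<^sup>-\<close> for \<open>a = 0\<close>
  and \<open>K\<^sup>+\<close> for \<open>a = m\<close>: it contains the annihilation part of
  \<open>K\<^sup>+(w)\<close> of the rows below \<open>a\<close> and the creation part of
  \<open>K\<^sup>-(z)\<close>, \<open>z = cc a w\<close>, of the other rows.\<close>

definition TV :: "int \<Rightarrow> int \<Rightarrow> int \<Rightarrow> int \<Rightarrow> endo" where
  "TV a i k l = cc a powi k \<bullet> vertex (fpsp (xG a) i) (fpsm (yG a) i) (fT a i) 0 (\<lambda>_. 0) (k + l)"

lemma cc0: "cc a \<noteq> 0" by (simp add: cc_def q0)

lemma qnum_xr: "qnum q (int r) * (q - inverse q) = q ^ r - inverse (q ^ r)"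
  using g0 by (simp add: qnum_def power_int_minus)

lemma q13_minus:
  "(q3 q d ^ r) powi (- a) = (q ^ r) powi (2 * a) * (q1 q d ^ r) powi a"
  "(q1 q d ^ r) powi (- a) = (q ^ r) powi (2 * a) * (q3 q d ^ r) powi a"
proof -
  have e: "(q1 q d ^ r) powi a * (q3 q d ^ r) powi a * (q ^ r) powi (2 * a) = 1"
    unfolding q13_powi inverse_square_powi by (subst power_int_add[symmetric]) (simp_all add: q0)
  have nz: "(q1 q d ^ r) powi a \<noteq> 0" "(q3 q d ^ r) powi a \<noteq> 0" using q13(2,3)[of r] by auto
  show "(q3 q d ^ r) powi (- a) = (q ^ r) powi (2 * a) * (q1 q d ^ r) powi a"
    "(q1 q d ^ r) powi (- a) = (q ^ r) powi (2 * a) * (q3 q d ^ r) powi a"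
    unfolding power_int_minus using e nz by (simp_all add: field_simps)
qed

text \<open>At either of the two poles \<open>z = cc a' w\<close> the exponents of \<open>E\<close> and
  \<open>F\<close> add up to that of a Cartan current: the tails of \<open>A\<close> and
  \<open>B\<close> are multiples of the coefficients of \<open>H\<close>, and the row
  \<open>a\<close> itself contributes in full or not at all, depending on the pole.\<close>

lemma G_coeff:
  assumes a': "a' = a \<or> a' = a + 1" and r: "r > 0"
  shows "inverse (cc a') ^ r * xA a s r + xB a s r = xG a' s r"
    and "cc a' ^ r * yA a s r + yB a s r = yG a' s r"
proof -
  define x where "x = q ^ r"
  define y1 where "y1 = q1 q d ^ r"
  define y3 where "y3 = q3 q d ^ r"
  define w where "w = qnum q (int r)"
  have x0: "x \<noteq> 0" and w0: "w \<noteq> 0" using q0 qnum_nz[of "int r"] r by (auto simp: x_def w_def)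
  have wg: "w * (q - inverse q) = x - inverse x" unfolding w_def x_def by (rule qnum_xr)
  have c: "cc a' ^ r = x powi (2 * a' - int m)" "inverse (cc a') ^ r = x powi (int m - 2 * a')"
    unfolding cc_def x_def power_int_minus[symmetric] powi_pow by simp_all
  have add: "x powi k * x powi l = x powi (k + l)" for k l
    using x0 by (simp add: power_int_add)
  consider "s < a" | "s = a" | "s > a" by linarith
  then show "inverse (cc a') ^ r * xA a s r + xB a s r = xG a' s r"
  proof cases
    case 1
    have "x * (1 - inverse (x * x)) = w * (q - inverse q)" unfolding wg using x0 by (simp add: field_simps)
    then have "1 / w * x * y1 powi s * (1 - inverse (x * x)) = (q - inverse q) * y1 powi s"
      using w0 by (metis (no_types, opaque_lifting) divide_self_if mult.assoc mult.commute mult.left_neutral times_divide_eq_left)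
    then show ?thesis using 1 a' by (auto simp: xA_def xB_def xG_def xH_def simp flip: x_def y1_def w_def)
  next
    case 2
    have "x powi (int m - 2 * a') * (x powi (- (int m - 1)) * y3 powi (- a)) = x powi (1 + 2 * a - 2 * a') * y1 powi a"
      unfolding y3_def q13_minus(1) x_def[symmetric] y1_def[symmetric] mult.assoc[symmetric] add
      by (rule arg_cong[where f = "\<lambda>k. x powi k * y1 powi a"]) simp
    then have e: "inverse (cc a') ^ r * xA a s r + xB a s r = 1 / w * (x - x powi (1 + 2 * a - 2 * a')) * y1 powi a"
      unfolding c using 2 by (simp add: xA_def xB_def algebra_simps diff_divide_distrib flip: x_def y1_def y3_def w_def)
    show ?thesis
    proof (cases "a' = a")
      case True
      then show ?thesis unfolding e using 2 by (simp add: xG_def)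
    next
      case False
      then have a1: "a' = a + 1" using a' by simp
      have "1 / w * (x - x powi (1 + 2 * a - 2 * a')) = q - inverse q"
        using wg w0 by (simp add: a1 power_int_minus field_simps)
      then show ?thesis unfolding e using 2 by (simp add: xG_def xH_def a1 y1_def)
    qed
  next
    case 3
    then show ?thesis using a' by (auto simp: xA_def xB_def xG_def)
  qed
  consider "s < a" | "s = a" | "s > a" by linarith
  then show "cc a' ^ r * yA a s r + yB a s r = yG a' s r"
  proof cases
    case 1
    then show ?thesis using a' by (auto simp: yA_def yB_def yG_def)
  next
    case 2
    have e: "cc a' ^ r * yA a s r + yB a s r = 1 / w * (x powi (2 * a' - int m) * x powi (int m - 2) - x powi (2 * a)) * y3 powi a"
      unfolding c yB_def q13_minus(2) using 2
      by (simp add: yA_def algebra_simps diff_divide_distrib flip: x_def y3_def w_def)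
    have e2: "x powi (2 * a' - int m) * x powi (int m - 2) = x powi (2 * a' - 2)"
      unfolding add by (rule arg_cong[where f = "power_int x"]) simp
    show ?thesis
    proof (cases "a' = a")
      case True
      have "x powi (2 * a - 2) - x powi (2 * a) = - (w * (q - inverse q) * x powi (2 * a - 1))"
        unfolding wg using x0 by (simp add: power_int_diff field_simps power2_eq_square)
      then have "cc a' ^ r * yA a s r + yB a s r = - (q - inverse q) * x powi (2 * a - 1) * y3 powi a"
        unfolding e e2 unfolding True using w0 by simp (simp add: algebra_simps)
      moreover have "x powi (2 * a - 1) = cc a' ^ r * x powi (int m - 1)"
        unfolding c add unfolding True by (rule arg_cong[where f = "power_int x"]) simp
      ultimately show ?thesis using 2 True by (simp add: yG_def yH_def flip: x_def y3_def)
    next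
      case False
      then have a1: "a' = a + 1" using a' by simp
      then show ?thesis unfolding e e2 using 2 by (simp add: yG_def a1)
    qed
  next
    case 3
    have "1 - x * x = - (w * (q - inverse q) * x)" unfolding wg using x0 by (simp add: field_simps)
    moreover have "1 / w * P * Y * - (w * g * x) = - g * (P * x) * Y" for P Y g
      using w0 by simp
    ultimately have "1 / w * x powi (int m - 2) * y3 powi s * (1 - x * x) = - (q - inverse q) * (x powi (int m - 2) * x) * y3 powi s"
      by (simp only:)
    moreover have "x powi (int m - 2) * x = x powi (int m - 1)"
      using add[of "int m - 2" 1] by simp
    ultimately show ?thesis using 3 a' by (auto simp: yA_def yB_def yG_def yH_def simp flip: x_def y3_def w_def)
  qed
qed

lemma G_rows:
  assumes "a' = a \<or> a' = a + 1" "r > 0"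
  shows "rowp (xG a') i r = inverse (cc a') ^ r \<bullet> rowp (xA a) i r + rowp (xB a) i r"
    and "rowm (yG a') i r = cc a' ^ r \<bullet> rowm (yA a) i r + rowm (yB a) i r"
  unfolding rowp_def rowm_def G_coeff[OF assms, symmetric]
  by (simp_all add: smul_sum smul_left_distrib sum.distrib)

text \<open>The bosons act on the Cartan current by the sum of their actions on \<open>E\<close> and
  \<open>F\<close> at the pole.\<close>

lemma TV_comm:
  assumes a': "a' = a \<or> a' = a + 1" and r: "r \<noteq> 0"
    and "r > 0 \<Longrightarrow> al s t r * rowm (yA a) i (nat r) - rowm (yA a) i (nat r) * al s t r = \<phi> \<bullet> 1"
    and "r > 0 \<Longrightarrow> al s t r * rowm (yB a) i (nat r) - rowm (yB a) i (nat r) * al s t r = \<psi> \<bullet> 1"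
    and "r < 0 \<Longrightarrow> al s t r * rowp (xA a) i (nat (- r)) - rowp (xA a) i (nat (- r)) * al s t r = \<phi> \<bullet> 1"
    and "r < 0 \<Longrightarrow> al s t r * rowp (xB a) i (nat (- r)) - rowp (xB a) i (nat (- r)) * al s t r = \<psi> \<bullet> 1"
  shows "al s t r * TV a' i k l - TV a' i k l * al s t r = \<phi> \<bullet> TV a' i (k + r) l + \<psi> \<bullet> TV a' i k (l + r)"
proof -
  have lin: "T * (c \<bullet> X + Y) - (c \<bullet> X + Y) * T = c \<bullet> (T * X - X * T) + (T * Y - Y * T)" for T X Y :: endo and c
    by (simp add: algebra_simps)
  let ?V = "vertex (fpsp (xG a') i) (fpsm (yG a') i) (fT a' i) 0 (\<lambda>_. 0)"
  have "al s t r * ?V j - ?V j * al s t r = (cc a' powi r * \<phi> + \<psi>) \<bullet> ?V (j + r)" for j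
  proof (rule vertex_bspan[OF annih_fpsp creat_fpsm bspan_al r])
    assume pos: "r > 0"
    then have c: "cc a' ^ nat r = cc a' powi r" by (simp add: power_int_def)
    show "al s t r * fpsm (yG a') i $ nat r - fpsm (yG a') i $ nat r * al s t r = (cc a' powi r * \<phi> + \<psi>) \<bullet> 1"
      using pos by (simp add: G_rows(2)[OF a'] lin assms(3,4) c smul_left_distrib)
  next
    assume neg: "r < 0"
    then have c: "inverse (cc a') ^ nat (- r) = cc a' powi r" by (simp add: power_int_def)
    show "al s t r * fpsp (xG a') i $ nat (- r) - fpsp (xG a') i $ nat (- r) * al s t r = (cc a' powi r * \<phi> + \<psi>) \<bullet> 1"
      using neg by (simp add: G_rows(1)[OF a'] lin assms(5,6) c smul_left_distrib)
  qed
  then have "al s t r * TV a' i k l - TV a' i k l * al s t r = (cc a' powi k * (cc a' powi r * \<phi> + \<psi>)) \<bullet> ?V (k + l + r)"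
    by (simp add: TV_def flip: smul_simps(2,7))
  then show ?thesis
    using cc0[of a'] by (simp add: TV_def smul_left_distrib power_int_add algebra_simps)
qed

lemma qnum_rec: "qnum q (k + 1) + qnum q (k - 1) = (q + inverse q) * qnum q k"
  using q0 g0 by (simp add: qnum_def power_int_add power_int_diff power_int_minus add_divide_distrib[symmetric])
    (simp add: field_simps)

text \<open>The coefficients of \<open>1 / ((1 - \<gamma> q y) (1 - \<gamma> q\<^sup>-\<^sup>1
  y))\<close> are \<open>\<gamma>\<^sup>p [p + 1]\<close>; the logarithmic derivative is read off
  from the denominator.\<close>

lemma diag_contraction:
  fixes \<gamma> :: complex
  defines "h \<equiv> Abs_fps (\<lambda>p. \<gamma> ^ p * qnum q (int p + 1))"
  shows "h $ 0 = 1"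
    and "fps_deriv h = h * Abs_fps (\<lambda>r. of_nat (Suc r) * (\<gamma> ^ Suc r * (q ^ Suc r + inverse (q ^ Suc r)) / of_nat (Suc r)))"
proof -
  show h0: "h $ 0 = 1" using g0 by (simp add: h_def qnum_def power_int_minus)
  let ?xs = "[\<gamma> * q, \<gamma> * inverse q]"
  define P where "P = fps_of_poly (den_poly q (map (\<lambda>x. (x, 0)) ?xs))"
  define L where "L = Abs_fps (\<lambda>r. - (\<Sum>x\<leftarrow>?xs. x ^ Suc r))"
  have P': "fps_deriv P = P * L" unfolding P_def L_def using den_poly_ode[of ?xs] by blast
  have Pe: "P = 1 - fps_const (\<gamma> * (q + inverse q)) * fps_X + fps_const (\<gamma> * \<gamma>) * fps_X * fps_X"
  proof -
    have "P = (1 - fps_const (\<gamma> * q) * fps_X) * (1 - fps_const (\<gamma> * inverse q) * fps_X)"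
      by (simp add: P_def fps_of_poly_mult fps_of_poly_pCons mult.commute del: mult_pCons_left)
    also have "\<dots> = 1 - (fps_const (\<gamma> * q) + fps_const (\<gamma> * inverse q)) * fps_X
        + fps_const (\<gamma> * q) * fps_const (\<gamma> * inverse q) * fps_X * fps_X"
      by (simp only: algebra_simps mult_1_left mult_1_right)
    finally show ?thesis using q0 by (simp add: distrib_left)
  qed
  have PH: "P * h = 1"
  proof (rule fps_ext)
    fix p
    have "(P * h) $ p = h $ p - \<gamma> * (q + inverse q) * (if p = 0 then 0 else h $ (p - 1)) + \<gamma> * \<gamma> * (if p < 2 then 0 else h $ (p - 2))"
      by (simp add: Pe left_diff_distrib distrib_right mult.assoc)
        (auto simp: numeral_2_eq_2)
    also have "\<dots> = 1 $ p"
    proof (cases p)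
      case 0
      then show ?thesis using h0 by simp
    next
      case (Suc p')
      show ?thesis
      proof (cases p')
        case 0
        have "qnum q 2 = q + inverse q" using qnum_rec[of 1] h0 by (simp add: h_def)
        then show ?thesis using Suc 0 h0 by (simp add: h_def)
      next
        case (Suc p'')
        have "\<gamma> ^ p * qnum q (int p + 1) - \<gamma> * (q + inverse q) * (\<gamma> ^ p' * qnum q (int p' + 1))
            + \<gamma> * \<gamma> * (\<gamma> ^ p'' * qnum q (int p'' + 1))
          = \<gamma> ^ p * (qnum q (int p' + 1 + 1) - (q + inverse q) * qnum q (int p' + 1) + qnum q (int p' + 1 - 1))"
          using \<open>p = Suc p'\<close> Suc by (simp add: algebra_simps)
        also have "\<dots> = 0" using qnum_rec[of "int p' + 1"] by (simp add: algebra_simps)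
        finally show ?thesis using \<open>p = Suc p'\<close> Suc by (simp add: h_def)
      qed
    qed
    finally show "(P * h) $ p = 1 $ p" .
  qed
  have "P * fps_deriv h + fps_deriv P * h = fps_deriv (P * h)" by simp
  then have "P * fps_deriv h = - (fps_deriv P * h)" unfolding PH by (simp add: eq_neg_iff_add_eq_0)
  then have "h * (P * fps_deriv h) = h * (- (fps_deriv P * h))" by simp
  then have "(P * h) * fps_deriv h = (P * h) * (h * (- L))" unfolding P' by (simp add: mult_ac)
  then have "fps_deriv h = h * (- L)" by (simp add: PH)
  also have "- L = Abs_fps (\<lambda>r. of_nat (Suc r) * (\<gamma> ^ Suc r * (q ^ Suc r + inverse (q ^ Suc r)) / of_nat (Suc r)))"
    by (rule fps_ext) (simp add: L_def power_mult_distrib power_inverse distrib_left add_divide_distrib del: of_nat_Suc power_Suc)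
  finally show "fps_deriv h = h * Abs_fps (\<lambda>r. of_nat (Suc r) * (\<gamma> ^ Suc r * (q ^ Suc r + inverse (q ^ Suc r)) / of_nat (Suc r)))" .
qed

lemma momentum_diag:
  assumes a: "a \<in> rows" and i: "i \<in> cols"
  defines "N \<nu> \<equiv> pt \<nu> a (prev_col i) - pt \<nu> a i"
  defines "R \<nu> \<equiv> (\<Sum>s\<in>rows. if s > a then pt \<nu> s (prev_col i) - pt \<nu> s i else 0) - (\<Sum>s\<in>rows. if s < a then pt \<nu> s (prev_col i) - pt \<nu> s i else 0)"
  shows "fV a i \<nu> * fU a i (\<nu> + - beta a i) = gam a powi (N \<nu> + 1) * q powi R \<nu>"
    and "fU a i \<nu> * fV a i (\<nu> + beta a i) = gam a powi (N \<nu> - 1) * q powi R \<nu>"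
    and "fT (a + 1) i \<nu> = q powi (R \<nu> - N \<nu>)" "fT a i \<nu> = q powi (R \<nu> + N \<nu>)"
proof -
  have GG: "GG i i = 2" using GG_cases(1)[OF i i] by simp
  have gg: "gg i (prev_col i) = - 1" using i n2 by (auto simp: gg_def prev_col_cases)
  have Y: "YV a i \<nu> + YU a i (\<nu> + - beta a i) = (2 * a - int m + 1) * (N \<nu> + 1) + R \<nu>"
    "YU a i \<nu> + YV a i (\<nu> + beta a i) = (2 * a - int m + 1) * (N \<nu> - 1) + R \<nu>"
    unfolding Y_beta[OF a a i i] GG by (simp_all add: YU_def YV_def R_def N_def exU_def exV_def algebra_simps)
  have X: "- XU a i \<nu> + XU a i (\<nu> + - beta a i) = 0" "XU a i \<nu> + - XU a i (\<nu> + beta a i) = 0"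
    unfolding XU_add XU_uminus XU_beta(2)[OF a a i i] by simp_all
  have S: "even (SU a i \<nu> + 1 + SU a i (\<nu> + - beta a i) - 0)" "even (SU a i \<nu> + (SU a i (\<nu> + beta a i) + 1) - 0)"
    using SU_beta[OF a a i i, of \<nu>] unfolding gg by simp_all
  have "fV a i \<nu> * fU a i (\<nu> + - beta a i) = (- 1) powi (SU a i \<nu> + 1 + SU a i (\<nu> + - beta a i))
      * sd powi (- XU a i \<nu> + XU a i (\<nu> + - beta a i)) * q powi (YV a i \<nu> + YU a i (\<nu> + - beta a i))"
    unfolding fU_def fV_def using q0 sd0 by (simp only: power_int_add neg_equal_0_iff_equal one_neq_zero simp_thms mult_ac)
  then show "fV a i \<nu> * fU a i (\<nu> + - beta a i) = gam a powi (N \<nu> + 1) * q powi R \<nu>"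
    unfolding X Y neg_one_powi_cong[OF S(1)] gam_def using q0 by (simp add: power_int_add power_int_mult)
  have "fU a i \<nu> * fV a i (\<nu> + beta a i) = (- 1) powi (SU a i \<nu> + (SU a i (\<nu> + beta a i) + 1))
      * sd powi (XU a i \<nu> + - XU a i (\<nu> + beta a i)) * q powi (YU a i \<nu> + YV a i (\<nu> + beta a i))"
    unfolding fU_def fV_def using q0 sd0 by (simp only: power_int_add neg_equal_0_iff_equal one_neq_zero simp_thms mult_ac)
  then show "fU a i \<nu> * fV a i (\<nu> + beta a i) = gam a powi (N \<nu> - 1) * q powi R \<nu>"
    unfolding X Y neg_one_powi_cong[OF S(2)] gam_def using q0 by (simp add: power_int_add power_int_mult)
  define D where "D s = pt \<nu> s (prev_col i) - pt \<nu> s i" for s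
  have RN: "R \<nu> = (\<Sum>s\<in>rows. if s > a then D s else if s < a then - D s else 0)" "N \<nu> = (\<Sum>s\<in>rows. if s = a then D s else 0)"
    using a unfolding R_def N_def D_def by (auto simp: sum_subtractf[symmetric] intro!: sum.cong)
  have "(\<Sum>s\<in>rows. if s < a + 1 then pt \<nu> s i - pt \<nu> s (prev_col i) else pt \<nu> s (prev_col i) - pt \<nu> s i) = R \<nu> - N \<nu>"
    unfolding RN sum_subtractf[symmetric] by (intro sum.cong) (auto simp: D_def)
  then show "fT (a + 1) i \<nu> = q powi (R \<nu> - N \<nu>)" by (simp add: fT_def)
  have "(\<Sum>s\<in>rows. if s < a then pt \<nu> s i - pt \<nu> s (prev_col i) else pt \<nu> s (prev_col i) - pt \<nu> s i) = R \<nu> + N \<nu>"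
    unfolding RN sum.distrib[symmetric] by (intro sum.cong) (auto simp: D_def)
  then show "fT a i \<nu> = q powi (R \<nu> + N \<nu>)" by (simp add: fT_def)
qed

text \<open>The two orders of the product expand the same rational function at \<open>w/z = 0\<close>
  and at \<open>z/w = 0\<close>. Let \<open>N\<close> be the difference of the momenta at the
  columns \<open>i - 1\<close> and \<open>i\<close> of the row. Between vacuum vectors the
  commutator has, up to a power of \<open>q\<close> that is independent of \<open>k\<close>, the
  coefficient \<open>\<gamma>\<^sup>k [k - N]\<close> for every integer \<open>k\<close>, one
  order contributing for \<open>k > N\<close> and the other one for \<open>k < N\<close>, and this
  is the difference of the two geometric series on the right hand side.\<close>

theorem EF_diag:
  assumes a: "a \<in> rows" and i: "i \<in> cols"
  shows "EV a i k * FV a i l - FV a i l * EV a i k = (1 / (q - inverse q)) \<bullet> (TV (a + 1) i k l - TV a i k l)"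
proof -
  define C where "C k l = EV a i k * FV a i l - FV a i l * EV a i k" for k l
  define T where "T k l = C k l - (1 / (q - inverse q)) \<bullet> (TV (a + 1) i k l - TV a i k l)" for k l
  define g where "g = q - inverse q"
  define \<gamma> where "\<gamma> = gam a"
  have \<gamma>0: "\<gamma> \<noteq> 0" by (simp add: \<gamma>_def gam0)
  define h where "h c = Abs_fps (\<lambda>p. c ^ p * qnum q (int p + 1))" for c
  have pcne: "prev_col i \<noteq> i" using i n2 by (auto simp: prev_col_cases)
  have cancel: "x / (qnum q (int r))\<^sup>2 * (qnum q (int r) * (qnum q (int r) / R * y)) = x * y / R"
    if "r > 0" for x y R :: complex and r
    using qnum_nz[of "int r"] that by (simp add: power2_eq_square)
  have k1: "fpsp (xA a) i $ r * fpsm (yB a) i $ r - fpsm (yB a) i $ r * fpsp (xA a) i $ r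
       = (\<gamma> ^ r * (q ^ r + inverse (q ^ r)) / of_nat r) \<bullet> 1" if r: "r > 0" for r
  proof -
    have "(\<Sum>s\<in>rows. xA a s r * yB a s r) * (qnum q (int r) * a_coeff q dc n i i (int r)) = \<gamma> ^ r * (q ^ r + inverse (q ^ r)) / of_nat r"
      unfolding pair_AB[OF a a] a_coeff_pc[OF i i r] if_P[OF refl] cancel[OF r] using pcne by (simp add: \<gamma>_def gam_def)
    with row_commutator[OF i i r, of "xA a" "yB a"] r show ?thesis by simp
  qed
  have k2: "fpsp (xB a) i $ r * fpsm (yA a) i $ r - fpsm (yA a) i $ r * fpsp (xB a) i $ r
       = (inverse \<gamma> ^ r * (q ^ r + inverse (q ^ r)) / of_nat r) \<bullet> 1" if r: "r > 0" for r
  proof -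
    have "(\<Sum>s\<in>rows. xB a s r * yA a s r) * (qnum q (int r) * a_coeff q dc n i i (int r)) = inverse \<gamma> ^ r * (q ^ r + inverse (q ^ r)) / of_nat r"
      unfolding pair_BA[OF a a r] a_coeff_pc[OF i i r] if_P[OF refl] cancel[OF r] \<gamma>_def gam_inverse using pcne by simp
    with row_commutator[OF i i r, of "xB a" "yA a"] r show ?thesis by simp
  qed
  have "T k l = 0"
  proof (rule vacuum_uniqueness)
    fix s t r :: int assume r: "r \<noteq> 0"
    obtain \<phi> \<psi> where m: "\<And>k. al s t r * EV a i k - EV a i k * al s t r = \<phi> \<bullet> EV a i (k + r)"
      "\<And>k. al s t r * FV a i k - FV a i k * al s t r = \<psi> \<bullet> FV a i (k + r)"
      "r > 0 \<Longrightarrow> al s t r * rowm (yA a) i (nat r) - rowm (yA a) i (nat r) * al s t r = \<phi> \<bullet> 1"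
      "r > 0 \<Longrightarrow> al s t r * rowm (yB a) i (nat r) - rowm (yB a) i (nat r) * al s t r = \<psi> \<bullet> 1"
      "r < 0 \<Longrightarrow> al s t r * rowp (xA a) i (nat (- r)) - rowp (xA a) i (nat (- r)) * al s t r = \<phi> \<bullet> 1"
      "r < 0 \<Longrightarrow> al s t r * rowp (xB a) i (nat (- r)) - rowp (xB a) i (nat (- r)) * al s t r = \<psi> \<bullet> 1"
      using mode_scalars[of r s t a i a i, OF r] by blast
    have 1: "al s t r * C k l - C k l * al s t r = \<phi> \<bullet> C (k + r) l + \<psi> \<bullet> C k (l + r)" for k l
      unfolding C_def by (rule product_comm[where X = "EV a i" and Y = "FV a i", OF m(1,2)])
    have 2: "al s t r * TV a' i k l - TV a' i k l * al s t r = \<phi> \<bullet> TV a' i (k + r) l + \<psi> \<bullet> TV a' i k (l + r)"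
      if "a' = a \<or> a' = a + 1" for a' k l
      by (rule TV_comm[OF that r]) (use m in auto)
    have lin: "A * (X - c \<bullet> (Y - Z)) - (X - c \<bullet> (Y - Z)) * A = (A * X - X * A) - c \<bullet> ((A * Y - Y * A) - (A * Z - Z * A))"
      for A X Y Z :: endo and c by (simp add: algebra_simps)
    have "al s t r * T k l - T k l * al s t r = \<phi> \<bullet> T (k + r) l + \<psi> \<bullet> T k (l + r)" for k l
      unfolding T_def lin 1 2[of a, simplified] 2[of "a + 1", simplified] by (simp add: algebra_simps)
    then show "\<exists>\<phi> \<psi>. \<forall>k l. al s t r * T k l - T k l * al s t r = \<phi> \<bullet> T (k + r) l + \<psi> \<bullet> T k (l + r)" by blast
  next
    fix k l b0 b' assume v: "vac b0" "vac b'"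
    obtain \<mu> \<nu> where b0: "b0 = (\<mu>, \<nu>)" by (cases b0)
    have v0: "vac (\<mu>, \<nu>)" using v b0 by simp
    define N where "N = pt \<nu> a (prev_col i) - pt \<nu> a i"
    define R where "R = (\<Sum>s\<in>rows. if s > a then pt \<nu> s (prev_col i) - pt \<nu> s i else 0) - (\<Sum>s\<in>rows. if s < a then pt \<nu> s (prev_col i) - pt \<nu> s i else 0)"
    note md = momentum_diag[OF a i, of \<nu>, folded N_def R_def \<gamma>_def]
    have GG: "GG i i = 2" using GG_cases(1)[OF i i] by simp
    have ex: "exU a i \<nu> = 1 - N" "exV a i \<nu> = 1 + N" by (simp_all add: exU_def exV_def N_def)
    have ex': "exU a i (\<nu> + - beta a i) = - 1 - N" "exV a i (\<nu> + beta a i) = N - 1"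
      using ex_beta[OF a a i i, of \<nu>] by (simp_all add: GG ex)
    have 1: "Poly_Mapping.lookup (app (EV a i k * FV a i l) (ket b0)) b' =
      (if b' = (\<mu>, \<nu> + - beta a i + beta a i) \<and> - l - exV a i \<nu> \<ge> 0 \<and> - k - exU a i (\<nu> + - beta a i) = l + exV a i \<nu>
       then fV a i \<nu> * fU a i (\<nu> + - beta a i) * h \<gamma> $ nat (- l - exV a i \<nu>) else 0)"
      unfolding b0 EV_def FV_def
      by (rule vac_product[OF annih_fpsp creat_fpsm annih_fpsp creat_fpsm v0 v(2) k1])
         (simp_all only: h_def diag_contraction)
    have 2: "Poly_Mapping.lookup (app (FV a i l * EV a i k) (ket b0)) b' =
      (if b' = (\<mu>, \<nu> + beta a i + - beta a i) \<and> - k - exU a i \<nu> \<ge> 0 \<and> - l - exV a i (\<nu> + beta a i) = k + exU a i \<nu>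
       then fU a i \<nu> * fV a i (\<nu> + beta a i) * h (inverse \<gamma>) $ nat (- k - exU a i \<nu>) else 0)"
      unfolding b0 EV_def FV_def
      by (rule vac_product[OF annih_fpsp creat_fpsm annih_fpsp creat_fpsm v0 v(2) k2])
         (simp_all only: h_def diag_contraction)
    have 3: "Poly_Mapping.lookup (app (TV a' i k l) (ket b0)) b' =
      cc a' powi k * (if - (k + l) - 0 = 0 \<and> b' = (\<mu>, \<nu> + 0) then fT a' i \<nu> else 0)" for a'
      unfolding b0 TV_def by (simp add: vac_vertex[OF annih_fpsp creat_fpsm v0 v(2)])
    have "Poly_Mapping.lookup (app (T k l) (ket b0)) b' =
       (if b' = (\<mu>, \<nu>) \<and> k + l = 0 then
          (if k - N - 1 \<ge> 0 then \<gamma> powi (N + 1) * q powi R * (\<gamma> ^ nat (k - N - 1) * qnum q (int (nat (k - N - 1)) + 1)) else 0)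
          - (if N - 1 - k \<ge> 0 then \<gamma> powi (N - 1) * q powi R * (inverse \<gamma> ^ nat (N - 1 - k) * qnum q (int (nat (N - 1 - k)) + 1)) else 0)
          - (1 / g) * (cc (a + 1) powi k * q powi (R - N) - cc a powi k * q powi (R + N)) else 0)"
    proof -
      have c: "(- l - (1 + N) \<ge> 0 \<and> - k - (- 1 - N) = l + (1 + N)) \<longleftrightarrow> (k + l = 0 \<and> k - N - 1 \<ge> 0)"
        "(- k - (1 - N) \<ge> 0 \<and> - l - (N - 1) = k + (1 - N)) \<longleftrightarrow> (k + l = 0 \<and> N - 1 - k \<ge> 0)"
        "- (k + l) - 0 = 0 \<longleftrightarrow> k + l = 0" by linarith+
      have b: "\<nu> + - beta a i + beta a i = \<nu>" "\<nu> + beta a i + - beta a i = \<nu>" "\<nu> + 0 = \<nu>" by simp_all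
      have n1: "- l - (1 + N) = k - N - 1" if "k + l = 0" using that by linarith
      have n2: "- k - (1 - N) = N - 1 - k" by linarith
      have L1: "Poly_Mapping.lookup (app (EV a i k * FV a i l) (ket b0)) b' = (if b' = (\<mu>, \<nu>) \<and> k + l = 0 then
          (if k - N - 1 \<ge> 0 then \<gamma> powi (N + 1) * q powi R * (\<gamma> ^ nat (k - N - 1) * qnum q (int (nat (k - N - 1)) + 1)) else 0) else 0)"
      proof (cases "k + l = 0")
        case True
        show ?thesis unfolding 1 ex ex' c(1) md b using True by (simp only: n1[OF True] h_def fps_nth_Abs_fps simp_thms if_bool_eq_conj) auto
      next
        case False
        then show ?thesis unfolding 1 ex ex' c(1) by (simp only: simp_thms if_False)
      qed
      have L2: "Poly_Mapping.lookup (app (FV a i l * EV a i k) (ket b0)) b' = (if b' = (\<mu>, \<nu>) \<and> k + l = 0 then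
          (if N - 1 - k \<ge> 0 then \<gamma> powi (N - 1) * q powi R * (inverse \<gamma> ^ nat (N - 1 - k) * qnum q (int (nat (N - 1 - k)) + 1)) else 0) else 0)"
      proof (cases "k + l = 0")
        case True
        show ?thesis unfolding 2 ex ex' c(2) md b n2 using True by (simp only: h_def fps_nth_Abs_fps simp_thms if_bool_eq_conj) auto
      next
        case False
        then show ?thesis unfolding 2 ex ex' c(2) by (simp only: simp_thms if_False)
      qed
      show ?thesis
        unfolding T_def C_def app_simps(4) app_simps(7) lookup_minus lookup_scale L1 L2 3 c(3) md b g_def[symmetric]
        by (cases "k + l = 0"; cases "b' = (\<mu>, \<nu>)") (simp_all only: simp_thms if_True if_False mult_zero_right diff_self)
    qed
    also have "\<dots> = 0"
    proof -
      have pw: "\<gamma> powi (N + 1) * \<gamma> ^ nat (k - N - 1) = \<gamma> powi k" if "k - N - 1 \<ge> 0"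
      proof -
        have "\<gamma> ^ nat (k - N - 1) = \<gamma> powi (k - N - 1)" using that by (simp add: power_int_def)
        then have "\<gamma> powi (N + 1) * \<gamma> ^ nat (k - N - 1) = \<gamma> powi ((N + 1) + (k - N - 1))"
          using \<gamma>0 by (simp only: power_int_add simp_thms)
        then show ?thesis by simp
      qed
      have pw': "\<gamma> powi (N - 1) * inverse \<gamma> ^ nat (N - 1 - k) = \<gamma> powi k" if "N - 1 - k \<ge> 0"
      proof -
        have "inverse \<gamma> ^ nat (N - 1 - k) = \<gamma> powi (- (N - 1 - k))" using that by (auto simp: power_int_def power_inverse)
        then have "\<gamma> powi (N - 1) * inverse \<gamma> ^ nat (N - 1 - k) = \<gamma> powi ((N - 1) + - (N - 1 - k))"
          using \<gamma>0 by (simp only: power_int_add simp_thms)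
        then show ?thesis by simp
      qed
      have c1: "cc (a + 1) = \<gamma> * q" "cc a = \<gamma> * inverse q"
      proof -
        have "cc (a + 1) = q powi ((2 * a - int m + 1) + 1)" "cc a = q powi ((2 * a - int m + 1) + - 1)"
          unfolding cc_def by (rule arg_cong[where f = "power_int q"], simp)+
        then show "cc (a + 1) = \<gamma> * q" "cc a = \<gamma> * inverse q"
          unfolding \<gamma>_def gam_def using q0 by (simp_all only: power_int_add simp_thms power_int_1_right power_int_minus)
      qed
      have rhs: "(1 / g) * (cc (a + 1) powi k * q powi (R - N) - cc a powi k * q powi (R + N)) = \<gamma> powi k * q powi R * qnum q (k - N)"
      proof -
        have "cc (a + 1) powi k * q powi (R - N) = \<gamma> powi k * q powi R * q powi (k - N)"
          unfolding c1 using q0 by (simp add: power_int_mult_distrib power_int_diff)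
        moreover have "cc a powi k * q powi (R + N) = \<gamma> powi k * q powi R * q powi (- (k - N))"
          unfolding c1 using q0 by (simp add: power_int_mult_distrib power_int_diff power_int_add power_int_inverse divide_inverse mult_ac)
        ultimately show ?thesis by (simp add: qnum_def g_def algebra_simps diff_divide_distrib)
      qed
      consider "k - N - 1 \<ge> 0" | "N - 1 - k \<ge> 0" | "k = N" by linarith
      then show ?thesis
      proof cases
        case 1
        then have "\<gamma> powi (N + 1) * q powi R * (\<gamma> ^ nat (k - N - 1) * qnum q (int (nat (k - N - 1)) + 1)) = \<gamma> powi k * q powi R * qnum q (k - N)"
          using pw by (simp add: mult_ac)
        then show ?thesis using 1 unfolding rhs by simp
      next
        case 2
        have "\<gamma> powi (N - 1) * q powi R * (inverse \<gamma> ^ nat (N - 1 - k) * qnum q (int (nat (N - 1 - k)) + 1))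
          = (\<gamma> powi (N - 1) * inverse \<gamma> ^ nat (N - 1 - k)) * q powi R * qnum q (int (nat (N - 1 - k)) + 1)" by (simp only: mult_ac)
        also have "\<dots> = - (\<gamma> powi k * q powi R * qnum q (k - N))"
          unfolding pw'[OF 2] using 2 qnum_minus[of q "N - k"] by simp
        finally show ?thesis using 2 unfolding rhs by simp
      next
        case 3
        then show ?thesis unfolding rhs by simp
      qed
    qed
    finally show "Poly_Mapping.lookup (app (T k l) (ket b0)) b' = 0" .
  qed
  then show ?thesis by (simp add: T_def C_def)
qed

end


section \<open>The operators of the Fock representation\<close>

definition dg :: "(fock_index \<Rightarrow> complex) \<Rightarrow> endo" where
  "dg f = Endo (diagonal f)"

lemma lin_diagonal: "lin (diagonal f)"
  unfolding diagonal_def by (rule lin_linear_ext)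

lemma app_dg: "app (dg f) = diagonal f"
  by (simp add: dg_def lin_diagonal)

lemma dg_ket [simp]: "app (dg f) (ket b) = f b \<cdot> ket b"
  by (simp add: app_dg diagonal_def)

lemma dg_mult: "dg f * dg g = dg (\<lambda>b. f b * g b)"
  by (rule endo_ket_eqI) (simp add: mult.commute)

lemma dg_const: "dg (\<lambda>b. c) = c \<bullet> 1"
  by (rule endo_ket_eqI) simp

lemma lookup_dg: "Poly_Mapping.lookup (app (dg f) w) b = f b * Poly_Mapping.lookup w b"
proof -
  have "Poly_Mapping.lookup (app (dg f) w) b =
      (\<Sum>b'\<in>Poly_Mapping.keys w. if b' = b then f b * Poly_Mapping.lookup w b else 0)"
    unfolding lookup_app[of "dg f" w b] by (intro sum.cong) (auto simp: lookup_single when_def)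
  also have "\<dots> = f b * Poly_Mapping.lookup w b" by (simp add: in_keys_iff)
  finally show ?thesis .
qed

lemma dg_graded:
  assumes "graded g D X" "\<And>b b'. g b' = g b + D \<Longrightarrow> f b' = c * f b"
  shows "dg f * X = c \<bullet> (X * dg f)"
proof (rule endo_ket_eqI, rule poly_mapping_eqI)
  fix b b'
  show "Poly_Mapping.lookup (app (dg f * X) (ket b)) b' = Poly_Mapping.lookup (app (c \<bullet> (X * dg f)) (ket b)) b'"
  proof (cases "b' \<in> Poly_Mapping.keys (app X (ket b))")
    case True
    then show ?thesis using assms(2)[OF gradedD[OF assms(1) True]] by (simp add: lookup_dg)
  next
    case False
    then show ?thesis by (simp add: lookup_dg in_keys_iff)
  qed
qed

lemma graded_pow:
  fixes h :: "fock_index \<Rightarrow> int"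
  assumes "graded h \<delta> X"
  shows "graded h (int A * \<delta>) (X ^ A)"
proof (induction A)
  case (Suc A)
  from graded_mult[OF assms Suc] show ?case by (simp add: algebra_simps)
qed (simp add: graded_1)

text \<open>Powers of \<open>X\<close> move \<open>h\<close> further and further, whereas
  \<open>\<bar>h\<bar>\<close> stays below the value of \<open>g\<close>, which does not change.\<close>

lemma graded_nilpotent:
  fixes g h :: "fock_index \<Rightarrow> int"
  assumes g: "graded g 0 X" and h: "graded h \<delta> X" and \<delta>: "\<bar>\<delta>\<bar> = 1" and bound: "\<And>b. \<bar>h b\<bar> \<le> g b"
  shows "\<exists>A. app (X ^ A) v = 0"
proof -
  define A where "A = Suc (nat (2 * (\<Sum>b\<in>Poly_Mapping.keys v. g b)))"
  have gp: "g b \<ge> 0" for b using bound[of b] by linarith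
  have "b' \<notin> Poly_Mapping.keys (app (X ^ A) v)" for b'
  proof
    assume "b' \<in> Poly_Mapping.keys (app (X ^ A) v)"
    from keys_app[OF this] obtain b where b: "b \<in> Poly_Mapping.keys v" "b' \<in> Poly_Mapping.keys (app (X ^ A) (ket b))"
      by blast
    have 1: "g b' = g b" "h b' = h b + int A * \<delta>"
      using gradedD[OF graded_pow[OF g] b(2)] gradedD[OF graded_pow[OF h] b(2)] by simp_all
    have "g b \<le> (\<Sum>b\<in>Poly_Mapping.keys v. g b)"
      by (rule member_le_sum) (use b gp in auto)
    then have "int A > 2 * g b" by (simp add: A_def)
    moreover have "\<bar>int A * \<delta>\<bar> = int A" using \<delta> by (simp add: abs_mult)
    ultimately show False using 1 bound[of b] bound[of b'] by linarith
  qed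
  then have "app (X ^ A) v = 0" by (metis keys_eq_empty equals0I)
  then show ?thesis ..
qed

lemma exp_fps_scale:
  assumes "\<And>r. X $ r = c ^ r \<bullet> Y $ r"
  shows "exp_fps X $ N = c ^ N \<bullet> exp_fps Y $ N"
proof -
  have "(X ^ k) $ N = c ^ N \<bullet> (Y ^ k) $ N" for k N
  proof (induction k arbitrary: N)
    case (Suc k)
    have "(X ^ Suc k) $ N = (\<Sum>i=0..N. c ^ N \<bullet> (Y $ i * (Y ^ k) $ (N - i)))"
      unfolding power_Suc fps_mult_nth
      by (intro sum.cong refl) (simp add: assms Suc power_add[symmetric])
    then show ?case by (simp add: fps_mult_nth smul_sum)
  qed auto
  then show ?thesis by (simp add: exp_fps_def smul_sum mult.commute)
qed

lemma exp_fps_zero: "exp_fps 0 $ N = (if N = 0 then 1 else 0)"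
proof -
  have "(1 / fact k) \<bullet> ((0 :: endo fps) ^ k) $ N = (if k = 0 then if N = 0 then 1 else 0 else 0)" for k
    by (cases k) auto
  then show ?thesis by (simp add: exp_fps_def)
qed

lemma nexp_no_creation:
  assumes "locfin P"
  shows "app (nexp P 0 p) v = (if p > 0 then 0 else app (exp_fps P $ nat (- p)) v)"
proof -
  have "app (cre_series 0 (p + int s)) (app (exp_fps P $ s) v) =
     (if s = nat (- p) then if p > 0 then 0 else app (exp_fps P $ nat (- p)) v else 0)" for s
    by (auto simp: cre_series_def exp_fps_zero)
  then show ?thesis
    unfolding nexp_def by (simp add: lin_nexp_fun[OF assms] nexp_fun_def)
qed

lemma nexp_no_annihilation: "app (nexp 0 M p) v = app (cre_series M p) v"
proof -
  have "locfin 0" by (auto simp: locfin_def exp_fps_zero)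
  then show ?thesis
    by (subst app_nexp[where S = 0]) (auto simp: exp_fps_zero)
qed

context bosons
begin

lemma nexp_graded:
  assumes "annih P" "creat M"
  shows "graded snd 0 (nexp P M p)" "graded bdeg p (nexp P M p)"
proof -
  have "graded g D (nexp P M p)"
    if "\<And>s. graded g D (cre_series M (p + int s) * exp_fps P $ s)" for g :: "fock_index \<Rightarrow> 'z::ab_group_add" and D
    unfolding graded_def
  proof (intro allI ballI)
    fix b b' assume b': "b' \<in> Poly_Mapping.keys (app (nexp P M p) (ket b))"
    let ?X = "\<Sum>s\<le>nat (bdeg b). cre_series M (p + int s) * exp_fps P $ s"
    have "app (nexp P M p) (ket b) = app ?X (ket b)"
      by (subst app_nexp[OF annih_locfin[OF assms(1)], where S = "nat (bdeg b)"])
        (auto simp: app_sum intro!: annih_ket[OF assms(1)])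
    then show "g b' = g b + D"
      using gradedD[OF graded_sum[where A = "{..nat (bdeg b)}" and X = "\<lambda>s. cre_series M (p + int s) * exp_fps P $ s", OF that], of b' b] b'
      by simp
  qed
  note * = this
  show "graded snd 0 (nexp P M p)"
    using graded_mult[OF creat_graded(1)[OF assms(2)] annih_graded(1)[OF assms(1)]] by (intro *) simp
  show "graded bdeg p (nexp P M p)"
    using graded_mult[OF creat_graded(2)[OF assms(2)] annih_graded(2)[OF assms(1)]]
    by (intro *) (metis add_diff_cancel_right' uminus_add_conv_diff add.commute)
qed

definition qdeg :: "((int \<times> int) \<Rightarrow>\<^sub>0 int) \<Rightarrow> int" where
  "qdeg \<nu> = (\<Sum>x\<in>Poly_Mapping.keys \<nu>. (Poly_Mapping.lookup \<nu> x)\<^sup>2)"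

lemma twice_deg_split: "twice_deg (\<mu>, \<nu>) = 2 * bdeg (\<mu>, \<nu>) + qdeg \<nu>"
  by (simp add: twice_deg_def bdeg_def qdeg_def)

lemma qdeg_superset:
  assumes "finite A" "Poly_Mapping.keys \<nu> \<subseteq> A"
  shows "qdeg \<nu> = (\<Sum>x\<in>A. (Poly_Mapping.lookup \<nu> x)\<^sup>2)"
  unfolding qdeg_def by (rule sum.mono_neutral_left[OF assms]) (auto simp: in_keys_iff)

lemma qdeg_single: "qdeg (\<nu> + Poly_Mapping.single x c) = qdeg \<nu> + 2 * c * Poly_Mapping.lookup \<nu> x + c\<^sup>2"
proof -
  let ?A = "insert x (Poly_Mapping.keys \<nu>)"
  have "Poly_Mapping.keys (\<nu> + Poly_Mapping.single x c) \<subseteq> ?A"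
    using keys_add[of \<nu> "Poly_Mapping.single x c"] by (auto split: if_splits)
  then have "qdeg (\<nu> + Poly_Mapping.single x c) = (\<Sum>y\<in>?A. (Poly_Mapping.lookup (\<nu> + Poly_Mapping.single x c) y)\<^sup>2)"
    by (intro qdeg_superset) auto
  also have "\<dots> = (\<Sum>y\<in>?A. (Poly_Mapping.lookup \<nu> y)\<^sup>2 + (if y = x then 2 * c * Poly_Mapping.lookup \<nu> x + c\<^sup>2 else 0))"
    by (intro sum.cong refl) (auto simp: lookup_add lookup_single power2_eq_square algebra_simps)
  also have "\<dots> = qdeg \<nu> + (2 * c * Poly_Mapping.lookup \<nu> x + c\<^sup>2)"
    by (subst qdeg_superset[of ?A]) (auto simp: sum.distrib)
  finally show ?thesis by simp
qed

text \<open>The bosonic degree changes by \<open>- k - ex \<nu>\<close>, which depends on the sector.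
  The shift of the momentum makes up for \<open>ex \<nu>\<close> if the latter is half the change
  of the squared momentum, as is the case for \<open>U\<close> and \<open>V\<close>.\<close>

lemma vertex_graded:
  assumes "annih P" "creat M"
  shows "graded snd \<beta> (vertex P M f \<beta> ex k)"
    and "(\<And>\<nu>. qdeg (\<nu> + \<beta>) = qdeg \<nu> + 2 * ex \<nu>) \<Longrightarrow> graded twice_deg (- 2 * k) (vertex P M f \<beta> ex k)"
proof -
  have *: "snd b' = snd b + \<beta> \<and> bdeg b' = bdeg b - k - ex (snd b)"
    if "b' \<in> Poly_Mapping.keys (app (vertex P M f \<beta> ex k) (ket b))" for b b'
  proof -
    obtain \<mu> \<nu> where b: "b = (\<mu>, \<nu>)" by (cases b)
    have "b' \<in> Poly_Mapping.keys (app (nexp P M (- k - ex \<nu>)) (ket (\<mu>, \<nu> + \<beta>)))"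
      using that subsetD[OF keys_scale] unfolding b vertex_ket by fast
    from gradedD[OF nexp_graded(1)[OF assms] this] gradedD[OF nexp_graded(2)[OF assms] this]
    show ?thesis by (simp add: b bdeg_def)
  qed
  show "graded snd \<beta> (vertex P M f \<beta> ex k)" unfolding graded_def using * by blast
  assume q: "\<And>\<nu>. qdeg (\<nu> + \<beta>) = qdeg \<nu> + 2 * ex \<nu>"
  show "graded twice_deg (- 2 * k) (vertex P M f \<beta> ex k)"
    unfolding graded_def
  proof (intro allI ballI)
    fix b b' assume "b' \<in> Poly_Mapping.keys (app (vertex P M f \<beta> ex k) (ket b))"
    from *[OF this] show "twice_deg b' = twice_deg b + - 2 * k"
      using q[of "snd b"] by (cases b; cases b') (simp add: twice_deg_split)
  qed
qed

end

context fock_rep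
begin

definition Eop :: "int \<Rightarrow> int \<Rightarrow> endo" where
  "Eop j k = (\<Sum>a\<in>rows. (if j = 0 then inverse (u a) else 1) \<bullet> EV a j k)"

definition Fop :: "int \<Rightarrow> int \<Rightarrow> endo" where
  "Fop j k = (\<Sum>a\<in>rows. (if j = 0 then u a else 1) \<bullet> FV a j k)"

definition Hop :: "int \<Rightarrow> int \<Rightarrow> endo" where
  "Hop j r = (if r > 0 then rowp xH j (nat r) else rowm yH j (nat (- r)))"

definition Kop :: "int \<Rightarrow> endo" where
  "Kop i = dg (\<lambda>b. q powi (ech (snd b) (prev_col i) - ech (snd b) i))"

definition Kiop :: "int \<Rightarrow> endo" where
  "Kiop i = dg (\<lambda>b. q powi (ech (snd b) i - ech (snd b) (prev_col i)))"

lemma Hop_span: "r \<noteq> 0 \<Longrightarrow> Hop j r \<in> bspan r"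
  using rowp_span[of xH j "nat r"] rowm_span[of yH j "nat (- r)"] by (cases "r > 0") (simp_all add: Hop_def)

lemma a_coeff_minus: "a_coeff q dc n i j (- r) = a_coeff q dc n j i r"
proof -
  have 1: "kdelta n i j = kdelta n j i" by (auto simp: kdelta_def)
  have 2: "kdelta n i (j - 1) = kdelta n j (i + 1)" for i j
  proof -
    have "i mod int n = (j - 1) mod int n \<longleftrightarrow> j mod int n = (i + 1) mod int n"
      by (metis diff_add_cancel mod_add_left_eq add_diff_cancel_right' mod_diff_left_eq)
    then show ?thesis by (simp add: kdelta_def)
  qed
  show ?thesis
    by (simp add: a_coeff_def qnum_minus 1 2[of i j] 2[of j i] algebra_simps)
qed

lemma Hop_commutator:
  assumes "i \<in> cols" "j \<in> cols" "r \<noteq> 0" "s \<noteq> 0"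
  shows "Hop i r * Hop j s - Hop j s * Hop i r =
    (if r + s = 0 then a_coeff q dc n i j r / (q - inverse q) * ((q ^ m) powi r - (q ^ m) powi (- r)) else 0) \<bullet> 1"
proof (cases "r + s = 0")
  case False
  then show ?thesis
    using bspan_commute[OF Hop_span[OF assms(3)] Hop_span[OF assms(4)] assms(3,4)] by simp
next
  case True
  have *: "Hop i r * Hop j (- r) - Hop j (- r) * Hop i r =
     (a_coeff q dc n i j r / (q - inverse q) * ((q ^ m) powi r - (q ^ m) powi (- r))) \<bullet> 1"
    if "r > 0" "i \<in> cols" "j \<in> cols" for i j and r :: int
  proof -
    have "(\<Sum>s\<in>rows. xH s (nat r) * yH s (nat r)) * (qnum q (int (nat r)) * a_coeff q dc n i j (int (nat r)))
      = a_coeff q dc n i j r / (q - inverse q) * ((q ^ m) powi r - (q ^ m) powi (- r))"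
      using pair_HH[of "nat r"] that(1)
      by (simp add: mult.assoc[symmetric] power_int_minus) (simp add: power_int_def)
    then show ?thesis
      using row_commutator[OF that(2,3), of "nat r" xH yH] that(1) by (simp add: Hop_def)
  qed
  show ?thesis
  proof (cases "r > 0")
    case r: True
    then show ?thesis using *[OF r assms(1,2)] True by (simp add: eq_neg_iff_add_eq_0[symmetric] add.commute)
  next
    case False
    then have "- r > 0" using assms(3) by simp
    from *[OF this assms(2,1)] have e: "Hop j (- r) * Hop i r - Hop i r * Hop j (- r) =
        (a_coeff q dc n i j r / (q - inverse q) * ((q ^ m) powi (- r) - (q ^ m) powi r)) \<bullet> 1"
      by (simp add: a_coeff_minus)
    have "s = - r" using True by simp
    then have "Hop i r * Hop j s - Hop j s * Hop i r = - (Hop j (- r) * Hop i r - Hop i r * Hop j (- r))" by simp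
    also have "\<dots> = - ((a_coeff q dc n i j r / (q - inverse q) * ((q ^ m) powi (- r) - (q ^ m) powi r)) \<bullet> 1)"
      unfolding e ..
    also have "\<dots> = (a_coeff q dc n i j r / (q - inverse q) * ((q ^ m) powi r - (q ^ m) powi (- r))) \<bullet> 1"
      unfolding smul_left_distrib(3)[symmetric] mult_minus_right[symmetric] minus_diff_eq ..
    finally show ?thesis using True by simp
  qed
qed

lemma H_vertex:
  assumes a: "a \<in> rows" and ij: "i \<in> cols" "j \<in> cols" and r: "r \<noteq> 0"
  shows "Hop i r * EV a j k - EV a j k * Hop i r =
      (a_coeff q dc n i j r * (if r > 0 then (q ^ m) powi (- r) else 1)) \<bullet> EV a j (k + r)"
    and "Hop i r * FV a j k - FV a j k * Hop i r =
      (- a_coeff q dc n i j r * (if r > 0 then 1 else (q ^ m) powi (- r))) \<bullet> FV a j (k + r)"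
proof -
  have sw: "T * X - X * T = c \<bullet> 1" if "X * T - T * X = (- c) \<bullet> 1" for X T :: endo and c
    using that by (metis minus_diff_eq minus_minus smul_left_distrib(3))
  have pw: "(q ^ nat r) powi (- int m) = (q ^ m) powi (- r)" if "r > 0"
  proof -
    have "(q ^ nat r) ^ m = (q ^ m) ^ nat r" by (simp only: power_mult[symmetric] mult.commute)
    moreover have "(q ^ m) powi r = (q ^ m) ^ nat r" using that by (simp add: power_int_def)
    ultimately show ?thesis by (simp add: power_int_minus)
  qed
  have pw': "(q ^ nat (- r)) ^ m = (q ^ m) powi (- r)" if "r < 0"
    using that by (simp add: power_int_def power_mult[symmetric] mult.commute)
  show "Hop i r * EV a j k - EV a j k * Hop i r =
      (a_coeff q dc n i j r * (if r > 0 then (q ^ m) powi (- r) else 1)) \<bullet> EV a j (k + r)"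
    unfolding EV_def
  proof (rule vertex_bspan[OF annih_fpsp creat_fpsm Hop_span[OF r] r])
    assume p: "r > 0"
    have "rowp xH i (nat r) * rowm (yA a) j (nat r) - rowm (yA a) j (nat r) * rowp xH i (nat r) =
       (a_coeff q dc n i j r * (q ^ m) powi (- r)) \<bullet> 1"
      using row_commutator[OF ij, of "nat r" xH "yA a"] pair_HA[OF a, of "nat r"] p qnum_nz[of r] by (simp add: pw mult_ac)
    then show "Hop i r * fpsm (yA a) j $ nat r - fpsm (yA a) j $ nat r * Hop i r =
        (a_coeff q dc n i j r * (if r > 0 then (q ^ m) powi (- r) else 1)) \<bullet> 1"
      using p by (simp add: Hop_def)
  next
    assume p: "r < 0"
    have "rowp (xA a) j (nat (- r)) * rowm yH i (nat (- r)) - rowm yH i (nat (- r)) * rowp (xA a) j (nat (- r)) =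
       (- a_coeff q dc n i j r) \<bullet> 1"
      using row_commutator[OF ij(2,1), of "nat (- r)" "xA a" yH] pair_AH[OF a, of "nat (- r)"] p qnum_nz[of "- r"]
        a_coeff_minus[of j i r] by simp
    from sw[OF this] show "Hop i r * fpsp (xA a) j $ nat (- r) - fpsp (xA a) j $ nat (- r) * Hop i r =
        (a_coeff q dc n i j r * (if r > 0 then (q ^ m) powi (- r) else 1)) \<bullet> 1"
      using p by (simp add: Hop_def)
  qed
  show "Hop i r * FV a j k - FV a j k * Hop i r =
      (- a_coeff q dc n i j r * (if r > 0 then 1 else (q ^ m) powi (- r))) \<bullet> FV a j (k + r)"
    unfolding FV_def
  proof (rule vertex_bspan[OF annih_fpsp creat_fpsm Hop_span[OF r] r])
    assume p: "r > 0"
    have "rowp xH i (nat r) * rowm (yB a) j (nat r) - rowm (yB a) j (nat r) * rowp xH i (nat r) =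
       (- a_coeff q dc n i j r) \<bullet> 1"
      using row_commutator[OF ij, of "nat r" xH "yB a"] pair_HB[OF a, of "nat r"] p qnum_nz[of r] by simp
    then show "Hop i r * fpsm (yB a) j $ nat r - fpsm (yB a) j $ nat r * Hop i r =
        (- a_coeff q dc n i j r * (if r > 0 then 1 else (q ^ m) powi (- r))) \<bullet> 1"
      using p by (simp add: Hop_def)
  next
    assume p: "r < 0"
    have "rowp (xB a) j (nat (- r)) * rowm yH i (nat (- r)) - rowm yH i (nat (- r)) * rowp (xB a) j (nat (- r)) =
       (- (- a_coeff q dc n i j r * (q ^ m) powi (- r))) \<bullet> 1"
      using row_commutator[OF ij(2,1), of "nat (- r)" "xB a" yH] pair_BH[OF a, of "nat (- r)"] p qnum_nz[of "- r"]
        a_coeff_minus[of j i r] by (simp add: pw' mult_ac)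
    from sw[OF this] show "Hop i r * fpsp (xB a) j $ nat (- r) - fpsp (xB a) j $ nat (- r) * Hop i r =
        (- a_coeff q dc n i j r * (if r > 0 then 1 else (q ^ m) powi (- r))) \<bullet> 1"
      using p by (simp add: Hop_def)
  qed
qed

lemma sum_commutator:
  assumes "\<And>a. a \<in> A \<Longrightarrow> T * X a - X a * T = c \<bullet> Y a"
  shows "T * (\<Sum>a\<in>A. w a \<bullet> X a) - (\<Sum>a\<in>A. w a \<bullet> X a) * T = c \<bullet> (\<Sum>a\<in>A. w a \<bullet> Y a)"
proof -
  have "T * (\<Sum>a\<in>A. w a \<bullet> X a) - (\<Sum>a\<in>A. w a \<bullet> X a) * T = (\<Sum>a\<in>A. w a \<bullet> (T * X a - X a * T))"
    by (simp add: sum_distrib_left sum_distrib_right sum_subtractf)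
  also have "\<dots> = (\<Sum>a\<in>A. c \<bullet> (w a \<bullet> Y a))"
    by (intro sum.cong refl) (simp add: assms mult.commute)
  finally show ?thesis by (simp only: smul_sum)
qed

lemma H_currents:
  assumes ij: "i \<in> cols" "j \<in> cols" and r: "r \<noteq> 0"
  shows "Hop i r * Eop j k - Eop j k * Hop i r =
      (a_coeff q dc n i j r * (if r > 0 then (q ^ m) powi (- r) else 1)) \<bullet> Eop j (k + r)"
    and "Hop i r * Fop j k - Fop j k * Hop i r =
      (- a_coeff q dc n i j r * (if r > 0 then 1 else (q ^ m) powi (- r))) \<bullet> Fop j (k + r)"
  unfolding Eop_def Fop_def by (rule sum_commutator, rule H_vertex[OF _ ij r], assumption)+

lemma qdeg_beta:
  assumes "a \<in> rows" "i \<in> cols"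
  shows "qdeg (\<nu> + beta a i) = qdeg \<nu> + 2 * exU a i \<nu>" "qdeg (\<nu> + - beta a i) = qdeg \<nu> + 2 * exV a i \<nu>"
proof -
  have ne: "i \<noteq> prev_col i" "prev_col i \<in> cols" using assms(2) n2 prev_col_cols[OF assms(2)] by (auto simp: prev_col_cases)
  have p: "pt \<nu> a i = Poly_Mapping.lookup \<nu> (a, i)" "pt \<nu> a (prev_col i) = Poly_Mapping.lookup \<nu> (a, prev_col i)"
    using assms ne(2) by (simp_all add: pt_def)
  have "\<nu> + beta a i = (\<nu> + Poly_Mapping.single (a, i) 1) + Poly_Mapping.single (a, prev_col i) (- 1)"
    by (simp add: beta_def single_uminus)
  then show "qdeg (\<nu> + beta a i) = qdeg \<nu> + 2 * exU a i \<nu>"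
    using ne(1) by (simp only: qdeg_single) (simp add: exU_def p lookup_add lookup_single)
  have "\<nu> + - beta a i = (\<nu> + Poly_Mapping.single (a, i) (- 1)) + Poly_Mapping.single (a, prev_col i) 1"
    by (simp add: beta_def single_uminus)
  then show "qdeg (\<nu> + - beta a i) = qdeg \<nu> + 2 * exV a i \<nu>"
    using ne(1) by (simp only: qdeg_single) (simp add: exV_def p lookup_add lookup_single)
qed

lemma V_graded:
  assumes "a \<in> rows" "i \<in> cols"
  shows "graded snd (beta a i) (EV a i k)" "graded snd (- beta a i) (FV a i k)"
    "graded twice_deg (- 2 * k) (EV a i k)" "graded twice_deg (- 2 * k) (FV a i k)"
  unfolding EV_def FV_def
  using vertex_graded(1)[OF annih_fpsp creat_fpsm] vertex_graded(2)[OF annih_fpsp creat_fpsm] qdeg_beta[OF assms] by blast+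

lemma currents_degree:
  assumes "i \<in> cols"
  shows "graded twice_deg (- 2 * k) (Eop i k)" "graded twice_deg (- 2 * k) (Fop i k)"
  unfolding Eop_def Fop_def by (intro graded_sum graded_smul V_graded assms; assumption)+

text \<open>A linear function of the momentum that takes the same value on the shifts of all rows gives
  a weight to the whole current.\<close>

lemma currents_weight:
  fixes \<phi> :: "((int \<times> int) \<Rightarrow>\<^sub>0 int) \<Rightarrow> int"
  assumes i: "i \<in> cols" and \<phi>: "\<And>\<nu> \<nu>'. \<phi> (\<nu> + \<nu>') = \<phi> \<nu> + \<phi> \<nu>'" and w: "\<And>a. a \<in> rows \<Longrightarrow> \<phi> (beta a i) = w"
  shows "graded (\<lambda>b. \<phi> (snd b)) w (Eop i k)" "graded (\<lambda>b. \<phi> (snd b)) (- w) (Fop i k)"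
proof -
  have z: "\<phi> 0 = 0" using \<phi>[of 0 0] by simp
  have m: "\<phi> (- \<nu>) = - \<phi> \<nu>" for \<nu> using \<phi>[of \<nu> "- \<nu>"] z by simp
  have "graded (\<lambda>b. \<phi> (snd b)) w (EV a i k) \<and> graded (\<lambda>b. \<phi> (snd b)) (- w) (FV a i k)" if a: "a \<in> rows" for a
    using V_graded(1,2)[OF a i, of k] w[OF a] unfolding graded_def by (simp add: \<phi> m del: add_uminus_conv_diff)
  then show "graded (\<lambda>b. \<phi> (snd b)) w (Eop i k)" "graded (\<lambda>b. \<phi> (snd b)) (- w) (Fop i k)"
    unfolding Eop_def Fop_def by (auto intro!: graded_sum graded_smul)
qed

lemma weight_commute:
  fixes \<phi> :: "((int \<times> int) \<Rightarrow>\<^sub>0 int) \<Rightarrow> int"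
  assumes "i \<in> cols" "\<And>\<nu> \<nu>'. \<phi> (\<nu> + \<nu>') = \<phi> \<nu> + \<phi> \<nu>'" "\<And>a. a \<in> rows \<Longrightarrow> \<phi> (beta a i) = w"
  shows "dg (\<lambda>b. q powi \<phi> (snd b)) * Eop i k = q powi w \<bullet> (Eop i k * dg (\<lambda>b. q powi \<phi> (snd b)))"
    and "dg (\<lambda>b. q powi \<phi> (snd b)) * Fop i k = q powi (- w) \<bullet> (Fop i k * dg (\<lambda>b. q powi \<phi> (snd b)))"
proof -
  note g = currents_weight[OF assms, of k]
  show "dg (\<lambda>b. q powi \<phi> (snd b)) * Eop i k = q powi w \<bullet> (Eop i k * dg (\<lambda>b. q powi \<phi> (snd b)))"
  proof (rule dg_graded[OF g(1)])
    fix b b' :: fock_index assume "\<phi> (snd b') = \<phi> (snd b) + w"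
    then show "q powi \<phi> (snd b') = q powi w * q powi \<phi> (snd b)"
      using q0 by (simp only: power_int_add simp_thms mult.commute)
  qed
  show "dg (\<lambda>b. q powi \<phi> (snd b)) * Fop i k = q powi (- w) \<bullet> (Fop i k * dg (\<lambda>b. q powi \<phi> (snd b)))"
  proof (rule dg_graded[OF g(2)])
    fix b b' :: fock_index assume "\<phi> (snd b') = \<phi> (snd b) + - w"
    then show "q powi \<phi> (snd b') = q powi (- w) * q powi \<phi> (snd b)"
      using q0 by (simp only: power_int_add simp_thms mult.commute)
  qed
qed

lemma GG_wt:
  assumes i: "i \<in> cols" and j: "j \<in> cols"
  shows "GG i j = wt n i j"
proof -
  have 1: "i mod int n = (j - 1) mod int n \<longleftrightarrow> prev_col j = i" using i by (auto simp: prev_col_def)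
  have 2: "i mod int n = (j + 1) mod int n \<longleftrightarrow> prev_col i = j"
    unfolding mod_neighbours(2)[OF i j n2] prev_col_cases[OF i] using i j n2 by auto
  have "wt n i j = (if i = j then 2 else 0) - (if prev_col j = i then 1 else 0) - (if prev_col i = j then 1 else 0)"
    unfolding wt_def facs_def 1 2 by simp
  moreover have "prev_col i \<noteq> i" using i n2 by (simp add: prev_col_cases)
  ultimately show ?thesis unfolding GG_cases(1)[OF i j] by auto
qed

lemma K_currents:
  assumes "i \<in> cols" "j \<in> cols"
  shows "Kop i * Eop j k = q powi wt n i j \<bullet> (Eop j k * Kop i)"
    and "Kop i * Fop j k = q powi (- wt n i j) \<bullet> (Fop j k * Kop i)"
proof -
  have "ech (beta a j) (prev_col i) - ech (beta a j) i = wt n i j" if "a \<in> rows" for a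
    using that assms prev_col_cols[OF assms(1)] by (simp add: ech_beta GG_wt[symmetric] GG_def)
  from weight_commute[OF assms(2), where \<phi> = "\<lambda>\<nu>. ech \<nu> (prev_col i) - ech \<nu> i", OF _ this]
  show "Kop i * Eop j k = q powi wt n i j \<bullet> (Eop j k * Kop i)"
    "Kop i * Fop j k = q powi (- wt n i j) \<bullet> (Fop j k * Kop i)"
    by (simp_all add: Kop_def ech_add)
qed

lemma K_inverse: "Kop i * Kiop i = 1" "Kiop i * Kop i = 1"
  using q0 by (simp_all add: Kop_def Kiop_def dg_mult power_int_add[symmetric] dg_const)

text \<open>For integers \<open>\<bar>x\<bar> \<le> x\<^sup>2\<close>, and the squares are part of the
  degree.\<close>

lemma ech_bound: "j \<in> cols \<Longrightarrow> \<bar>ech (snd b) j\<bar> \<le> twice_deg b"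
proof -
  assume j: "j \<in> cols"
  obtain \<mu> \<nu> where b: "b = (\<mu>, \<nu>)" by (cases b)
  have "\<bar>ech \<nu> j\<bar> \<le> (\<Sum>s\<in>rows. \<bar>pt \<nu> s j\<bar>)"
    unfolding ech_def abs_minus_cancel by (rule sum_abs)
  also have "\<dots> \<le> (\<Sum>s\<in>rows. (pt \<nu> s j)\<^sup>2)"
  proof (rule sum_mono)
    show "\<bar>x\<bar> \<le> x\<^sup>2" for x :: int
    proof (cases "x = 0")
      case False
      then have "\<bar>x\<bar> * 1 \<le> \<bar>x\<bar> * \<bar>x\<bar>" by (intro mult_left_mono) auto
      then show ?thesis by (simp add: power2_eq_square)
    qed simp
  qed
  also have "\<dots> = (\<Sum>s\<in>rows. (Poly_Mapping.lookup \<nu> (s, j))\<^sup>2)"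
    using j by (intro sum.cong) (auto simp: pt_def)
  also have "\<dots> = (\<Sum>x\<in>(\<lambda>s. (s, j)) ` rows. (Poly_Mapping.lookup \<nu> x)\<^sup>2)"
    by (subst sum.reindex) (auto simp: inj_on_def)
  also have "\<dots> \<le> (\<Sum>x\<in>Poly_Mapping.keys \<nu> \<union> (\<lambda>s. (s, j)) ` rows. (Poly_Mapping.lookup \<nu> x)\<^sup>2)"
    by (rule sum_mono2) auto
  also have "\<dots> = qdeg \<nu>" by (rule qdeg_superset[symmetric]) auto
  also have "\<dots> \<le> twice_deg b" using bdeg_nonneg[of b] by (simp add: b twice_deg_split)
  finally show ?thesis by (simp add: b)
qed

text \<open>The zero modes preserve the degree and change the charge of the column \<open>i\<close> by
  one.\<close>

lemma currents_nilpotent: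
  assumes "i \<in> cols"
  shows "\<exists>A. app (Eop i 0 ^ A) v = 0" "\<exists>A. app (Fop i 0 ^ A) v = 0"
proof -
  have gi: "gg i i = 1" using assms n2 by (auto simp: gg_def prev_col_cases)
  have "ech (beta a i) i = - 1" if "a \<in> rows" for a using ech_beta[OF that assms assms] gi by simp
  from currents_weight[OF assms, where \<phi> = "\<lambda>\<nu>. ech \<nu> i", OF ech_add this, of 0]
  have w: "graded (\<lambda>b. ech (snd b) i) (- 1) (Eop i 0)" "graded (\<lambda>b. ech (snd b) i) 1 (Fop i 0)" by simp_all
  have d: "graded twice_deg 0 (Eop i 0)" "graded twice_deg 0 (Fop i 0)" using currents_degree[OF assms, of 0] by simp_all
  show "\<exists>A. app (Eop i 0 ^ A) v = 0" "\<exists>A. app (Fop i 0 ^ A) v = 0"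
    using graded_nilpotent[OF d(1) w(1) _ ech_bound[OF assms]] graded_nilpotent[OF d(2) w(2) _ ech_bound[OF assms]]
    by simp_all
qed

lemma sector_commute:
  assumes "graded snd 0 X"
  shows "dg (\<lambda>b. f (snd b)) * X = X * dg (\<lambda>b. f (snd b))"
  using dg_graded[OF assms, of "\<lambda>b. f (snd b)" 1] by simp

lemma ech_rows:
  "ech \<nu> (prev_col i) - ech \<nu> i = (\<Sum>s\<in>rows. pt \<nu> s i - pt \<nu> s (prev_col i))"
  "ech \<nu> i - ech \<nu> (prev_col i) = (\<Sum>s\<in>rows. pt \<nu> s (prev_col i) - pt \<nu> s i)"
  by (simp_all add: ech_def sum_subtractf)

text \<open>At the ends of the chain of rows one of the two exponentials in \<open>T\<^sub>a\<close> is
  empty and the other one extends over all rows.\<close>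

lemma TV_top: "TV (int m) i k l = (q ^ m) powi k \<bullet> half_series (Kop i) (h_series (q - inverse q) (Hop i)) (k + l)"
proof -
  have P: "fpsp (xG (int m)) i = h_series (q - inverse q) (Hop i)"
  proof (rule fps_ext)
    fix r show "fpsp (xG (int m)) i $ r = h_series (q - inverse q) (Hop i) $ r"
      by (auto simp: h_series_def Hop_def rowp_def xG_def smul_sum intro!: sum.cong)
  qed
  have M: "fpsm (yG (int m)) i = 0"
    by (rule fps_ext) (auto simp: rowm_def yG_def intro!: sum.neutral)
  have c: "cc (int m) = q ^ m" by (simp add: cc_def)
  have f: "fT (int m) i \<nu> = q powi (ech \<nu> (prev_col i) - ech \<nu> i)" for \<nu>
    unfolding fT_def ech_rows by (intro arg_cong[where f = "power_int q"] sum.cong) auto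
  have "vertex (fpsp (xG (int m)) i) (fpsm (yG (int m)) i) (fT (int m) i) 0 (\<lambda>_. 0) (k + l) =
      half_series (Kop i) (h_series (q - inverse q) (Hop i)) (k + l)"
  proof (rule endo_ket_eqI)
    fix b :: fock_index
    obtain \<mu> \<nu> where b: "b = (\<mu>, \<nu>)" by (cases b)
    have comm: "Kop i * exp_fps (h_series (q - inverse q) (Hop i)) $ N = exp_fps (h_series (q - inverse q) (Hop i)) $ N * Kop i" for N
      unfolding Kop_def P[symmetric] by (rule sector_commute[where f = "\<lambda>\<nu>. q powi (ech \<nu> (prev_col i) - ech \<nu> i)"]) (rule annih_graded(1)[OF annih_fpsp])
    have K: "app (Kop i) (ket b) = fT (int m) i \<nu> \<cdot> ket b" by (simp add: Kop_def b f)
    show "app (vertex (fpsp (xG (int m)) i) (fpsm (yG (int m)) i) (fT (int m) i) 0 (\<lambda>_. 0) (k + l)) (ket b) =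
      app (half_series (Kop i) (h_series (q - inverse q) (Hop i)) (k + l)) (ket b)"
      unfolding b vertex_ket M
      by (subst nexp_no_creation[OF annih_locfin[OF annih_fpsp]])
        (simp add: half_series_def comm K[unfolded b] P add.commute)
  qed
  then show ?thesis by (simp only: TV_def c)
qed

lemma TV_bottom: "TV 0 i k l = (q ^ m) powi l \<bullet> half_series (Kiop i) (h_series (- (q - inverse q)) (\<lambda>r. Hop i (- r))) (- (k + l))"
proof -
  let ?Y = "h_series (- (q - inverse q)) (\<lambda>r. Hop i (- r))"
  have M: "fpsm (yG 0) i $ r = cc 0 ^ r \<bullet> ?Y $ r" for r
    by (auto simp: h_series_def Hop_def rowm_def yG_def smul_sum mult_ac intro!: sum.cong)
  have P: "fpsp (xG 0) i = 0"
    by (rule fps_ext) (auto simp: rowp_def xG_def intro!: sum.neutral)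
  have c: "cc 0 = inverse (q ^ m)" by (simp add: cc_def power_int_minus)
  have f: "fT 0 i \<nu> = q powi (ech \<nu> i - ech \<nu> (prev_col i))" for \<nu>
    unfolding fT_def ech_rows by (intro arg_cong[where f = "power_int q"] sum.cong) auto
  have cp: "cc 0 powi k * cc 0 ^ nat (- (k + l)) = (q ^ m) powi l" if "\<not> - (k + l) < 0"
  proof -
    have "cc 0 ^ nat (- (k + l)) = cc 0 powi (- (k + l))" using that by (simp add: power_int_def)
    then have "cc 0 powi k * cc 0 ^ nat (- (k + l)) = cc 0 powi (k + - (k + l))"
      using cc0[of 0] by (simp only: power_int_add simp_thms)
    then show ?thesis by (simp add: c power_int_minus power_int_inverse)
  qed
  have Y: "creat ?Y"
    using Hop_span by (auto simp: creat_def h_series_def intro!: bspan_smul)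
  show ?thesis
  proof (rule endo_ket_eqI)
    fix b :: fock_index
    obtain \<mu> \<nu> where b: "b = (\<mu>, \<nu>)" by (cases b)
    have comm: "Kiop i * cre_series ?Y p = cre_series ?Y p * Kiop i" for p
      unfolding Kiop_def by (rule sector_commute[where f = "\<lambda>\<nu>. q powi (ech \<nu> i - ech \<nu> (prev_col i))"]) (rule creat_graded(1)[OF Y])
    have K: "app (Kiop i) (ket b) = fT 0 i \<nu> \<cdot> ket b" by (simp add: Kiop_def b f)
    have hs: "half_series (Kiop i) ?Y p = cre_series ?Y p * Kiop i" for p
      unfolding comm[symmetric] by (simp add: half_series_def cre_series_def)
    have cre: "cre_series (fpsm (yG 0) i) p = (cc 0 ^ nat p) \<bullet> cre_series ?Y p" for p
      using exp_fps_scale[of "fpsm (yG 0) i" "cc 0" ?Y, OF M] by (simp add: cre_series_def)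
    show "app (TV 0 i k l) (ket b) = app ((q ^ m) powi l \<bullet> half_series (Kiop i) ?Y (- (k + l))) (ket b)"
    proof (cases "- (k + l) < 0")
      case True
      then show ?thesis
        unfolding b TV_def app_simps(7) vertex_ket P nexp_no_annihilation by (simp add: cre_series_def half_series_def)
    next
      case False
      then show ?thesis
        unfolding b TV_def app_simps(7) vertex_ket P nexp_no_annihilation hs app_simps(6) K[unfolded b]
          cp[OF False, symmetric] cre
        by (simp add: mult_ac)
    qed
  qed
qed

lemma telescope_rows: "(\<Sum>a\<in>{0..<int N}. f (a + 1) - f a) = f (int N) - f 0" for f :: "int \<Rightarrow> endo"
proof (induction N)
  case (Suc N)
  have "{0..<int (Suc N)} = insert (int N) {0..<int N}" by auto
  then show ?case using Suc by (simp add: add.commute)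
qed simp

text \<open>The rows of the double sum decouple, the parameters \<open>u\<close> cancel on the
  diagonal, and the sum over the diagonal telescopes.\<close>

lemma EF_commutator:
  assumes "i \<in> cols" "j \<in> cols"
  shows "Eop i k * Fop j l - Fop j l * Eop i k = (if i = j then (1 / (q - inverse q)) \<bullet>
          ((q ^ m) powi k \<bullet> half_series (Kop i) (h_series (q - inverse q) (Hop i)) (k + l)
           - (q ^ m) powi l \<bullet> half_series (Kiop i) (h_series (- (q - inverse q)) (\<lambda>r. Hop i (- r))) (- (k + l)))
         else 0)"
proof -
  define e f where "e a = (if i = 0 then inverse (u a) else 1)" and "f b = (if j = 0 then u b else 1)" for a b
  define Z where "Z a b = EV a i k * FV b j l - FV b j l * EV a i k" for a b
  have "Eop i k * Fop j l = (\<Sum>a\<in>rows. \<Sum>b\<in>rows. (e a * f b) \<bullet> (EV a i k * FV b j l))"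
    by (simp add: Eop_def Fop_def e_def f_def sum_product mult.commute)
  moreover have "Fop j l * Eop i k = (\<Sum>a\<in>rows. \<Sum>b\<in>rows. (e a * f b) \<bullet> (FV b j l * EV a i k))"
    unfolding Eop_def Fop_def e_def[symmetric] f_def[symmetric] sum_product
    by (subst sum.swap) (simp add: mult.commute)
  ultimately have S: "Eop i k * Fop j l - Fop j l * Eop i k = (\<Sum>a\<in>rows. \<Sum>b\<in>rows. (e a * f b) \<bullet> Z a b)"
    by (simp add: Z_def sum_subtractf)
  show ?thesis
  proof (cases "i = j")
    case False
    have "Z a b = 0" if "a \<in> rows" "b \<in> rows" for a b
      using EF_vanish[OF that assms, of k l] False by (simp add: Z_def)
    then show ?thesis using S False by simp
  next
    case True
    have "(\<Sum>b\<in>rows. (e a * f b) \<bullet> Z a b) = (1 / (q - inverse q)) \<bullet> (TV (a + 1) i k l - TV a i k l)" if a: "a \<in> rows" for a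
    proof -
      have "(e a * f b) \<bullet> Z a b = (if b = a then (1 / (q - inverse q)) \<bullet> (TV (a + 1) i k l - TV a i k l) else 0)" if b: "b \<in> rows" for b
      proof (cases "b = a")
        case True
        have "e a * f a = 1" using u0[OF a] \<open>i = j\<close> by (simp add: e_def f_def)
        then show ?thesis using EF_diag[OF a assms(1), of k l] True \<open>i = j\<close> by (simp add: Z_def)
      next
        case False
        then show ?thesis using EF_vanish[OF a b assms, of k l] by (simp add: Z_def)
      qed
      then show ?thesis using a by simp
    qed
    then have "Eop i k * Fop j l - Fop j l * Eop i k = (1 / (q - inverse q)) \<bullet> (\<Sum>a\<in>rows. TV (a + 1) i k l - TV a i k l)"
      unfolding S smul_sum by (intro sum.cong refl) simp
    then show ?thesis using True by (simp only: telescope_rows[of "\<lambda>a. TV a i k l"] telescope_rows[of "\<lambda>a. TV a j k l"] TV_top TV_bottom if_True simp_thms)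
  qed
qed

sublocale T: toroidal_ops q dc "q ^ m" n Eop Fop Hop Kop Kiop
proof
  show "Hop i r * Hop i s = Hop i s * Hop i r" if "i \<in> cols" "r * s > 0" for i r s
  proof -
    have "r \<noteq> 0" "s \<noteq> 0" "r + s \<noteq> 0" using that(2) by (auto simp: zero_less_mult_iff)
    then show ?thesis using Hop_commutator[OF that(1,1), of r s] by simp
  qed
qed (use q0 dc0 not_root nondeg n2 K_inverse K_currents H_currents EF_commutator currents_nilpotent in \<open>(auto; fail)+\<close>)

sublocale Td: toroidal_ops q "inverse dc" "inverse (q ^ m)" n "\<lambda>i k. Fop i (- k)" "\<lambda>i k. Eop i (- k)"
  "\<lambda>i r. - Hop i (- r)" Kiop Kop
  by (rule T.dual)

end


section \<open>Comparison with the explicit formulas\<close>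

lemma app_fps_power:
  assumes "F $ 0 = 0" "\<And>r v. r > 0 \<Longrightarrow> app (F $ r) v = X r v"
  shows "app ((F ^ k) $ N) v = op_power X k N v"
proof (induction k arbitrary: N)
  case (Suc k)
  have "app ((F ^ Suc k) $ N) v = (\<Sum>r\<in>insert 0 {1..N}. app (F $ r) (app ((F ^ k) $ (N - r)) v))"
    unfolding power_Suc fps_mult_nth app_sum app_simps(6) by (intro sum.cong refl) auto
  also have "\<dots> = (\<Sum>r = 1..N. app (F $ r) (app ((F ^ k) $ (N - r)) v))"
    by (subst sum.insert) (simp_all add: assms(1))
  also have "\<dots> = (\<Sum>r = 1..N. X r (op_power X k (N - r) v))"
    by (intro sum.cong refl) (simp add: assms(2) Suc)
  finally show ?case by simp
qed simp

lemma normal_exp_nexp: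
  assumes "P $ 0 = 0" "\<And>r v. r > 0 \<Longrightarrow> app (P $ r) v = Xp r v"
    "M $ 0 = 0" "\<And>r v. r > 0 \<Longrightarrow> app (M $ r) v = Xm r v"
    and P: "locfin P"
  shows "normal_exp Xp Xm p v = app (nexp P M p) v"
proof -
  have e: "app (exp_fps F $ N) v = op_exp X N v"
    if "F $ 0 = 0" "\<And>r v. r > 0 \<Longrightarrow> app (F $ r) v = X r v" for F X N v
    by (simp add: exp_fps_def op_exp_def app_sum app_fps_power[OF that])
  have "app (cre_series M (p + int s)) (app (exp_fps P $ s) v)
    = (if p + int s < 0 then 0 else op_exp Xm (nat (p + int s)) (op_exp Xp s v))" for s
    by (simp add: cre_series_def e[OF assms(1,2)] e[OF assms(3,4)])
  then show ?thesis
    unfolding nexp_def by (simp add: lin_nexp_fun[OF P] nexp_fun_def normal_exp_def)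
qed

text \<open>On a basis vector \<open>W\<close> produces a single power of \<open>z\<close>; hence only
  finitely many \<open>a\<close> contribute to the sum on a given vector.\<close>

lemma vertex_coefficient:
  fixes W :: "int \<Rightarrow> fock \<Rightarrow> fock"
  assumes N: "\<And>p v. normal_exp Xp Xm p v = app (nexp P M p) v"
    and W: "\<And>p. lin (W p)"
    and ket: "\<And>p \<mu> \<nu>. W p (ket (\<mu>, \<nu>)) = (if ex \<nu> = p then f \<nu> \<cdot> ket (\<mu>, \<nu> + \<beta>) else 0)"
  shows "Sum_any (\<lambda>a :: int. normal_exp Xp Xm a (W (- k - a) v)) = app (vertex P M f \<beta> ex k) v"
proof -
  let ?A = "(\<lambda>b. - k - ex (snd b)) ` Poly_Mapping.keys v"
  have kt: "W p (ket b) = (if ex (snd b) = p then f (snd b) \<cdot> ket (fst b, snd b + \<beta>) else 0)" for p b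
    using ket[of p "fst b" "snd b"] by simp
  have Wv: "W p v = (\<Sum>b\<in>Poly_Mapping.keys v. Poly_Mapping.lookup v b \<cdot> W p (ket b))" for p
    using lin_ext[OF W, of p v] by (simp add: linear_ext_def)
  have T: "normal_exp Xp Xm a (W (- k - a) v) =
      (\<Sum>b\<in>Poly_Mapping.keys v. if a = - k - ex (snd b)
         then Poly_Mapping.lookup v b \<cdot> app (vertex P M f \<beta> ex k) (ket b) else 0)" for a
    unfolding N Wv app_sum_right
  proof (intro sum.cong refl)
    fix b :: fock_index
    have "a = - k - ex (snd b) \<longleftrightarrow> ex (snd b) = - k - a" by linarith
    then show "app (nexp P M a) (Poly_Mapping.lookup v b \<cdot> W (- k - a) (ket b)) =
      (if a = - k - ex (snd b) then Poly_Mapping.lookup v b \<cdot> app (vertex P M f \<beta> ex k) (ket b) else 0)"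
      using vertex_ket[of P M f \<beta> ex k "fst b" "snd b"] by (simp add: kt)
  qed
  have "Sum_any (\<lambda>a :: int. normal_exp Xp Xm a (W (- k - a) v)) = (\<Sum>a\<in>?A. normal_exp Xp Xm a (W (- k - a) v))"
  proof (rule Sum_any.expand_superset)
    have "normal_exp Xp Xm a (W (- k - a) v) = 0" if "a \<notin> ?A" for a
      unfolding T using that by (intro sum.neutral ballI if_not_P) blast
    then show "{a. normal_exp Xp Xm a (W (- k - a) v) \<noteq> 0} \<subseteq> ?A" by blast
  qed simp
  also have "\<dots> = (\<Sum>b\<in>Poly_Mapping.keys v. \<Sum>a\<in>?A. if a = - k - ex (snd b)
         then Poly_Mapping.lookup v b \<cdot> app (vertex P M f \<beta> ex k) (ket b) else 0)"
    unfolding T by (rule sum.swap)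
  also have "\<dots> = (\<Sum>b\<in>Poly_Mapping.keys v. Poly_Mapping.lookup v b \<cdot> app (vertex P M f \<beta> ex k) (ket b))"
    by (intro sum.cong refl) (simp add: sum.delta')
  also have "\<dots> = app (vertex P M f \<beta> ex k) v"
    using lin_ext[of "app (vertex P M f \<beta> ex k)" v] by (simp add: linear_ext_def)
  finally show ?thesis .
qed

context fock_rep
begin

lemma fock_E_eq:
  assumes j: "j \<in> cols"
  shows "fock_E q d dc sd m n u j k v = app (Eop j k) v"
proof -
  have r: "{0..int m - 1} = rows" by auto
  have "Sum_any (\<lambda>p :: int. normal_exp (A_p q d dc m n a j) (A_m q d dc m n a j) p (U_op q sd m n a j (- k - p) v)) = app (EV a j k) v"
    if a: "a \<in> rows" for a
    unfolding EV_def
  proof (rule vertex_coefficient)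
    show "normal_exp (A_p q d dc m n a j) (A_m q d dc m n a j) p v = app (nexp (fpsp (xA a) j) (fpsm (yA a) j) p) v" for p v
      by (rule normal_exp_nexp) (simp_all add: app_AB[OF a] annih_locfin)
    show "lin (U_op q sd m n a j p)" for p
      unfolding U_op_def comp_def by (intro lin_compose[OF lin_exp_eps lin_compose[OF lin_exp_eps lin_diagonal]])
    show "U_op q sd m n a j p (ket (\<mu>, \<nu>)) = (if exU a j \<nu> = p then fU a j \<nu> \<cdot> ket (\<mu>, \<nu> + beta a j) else 0)" for p \<mu> \<nu>
      using U0_ket[OF a j, of \<mu> \<nu>] by (simp add: U_op_def U0_def exponents exp_eps_scale)
  qed
  then show ?thesis
    unfolding fock_E_def r Eop_def app_sum by (intro sum.cong refl) simp
qed

lemma fock_F_eq: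
  assumes j: "j \<in> cols"
  shows "fock_F q d dc sd m n u j k v = app (Fop j k) v"
proof -
  have r: "{0..int m - 1} = rows" by auto
  have "Sum_any (\<lambda>p :: int. normal_exp (B_p q d dc m n a j) (B_m q d dc m n a j) p (V_op q sd m n a j (- k - p) v)) = app (FV a j k) v"
    if a: "a \<in> rows" for a
    unfolding FV_def
  proof (rule vertex_coefficient)
    show "normal_exp (B_p q d dc m n a j) (B_m q d dc m n a j) p v = app (nexp (fpsp (xB a) j) (fpsm (yB a) j) p) v" for p v
      by (rule normal_exp_nexp) (simp_all add: app_AB[OF a] annih_locfin)
    show "lin (V_op q sd m n a j p)" for p
      unfolding V_op_def comp_def by (intro lin_compose[OF lin_exp_eps lin_compose[OF lin_exp_eps lin_diagonal]])
    show "V_op q sd m n a j p (ket (\<mu>, \<nu>)) = (if exV a j \<nu> = p then fV a j \<nu> \<cdot> ket (\<mu>, \<nu> + - beta a j) else 0)" for p \<mu> \<nu>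
      using V0_ket[OF a j, of \<mu> \<nu>] by (simp add: V_op_def V0_def exponents exp_eps_scale)
  qed
  then show ?thesis
    unfolding fock_F_def r Fop_def app_sum by (intro sum.cong refl) simp
qed

end

text \<open>The operators above act on the span of all labels; stable ones restrict to the Fock space
  of the \<open>m \<times> n\<close> array.\<close>

definition stable :: "nat \<Rightarrow> nat \<Rightarrow> endo \<Rightarrow> bool" where
  "stable m n X \<longleftrightarrow> (\<forall>b\<in>fock_basis m n. Poly_Mapping.keys (app X (ket b)) \<subseteq> fock_basis m n)"

lemma stable_space:
  assumes "stable m n X" "v \<in> fock_space m n"
  shows "app X v \<in> fock_space m n"
  using assms keys_app[of _ X v] unfolding stable_def fock_space_def by blast

lemma stable_mult: "stable m n X \<Longrightarrow> stable m n Y \<Longrightarrow> stable m n (X * Y)"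
  unfolding stable_def
proof (intro ballI subsetI)
  fix b b'
  assume X: "\<forall>b\<in>fock_basis m n. Poly_Mapping.keys (app X (ket b)) \<subseteq> fock_basis m n"
    and Y: "\<forall>b\<in>fock_basis m n. Poly_Mapping.keys (app Y (ket b)) \<subseteq> fock_basis m n"
    and b: "b \<in> fock_basis m n" and b': "b' \<in> Poly_Mapping.keys (app (X * Y) (ket b))"
  from b' have "b' \<in> Poly_Mapping.keys (app X (app Y (ket b)))" by simp
  from keys_app[OF this] show "b' \<in> fock_basis m n" using X Y b by blast
qed

lemma stable_scalar: "stable m n 1" "stable m n 0"
  by (auto simp: stable_def)

lemma stable_smul: "stable m n X \<Longrightarrow> stable m n (c \<bullet> X)"
  unfolding stable_def using keys_scale by fastforce

lemma stable_add: "stable m n X \<Longrightarrow> stable m n Y \<Longrightarrow> stable m n (X + Y)"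
  unfolding stable_def using keys_add by fastforce


lemma stable_sum: "(\<And>i. i \<in> A \<Longrightarrow> stable m n (X i)) \<Longrightarrow> stable m n (\<Sum>i\<in>A. X i)"
  by (induction A rule: infinite_finite_induct) (auto intro: stable_scalar stable_add)

lemma stable_dg: "stable m n (dg f)"
  by (auto simp: stable_def split: if_splits dest: subsetD[OF keys_scale])

lemma stable_exp:
  assumes "\<And>r. stable m n (X $ r)"
  shows "stable m n (exp_fps X $ N)"
proof -
  have "stable m n ((X ^ k) $ N)" for k N
  proof (induction k arbitrary: N)
    case (Suc k)
    show ?case unfolding power_Suc fps_mult_nth by (intro stable_sum stable_mult assms Suc)
  qed (auto intro: stable_scalar)
  then show ?thesis by (auto simp: exp_fps_def intro!: stable_sum stable_smul)
qed

context bosons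
begin

lemma stable_al:
  assumes "r \<noteq> 0"
  shows "stable m n (al s t r)"
  unfolding stable_def
proof (intro ballI subsetI)
  fix b b' assume b: "b \<in> fock_basis m n" and b': "b' \<in> Poly_Mapping.keys (app (al s t r) (ket b))"
  obtain \<mu> \<nu> where e: "b = (\<mu>, \<nu>)" by (cases b)
  have m: "mode s t r \<in> {0..<int m} \<times> {0..<int n} \<times> {1..}"
    using m1 n2 assms by (auto simp: mode_def)
  show "b' \<in> fock_basis m n"
  proof (cases "r < 0")
    case True
    then have "b' = (\<mu> + Poly_Mapping.single (mode s t r) 1, \<nu>)" using b' by (simp add: e al_cre)
    then show ?thesis using b m keys_add[of \<mu> "Poly_Mapping.single (mode s t r) 1"]
      by (auto simp: e fock_basis_def)
  next
    case False
    then have "b' = (\<mu> - Poly_Mapping.single (mode s t r) 1, \<nu>)"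
      using b' assms by (auto simp: e al_ann dest: subsetD[OF keys_scale])
    moreover have "Poly_Mapping.keys (\<mu> - Poly_Mapping.single (mode s t r) 1) \<subseteq> Poly_Mapping.keys \<mu>"
      by (auto simp: in_keys_iff lookup_minus)
    ultimately show ?thesis using b by (auto simp: e fock_basis_def)
  qed
qed

lemma stable_bspan: "X \<in> bspan k \<Longrightarrow> k \<noteq> 0 \<Longrightarrow> stable m n X"
  by (induction X rule: bspan_induct) (auto intro: stable_al stable_add stable_smul stable_scalar)

lemma stable_vertex:
  assumes P: "annih P" and M: "creat M" and \<beta>: "Poly_Mapping.keys \<beta> \<subseteq> {0..<int m} \<times> {0..<int n}"
  shows "stable m n (vertex P M f \<beta> ex k)"
  unfolding stable_def
proof (intro ballI subsetI)
  fix b b' assume b: "b \<in> fock_basis m n" and b': "b' \<in> Poly_Mapping.keys (app (vertex P M f \<beta> ex k) (ket b))"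
  obtain \<mu> \<nu> where e: "b = (\<mu>, \<nu>)" by (cases b)
  let ?b = "(\<mu>, \<nu> + \<beta>)"
  have sb: "?b \<in> fock_basis m n" using b \<beta> keys_add[of \<nu> \<beta>] by (auto simp: e fock_basis_def)
  have st: "stable m n (exp_fps P $ N)" "stable m n (cre_series M p)" for N p
  proof -
    have "stable m n (P $ r)" "stable m n (M $ r)" for r
      using P M stable_bspan[of "P $ r" "int r"] stable_bspan[of "M $ r" "- int r"]
      by (cases "r = 0"; simp add: annih_def creat_def stable_scalar)+
    then show "stable m n (exp_fps P $ N)" "stable m n (cre_series M p)"
      by (auto simp: cre_series_def stable_scalar intro!: stable_exp)
  qed
  let ?X = "\<lambda>p. \<Sum>s\<le>nat (bdeg ?b). cre_series M (p + int s) * exp_fps P $ s"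
  have X: "app (nexp P M p) (ket ?b) = app (?X p) (ket ?b)" for p
    by (subst app_nexp[OF annih_locfin[OF P], where S = "nat (bdeg ?b)"])
      (auto simp: app_sum intro!: annih_ket[OF P])
  have "stable m n (?X p)" for p by (intro stable_sum stable_mult st)
  then have "Poly_Mapping.keys (app (nexp P M p) (ket ?b)) \<subseteq> fock_basis m n" for p
    unfolding X using sb unfolding stable_def by blast
  then show "b' \<in> fock_basis m n"
    using b' subsetD[OF keys_scale] unfolding e vertex_ket by fast
qed

end

context fock_rep
begin

lemma stable_operators:
  "r \<noteq> 0 \<Longrightarrow> stable m n (Hop j r)"
  "j \<in> cols \<Longrightarrow> stable m n (Eop j k)" "j \<in> cols \<Longrightarrow> stable m n (Fop j k)"
proof -
  show "r \<noteq> 0 \<Longrightarrow> stable m n (Hop j r)" by (rule stable_bspan[OF Hop_span])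
  assume j: "j \<in> cols"
  have kb: "Poly_Mapping.keys (beta a j) \<subseteq> rows \<times> cols" if "a \<in> rows" for a
    using that j prev_col_cols[OF j] keys_diff[of "Poly_Mapping.single (a, j) (1::int)" "Poly_Mapping.single (a, prev_col j) 1"]
    by (auto simp: beta_def)
  then show "stable m n (Eop j k)" "stable m n (Fop j k)"
    unfolding Eop_def Fop_def EV_def FV_def
    by (intro stable_sum stable_smul stable_vertex annih_fpsp creat_fpsm; simp add: kb)+
qed

end


section \<open>Actions of algebras given by generators and relations\<close>

definition eval_word :: "('g \<Rightarrow> endo) \<Rightarrow> 'g list \<Rightarrow> endo" where
  "eval_word g w = prod_list (map g w)"

definition eval_free :: "('g \<Rightarrow> endo) \<Rightarrow> ('g list \<Rightarrow>\<^sub>0 complex) \<Rightarrow> endo" where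
  "eval_free g x = (\<Sum>w\<in>Poly_Mapping.keys x. Poly_Mapping.lookup x w \<bullet> eval_word g w)"

lemma eval_word_simps [simp]: "eval_word g 0 = 1" "eval_word g [] = 1"
   "eval_word g (w + w') = eval_word g w * eval_word g w'" "eval_word g [x] = g x"
  by (simp_all add: eval_word_def zero_list_def plus_list_def)

lemma eval_free_superset:
  assumes "finite A" "Poly_Mapping.keys x \<subseteq> A"
  shows "eval_free g x = (\<Sum>w\<in>A. Poly_Mapping.lookup x w \<bullet> eval_word g w)"
  unfolding eval_free_def by (rule sum.mono_neutral_left[OF assms]) (auto simp: in_keys_iff)

lemma eval_single [simp]: "eval_free g (Poly_Mapping.single w c) = c \<bullet> eval_word g w"
  by (cases "c = 0") (simp_all add: eval_free_def)

lemma eval_one [simp]: "eval_free g 1 = 1"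
  using eval_single[of g 0 1] by simp

lemma eval_zero [simp]: "eval_free g 0 = 0"
  by (simp add: eval_free_def)

lemma eval_add [simp]: "eval_free g (x + y) = eval_free g x + eval_free g y"
proof -
  let ?A = "Poly_Mapping.keys x \<union> Poly_Mapping.keys y"
  have "eval_free g (x + y) = (\<Sum>w\<in>?A. Poly_Mapping.lookup (x + y) w \<bullet> eval_word g w)"
    by (rule eval_free_superset) (auto simp: keys_add)
  then show ?thesis
    by (simp add: eval_free_superset[of ?A] lookup_add smul_left_distrib sum.distrib)
qed

lemma eval_scale [simp]: "eval_free g (c \<cdot> x) = c \<bullet> eval_free g x"
proof -
  have "eval_free g (c \<cdot> x) = (\<Sum>w\<in>Poly_Mapping.keys x. Poly_Mapping.lookup (c \<cdot> x) w \<bullet> eval_word g w)"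
    by (rule eval_free_superset) (auto simp: keys_scale)
  then show ?thesis by (simp add: eval_free_def smul_sum)
qed

lemma eval_uminus [simp]: "eval_free g (- x) = - eval_free g x"
  using eval_add[of g x "- x"] by (simp add: eq_neg_iff_add_eq_0 add.commute)

lemma eval_diff [simp]: "eval_free g (x - y) = eval_free g x - eval_free g y"
  using eval_add[of g x "- y"] by simp

lemma eval_sum [simp]: "eval_free g (\<Sum>i\<in>A. f i) = (\<Sum>i\<in>A. eval_free g (f i))"
  by (induction A rule: infinite_finite_induct) auto

lemma sum_monomials: "x = (\<Sum>w\<in>Poly_Mapping.keys x. Poly_Mapping.single w (Poly_Mapping.lookup x w))"
  for x :: "'k \<Rightarrow>\<^sub>0 complex"
proof (rule poly_mapping_eqI)
  fix k
  have "Poly_Mapping.lookup (\<Sum>w\<in>Poly_Mapping.keys x. Poly_Mapping.single w (Poly_Mapping.lookup x w)) k =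
     (\<Sum>w\<in>Poly_Mapping.keys x. if w = k then Poly_Mapping.lookup x w else 0)"
    unfolding lookup_sum by (intro sum.cong) (auto simp: lookup_single when_def)
  then show "Poly_Mapping.lookup x k =
     Poly_Mapping.lookup (\<Sum>w\<in>Poly_Mapping.keys x. Poly_Mapping.single w (Poly_Mapping.lookup x w)) k"
    by (simp add: in_keys_iff)
qed

lemma eval_mult [simp]: "eval_free g (x * y) = eval_free g x * eval_free g y"
proof -
  have "x * y = (\<Sum>w\<in>Poly_Mapping.keys x. \<Sum>w'\<in>Poly_Mapping.keys y.
     Poly_Mapping.single (w + w') (Poly_Mapping.lookup x w * Poly_Mapping.lookup y w'))"
    by (subst sum_monomials[of x], subst sum_monomials[of y]) (simp add: sum_product mult_single)
  then have "eval_free g (x * y) = (\<Sum>w\<in>Poly_Mapping.keys x. \<Sum>w'\<in>Poly_Mapping.keys y.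
     (Poly_Mapping.lookup x w * Poly_Mapping.lookup y w') \<bullet> (eval_word g w * eval_word g w'))"
    by simp
  then show ?thesis by (simp add: eval_free_def sum_product mult.commute)
qed

lemma eval_power [simp]: "eval_free g (x ^ k) = eval_free g x ^ k"
  by (induction k) simp_all

lemma eval_series_exp:
  fixes X :: "gen_alg fps"
  shows "eval_free g (fps_nth (series_exp X) N) = exp_fps (Abs_fps (\<lambda>r. eval_free g (X $ r))) $ N"
proof -
  have "eval_free g ((X ^ k) $ N) = (Abs_fps (\<lambda>r. eval_free g (X $ r)) ^ k) $ N" for k N
    by (induction k arbitrary: N) (simp_all add: fps_mult_nth)
  then show ?thesis by (simp add: series_exp_def exp_fps_def)
qed

definition words :: "'g set \<Rightarrow> ('g list \<Rightarrow>\<^sub>0 complex) set" where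
  "words X = {x. \<forall>w\<in>Poly_Mapping.keys x. set w \<subseteq> X}"

lemma words_single: "set w \<subseteq> X \<Longrightarrow> Poly_Mapping.single w c \<in> words X"
  by (cases "c = 0") (auto simp: words_def)

lemma words_const: "0 \<in> words X" "1 \<in> words X"
  using words_single[of 0 X 1] by (auto simp: words_def zero_list_def)

lemma words_add: "x \<in> words X \<Longrightarrow> y \<in> words X \<Longrightarrow> x + y \<in> words X"
  unfolding words_def using keys_add by fastforce

lemma words_scale: "x \<in> words X \<Longrightarrow> c \<cdot> x \<in> words X"
  unfolding words_def using keys_scale by fastforce

lemma words_uminus: "x \<in> words X \<Longrightarrow> - x \<in> words X"
  by (simp add: words_def)

lemma words_diff: "x \<in> words X \<Longrightarrow> y \<in> words X \<Longrightarrow> x - y \<in> words X"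
  using words_add[OF _ words_uminus] by fastforce

lemma words_mult: "x \<in> words X \<Longrightarrow> y \<in> words X \<Longrightarrow> x * y \<in> words X"
  unfolding words_def using keys_mult[of x y] by (fastforce simp: plus_list_def)

lemma words_sum: "(\<And>i. i \<in> A \<Longrightarrow> f i \<in> words X) \<Longrightarrow> (\<Sum>i\<in>A. f i) \<in> words X"
  by (induction A rule: infinite_finite_induct) (auto intro: words_const words_add)

lemma words_power: "x \<in> words X \<Longrightarrow> x ^ k \<in> words X"
  by (induction k) (auto intro: words_const words_mult)

lemma words_series_exp:
  assumes "\<And>r. fps_nth F r \<in> words X"
  shows "fps_nth (series_exp F) N \<in> words X"
proof -
  have "(F ^ k) $ N \<in> words X" for k N
  proof (induction k arbitrary: N)
    case (Suc k)
    show ?case unfolding power_Suc fps_mult_nth by (intro words_sum words_mult assms Suc)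
  qed (auto intro: words_const)
  then show ?thesis unfolding series_exp_def by (auto intro!: words_sum words_scale)
qed

lemma free_algebra_simps [simp]:
  "carrier (free_algebra X) = words X" "mult (free_algebra X) = (*)" "one (free_algebra X) = 1"
  "zero (free_algebra X) = 0" "add (free_algebra X) = (+)"
  by (simp_all add: free_algebra_def words_def)

lemma ring_free_algebra: "ring (free_algebra X)"
proof (rule ringI)
  show "abelian_group (free_algebra X)"
    by (rule abelian_groupI)
      (auto simp: words_const words_add add_ac intro: bexI[of _ "- x" for x] words_uminus)
  show "Group.monoid (free_algebra X)"
    by (rule monoidI) (auto simp: words_const words_mult mult.assoc)
qed (auto simp: algebra_simps)

definition endo_ring :: "endo ring" where
  "endo_ring = \<lparr>carrier = UNIV, mult = (*), one = 1, zero = 0, add = (+)\<rparr>"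

lemma ring_endo_ring: "ring endo_ring"
proof (rule ringI)
  show "abelian_group endo_ring"
    by (rule abelian_groupI) (auto simp: endo_ring_def add_ac intro: exI[of _ "- x" for x])
  show "Group.monoid endo_ring"
    by (rule monoidI) (auto simp: endo_ring_def mult.assoc)
qed (auto simp: endo_ring_def algebra_simps)

lemma eval_stable:
  assumes "\<And>x. x \<in> X \<Longrightarrow> stable m n (g x)" "x \<in> words X"
  shows "stable m n (eval_free g x)"
proof -
  have "stable m n (eval_word g w)" if "set w \<subseteq> X" for w
    using that by (induction w) (auto simp: eval_word_def stable_scalar intro!: stable_mult assms)
  then show ?thesis
    using assms(2) unfolding eval_free_def words_def by (auto intro!: stable_sum stable_smul)
qed

text \<open>Evaluation is a homomorphism of rings, and its kernel contains the ideal generated by the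
  relations; hence a class of the quotient acts through any of its representatives.\<close>

lemma action_of_quotient:
  fixes g :: "'g \<Rightarrow> endo" and X :: "'g set" and R :: "('g list \<Rightarrow>\<^sub>0 complex) set"
  assumes R: "\<And>x. x \<in> R \<Longrightarrow> x \<in> words X \<and> eval_free g x = 0"
    and st: "\<And>x. x \<in> X \<Longrightarrow> stable m n (g x)"
  defines "A \<equiv> free_algebra X" and "I \<equiv> Idl\<^bsub>free_algebra X\<^esub> R"
  shows "\<exists>act. algebra_action (A Quot I) (\<lambda>c. I +>\<^bsub>A\<^esub> Poly_Mapping.single 0 c) (fock_space m n) act \<and>
     (\<forall>x\<in>words X. \<forall>v. act (I +>\<^bsub>A\<^esub> x) v = app (eval_free g x) v)"
proof -
  interpret A: ring A unfolding A_def by (rule ring_free_algebra)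
  have carr: "carrier A = words X" by (simp add: A_def)
  have "ring_hom_ring A endo_ring (eval_free g)"
    by (rule ring_hom_ringI2[OF A.ring_axioms ring_endo_ring], rule ring_hom_memI)
      (auto simp: A_def endo_ring_def)
  then have ker: "ideal (a_kernel A endo_ring (eval_free g)) A" by (rule ring_hom_ring.kernel_is_ideal)
  have kerE: "a_kernel A endo_ring (eval_free g) = {x\<in>words X. eval_free g x = 0}"
    by (simp add: a_kernel_def' carr endo_ring_def)
  have RA: "R \<subseteq> carrier A" using R carr by auto
  have I: "ideal I A" unfolding I_def A_def[symmetric] by (rule A.genideal_ideal[OF RA])
  have "I \<subseteq> {x\<in>words X. eval_free g x = 0}"
    unfolding I_def A_def[symmetric] kerE[symmetric]
    by (rule A.genideal_minimal[OF ker]) (use R kerE in auto)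
  then have I0: "\<And>i. i \<in> I \<Longrightarrow> eval_free g i = 0" by auto
  interpret I: ideal I A by (rule I)
  define act where "act C v = app (eval_free g (SOME x. x \<in> C)) v" for C v
  have act: "act (I +>\<^bsub>A\<^esub> x) v = app (eval_free g x) v" if x: "x \<in> words X" for x v
  proof -
    have "x \<in> I +>\<^bsub>A\<^esub> x" using I.a_rcos_self x carr by simp
    then have "(SOME y. y \<in> I +>\<^bsub>A\<^esub> x) \<in> I +>\<^bsub>A\<^esub> x" by (rule someI)
    then obtain i where "i \<in> I" "(SOME y. y \<in> I +>\<^bsub>A\<^esub> x) = i + x"
      by (auto simp: a_r_coset_def' A_def)
    then show ?thesis by (simp add: act_def I0)
  qed
  have carrQ: "\<exists>x\<in>words X. C = I +>\<^bsub>A\<^esub> x" if "C \<in> carrier (A Quot I)" for C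
    using that carr by (auto simp: FactRing_def A_RCOSETS_def')
  have stab: "stable m n (eval_free g x)" if "x \<in> words X" for x
    by (rule eval_stable[OF st that])
  have "algebra_action (A Quot I) (\<lambda>c. I +>\<^bsub>A\<^esub> Poly_Mapping.single 0 c) (fock_space m n) act"
    unfolding algebra_action_def
  proof (intro conjI ballI allI)
    fix C v assume C: "C \<in> carrier (A Quot I)" and v: "v \<in> fock_space m n"
    from carrQ[OF C] obtain x where x: "x \<in> words X" "C = I +>\<^bsub>A\<^esub> x" by blast
    show "act C v \<in> fock_space m n" using stable_space[OF stab[OF x(1)] v] by (simp add: x act)
    show "act C (v + w) = act C v + act C w" for w by (simp add: x act)
    show "act C (c \<cdot> v) = c \<cdot> act C v" for c by (simp add: x act)
    fix D assume D: "D \<in> carrier (A Quot I)"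
    from carrQ[OF D] obtain y where y: "y \<in> words X" "D = I +>\<^bsub>A\<^esub> y" by blast
    have "C \<oplus>\<^bsub>A Quot I\<^esub> D = I +>\<^bsub>A\<^esub> (x + y)"
      using I.a_rcos_sum[of x y] x y by (simp add: FactRing_def carr) (simp add: A_def)
    then show "act (C \<oplus>\<^bsub>A Quot I\<^esub> D) v = act C v + act D v"
      using x y by (simp add: act words_add)
    have "C \<otimes>\<^bsub>A Quot I\<^esub> D = I +>\<^bsub>A\<^esub> (x * y)"
      using I.rcoset_mult_add[of x y] x y by (simp add: FactRing_def carr) (simp add: A_def)
    then show "act (C \<otimes>\<^bsub>A Quot I\<^esub> D) v = act C (act D v)"
      using x y by (simp add: act words_mult)
  next
    fix c v assume "v \<in> fock_space m n"
    show "act (I +>\<^bsub>A\<^esub> Poly_Mapping.single 0 c) v = c \<cdot> v"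
      by (simp add: act words_single zero_list_def)
  qed
  then show ?thesis using act by blast
qed


section \<open>The defining relations\<close>

lemma laurent_mult_superset:
  assumes "finite A" "Poly_Mapping.keys p \<subseteq> A"
  shows "laurent_mult p f e = (\<Sum>e'\<in>A. Poly_Mapping.lookup p e' \<cdot> f (e - e'))"
  unfolding laurent_mult_def by (rule sum.mono_neutral_left[OF assms]) (auto simp: in_keys_iff)

lemma laurent_mult_add: "laurent_mult (p + p') f e = laurent_mult p f e + laurent_mult p' f e"
proof -
  let ?A = "Poly_Mapping.keys p \<union> Poly_Mapping.keys p'"
  have "laurent_mult (p + p') f e = (\<Sum>e'\<in>?A. Poly_Mapping.lookup (p + p') e' \<cdot> f (e - e'))"
    by (rule laurent_mult_superset) (auto simp: keys_add)
  then show ?thesis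
    by (simp add: laurent_mult_superset[of ?A] lookup_add scale_add_left sum.distrib)
qed

lemma laurent_mult_single: "laurent_mult (Poly_Mapping.single e' c) f e = c \<cdot> f (e - e')"
  by (cases "c = 0") (simp_all add: laurent_mult_def)

lemma laurent_mult_scale: "laurent_mult (c \<cdot> p) f e = c \<cdot> laurent_mult p f e"
proof -
  have "laurent_mult (c \<cdot> p) f e = (\<Sum>e'\<in>Poly_Mapping.keys p. Poly_Mapping.lookup (c \<cdot> p) e' \<cdot> f (e - e'))"
    by (rule laurent_mult_superset) (auto simp: keys_scale)
  then show ?thesis by (simp add: laurent_mult_def scale_sum)
qed

lemma laurent_mult_diff: "laurent_mult (p - p') f e = laurent_mult p f e - laurent_mult p' f e"
  using laurent_mult_add[of p "(- 1) \<cdot> p'" f e]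
  unfolding laurent_mult_scale by (simp add: scale_uminus_left)

lemmas laurent_simps = laurent_mult_add laurent_mult_diff laurent_mult_scale laurent_mult_single
  zvar_def wvar_def

text \<open>Needed for the quadratic structure functions of the case \<open>n = 2\<close>.\<close>

lemma quadratic_expand: "(x - a \<cdot> y) * (x - b \<cdot> y) = x * x - (a + b) \<cdot> (x * y) + (a * b) \<cdot> (y * y)"
  for x y :: laurent2
  by (simp add: scale_conv_mult algebra_simps mult_single single_add)

lemma monomials:
  "zvar * zvar = Poly_Mapping.single (2, 0) 1" "zvar * wvar = Poly_Mapping.single (1, 1) 1"
  "wvar * zvar = Poly_Mapping.single (1, 1) 1" "wvar * wvar = Poly_Mapping.single (0, 2) 1"
  by (simp_all add: zvar_def wvar_def mult_single)

context fock_rep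
begin

text \<open>The exponent of \<open>q\<close> by which \<open>q\<^sup>h\<close> acts on the sector of
  momentum \<open>\<nu>\<close>.\<close>

definition q_weight :: "(int \<Rightarrow>\<^sub>0 int) \<Rightarrow> ((int \<times> int) \<Rightarrow>\<^sub>0 int) \<Rightarrow> int" where
  "q_weight h \<nu> = (\<Sum>c\<in>cols. Poly_Mapping.lookup h c * ech \<nu> c)"

fun gen_op :: "gen \<Rightarrow> endo" where
  "gen_op (Egen j k) = Eop j k"
| "gen_op (Fgen j k) = Fop j k"
| "gen_op (Hgen j r) = Hop j r"
| "gen_op (Qgen h) = dg (\<lambda>b. q powi q_weight h (snd b))"
| "gen_op Cgen = (q ^ m) \<bullet> 1"
| "gen_op Cinv = inverse (q ^ m) \<bullet> 1"
| "gen_op Dgen = dg (\<lambda>b. sq powi twice_deg b)"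
| "gen_op Dinv = dg (\<lambda>b. sq powi (- twice_deg b))"

abbreviation "ev \<equiv> eval_free gen_op"

lemma q_weight_simps:
  "q_weight (h + h') \<nu> = q_weight h \<nu> + q_weight h' \<nu>" "q_weight (- h) \<nu> = - q_weight h \<nu>" "q_weight 0 \<nu> = 0"
  "q_weight h (\<nu> + \<nu>') = q_weight h \<nu> + q_weight h \<nu>'"
  by (simp_all add: q_weight_def lookup_add ech_add algebra_simps sum.distrib sum_negf)

lemma lookup_alpha: "i \<in> cols \<Longrightarrow> Poly_Mapping.lookup (alpha n i) c = - gg i c"
  by (simp add: alpha_def eps_def gg_def lookup_minus lookup_single when_def prev_col_def)

lemma q_weight_alpha:
  assumes i: "i \<in> cols"
  shows "q_weight (alpha n i) \<nu> = ech \<nu> (prev_col i) - ech \<nu> i"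
proof -
  have "q_weight (alpha n i) \<nu> = (\<Sum>c\<in>cols. (if c = prev_col i then ech \<nu> (prev_col i) else 0) - (if c = i then ech \<nu> i else 0))"
    unfolding q_weight_def by (intro sum.cong refl) (auto simp: lookup_alpha[OF i] gg_def)
  then show ?thesis using i prev_col_cols[OF i] by (simp add: sum_subtractf)
qed

lemma q_weight_eps:
  assumes i: "i \<in> cols"
  shows "q_weight (eps n i) \<nu> = ech \<nu> i"
proof -
  have "q_weight (eps n i) \<nu> = (\<Sum>c\<in>cols. if c = i then ech \<nu> i else 0)"
    unfolding q_weight_def using i by (intro sum.cong refl) (auto simp: eps_def lookup_single when_def)
  then show ?thesis using i by simp
qed

lemma q_weight_beta:
  assumes h: "h \<in> lattice_P n" and i: "i \<in> cols" and a: "a \<in> rows"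
  shows "q_weight h (beta a i) = pairing h (alpha n i)"
proof -
  have "q_weight h (beta a i) = (\<Sum>c\<in>cols. Poly_Mapping.lookup h c * Poly_Mapping.lookup (alpha n i) c)"
    unfolding q_weight_def by (intro sum.cong refl) (simp add: ech_beta[OF a i] lookup_alpha[OF i])
  also have "\<dots> = pairing h (alpha n i)"
    unfolding pairing_def using h
    by (intro sum.mono_neutral_right) (auto simp: lattice_P_def in_keys_iff)
  finally show ?thesis .
qed

lemma gen_op_alpha: "i \<in> cols \<Longrightarrow> gen_op (Qgen (alpha n i)) = Kop i" "i \<in> cols \<Longrightarrow> gen_op (Qgen (- alpha n i)) = Kiop i"
  by (simp_all add: q_weight_alpha q_weight_simps Kop_def Kiop_def)

lemma ev_Kplus:
  assumes "i \<in> cols"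
  shows "ev (Kplus q n i $ N) = Kop i * exp_fps (h_series (q - inverse q) (Hop i)) $ N"
proof -
  have "Abs_fps (\<lambda>r. ev (Abs_fps (\<lambda>r. if r = 0 then 0 else (q - inverse q) \<cdot> var (Hgen i (int r))) $ r))
      = h_series (q - inverse q) (Hop i)"
    by (rule fps_ext) (simp add: h_series_def)
  then show ?thesis
    using gen_op_alpha(1)[OF assms] by (simp add: Kplus_def eval_series_exp)
qed

lemma ev_Kminus:
  assumes "i \<in> cols"
  shows "ev (Kminus q n i $ N) = Kiop i * exp_fps (h_series (- (q - inverse q)) (\<lambda>r. Hop i (- r))) $ N"
proof -
  have "Abs_fps (\<lambda>r. ev (Abs_fps (\<lambda>r. if r = 0 then 0 else (- (q - inverse q)) \<cdot> var (Hgen i (- int r))) $ r))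
      = h_series (- (q - inverse q)) (\<lambda>r. Hop i (- r))"
    by (rule fps_ext) (simp add: h_series_def)
  then show ?thesis
    using gen_op_alpha(2)[OF assms] by (simp add: Kminus_def eval_series_exp)
qed

lemma ev_int_nth:
  assumes "i \<in> cols"
  shows "ev (int_nth (Kplus q n i) k) = half_series (Kop i) (h_series (q - inverse q) (Hop i)) k"
    "ev (int_nth (Kminus q n i) k) = half_series (Kiop i) (h_series (- (q - inverse q)) (\<lambda>r. Hop i (- r))) k"
  by (simp_all add: int_nth_def half_series_def ev_Kplus[OF assms] ev_Kminus[OF assms])

lemma ev_Cpow: "ev (Cpow k) = (q ^ m) powi k \<bullet> 1"
proof -
  have "(c \<bullet> (1 :: endo)) ^ N = c ^ N \<bullet> 1" for c N
    by (induction N) (simp_all add: mult.commute)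
  then show ?thesis by (simp add: Cpow_def power_int_def)
qed

lemma ev_qcomm: "ev (qcomm c x y) = ecomm c (ev x) (ev y)"
  by (simp add: qcomm_def ecomm_def)

lemma sq0: "sq \<noteq> 0" using sq q0 by auto

lemma sq_powi: "sq powi (2 * k) = q powi k"
proof -
  have "sq powi (2 * k) = (sq powi 2) powi k" by (rule power_int_mult)
  then show ?thesis using sq by simp
qed

lemma degree_conjugation:
  assumes "graded twice_deg (- 2 * k) X"
  shows "gen_op Dgen * X * gen_op Dinv = q powi (- k) \<bullet> X"
proof -
  have "gen_op Dgen * X = sq powi (- 2 * k) \<bullet> (X * gen_op Dgen)"
    unfolding gen_op.simps
  proof (rule dg_graded[OF assms])
    fix b b' assume "twice_deg b' = twice_deg b + - 2 * k"
    then show "sq powi twice_deg b' = sq powi (- 2 * k) * sq powi twice_deg b"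
      using sq0 by (simp only: power_int_add simp_thms mult.commute)
  qed
  moreover have "gen_op Dgen * gen_op Dinv = 1"
    using sq0 by (simp add: dg_mult power_int_minus dg_const)
  moreover have "sq powi (- 2 * k) = q powi (- k)" using sq_powi[of "- k"] by simp
  ultimately show ?thesis by (simp add: mult.assoc)
qed

lemma dg_twice_deg: "graded twice_deg 0 (dg f)"
  by (auto simp: graded_def dest: subsetD[OF keys_scale])

lemma bspan_twice_deg: "X \<in> bspan k \<Longrightarrow> k \<noteq> 0 \<Longrightarrow> graded twice_deg (- 2 * k) X"
proof -
  assume X: "X \<in> bspan k" "k \<noteq> 0"
  note g = bspan_graded[OF X]
  show ?thesis
    unfolding graded_def
  proof (intro allI ballI)
    fix b b' assume "b' \<in> Poly_Mapping.keys (app X (ket b))"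
    from gradedD[OF g(1) this] gradedD[OF g(2) this]
    show "twice_deg b' = twice_deg b + - 2 * k" by (cases b; cases b') (simp add: twice_deg_split)
  qed
qed

lemma cartan_degree:
  assumes "i \<in> cols"
  shows "graded twice_deg (- 2 * int N) (ev (Kplus q n i $ N))" "graded twice_deg (- 2 * - int N) (ev (Kminus q n i $ N))"
proof -
  let ?X = "h_series (q - inverse q) (Hop i)" and ?Y = "h_series (- (q - inverse q)) (\<lambda>r. Hop i (- r))"
  have "graded twice_deg (- 2 * int N) (exp_fps ?X $ N)"
  proof (rule graded_exp_fps[where D = "\<lambda>r. - 2 * int r"])
    fix r :: nat assume "r > 0"
    then show "graded twice_deg (- 2 * int r) (?X $ r)"
      using bspan_twice_deg[OF Hop_span[of "int r" i]] by (auto simp: h_series_def intro!: graded_smul)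
  qed (auto simp: h_series_def)
  from graded_mult[OF dg_twice_deg this] show "graded twice_deg (- 2 * int N) (ev (Kplus q n i $ N))"
    by (simp add: ev_Kplus[OF assms] Kop_def)
  have "graded twice_deg (2 * int N) (exp_fps ?Y $ N)"
  proof (rule graded_exp_fps[where D = "\<lambda>r. 2 * int r"])
    fix r :: nat assume "r > 0"
    then show "graded twice_deg (2 * int r) (?Y $ r)"
      using bspan_twice_deg[OF Hop_span[of "- int r" i]] by (auto simp: h_series_def intro!: graded_uminus graded_smul)
  qed (auto simp: h_series_def)
  from graded_mult[OF dg_twice_deg this] show "graded twice_deg (- 2 * - int N) (ev (Kminus q n i $ N))"
    by (simp add: ev_Kminus[OF assms] Kiop_def)
qed

lemma Q_conjugation:
  assumes h: "h \<in> lattice_P n" and i: "i \<in> cols"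
  shows "gen_op (Qgen h) * Eop i k * gen_op (Qgen (- h)) = q powi pairing h (alpha n i) \<bullet> Eop i k"
    "gen_op (Qgen h) * Fop i k * gen_op (Qgen (- h)) = q powi (- pairing h (alpha n i)) \<bullet> Fop i k"
proof -
  have inv: "gen_op (Qgen h) * gen_op (Qgen (- h)) = 1"
    using q0 by (simp add: dg_mult q_weight_simps power_int_minus dg_const)
  from weight_commute[OF i, where \<phi> = "q_weight h", OF q_weight_simps(4) q_weight_beta[OF h i]]
  have "gen_op (Qgen h) * Eop i k = q powi pairing h (alpha n i) \<bullet> (Eop i k * gen_op (Qgen h))"
    "gen_op (Qgen h) * Fop i k = q powi (- pairing h (alpha n i)) \<bullet> (Fop i k * gen_op (Qgen h))" by simp_all
  then show "gen_op (Qgen h) * Eop i k * gen_op (Qgen (- h)) = q powi pairing h (alpha n i) \<bullet> Eop i k"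
    "gen_op (Qgen h) * Fop i k * gen_op (Qgen (- h)) = q powi (- pairing h (alpha n i)) \<bullet> Fop i k"
    using inv by (simp_all add: mult.assoc)
qed

lemma node_cases:
  assumes i: "i \<in> cols" and j: "j \<in> cols"
  obtains (same) "i = j"
  | (edge2) "n = 2" "i \<noteq> j"
  | (before) "n \<noteq> 2" "i \<noteq> j" "i mod int n = (j - 1) mod int n" "j mod int n = (i + 1) mod int n"
      "i mod int n \<noteq> (j + 1) mod int n" "j mod int n \<noteq> (i - 1) mod int n"
  | (after) "n \<noteq> 2" "i \<noteq> j" "i mod int n = (j + 1) mod int n" "j mod int n = (i - 1) mod int n"
      "i mod int n \<noteq> (j - 1) mod int n" "j mod int n \<noteq> (i + 1) mod int n"
  | (far) "n \<noteq> 2" "i \<noteq> j" "i mod int n \<noteq> (j - 1) mod int n" "j mod int n \<noteq> (i + 1) mod int n"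
      "i mod int n \<noteq> (j + 1) mod int n" "j mod int n \<noteq> (i - 1) mod int n"
proof -
  note m = mod_neighbours[OF i j n2] mod_neighbours[OF j i n2]
  have b: "0 \<le> i" "i \<le> int n - 1" "0 \<le> j" "j \<le> int n - 1" using i j by auto
  have s: "i mod int n = (j - 1) mod int n \<longleftrightarrow> j mod int n = (i + 1) mod int n"
    "i mod int n = (j + 1) mod int n \<longleftrightarrow> j mod int n = (i - 1) mod int n"
    unfolding m by auto
  have x: "n \<noteq> 2 \<Longrightarrow> \<not> (i mod int n = (j - 1) mod int n \<and> i mod int n = (j + 1) mod int n)"
    unfolding m using b n2 by auto
  show thesis using same edge2 before after far s x by blast
qed

text \<open>Up to an invertible scalar the relation is the exchange relation of theorem
  \<open>EE\<close>; for distant nodes it is the difference of two commutators.\<close>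

lemma ev_EE:
  assumes i: "i \<in> cols" and j: "j \<in> cols"
  shows "ev (d_coeff dc n i j \<cdot> laurent_mult (g_poly q dc n i j zvar wvar) (prod_zw Egen i j) (- k, - l)
       + laurent_mult (g_poly q dc n j i wvar zvar) (prod_wz Egen j i) (- k, - l)) = 0"
proof -
  have ij: "i mod int n = j mod int n \<longleftrightarrow> i = j" "j mod int n = i mod int n \<longleftrightarrow> i = j" using i j by auto
  have X: "exch q (facs dc n i j) (Eop i) (Eop j) k l = 0" for k l by (rule T.EE[OF i j])
  have dd: "dc * inverse dc = 1" "dc * (inverse dc * x) = x" for x using dc0 by simp_all
  from i j show ?thesis
  proof (cases rule: node_cases)
    case same
    have d: "d_coeff dc n j j = 1" and g: "g_poly q dc n j j z w = z - q\<^sup>2 \<cdot> w" for z w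
      using n2 by (auto simp: d_coeff_def g_poly_def Let_def mod_eq_dvd_iff)
    show ?thesis
      using X[of "k + 1" l] T.wt_simps(2)[OF j j]
      unfolding same d g
      by (simp add: laurent_simps prod_zw_def prod_wz_def exch_def algebra_simps smul_left_distrib)
  next
    case edge2
    have d: "d_coeff dc n i j = - 1"
      and g: "g_poly q dc n i j z w = z * z - (inverse q * dc + inverse q * inverse dc) \<cdot> (z * w) + (inverse q * inverse q) \<cdot> (w * w)"
        "g_poly q dc n j i z w = z * z - (inverse q * dc + inverse q * inverse dc) \<cdot> (z * w) + (inverse q * inverse q) \<cdot> (w * w)"
      for z w unfolding d_coeff_def g_poly_def ij Let_def using edge2 by (simp_all add: quadratic_expand mult_ac dd)
    show ?thesis
      using X[of "k + 2" l]
      unfolding T.wt_simps(5)[OF i j edge2] d g monomials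
      by (simp add: laurent_simps prod_zw_def prod_wz_def exch_def algebra_simps smul_left_distrib dd)
  next
    case before
    have f: "facs dc n i j = [(dc, - 1)]" unfolding facs_def using before by simp
    have d: "d_coeff dc n i j = inverse dc"
      and g: "g_poly q dc n i j z w = z - (inverse q * dc) \<cdot> w" "g_poly q dc n j i z w = z - (inverse q * inverse dc) \<cdot> w"
      for z w unfolding d_coeff_def g_poly_def ij Let_def using before by simp_all
    show ?thesis
      using arg_cong[OF X[of "k + 1" l], of "smul (inverse dc)"]
      unfolding f d g
      by (simp add: laurent_simps prod_zw_def prod_wz_def exch_def algebra_simps smul_left_distrib dd)
  next
    case after
    have f: "facs dc n i j = [(inverse dc, - 1)]" unfolding facs_def using after by simp
    have d: "d_coeff dc n i j = dc"
      and g: "g_poly q dc n i j z w = z - (inverse q * inverse dc) \<cdot> w" "g_poly q dc n j i z w = z - (inverse q * dc) \<cdot> w"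
      for z w unfolding d_coeff_def g_poly_def ij Let_def using after by simp_all
    show ?thesis
      using arg_cong[OF X[of "k + 1" l], of "smul (dc)"]
      unfolding f d g
      by (simp add: laurent_simps prod_zw_def prod_wz_def exch_def algebra_simps smul_left_distrib dd)
  next
    case far
    then show ?thesis
      using X[of "k + 1" l] X[of k "l + 1"]
      by (simp add: facs_def d_coeff_def g_poly_def ij laurent_simps prod_zw_def prod_wz_def exch_def Let_def algebra_simps)
  qed
qed

lemma ev_FF:
  assumes i: "i \<in> cols" and j: "j \<in> cols"
  shows "ev (d_coeff dc n j i \<cdot> laurent_mult (g_poly q dc n j i wvar zvar) (prod_zw Fgen i j) (- k, - l)
       + laurent_mult (g_poly q dc n i j zvar wvar) (prod_wz Fgen j i) (- k, - l)) = 0"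
proof -
  have ij: "i mod int n = j mod int n \<longleftrightarrow> i = j" "j mod int n = i mod int n \<longleftrightarrow> i = j" using i j by auto
  have X: "exch q (facs (inverse dc) n i j) (\<lambda>k. Fop i (- k)) (\<lambda>k. Fop j (- k)) (- k) (- l) = 0" for k l
    by (rule Td.EE[OF i j])
  have dd: "dc * inverse dc = 1" "dc * (inverse dc * x) = x" for x using dc0 by simp_all
  from i j show ?thesis
  proof (cases rule: node_cases)
    case same
    have d: "d_coeff dc n j j = 1" and g: "g_poly q dc n j j z w = z - q\<^sup>2 \<cdot> w" for z w
      using n2 by (auto simp: d_coeff_def g_poly_def Let_def mod_eq_dvd_iff)
    show ?thesis
      using X[of k "l + 1"] Td.wt_simps(2)[OF j j]
      unfolding same d g
      by (simp add: laurent_simps prod_zw_def prod_wz_def exch_def algebra_simps smul_left_distrib)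
  next
    case edge2
    have d: "d_coeff dc n j i = - 1"
      and g: "g_poly q dc n i j z w = z * z - (inverse q * dc + inverse q * inverse dc) \<cdot> (z * w) + (inverse q * inverse q) \<cdot> (w * w)"
        "g_poly q dc n j i z w = z * z - (inverse q * dc + inverse q * inverse dc) \<cdot> (z * w) + (inverse q * inverse q) \<cdot> (w * w)"
      for z w unfolding d_coeff_def g_poly_def ij Let_def using edge2 by (simp_all add: quadratic_expand mult_ac dd)
    show ?thesis
      using X[of k "l + 2"]
      unfolding Td.wt_simps(5)[OF i j edge2] d g monomials
      by (simp add: laurent_simps prod_zw_def prod_wz_def exch_def algebra_simps smul_left_distrib dd)
  next
    case before
    have f: "facs (inverse dc) n i j = [(inverse dc, - 1)]" unfolding facs_def using before by simp
    have d: "d_coeff dc n j i = dc"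
      and g: "g_poly q dc n i j z w = z - (inverse q * dc) \<cdot> w" "g_poly q dc n j i z w = z - (inverse q * inverse dc) \<cdot> w"
      for z w unfolding d_coeff_def g_poly_def ij Let_def using before by simp_all
    show ?thesis
      using arg_cong[OF X[of k "l + 1"], of "smul (dc)"]
      unfolding f d g
      by (simp add: laurent_simps prod_zw_def prod_wz_def exch_def algebra_simps smul_left_distrib dd)
  next
    case after
    have f: "facs (inverse dc) n i j = [(dc, - 1)]" unfolding facs_def using after by simp
    have d: "d_coeff dc n j i = inverse dc"
      and g: "g_poly q dc n i j z w = z - (inverse q * inverse dc) \<cdot> w" "g_poly q dc n j i z w = z - (inverse q * dc) \<cdot> w"
      for z w unfolding d_coeff_def g_poly_def ij Let_def using after by simp_all
    show ?thesis
      using arg_cong[OF X[of k "l + 1"], of "smul (inverse dc)"]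
      unfolding f d g
      by (simp add: laurent_simps prod_zw_def prod_wz_def exch_def algebra_simps smul_left_distrib dd)
  next
    case far
    then show ?thesis
      using X[of "k + 1" l] X[of k "l + 1"]
      by (simp add: facs_def d_coeff_def g_poly_def ij laurent_simps prod_zw_def prod_wz_def exch_def Let_def algebra_simps)
  qed
qed

lemma words_var: "x \<in> gens n \<Longrightarrow> var x \<in> words (gens n)"
  by (rule words_single) simp

lemma lattice_P_closed:
  "alpha n i \<in> lattice_P n" "h \<in> lattice_P n \<Longrightarrow> - h \<in> lattice_P n" "0 \<in> lattice_P n"
  "h \<in> lattice_P n \<Longrightarrow> h' \<in> lattice_P n \<Longrightarrow> h + h' \<in> lattice_P n"
proof -
  show "alpha n i \<in> lattice_P n"
    using n2 keys_diff[of "eps n (i - 1)" "eps n i"] by (auto simp: lattice_P_def alpha_def eps_def)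
  show "h \<in> lattice_P n \<Longrightarrow> h' \<in> lattice_P n \<Longrightarrow> h + h' \<in> lattice_P n"
    using keys_add[of h h'] by (auto simp: lattice_P_def)
qed (auto simp: lattice_P_def)

lemma gens_intros:
  "i \<in> cols \<Longrightarrow> Egen i k \<in> gens n" "i \<in> cols \<Longrightarrow> Fgen i k \<in> gens n" "i \<in> cols \<Longrightarrow> r \<noteq> 0 \<Longrightarrow> Hgen i r \<in> gens n"
  "h \<in> lattice_P n \<Longrightarrow> Qgen h \<in> gens n" "Cgen \<in> gens n" "Cinv \<in> gens n" "Dgen \<in> gens n" "Dinv \<in> gens n"
  by (auto simp: gens_def)

lemma words_cartan:
  assumes "i \<in> cols"
  shows "Kplus q n i $ N \<in> words (gens n)" "Kminus q n i $ N \<in> words (gens n)"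
  unfolding Kplus_def Kminus_def fps_mult_left_const_nth
  by (intro words_mult words_var gens_intros lattice_P_closed words_series_exp;
      auto intro!: words_const words_scale words_var gens_intros assms)+

lemma words_relations:
  assumes "toroidal_rel q dc n x y"
  shows "x \<in> words (gens n) \<and> y \<in> words (gens n)"
proof -
  have Cp: "Cpow k \<in> words (gens n)" for k
    by (auto simp: Cpow_def intro!: words_power words_var gens_intros)
  have lm: "laurent_mult p f e \<in> words (gens n)" if "\<And>e. f e \<in> words (gens n)" for p f e
    unfolding laurent_mult_def by (intro words_sum words_scale that)
  have qc: "qcomm c a b \<in> words (gens n)" if "a \<in> words (gens n)" "b \<in> words (gens n)" for c a b
    unfolding qcomm_def by (intro words_diff words_mult words_scale that)
  have kn: "int_nth (Kplus q n i) k \<in> words (gens n)" "int_nth (Kminus q n i) k \<in> words (gens n)" if "i \<in> cols" for i k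
    by (simp_all add: int_nth_def words_const words_cartan[OF that])
  have vX: "var (X i k) \<in> words (gens n)" if "X = Egen \<or> X = Fgen" "i \<in> cols" for X i k
    using that by (auto intro!: words_var gens_intros)
  from assms show ?thesis
  proof cases
    case (Serre2 X i j l k1 k2 k3)
    have "var (X i k) \<in> words (gens n)" "var (X j k) \<in> words (gens n)" for k
      using vX[OF Serre2(4)] Serre2(5,6) by blast+
    then show ?thesis unfolding Serre2(1,2) sym3_def by (intro conjI words_const words_add qc)
  qed (auto simp: prod_zw_def prod_wz_def sym2_def
        intro!: words_const words_mult words_diff words_add words_scale words_var gens_intros lattice_P_closed
          words_cartan Cp lm qc kn intro: vX)
qed

lemma wt_edge:
  assumes i: "i \<in> cols" and j: "j \<in> cols" and n3: "n \<ge> 3"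
    and e: "j mod int n = (i + 1) mod int n \<or> j mod int n = (i - 1) mod int n"
  shows "wt n i j = - 1"
  using i j
proof (cases rule: node_cases)
  case same
  then show ?thesis using e n3 by (auto simp: mod_eq_dvd_iff)
qed (use e n3 in \<open>auto simp: wt_def facs_def\<close>)

lemma serre_currents:
  assumes X: "X = Egen \<or> X = Fgen" and i: "i \<in> cols" and j: "j \<in> cols" and w: "wt n i j = - 1"
  shows "ev (sym2 (\<lambda>k1 k2. qcomm (inverse q) (var (X i k1)) (qcomm q (var (X i k2)) (var (X j l)))) k1 k2) = 0"
  using X
proof
  assume "X = Egen"
  then show ?thesis using T.serre[OF i j w, of k1 k2 l] by (simp add: sym2_def ev_qcomm)
next
  assume "X = Fgen"
  then show ?thesis using Td.serre[OF i j w, of "- k1" "- k2" "- l"] by (simp add: sym2_def ev_qcomm)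
qed

lemma serre2_currents:
  assumes X: "X = Egen \<or> X = Fgen" and i: "i \<in> cols" and j: "j \<in> cols" and w: "wt n i j = - 2"
  shows "ev (sym3 (\<lambda>k1 k2 k3. qcomm (q powi (- 2)) (var (X i k1))
         (qcomm 1 (var (X i k2)) (qcomm (q ^ 2) (var (X i k3)) (var (X j l))))) k1 k2 k3) = 0"
  using X
proof
  assume "X = Egen"
  then show ?thesis using T.serre2[OF i j w, of k1 k2 k3 l] by (simp add: sym3_def ev_qcomm)
next
  assume "X = Fgen"
  then show ?thesis using Td.serre2[OF i j w, of "- k1" "- k2" "- k3" "- l"] by (simp add: sym3_def ev_qcomm)
qed

theorem ev_relations:
  assumes "toroidal_rel q dc n x y"
  shows "ev x = ev y"
  using assms
proof cases
  case (C_central z)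
  then show ?thesis by simp
next
  case C_inv
  then show ?thesis using q0 by simp
next
  case C_inv'
  then show ?thesis using q0 by simp
next
  case D_inv
  then show ?thesis using sq0 by (simp add: dg_mult power_int_minus dg_const)
next
  case D_inv'
  then show ?thesis using sq0 by (simp add: dg_mult power_int_minus dg_const)
next
  case (Q_add h h')
  then show ?thesis using q0 by (simp add: dg_mult q_weight_simps power_int_add)
next
  case Q_0
  then show ?thesis by (simp add: q_weight_simps dg_const)
next
  case (DQ h)
  then show ?thesis by (simp add: dg_mult mult.commute)
next
  case (QE h i k)
  then show ?thesis using Q_conjugation(1)[of h i k] by (simp del: gen_op.simps(4))
next
  case (QF h i k)
  then show ?thesis using Q_conjugation(2)[of h i k] by (simp del: gen_op.simps(4))
next
  case (DE i k)
  then show ?thesis using degree_conjugation[OF currents_degree(1), of i k] by (simp del: gen_op.simps(7,8))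
next
  case (DF i k)
  then show ?thesis using degree_conjugation[OF currents_degree(2), of i k] by (simp del: gen_op.simps(7,8))
next
  case (DKplus i N)
  then show ?thesis using degree_conjugation[OF cartan_degree(1), of i N] by (simp del: gen_op.simps(7,8))
next
  case (DKminus i N)
  then show ?thesis using degree_conjugation[OF cartan_degree(2), of i N] by (simp del: gen_op.simps(7,8))
next
  case (HE i j r k)
  have "(r + \<bar>r\<bar>) div 2 = (if r > 0 then r else 0)" by simp
  then show ?thesis
    using HE H_currents(1)[OF HE(3,4,5), of k] by (simp add: ev_qcomm ecomm_def ev_Cpow)
next
  case (HF i j r k)
  have "(r - \<bar>r\<bar>) div 2 = (if r > 0 then 0 else r)" by simp
  then show ?thesis
    using HF H_currents(2)[OF HF(3,4,5), of k] by (simp add: ev_qcomm ecomm_def ev_Cpow)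
next
  case (HH i j r s)
  then show ?thesis
    using Hop_commutator[OF HH(3,4,5,6)] by (simp add: ev_qcomm ecomm_def ev_Cpow smul_left_distrib right_diff_distrib)
next
  case (EF i j k l)
  then show ?thesis
    using EF_commutator[OF EF(3,4), of k l] by (simp add: ev_qcomm ecomm_def ev_Cpow ev_int_nth)
next
  case (comm X i j k l)
  have f: "facs c n i j = []" for c using comm by (auto simp: facs_def)
  from comm(3) show ?thesis
  proof
    assume X: "X = Egen"
    show ?thesis using T.EE[OF comm(4,5), of k l] unfolding comm(1,2) X f by (simp add: ev_qcomm ecomm_def exch_def)
  next
    assume X: "X = Fgen"
    show ?thesis using Td.EE[OF comm(4,5), of "- k" "- l"] unfolding comm(1,2) X f by (simp add: ev_qcomm ecomm_def exch_def)
  qed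
next
  case (EE i j k l)
  then show ?thesis using ev_EE[of i j k l] by simp
next
  case (FF i j k l)
  then show ?thesis using ev_FF[of i j k l] by simp
next
  case (Serre X i j l k1 k2)
  show ?thesis
    unfolding Serre(1,2) using serre_currents[OF Serre(4-6) wt_edge[OF Serre(5,6,3,7)]] by simp
next
  case (Serre2 X i j l k1 k2 k3)
  then have "wt n i j = - 2" using T.wt_simps(4)[of i j] by auto
  then show ?thesis
    unfolding Serre2(1,2) using serre2_currents[OF Serre2(4-6)] by simp
qed

lemma stable_gen_op: "x \<in> gens n \<Longrightarrow> stable m n (gen_op x)"
  by (auto simp: gens_def stable_operators stable_dg stable_smul stable_scalar)

theorem fock_action:
  "\<exists>act. algebra_action (toroidal_algebra q dc n)
       (\<lambda>c. toroidal_class q dc n (Poly_Mapping.single 0 c)) (fock_space m n) act \<and>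
     (\<forall>x\<in>gens n. \<forall>v. act (toroidal_class q dc n (var x)) v = app (gen_op x) v)"
proof -
  have "x - y \<in> words (gens n) \<and> ev (x - y) = 0" if "toroidal_rel q dc n x y" for x y
    using words_relations[OF that] ev_relations[OF that] by (simp add: words_diff)
  then have "\<exists>act. algebra_action (toroidal_algebra q dc n)
       (\<lambda>c. toroidal_class q dc n (Poly_Mapping.single 0 c)) (fock_space m n) act \<and>
     (\<forall>x\<in>words (gens n). \<forall>v. act (toroidal_class q dc n x) v = app (ev x) v)"
    unfolding toroidal_algebra_def toroidal_class_def toroidal_ideal_def
    by (intro action_of_quotient stable_gen_op) auto
  then show ?thesis using words_var by fastforce
qed

lemma gen_op_formulas:
  assumes j: "j \<in> cols"
  shows "app (gen_op (Qgen (eps n j))) v = fock_q_eps q m n j v"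
    and "r > 0 \<Longrightarrow> app (gen_op (Hgen j (int r))) v = fock_H_p q d dc m n j r v"
    and "r > 0 \<Longrightarrow> app (gen_op (Hgen j (- int r))) v = fock_H_m q d dc m n j r v"
    and "app (gen_op (Egen j k)) v = fock_E q d dc sd m n u j k v"
    and "app (gen_op (Fgen j k)) v = fock_F q d dc sd m n u j k v"
    and "app (gen_op Cgen) v = q ^ m \<cdot> v"
    and "app (gen_op Dgen) v = fock_D sq v"
proof -
  have "e_check m n b j = ech (snd b) j" for b
    by (cases b) (simp add: e_check_ech)
  then show "app (gen_op (Qgen (eps n j))) v = fock_q_eps q m n j v"
    by (simp add: app_dg fock_q_eps_def q_weight_eps[OF j])
qed (simp_all add: Hop_def app_H fock_E_eq[OF j] fock_F_eq[OF j] app_dg fock_D_def)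

end


theorem proposition3p5:
  fixes q d dc sq sd :: complex and m n :: nat and u :: "int \<Rightarrow> complex"
  assumes "q \<noteq> 0" and "d \<noteq> 0" and "dc \<noteq> 0"
    and "sq\<^sup>2 = q" and "sd\<^sup>2 = dc"
    and "generic (inverse q * d) (q\<^sup>2) (inverse q * inverse d)"
    and "generic (inverse q * dc) (q\<^sup>2) (inverse q * inverse dc)"
    and "n \<ge> 2" and "m \<ge> 1"
    and "\<forall>i \<in> {0..<int m}. u i \<noteq> 0"
  shows "\<exists>act. algebra_action (toroidal_algebra q dc n)
           (\<lambda>c. toroidal_class q dc n (Poly_Mapping.single 0 c)) (fock_space m n) act \<and>
         (\<forall>v \<in> fock_space m n.
            act (toroidal_class q dc n (var Cgen)) v = q ^ m \<cdot> v \<and>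
            act (toroidal_class q dc n (var Dgen)) v = fock_D sq v \<and>
            (\<forall>j \<in> {0..<int n}.
               act (toroidal_class q dc n (var (Qgen (eps n j)))) v = fock_q_eps q m n j v \<and>
               (\<forall>r :: nat. r > 0 \<longrightarrow>
                  act (toroidal_class q dc n (var (Hgen j (int r)))) v = fock_H_p q d dc m n j r v \<and>
                  act (toroidal_class q dc n (var (Hgen j (- int r)))) v = fock_H_m q d dc m n j r v) \<and>
               (\<forall>k :: int.
                  act (toroidal_class q dc n (var (Egen j k))) v = fock_E q d dc sd m n u j k v \<and>
                  act (toroidal_class q dc n (var (Fgen j k))) v = fock_F q d dc sd m n u j k v)))"
proof -
  have gen: "i = j \<and> j = k" if "(inverse q * dc) powi i * (q\<^sup>2) powi j * (inverse q * inverse dc) powi k = 1" for i j k :: int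
    using assms(7) that unfolding generic_def by blast
  have "fock_rep q m n d dc sq sd u"
  proof
    show "q powi k \<noteq> 1" if "k \<noteq> 0" for k :: int
    proof
      assume "q powi k = 1"
      then have "(q\<^sup>2) powi k = 1" by (simp add: power2_eq_square power_int_mult_distrib)
      then show False using gen[of 0 k 0] that by simp
    qed
    show "(q * dc) powi k \<noteq> 1 \<and> (q * inverse dc) powi k \<noteq> 1" if "k \<noteq> 0" for k :: int
    proof -
      have "(inverse q * dc) * q\<^sup>2 = q * dc" "q\<^sup>2 * (inverse q * inverse dc) = q * inverse dc"
        using assms(1) by (simp_all add: power2_eq_square)
      then have "(inverse q * dc) powi k * (q\<^sup>2) powi k = (q * dc) powi k"
        "(q\<^sup>2) powi k * (inverse q * inverse dc) powi k = (q * inverse dc) powi k"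
        by (metis power_int_mult_distrib)+
      then show ?thesis using gen[of k k 0] gen[of 0 k k] that by auto
    qed
  qed (use assms in auto)
  then interpret fock_rep q m n d dc sq sd u .
  have g: "Cgen \<in> gens n" "Dgen \<in> gens n" "\<And>j. j \<in> cols \<Longrightarrow> Qgen (eps n j) \<in> gens n"
    "\<And>j r. j \<in> cols \<Longrightarrow> r \<noteq> 0 \<Longrightarrow> Hgen j r \<in> gens n" "\<And>j k. j \<in> cols \<Longrightarrow> Egen j k \<in> gens n"
    "\<And>j k. j \<in> cols \<Longrightarrow> Fgen j k \<in> gens n"
    by (auto simp: gens_def lattice_P_def eps_def)
  have "0 \<in> cols" using assms(8) by simp
  note C = gen_op_formulas(6,7)[OF this]
  from fock_action obtain act where act:
    "algebra_action (toroidal_algebra q dc n)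
       (\<lambda>c. toroidal_class q dc n (Poly_Mapping.single 0 c)) (fock_space m n) act"
    "\<And>x v. x \<in> gens n \<Longrightarrow> act (toroidal_class q dc n (var x)) v = app (gen_op x) v"
    by blast
  show ?thesis
  proof (intro exI[of _ act] conjI ballI allI impI)
    show "algebra_action (toroidal_algebra q dc n)
       (\<lambda>c. toroidal_class q dc n (Poly_Mapping.single 0 c)) (fock_space m n) act" by (rule act(1))
  qed (use g in \<open>simp_all add: act(2) gen_op_formulas C del: gen_op.simps\<close>)
qed

end
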